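(* There is a randomized algorithm that solves \textsc{kSTMVC} in time $$O\Big(\big(n+(|S|+|T|)k\big)^{\omega}+|S|\,|T|\,k^{\omega}\Big),$$ where $\omega$ is the matrix-multiplication exponent.
   Context: \textsc{kSTMVC}: given a directed graph $G=(V,E)$ with $n$ vertices and unit vertex capacities, two subsets $S,T\subseteq V$ and a parameter $k>0$, find all pairs $s\in S$, $t\in T$ for which the minimum $s$-$t$ vertex cut value (maximum number of internally vertex-disjoint $s$-$t$ paths) is less than $k$, and report that value. *)

theory Defs
  imports
    "HOL-Probability.Probability_Mass_Function"
    "Graph_Theory.Graph_Theory"
    "Jordan_Normal_Form.Matrix"
begin

section \<open>A randomized word RAM\<close>

text \<open>
  Programs are while programs over registers and a random access memory, both indexed by and
  (once the input fits) holding words, i.e. naturals below \<open>2 ^ w\<close>. The word length \<open>w\<close> is a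
  parameter of the execution, not of the program. Every command costs one time unit; since a
  program is a fixed finite object, evaluating its expressions costs only a constant factor.
\<close>

datatype expr =
    Const nat
  | Reg nat
  | Load expr
  | Add expr expr
  | Sub expr expr
  | Mul expr expr
  | Div expr expr
  | Mod expr expr
  | Less expr expr

datatype cmd =
    Skip
  | Assign nat expr
  | Store expr expr
  | Rand nat
  | Seq cmd cmd
  | Branch expr cmd cmd
  | While expr cmd

record state =
  regs :: "nat \<Rightarrow> nat"
  mem :: "nat \<Rightarrow> nat"

text \<open>Addition and multiplication wrap around; subtraction is truncated at zero.\<close>

fun eval :: "nat \<Rightarrow> state \<Rightarrow> expr \<Rightarrow> nat" where
  "eval w s (Const c) = c mod 2 ^ w"
| "eval w s (Reg r) = regs s r"
| "eval w s (Load a) = mem s (eval w s a)"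
| "eval w s (Add a b) = (eval w s a + eval w s b) mod 2 ^ w"
| "eval w s (Sub a b) = eval w s a - eval w s b"
| "eval w s (Mul a b) = (eval w s a * eval w s b) mod 2 ^ w"
| "eval w s (Div a b) = eval w s a div eval w s b"
| "eval w s (Mod a b) = eval w s a mod eval w s b"
| "eval w s (Less a b) = (if eval w s a < eval w s b then 1 else 0)"

text \<open>
  A configuration is the list of commands still to be executed together with the state; the
  machine has halted when that list is empty, and then stays as it is.
\<close>

type_synonym config = "cmd list \<times> state"

fun step :: "nat \<Rightarrow> config \<Rightarrow> config pmf" where
  "step w ([], s) = return_pmf ([], s)"
| "step w (Skip # cs, s) = return_pmf (cs, s)"
| "step w (Assign r a # cs, s) =
     return_pmf (cs, s\<lparr>regs := (regs s)(r := eval w s a)\<rparr>)"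
| "step w (Store a b # cs, s) =
     return_pmf (cs, s\<lparr>mem := (mem s)(eval w s a := eval w s b)\<rparr>)"
| "step w (Rand r # cs, s) =
     map_pmf (\<lambda>v. (cs, s\<lparr>regs := (regs s)(r := v)\<rparr>)) (pmf_of_set {..<2 ^ w})"
| "step w (Seq c d # cs, s) = return_pmf (c # d # cs, s)"
| "step w (Branch a c d # cs, s) =
     return_pmf ((if eval w s a \<noteq> 0 then c else d) # cs, s)"
| "step w (While a c # cs, s) =
     return_pmf (if eval w s a \<noteq> 0 then c # While a c # cs else cs, s)"

primrec run :: "nat \<Rightarrow> nat \<Rightarrow> config \<Rightarrow> config pmf" where
  "run w 0 x = return_pmf x"
| "run w (Suc t) x = bind_pmf (step w x) (run w t)"

definition halted :: "config \<Rightarrow> bool" where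
  "halted x \<longleftrightarrow> fst x = []"

text \<open>
  The input is a list of words at the start of the memory, everything else being zero. The
  output is a list of words whose start address is in register 0 when the machine has halted.
\<close>

definition start :: "cmd \<Rightarrow> nat list \<Rightarrow> config" where
  "start P xs = ([P], \<lparr>regs = (\<lambda>_. 0), mem = (\<lambda>i. if i < length xs then xs ! i else 0)\<rparr>)"

definition has_output :: "config \<Rightarrow> nat list \<Rightarrow> bool" where
  "has_output x ys \<longleftrightarrow>
     halted x \<and> (\<forall>i<length ys. mem (snd x) (regs (snd x) 0 + i) = ys ! i)"

fun deterministic :: "cmd \<Rightarrow> bool" where
  "deterministic (Rand r) \<longleftrightarrow> False"
| "deterministic (Seq c d) \<longleftrightarrow> deterministic c \<and> deterministic d"
| "deterministic (Branch a c d) \<longleftrightarrow> deterministic c \<and> deterministic d"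
| "deterministic (While a c) \<longleftrightarrow> deterministic c"
| "deterministic _ \<longleftrightarrow> True"


section \<open>The matrix multiplication exponent\<close>

definition mat_words :: "nat mat \<Rightarrow> nat list" where
  "mat_words A = concat (map (\<lambda>i. map (\<lambda>j. A $$ (i, j)) [0..<dim_col A]) [0..<dim_row A])"

text \<open>
  \<open>matmul_time \<tau>\<close>: two \<open>n \<times> n\<close> matrices with entries below \<open>m\<close> can be multiplied in
  \<open>O(n powr \<tau>)\<close> operations on words of length \<open>O(log (n + m))\<close>. The constants do not depend
  on \<open>n\<close>, \<open>m\<close> or the actual word length.
\<close>

definition matmul_time :: "real \<Rightarrow> bool" where
  "matmul_time \<tau> \<longleftrightarrow>
     (\<exists>P. deterministic P \<and> (\<exists>(c::nat) (C::real).
        \<forall>n m w A B. 1 \<le> n \<and> 1 \<le> m \<and> (n + m) ^ c \<le> 2 ^ w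
          \<and> A \<in> carrier_mat n n \<and> B \<in> carrier_mat n n
          \<and> (\<forall>i<n. \<forall>j<n. A $$ (i, j) < m \<and> B $$ (i, j) < m) \<longrightarrow>
          (\<forall>x \<in> set_pmf (run w (nat \<lfloor>C * real n powr \<tau>\<rfloor>)
                             (start P ([n, m] @ mat_words A @ mat_words B))).
             has_output x (mat_words (A * B)))))"

definition omega :: real where
  "omega = Inf {\<tau>. matmul_time \<tau>}"


section \<open>Bounded vertex cut values\<close>

definition int_disjoint_paths ::
    "'a pair_pre_digraph \<Rightarrow> 'a \<Rightarrow> 'a \<Rightarrow> ('a \<times> 'a) list set \<Rightarrow> bool" where
  "int_disjoint_paths G s t Q \<longleftrightarrow>
     (\<forall>p\<in>Q. pre_digraph.apath (with_proj G) s p t) \<and>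
     pairwise (\<lambda>p q. disjnt (set (pre_digraph.inner_verts (with_proj G) p))
                            (set (pre_digraph.inner_verts (with_proj G) q))) Q"

text \<open>
  The value is only meaningful for \<open>s \<noteq> t\<close>. If \<open>(s, t)\<close> is an arc, no set of vertices
  separates \<open>s\<close> from \<open>t\<close>; the arc then simply counts as one of the paths.
\<close>

definition vertex_cut_value :: "'a pair_pre_digraph \<Rightarrow> 'a \<Rightarrow> 'a \<Rightarrow> nat" where
  "vertex_cut_value G s t = Max {card Q | Q. int_disjoint_paths G s t Q}"

definition kSTMVC :: "'a pair_pre_digraph \<Rightarrow> 'a set \<Rightarrow> 'a set \<Rightarrow> nat \<Rightarrow> ('a \<times> 'a \<times> nat) set" where
  "kSTMVC G S T k =
     {(s, t, v). s \<in> S \<and> t \<in> T \<and> s \<noteq> t \<and> v = vertex_cut_value G s t \<and> v < k}"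

text \<open>
  Instances have vertex set \<open>{..<n}\<close>; the graph is given by its adjacency matrix and the two
  vertex sets by their characteristic vectors.
\<close>

definition instance_words ::
    "nat \<Rightarrow> nat pair_pre_digraph \<Rightarrow> nat set \<Rightarrow> nat set \<Rightarrow> nat \<Rightarrow> nat list" where
  "instance_words n G S T k =
     [n, k] @ map (\<lambda>v. of_bool (v \<in> S)) [0..<n] @ map (\<lambda>v. of_bool (v \<in> T)) [0..<n]
     @ mat_words (mat n n (\<lambda>e. of_bool (e \<in> parcs G)))"

text \<open>The answer is reported as a repetition-free list of triples, in any order.\<close>

definition answer_words :: "(nat \<times> nat \<times> nat) list \<Rightarrow> nat list" where
  "answer_words L = length L # concat (map (\<lambda>(s, t, v). [s, t, v]) L)"

definition correct_answer ::
    "nat pair_pre_digraph \<Rightarrow> nat set \<Rightarrow> nat set \<Rightarrow> nat \<Rightarrow> config \<Rightarrow> bool" where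
  "correct_answer G S T k x \<longleftrightarrow>
     (\<exists>L. distinct L \<and> set L = kSTMVC G S T k \<and> has_output x (answer_words L))"

text \<open>
  \<open>P\<close> solves the problem in time \<open>O(f n |S| |T| k)\<close> on words of length \<open>O(log (n + k))\<close>: the
  time bound holds for every outcome of the random choices, and the whole answer is correct
  with probability at least 2/3.
\<close>

definition solves_kSTMVC_in_time :: "cmd \<Rightarrow> (nat \<Rightarrow> nat \<Rightarrow> nat \<Rightarrow> nat \<Rightarrow> real) \<Rightarrow> bool" where
  "solves_kSTMVC_in_time P f \<longleftrightarrow>
     (\<exists>(c::nat) (C::real). \<forall>n G S T k w.
        1 \<le> n \<and> pair_fin_digraph G \<and> pverts G = {..<n} \<and> S \<subseteq> {..<n} \<and> T \<subseteq> {..<n}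
        \<and> 0 < k \<and> (n + k) ^ c \<le> 2 ^ w \<longrightarrow>
        (let D = run w (nat \<lfloor>C * f n (card S) (card T) k\<rfloor>) (start P (instance_words n G S T k))
         in (\<forall>x \<in> set_pmf D. halted x) \<and>
            measure_pmf.prob D {x. correct_answer G S T k x} \<ge> 2 / 3))"

end

theory Submission
  imports
    "HOL-Probability.Product_PMF"
    "HOL-Combinatorics.Cycles"
    "Jordan_Normal_Form.Determinant"
    "HOL-Number_Theory.Cong"
    Defs
begin

text \<open>
  For \<open>s \<noteq> t\<close>, disjoint \<open>s\<close>-\<open>t\<close> paths correspond to permutations supported on a sparse matrix:
  take the pattern of the identity plus the arcs, filled with random entries modulo a prime, and
  border it with rows and columns that force the permutation to leave \<open>s\<close> and to enter \<open>t\<close>.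
  The bordered matrix with \<open>m\<close> extra rows and columns is generically nonsingular iff there are
  enough disjoint paths. All bordered matrices share the block \<open>A\<close> of size \<open>O(n + (|S| + |T|) k)\<close>,
  so \<open>A\<close> is inverted once and each pair only needs the leading minors of the Schur complement
  \<open>P A\<^sup>-\<^sup>1 Q\<close> restricted to \<open>k + 2\<close> rows and columns. A recursive block inversion finds the
  first vanishing leading minor in the time of a matrix multiplication, because the exponent is
  at least two. The prime is found among random candidates by trial division; to stay below
  quadratic time the candidates are kept below \<open>G\<^sup>2\<close> with \<open>G\<close> about \<open>D powr (7/4)\<close> for
  matrices of size \<open>D\<close>.
\<close>

section \<open>Deterministic execution with time\<close>

text \<open>The multiplication program behind an exponent is a black box: it expects zeroed
  registers and a memory that is zero outside its input, and it is specified separately for each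
  word length. It is therefore simulated at a shorter word length \<open>v\<close> inside a fresh
  block of \<open>2 * 2 ^ v\<close> cells, one block per product, and the heap only grows. No block
  is ever cleared, so time is unaffected; memory stays polynomial in \<open>n + k\<close>, which the
  free exponent of the word length pays for.

  All algebra is done on integer matrices and only residues are stored, so the argument never needs
  more than divisibility of integer minors by \<open>p\<close>. The error is one-sided: a
  nonvanishing minor always yields disjoint paths, and bad luck can lower a count but never raise
  it.

  The exponent 7/4 is a convenient value strictly between 3/2 and 2. The union bound over all pairs
  and orders asks for \<open>p >= 1024 * D ^ 3\<close>, and the logarithmic scarcity of primes comes
  on top, which forces more than 3/2. Logarithmically many trial divisions within
  \<open>O(D ^ 2)\<close> force less than 2.\<close>

definition exec :: "nat => cmd => state => nat => state => bool" where
 "exec w c s t s' \<longleftrightarrow> (ALL cs. run w t (c # cs, s) = return_pmf (cs, s'))"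

definition upd :: "state => nat => nat => state" where
 "upd s r v = s\<lparr>regs := (regs s)(r := v)\<rparr>"

definition updm :: "state => nat => nat => state" where
 "updm s a v = s\<lparr>mem := (mem s)(a := v)\<rparr>"

lemma upd_simps [simp]:
 "regs (upd s r v) = (regs s)(r := v)" "mem (upd s r v) = mem s"
 "regs (updm s a v) = regs s" "mem (updm s a v) = (mem s)(a := v)"
 by (auto simp: upd_def updm_def)

lemma run_add: "run w (a + b) x = bind_pmf (run w a x) (run w b)"
proof (induction a arbitrary: x)
 case (Suc a)
 then have "run w (a + b) = (%x. bind_pmf (run w a x) (run w b))" by (simp add: fun_eq_iff)
 then show ?case by (simp add: bind_assoc_pmf)
qed (simp add: bind_return_pmf)

lemma run_halted: "run w t ([], s) = return_pmf ([], s)"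
 by (induction t) (auto simp: bind_return_pmf)

lemma exec_Skip: "exec w Skip s 1 s"
 by (simp add: exec_def bind_return_pmf)

lemma exec_Assign: "exec w (Assign r e) s 1 (upd s r (eval w s e))"
 by (simp add: exec_def bind_return_pmf upd_def)

lemma exec_Store: "exec w (Store a e) s 1 (updm s (eval w s a) (eval w s e))"
 by (simp add: exec_def bind_return_pmf updm_def)

lemma exec_Seq:
 assumes "exec w c s t1 s1" "exec w d s1 t2 s2"
 shows "exec w (Seq c d) s (1 + t1 + t2) s2"
 using assms by (simp add: exec_def bind_return_pmf run_add)

lemma exec_Branch:
 assumes "exec w (if eval w s e ~= 0 then c else d) s t s'"
 shows "exec w (Branch e c d) s (1 + t) s'"
 using assms by (auto simp: exec_def bind_return_pmf split: if_splits)

lemma exec_While_stop: "eval w s b = 0 ==> exec w (While b c) s 1 s"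
 by (simp add: exec_def bind_return_pmf)

lemma exec_While_step:
 assumes "eval w s b ~= 0" "exec w c s t1 s1" "exec w (While b c) s1 t2 s2"
 shows "exec w (While b c) s (1 + t1 + t2) s2"
 using assms by (simp add: exec_def bind_return_pmf run_add)

lemma exec_for:
 assumes step: "!!i s. i < n ==> I i s ==>
  eval w s b ~= 0 & (EX t s'. t <= T & exec w c s t s' & I (Suc i) s')"
 and stop: "!!s. I n s ==> eval w s b = 0"
 and init: "I 0 s"
 shows "EX t s'. t <= n * (T + 1) + 1 & exec w (While b c) s t s' & I n s'"
proof -
 have "EX t s'. t <= (n - i) * (T + 1) + 1 & exec w (While b c) s t s' & I n s'"
 if "i <= n" "I i s" for i s
 using that
 proof (induction "n - i" arbitrary: i s)
 case 0
 then show ?case using exec_While_stop[of w s b c] stop[of s] by auto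
 next
 case (Suc m)
 then have "i < n" by simp
 from step[OF this Suc.prems(2)] obtain t1 s1 where 1: "eval w s b ~= 0" "t1 <= T"
  "exec w c s t1 s1" "I (Suc i) s1" by blast
 have "m = n - Suc i" "Suc i <= n" using Suc.hyps(2) \<open>i < n\<close> by auto
 from Suc.hyps(1)[OF this 1(4)] obtain t2 s2 where 2:
  "t2 <= (n - Suc i) * (T + 1) + 1" "exec w (While b c) s1 t2 s2" "I n s2" by blast
 have "exec w (While b c) s (1 + t1 + t2) s2"
  using exec_While_step[OF 1(1,3) 2(2)] .
 moreover have "1 + t1 + t2 <= (n - i) * (T + 1) + 1"
 proof -
  have "n - i = Suc (n - Suc i)" using \<open>i < n\<close> by simp
  then show ?thesis using 1(2) 2(1) by simp
 qed
 ultimately show ?case using 2(3) by blast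
 qed
 from this[of 0 s] init show ?thesis by simp
qed

text \<open>Evaluation without wrap-around.\<close>

fun evn :: "state => expr => nat" where
 "evn s (Const c) = c"
| "evn s (Reg r) = regs s r"
| "evn s (Load a) = mem s (evn s a)"
| "evn s (Add a b) = evn s a + evn s b"
| "evn s (Sub a b) = evn s a - evn s b"
| "evn s (Mul a b) = evn s a * evn s b"
| "evn s (Div a b) = evn s a div evn s b"
| "evn s (Mod a b) = evn s a mod evn s b"
| "evn s (Less a b) = (if evn s a < evn s b then 1 else 0)"

text \<open>If all registers, memory cells and constants are at most \<open>B\<close>, then the value of an
 expression is at most \<open>B\<close> to the power of its weight.\<close>

fun weight :: "expr => nat" where
 "weight (Const c) = 1"
| "weight (Reg r) = 1"
| "weight (Load a) = weight a + 1"
| "weight (Add a b) = weight a + weight b"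
| "weight (Sub a b) = weight a + weight b"
| "weight (Mul a b) = weight a + weight b"
| "weight (Div a b) = weight a + weight b"
| "weight (Mod a b) = weight a + weight b"
| "weight (Less a b) = weight a + weight b"

fun consts_le :: "nat => expr => bool" where
 "consts_le B (Const c) \<longleftrightarrow> c <= B"
| "consts_le B (Reg r) \<longleftrightarrow> True"
| "consts_le B (Load a) \<longleftrightarrow> consts_le B a"
| "consts_le B (Add a b) \<longleftrightarrow> consts_le B a & consts_le B b"
| "consts_le B (Sub a b) \<longleftrightarrow> consts_le B a & consts_le B b"
| "consts_le B (Mul a b) \<longleftrightarrow> consts_le B a & consts_le B b"
| "consts_le B (Div a b) \<longleftrightarrow> consts_le B a & consts_le B b"
| "consts_le B (Mod a b) \<longleftrightarrow> consts_le B a & consts_le B b"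
| "consts_le B (Less a b) \<longleftrightarrow> consts_le B a & consts_le B b"

lemma weight_pos: "1 <= weight e"
 by (induction e) auto

lemma eval_evn_weight:
 fixes B :: nat
 assumes "ALL r. regs s r <= B" "ALL a. mem s a <= B" "2 <= B" "consts_le B e" "B ^ weight e < 2 ^ w"
 shows "eval w s e = evn s e & evn s e <= B ^ weight e"
proof -
 have mono: "B ^ i <= B ^ j" if "i <= j" for i j
 using that assms(3) by (intro power_increasing) auto
 have pw: "B ^ i < 2 ^ w" if "i <= j" "B ^ j < 2 ^ w" for i j
 using mono[OF that(1)] that(2) by linarith
 have le1: "x <= B ^ (i + j)" if "x <= B ^ i" for x i j
 using mono[of i "i + j"] that by linarith
 \<comment> \<open>Both bounds are at least 2, because every weight is at least 1, and the sum of
   two numbers that are at least 2 is at most their product. So weights add under \<open>Add\<close>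
   just as under \<open>Mul\<close>.\<close>
 have add: "x + y <= B ^ (i + j)" if "x <= B ^ i" "y <= B ^ j" "1 <= i" "1 <= j" for x y i j
 proof -
 have "2 <= B ^ i" "2 <= B ^ j"
  using mono[OF that(3)] mono[OF that(4)] assms(3) by auto
 then obtain u v where "B ^ i = u + 2" "B ^ j = v + 2" by (metis le_add_diff_inverse2)
 then have "B ^ i + B ^ j <= B ^ i * B ^ j" by simp
 then show ?thesis using that by (simp add: power_add)
 qed
 have B1: "n <= B ==> n <= B ^ Suc i" for n i
 using mono[of 1 "Suc i"] by (simp del: power_Suc)
 show ?thesis using assms(4,5)
 proof (induction e)
 case (Load a)
 have "B ^ weight a < 2 ^ w" using Load pw[of "weight a" "weight a + 1"] by simp
 then show ?case using Load assms(2) B1 by simp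
 next
 case (Add a b)
 have ab: "B ^ weight a < 2 ^ w" "B ^ weight b < 2 ^ w" using Add.prems pw[of _ "weight a + weight b"] by auto
 then have IH: "eval w s a = evn s a" "evn s a <= B ^ weight a" "eval w s b = evn s b" "evn s b <= B ^ weight b"
  using Add ab by auto
 have "evn s a + evn s b <= B ^ (weight a + weight b)"
  using add[OF IH(2,4)] weight_pos by auto
 then show ?case using IH Add.prems by simp
 next
 case (Mul a b)
 have ab: "B ^ weight a < 2 ^ w" "B ^ weight b < 2 ^ w" using Mul.prems pw[of _ "weight a + weight b"] by auto
 then have IH: "eval w s a = evn s a" "evn s a <= B ^ weight a" "eval w s b = evn s b" "evn s b <= B ^ weight b"
  using Mul ab by auto
 have "evn s a * evn s b <= B ^ (weight a + weight b)"
  using IH by (simp add: power_add mult_mono)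
 then show ?case using IH Mul.prems by simp
 next
 case (Sub a b)
 have ab: "B ^ weight a < 2 ^ w" "B ^ weight b < 2 ^ w" using Sub.prems pw[of _ "weight a + weight b"] by auto
 then have IH: "eval w s a = evn s a" "evn s a <= B ^ weight a" "eval w s b = evn s b"
  using Sub ab by auto
 then show ?case using le1[of "evn s a - evn s b"] by simp
 next
 case (Div a b)
 have ab: "B ^ weight a < 2 ^ w" "B ^ weight b < 2 ^ w" using Div.prems pw[of _ "weight a + weight b"] by auto
 then have IH: "eval w s a = evn s a" "evn s a <= B ^ weight a" "eval w s b = evn s b"
  using Div ab by auto
 have "evn s a div evn s b <= B ^ weight a" using IH(2) div_le_dividend le_trans by blast
 then show ?case using IH le1 by simp
 next
 case (Mod a b)
 have ab: "B ^ weight a < 2 ^ w" "B ^ weight b < 2 ^ w" using Mod.prems pw[of _ "weight a + weight b"] by auto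
 then have IH: "eval w s a = evn s a" "evn s a <= B ^ weight a" "eval w s b = evn s b"
  using Mod ab by auto
 have "evn s a mod evn s b <= B ^ weight a" using IH(2) mod_less_eq_dividend le_trans by blast
 then show ?case using IH le1 by simp
 next
 case (Less a b)
 have ab: "B ^ weight a < 2 ^ w" "B ^ weight b < 2 ^ w" using Less.prems pw[of _ "weight a + weight b"] by auto
 then have IH: "eval w s a = evn s a" "eval w s b = evn s b"
  using Less ab by auto
 then show ?case using assms(3) by simp
 qed (use assms in auto)
qed

definition arr :: "(nat => nat) => nat => nat => (nat => nat) => bool" where
 "arr m a L f \<longleftrightarrow> (ALL i<L. m (a + i) = f i)"

text \<open>Register 2 is the heap pointer: everything from there on is still zero, and everything below
 it is never written again. Registers 3 and 4 belong to the array constructor \<open>tab\<close>.\<close>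

abbreviation (input) "HP == 2 :: nat"
abbreviation (input) "TI == 3 :: nat"
abbreviation (input) "TL == 4 :: nat"

text \<open>\<open>B\<close> bounds every register and every cell. The exponent 200 is a ceiling on
  the weights of expressions, so no expression of the programs wraps around; \<open>2 ^ 20\<close>
  covers the explicit numerals, the largest of which is 16384. \<open>V\<close> is the rate at which
  the heap may grow per time unit; it becomes the size of a simulation block.\<close>

locale ram =
 fixes w B V :: nat
 assumes word: "B ^ 200 < 2 ^ w" and B20: "2 ^ 20 <= B" and V_pos: "1 <= V"
begin

definition ok :: "state => bool" where
 "ok s \<longleftrightarrow> (ALL r. regs s r <= B) & (ALL a. mem s a <= B) & (\<forall>a\<ge>regs s HP. mem s a = 0)"

text \<open>Cells below the old heap pointer keep their content for ever. This is what lets saved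
  addresses, stack frames and linked lists be trusted later without any separation argument.\<close>

definition fr :: "nat set => state => state => bool" where
 "fr F s s' \<longleftrightarrow> ok s' & regs s HP <= regs s' HP & (ALL a<regs s HP. mem s' a = mem s a)
  & (ALL r. r ~: F --> regs s' r = regs s r)"

text \<open>The heap grows by at most \<open>V\<close> cells per time unit.\<close>

definition call :: "nat set => nat => cmd => state => (state => bool) => bool" where
 "call F T c s Q \<longleftrightarrow> (ok s & regs s HP + T * V <= B -->
  (EX t s'. t <= T & exec w c s t s' & fr F s s' & regs s' HP <= regs s HP + T * V & Q s'))"

definition small :: "expr => bool" where
 "small e \<longleftrightarrow> weight e <= 200 & consts_le B e"

lemma eval_evn: "ok s ==> small e ==> eval w s e = evn s e"
proof -
 assume "ok s" "small e"
 moreover have "B ^ weight e <= B ^ 200" if "weight e <= 200"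
 using that B20 by (intro power_increasing) auto
 ultimately show ?thesis
 using eval_evn_weight[of s B e w] word B20 by (auto simp: ok_def small_def intro: order.strict_trans1)
qed

lemma ok_regs: "ok s ==> regs s r <= B" and ok_mem: "ok s ==> mem s a <= B"
 and ok_zero: "ok s ==> regs s HP <= a ==> mem s a = 0"
 by (auto simp: ok_def)

lemma ok_upd: "ok s ==> r ~= HP ==> v <= B ==> ok (upd s r v)"
 by (auto simp: ok_def)

lemma ok_upd_HP: "ok s ==> regs s HP <= v ==> v <= B ==> ok (upd s HP v)"
 by (auto simp: ok_def)

lemma fr_refl: "ok s ==> fr F s s"
 by (auto simp: fr_def)

lemma fr_trans: "fr F s s1 ==> fr F s1 s2 ==> fr F s s2"
 unfolding fr_def by (metis le_trans order_less_le_trans)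

lemma fr_mono: "fr F s s1 ==> F \<subseteq> F' ==> fr F' s s1"
 unfolding fr_def by blast

lemma fr_ok: "fr F s s' ==> ok s'" by (simp add: fr_def)
lemma fr_HP: "fr F s s' ==> regs s HP <= regs s' HP" by (simp add: fr_def)
lemma fr_mem: "fr F s s' ==> a < regs s HP ==> mem s' a = mem s a" by (simp add: fr_def)
lemma fr_regs: "fr F s s' ==> r ~: F ==> regs s' r = regs s r" by (simp add: fr_def)

lemma fr_arr: "fr F s s' ==> arr (mem s) a L f ==> a + L <= regs s HP ==> arr (mem s') a L f"
 unfolding fr_def arr_def by auto

lemma callD:
 assumes "call F T c s Q" "ok s" "regs s HP + T * V <= B"
 obtains t s' where "t <= T" "exec w c s t s'" "fr F s s'" "regs s' HP <= regs s HP + T * V" "Q s'"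
 using assms unfolding call_def by blast

lemma callI:
 assumes "ok s ==> regs s HP + T * V <= B ==>
  EX t s'. t <= T & exec w c s t s' & fr F s s' & regs s' HP <= regs s HP + T * V & Q s'"
 shows "call F T c s Q"
 using assms unfolding call_def by blast

lemma call_conseq:
 assumes "call F T c s Q" "F \<subseteq> F'" "T <= T'" "!!s'. fr F s s' ==> Q s' ==> Q' s'"
 shows "call F' T' c s Q'"
proof (rule callI)
 assume 1: "ok s" "regs s HP + T' * V <= B"
 have "T * V <= T' * V" using assms(3) by simp
 with 1 have "regs s HP + T * V <= B" by linarith
 from callD[OF assms(1) 1(1) this] obtain t s' where "t <= T" "exec w c s t s'" "fr F s s'" 
 "regs s' HP <= regs s HP + T * V" "Q s'" .
 then show "EX t s'. t <= T' & exec w c s t s' & fr F' s s' & regs s' HP <= regs s HP + T' * V & Q' s'"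
 using assms \<open>T * V <= T' * V\<close> fr_mono[OF _ assms(2)]
 by (intro exI[of _ t] exI[of _ s'] conjI) (assumption | linarith | blast)+
qed

lemma call_ok: "(ok s ==> call F T c s Q) ==> call F T c s Q"
 unfolding call_def by blast

lemma call_Seq:
 assumes "call F T1 c s Q1" "!!s1. fr F s s1 ==> Q1 s1 ==> call F T2 d s1 Q" "1 + T1 + T2 <= T"
 shows "call F T (Seq c d) s Q"
proof (rule callI)
 assume 1: "ok s" "regs s HP + T * V <= B"
 have "(1 + T1 + T2) * V <= T * V" using assms(3) mult_le_mono1 by blast
 then have TV: "T1 * V + T2 * V <= T * V" by (simp add: algebra_simps)
 with 1 have "regs s HP + T1 * V <= B" by linarith
 from callD[OF assms(1) 1(1) this] obtain t1 s1 where s1: "t1 <= T1" "exec w c s t1 s1" "fr F s s1"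
 "regs s1 HP <= regs s HP + T1 * V" "Q1 s1" .
 have "regs s1 HP + T2 * V <= B" using TV 1 s1(4) by linarith
 from callD[OF assms(2)[OF s1(3,5)] fr_ok[OF s1(3)] this] obtain t2 s2 where
 s2: "t2 <= T2" "exec w d s1 t2 s2" "fr F s1 s2" "regs s2 HP <= regs s1 HP + T2 * V" "Q s2" .
 show "EX t s'. t <= T & exec w (Seq c d) s t s' & fr F s s' & regs s' HP <= regs s HP + T * V & Q s'"
 proof (intro exI conjI)
 show "exec w (Seq c d) s (1 + t1 + t2) s2" using exec_Seq[OF s1(2) s2(2)] .
 show "fr F s s2" using fr_trans[OF s1(3) s2(3)] .
 show "1 + t1 + t2 <= T" using s1(1) s2(1) assms(3) by linarith
 show "regs s2 HP <= regs s HP + T * V" using s1(4) s2(4) TV by linarith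
 qed (rule s2(5))
qed

lemma call_Assign:
 assumes "small e" "r ~= HP" "r \<in> F" "ok s ==> evn s e <= B" "ok s ==> Q (upd s r (evn s e))" "1 <= T"
 shows "call F T (Assign r e) s Q"
proof (rule callI)
 assume 1: "ok s" "regs s HP + T * V <= B"
 have "fr F s (upd s r (evn s e))"
 using assms 1 ok_upd unfolding fr_def by auto
 then show "EX t s'. t <= T & exec w (Assign r e) s t s' & fr F s s' & regs s' HP <= regs s HP + T * V & Q s'"
 using exec_Assign[of w r e s] assms 1 eval_evn[OF 1(1) assms(1)]
 by (intro exI[of _ 1] exI[of _ "upd s r (evn s e)"]) auto
qed

lemma call_Branch:
 assumes "small e" "ok s ==> evn s e ~= 0 ==> call F T' c s Q" "ok s ==> evn s e = 0 ==> call F T' d s Q"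
 "1 + T' <= T"
 shows "call F T (Branch e c d) s Q"
proof (rule callI)
 assume 1: "ok s" "regs s HP + T * V <= B"
 have 2: "call F T' (if eval w s e ~= 0 then c else d) s Q"
 using assms 1 eval_evn by auto
 have 3: "T' * V <= T * V" using assms(4) by (intro mult_le_mono1) simp
 then have "regs s HP + T' * V <= B" using 1(2) by linarith
 from callD[OF 2 1(1) this] obtain t s' where "t <= T'" "exec w (if eval w s e ~= 0 then c else d) s t s'"
 "fr F s s'" "regs s' HP <= regs s HP + T' * V" "Q s'" .
 then show "EX t s'. t <= T & exec w (Branch e c d) s t s' & fr F s s' & regs s' HP <= regs s HP + T * V & Q s'"
 using exec_Branch 3 assms(4) by (intro exI[of _ "1 + t"] exI[of _ s'] conjI) (assumption | linarith | blast)+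
qed

lemma call_Skip: "Q s ==> 1 <= T ==> call F T Skip s Q"
 by (rule callI) (use exec_Skip fr_refl in "auto intro!: exI[of _ 1] exI[of _ s]")

end

text \<open>The general allocation command: cells are appended behind the heap pointer, which is
  moved once at the end. The entry expression can read \<open>TI\<close>, so matrices, stack frames
  and list nodes are all written in this way.\<close>

definition tab :: "nat => expr => expr => cmd" where
 "tab r l e = Seq (Assign r (Reg HP)) (Seq (Assign TL l) (Seq (Assign TI (Const 0))
  (Seq (While (Less (Reg TI) (Reg TL))
  (Seq (Store (Add (Reg HP) (Reg TI)) e) (Assign TI (Add (Reg TI) (Const 1)))))
  (Assign HP (Add (Reg HP) (Reg TL))))))"

context ram
begin

text \<open>The hypothesis on \<open>e\<close> grants it only the cells below the old heap pointer,
  so no entry depends on entries written earlier in the same loop.\<close>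

lemma call_tab:
 assumes r: "r ~: {HP, TI, TL}" and F: "{r, HP, TI, TL} \<subseteq> F"
 and l: "small l" and e: "small e"
 and L: "ok s ==> evn (upd s r (regs s HP)) l = L"
 and f: "!!i s'. i < L ==> ok s ==> regs s' = (regs s)(r := regs s HP, TL := L, TI := i) ==>
  ALL a<regs s HP. mem s' a = mem s a ==> evn s' e = f i & f i <= B"
 and T: "5 * L + 15 <= T"
 and Q: "!!s'. ok s ==> fr {r, HP, TI, TL} s s' ==>
  regs s' = (regs s)(r := regs s HP, TL := L, TI := L, HP := regs s HP + L) ==>
  arr (mem s') (regs s HP) L f ==> Q s'"
 shows "call F T (tab r l e) s Q"
proof (rule callI)
 assume 1: "ok s" "regs s HP + T * V <= B"
 define hp where "hp = regs s HP"
 have "T <= T * V" using V_pos by simp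
 with 1(2) T have LB: "hp + L <= B" "hp + T <= B" "L <= B" unfolding hp_def by linarith+
 define s0 where "s0 = upd s r hp"
 have ok0: "ok s0" using 1 r by (auto simp: s0_def hp_def intro: ok_upd ok_regs)
 define s1 where "s1 = upd s0 TL L"
 have ok1: "ok s1" using ok0 LB by (auto simp: s1_def intro: ok_upd)
 define s2 where "s2 = upd s1 TI 0"
 have ok2: "ok s2" using ok1 by (auto simp: s2_def intro: ok_upd)
 \<comment> \<open>During the loop \<open>ok\<close> may fail, since cells behind the heap pointer
   are already filled. The invariant keeps only the bounds that evaluation needs; \<open>ok\<close>
   returns when the pointer moves.\<close>
 define I :: "nat => state => bool" where "I = (%i s'. i <= L & regs s' = (regs s)(r := hp, TL := L, TI := i) &
  mem s' = (%a. if hp <= a & a < hp + i then f (a - hp) else mem s a))"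
 have fB: "f i <= B" if "i < L" for i
 using f[OF that 1(1), of "s\<lparr>regs := (regs s)(r := regs s HP, TL := L, TI := i)\<rparr>"] by simp
 have Iok: "ALL x. regs s' x <= B" "ALL a. mem s' a <= B" if "I i s'" for i s'
 using that 1(1) LB fB unfolding I_def ok_def hp_def by auto
 have Iev: "eval w s' x = evn s' x" if "I i s'" "small x" for i s' x
 proof -
 have "B ^ weight x <= B ^ 200" using that(2) B20 unfolding small_def by (intro power_increasing) auto
 then show ?thesis
 using eval_evn_weight[of s' B x w] word B20 Iok[OF that(1)] that(2)
 by (auto simp: small_def intro: order.strict_trans1)
 qed
 have lc: "small (Const 0)" "small (Const 1)" "small (Reg HP)" "small (Less (Reg TI) (Reg TL))"
 "small (Add (Reg HP) (Reg TI))" "small (Add (Reg TI) (Const 1))" "small (Add (Reg HP) (Reg TL))"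
 using B20 by (auto simp: small_def)
 have step: "eval w s' (Less (Reg TI) (Reg TL)) ~= 0 & (EX t s''. t <= 3 &
  exec w (Seq (Store (Add (Reg HP) (Reg TI)) e) (Assign TI (Add (Reg TI) (Const 1)))) s' t s'' & I (Suc i) s'')"
 if "i < L" "I i s'" for i s'
 proof -
 have reg: "regs s' = (regs s)(r := hp, TL := L, TI := i)" using that(2) by (simp add: I_def)
 have c: "eval w s' (Less (Reg TI) (Reg TL)) ~= 0" using that reg by simp
 have ev: "eval w s' e = f i"
  using Iev[OF that(2) e] f[OF that(1) 1(1)] that(2) by (auto simp: I_def hp_def)
 have ad: "eval w s' (Add (Reg HP) (Reg TI)) = hp + i"
  using Iev[OF that(2) lc(5)] reg r by (simp add: hp_def)
 define s'' where "s'' = updm s' (hp + i) (f i)"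
 have ex1: "exec w (Store (Add (Reg HP) (Reg TI)) e) s' 1 s''"
  using exec_Store[of w "Add (Reg HP) (Reg TI)" e s'] ev ad by (simp only: s''_def)
 have mem'': "mem s'' = (%a. if hp <= a & a < hp + Suc i then f (a - hp) else mem s a)"
  using that(2) unfolding s''_def I_def by (auto simp: fun_eq_iff less_Suc_eq)
 have "Suc i < 2 ^ w"
 proof -
  have "B ^ 1 <= B ^ 200" using B20 by (intro power_increasing) auto
  then show ?thesis using word LB that(1) by simp
 qed
 then have "eval w s'' (Add (Reg TI) (Const 1)) = Suc i"
  using reg by (cases w) (simp_all add: s''_def mod_simps)
 then have ex2: "exec w (Assign TI (Add (Reg TI) (Const 1))) s'' 1 (upd s'' TI (Suc i))"
  using exec_Assign[of w TI "Add (Reg TI) (Const 1)" s''] by (simp only:)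
 have "I (Suc i) (upd s'' TI (Suc i))"
  using that mem'' reg unfolding I_def s''_def by (auto simp: fun_eq_iff)
 then show ?thesis using c exec_Seq[OF ex1 ex2] by (intro conjI exI) auto
 qed
 have I0: "I 0 s2" using r by (auto simp: I_def s2_def s1_def s0_def fun_eq_iff)
 have stop: "eval w s' (Less (Reg TI) (Reg TL)) = 0" if "I L s'" for s'
 using that by (simp add: I_def)
 obtain t3 s3 where s3: "t3 <= L * (3 + 1) + 1"
 "exec w (While (Less (Reg TI) (Reg TL))
  (Seq (Store (Add (Reg HP) (Reg TI)) e) (Assign TI (Add (Reg TI) (Const 1))))) s2 t3 s3" "I L s3"
 using exec_for[of L I w "Less (Reg TI) (Reg TL)" 3, OF step stop I0] by blast
 have reg3: "regs s3 = (regs s)(r := hp, TL := L, TI := L)" using s3(3) by (simp add: I_def)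
 define s4 where "s4 = upd s3 HP (hp + L)"
 have "eval w s3 (Add (Reg HP) (Reg TL)) = hp + L"
 using Iev[OF s3(3) lc(7)] reg3 r by (simp add: hp_def)
 then have ex4: "exec w (Assign HP (Add (Reg HP) (Reg TL))) s3 1 s4"
 unfolding s4_def using exec_Assign[of w HP "Add (Reg HP) (Reg TL)" s3] by (simp only:)
 have x0: "exec w (Assign r (Reg HP)) s 1 s0"
 using exec_Assign[of w r "Reg HP" s] by (simp add: s0_def hp_def)
 have "eval w s0 l = L" using eval_evn[OF ok0 l] L 1 by (simp add: s0_def hp_def)
 then have x1: "exec w (Assign TL l) s0 1 s1"
 using exec_Assign[of w TL l s0] by (simp add: s1_def)
 have x2: "exec w (Assign TI (Const 0)) s1 1 s2"
 using exec_Assign[of w TI "Const 0" s1] by (simp add: s2_def)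
 have ex: "exec w (tab r l e) s (1 + 1 + (1 + 1 + (1 + 1 + (1 + t3 + 1)))) s4"
 unfolding tab_def by (rule exec_Seq[OF x0 exec_Seq[OF x1 exec_Seq[OF x2 exec_Seq[OF s3(2) ex4]]]])
 have ok4: "ok s4" using s3(3) fB 1 LB r Iok[OF s3(3)] unfolding I_def ok_def s4_def by (auto simp: hp_def)
 have reg4: "regs s4 = (regs s)(r := regs s HP, TL := L, TI := L, HP := regs s HP + L)"
 using reg3 r by (auto simp: s4_def hp_def fun_eq_iff)
 have mem4: "mem s4 = (%a. if hp <= a & a < hp + L then f (a - hp) else mem s a)"
 using s3(3) by (simp add: s4_def I_def)
 have fr4: "fr {r, HP, TI, TL} s s4"
 using ok4 reg4 mem4 r unfolding fr_def by (auto simp: hp_def)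
 have "L <= T * V" using \<open>T <= T * V\<close> T by linarith
 then have h4: "regs s4 HP <= regs s HP + T * V" using reg4 r by simp
 have "arr (mem s4) (regs s HP) L f" using mem4 by (auto simp: arr_def hp_def)
 then have "Q s4" using Q 1 fr4 reg4 by blast
 then show "EX t s'. t <= T & exec w (tab r l e) s t s' & fr F s s' & regs s' HP <= regs s HP + T * V & Q s'"
 using ex fr_mono[OF fr4 F] h4 s3(1) T by (intro exI[of _ "1 + 1 + (1 + 1 + (1 + 1 + (1 + t3 + 1)))"] exI[of _ s4]) auto
qed

end

section \<open>Running a program in a fresh memory block\<close>

abbreviation (input) "RW == 5 :: nat"
abbreviation (input) "RB == 6 :: nat"
abbreviation (input) "DM == 7 :: nat"
abbreviation (input) "PR == 8 :: nat"

text \<open>The relocated program simulates word length \<open>v\<close>, where \<open>2 ^ v\<close> is in register \<open>RW\<close>, in the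
 memory block that starts at the address in register \<open>RB\<close>.\<close>

fun reloc_expr :: "expr => expr" where
 "reloc_expr (Const c) = Mod (Const c) (Reg RW)"
| "reloc_expr (Reg r) = Reg (r + 100)"
| "reloc_expr (Load a) = Load (Add (Reg RB) (reloc_expr a))"
| "reloc_expr (Add a b) = Mod (Add (reloc_expr a) (reloc_expr b)) (Reg RW)"
| "reloc_expr (Sub a b) = Sub (reloc_expr a) (reloc_expr b)"
| "reloc_expr (Mul a b) = Mod (Mul (reloc_expr a) (reloc_expr b)) (Reg RW)"
| "reloc_expr (Div a b) = Div (reloc_expr a) (reloc_expr b)"
| "reloc_expr (Mod a b) = Mod (reloc_expr a) (reloc_expr b)"
| "reloc_expr (Less a b) = Less (reloc_expr a) (reloc_expr b)"

text \<open>Registers move up by 100, out of reach of the host program. One command becomes one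
  command and one expression becomes one expression, so that steps correspond one to one.\<close>

fun reloc :: "cmd => cmd" where
 "reloc Skip = Skip"
| "reloc (Assign r a) = Assign (r + 100) (reloc_expr a)"
| "reloc (Store a b) = Store (Add (Reg RB) (reloc_expr a)) (reloc_expr b)"
| "reloc (Rand r) = Skip"
| "reloc (Seq c d) = Seq (reloc c) (reloc d)"
| "reloc (Branch a c d) = Branch (reloc_expr a) (reloc c) (reloc d)"
| "reloc (While a c) = While (reloc_expr a) (reloc c)"

fun expr_regs :: "expr => nat set" where
 "expr_regs (Const c) = {}"
| "expr_regs (Reg r) = {r}"
| "expr_regs (Load a) = expr_regs a"
| "expr_regs (Add a b) = expr_regs a \<union> expr_regs b"
| "expr_regs (Sub a b) = expr_regs a \<union> expr_regs b"
| "expr_regs (Mul a b) = expr_regs a \<union> expr_regs b"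
| "expr_regs (Div a b) = expr_regs a \<union> expr_regs b"
| "expr_regs (Mod a b) = expr_regs a \<union> expr_regs b"
| "expr_regs (Less a b) = expr_regs a \<union> expr_regs b"

fun cmd_regs :: "cmd => nat set" where
 "cmd_regs Skip = {}"
| "cmd_regs (Assign r a) = insert r (expr_regs a)"
| "cmd_regs (Store a b) = expr_regs a \<union> expr_regs b"
| "cmd_regs (Rand r) = {r}"
| "cmd_regs (Seq c d) = cmd_regs c \<union> cmd_regs d"
| "cmd_regs (Branch a c d) = expr_regs a \<union> cmd_regs c \<union> cmd_regs d"
| "cmd_regs (While a c) = expr_regs a \<union> cmd_regs c"

lemma finite_expr_regs: "finite (expr_regs e)"
 by (induction e) auto

lemma finite_cmd_regs: "finite (cmd_regs c)"
 by (induction c) (auto simp: finite_expr_regs)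

text \<open>Addresses stay below \<open>2 ^ v\<close>, but an output may start at any of them and
  run past the end. Agreement on twice as many cells covers this; the second half of the block is
  never written.\<close>

definition sim :: "nat => nat => state => state => bool" where
 "sim v R sg s \<longleftrightarrow> regs s RW = 2 ^ v & (ALL r<R. regs s (r + 100) = regs sg r & regs sg r < 2 ^ v)
  & (ALL a. mem sg a < 2 ^ v) & (ALL a<2 * 2 ^ v. mem s (regs s RB + a) = mem sg a)"

definition sim_frame :: "nat => nat => state => state => bool" where
 "sim_frame v R s s' \<longleftrightarrow> (ALL r. r < 100 | 100 + R <= r --> regs s' r = regs s r)
  & (ALL a. a < regs s RB | regs s RB + 2 ^ v <= a --> mem s' a = mem s a)"

lemma sim_frame_refl: "sim_frame v R s s"
 by (simp add: sim_frame_def)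

lemma sim_frame_trans: "sim_frame v R s s1 ==> sim_frame v R s1 s2 ==> sim_frame v R s s2"
 by (simp add: sim_frame_def)

text \<open>Reducing modulo \<open>2 ^ w\<close> first does no harm because \<open>2 ^ v\<close>
  divides \<open>2 ^ w\<close>, and the room condition keeps shifted addresses from wrapping
  around.\<close>

lemma sim_eval:
 assumes "sim v R sg s" "1 <= v" "v <= w" "regs s RB + 2 * 2 ^ v <= 2 ^ w" "expr_regs e \<subseteq> {..<R}"
 shows "eval w s (reloc_expr e) = eval v sg e & eval v sg e < 2 ^ v"
proof -
 have dvd: "(2::nat) ^ v dvd 2 ^ w" using assms(3) by (rule le_imp_power_dvd)
 have modmod: "x mod 2 ^ w mod 2 ^ v = x mod 2 ^ v" for x :: nat
 using dvd by (rule mod_mod_cancel)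
 have rw: "regs s RW = 2 ^ v" using assms(1) by (simp add: sim_def)
 have lt: "x - y < 2 ^ v" "x div y < 2 ^ v" "x mod y < 2 ^ v" if "x < 2 ^ v" for x y :: nat
 using that by (auto intro: le_less_trans[OF div_le_dividend] le_less_trans[OF mod_less_eq_dividend])
 have one: "(1::nat) < 2 ^ v" using one_less_power[of "2::nat" v] assms(2) by simp
 show ?thesis using assms(5)
 proof (induction e)
 case (Load a)
 then have IH: "eval w s (reloc_expr a) = eval v sg a" "eval v sg a < 2 ^ v" by auto
 then have "(regs s RB + eval v sg a) mod 2 ^ w = regs s RB + eval v sg a"
  using assms(4) by simp
 then show ?case using IH assms(1) by (simp add: sim_def)
 qed (use assms(1) one lt in "auto simp: sim_def modmod rw")
qed

lemma sim_step:
 assumes sim: "sim v R sg s" and v: "1 <= v" "v <= w" and room: "regs s RB + 2 * 2 ^ v <= 2 ^ w"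
 and det: "deterministic c" and reg: "cmd_regs c \<subseteq> {..<R}"
 shows "EX ds sg' s'. step v (c # cs, sg) = return_pmf (ds @ cs, sg') &
  (ALL cs'. step w (reloc c # cs', s) = return_pmf (map reloc ds @ cs', s')) & sim v R sg' s' & sim_frame v R s s' &
  (\<forall>d\<in>set ds. deterministic d & cmd_regs d \<subseteq> {..<R})"
proof -
 have ev: "eval w s (reloc_expr e) = eval v sg e & eval v sg e < 2 ^ v" if "expr_regs e \<subseteq> {..<R}" for e
 using sim_eval[OF sim v room that] .
 show ?thesis
 proof (cases c)
 case Skip
 then show ?thesis using sim sim_frame_refl by (intro exI[of _ "[]"]) auto
 next
 case (Assign r e)
 define sg' where "sg' = upd sg r (eval v sg e)"
 define s' where "s' = upd s (r + 100) (eval v sg e)"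
 have e: "eval w s (reloc_expr e) = eval v sg e" "eval v sg e < 2 ^ v" "r < R" using ev[of e] reg Assign by auto
 have "sim v R sg' s'" using sim e unfolding sim_def sg'_def s'_def by auto
 moreover have "sim_frame v R s s'" using e by (auto simp: sim_frame_def s'_def)
 ultimately show ?thesis using e Assign
  by (intro exI[of _ "[]"] exI[of _ sg'] exI[of _ s']) (auto simp: sg'_def s'_def upd_def)
 next
 case (Store a e)
 define sg' where "sg' = updm sg (eval v sg a) (eval v sg e)"
 define s' where "s' = updm s (regs s RB + eval v sg a) (eval v sg e)"
 have e: "eval w s (reloc_expr e) = eval v sg e" "eval v sg e < 2 ^ v"
  "eval w s (reloc_expr a) = eval v sg a" "eval v sg a < 2 ^ v" using ev[of e] ev[of a] reg Store by auto
 have "(regs s RB + eval v sg a) mod 2 ^ w = regs s RB + eval v sg a"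
  using room e by simp
 moreover have "sim v R sg' s'" using sim e unfolding sim_def sg'_def s'_def by auto
 moreover have "sim_frame v R s s'" using e by (auto simp: sim_frame_def s'_def)
 ultimately show ?thesis using e Store
  by (intro exI[of _ "[]"] exI[of _ sg'] exI[of _ s']) (auto simp: sg'_def s'_def updm_def)
 next
 case (Rand r)
 then show ?thesis using det by simp
 next
 case (Seq c d)
 then show ?thesis using sim sim_frame_refl det reg
  by (intro exI[of _ "[c, d]"] exI[of _ sg] exI[of _ s]) auto
 next
 case (Branch e c d)
 then show ?thesis using sim sim_frame_refl det reg ev[of e]
  by (intro exI[of _ "[if eval v sg e ~= 0 then c else d]"] exI[of _ sg] exI[of _ s]) auto
 next
 case (While e c)
 then show ?thesis using sim sim_frame_refl det reg ev[of e]
  by (intro exI[of _ "if eval v sg e ~= 0 then [c, While e c] else []"] exI[of _ sg] exI[of _ s]) auto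
 qed
qed

text \<open>Since steps correspond one to one, the simulation costs no time factor. The count
  \<open>t'\<close> may be smaller than \<open>t\<close>: a halted source idles, whereas the
  relocated program hands over to \<open>rest\<close> at once.\<close>

lemma sim_run:
 assumes "run v t (cs, sg) = return_pmf ([], sgf)"
 and "sim v R sg s" and v: "1 <= v" "v <= w" and "regs s RB + 2 * 2 ^ v <= 2 ^ w"
 and "\<forall>c\<in>set cs. deterministic c & cmd_regs c \<subseteq> {..<R}"
 shows "EX t' s'. t' <= t & (ALL rest. run w t' (map reloc cs @ rest, s) = return_pmf (rest, s')) &
 sim v R sgf s' & sim_frame v R s s'"
 using assms(1,2,5,6)
proof (induction t arbitrary: cs sg s)
 case 0
 then show ?case using sim_frame_refl by (intro exI[of _ 0] exI[of _ s]) auto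
next
 case (Suc t)
 show ?case
 proof (cases cs)
 case Nil
 then have "sgf = sg" using Suc.prems(1) by (simp add: bind_return_pmf run_halted)
 then show ?thesis using sim_frame_refl Nil Suc.prems by (intro exI[of _ 0] exI[of _ s]) auto
 next
 case (Cons c cs1)
 obtain ds sg' s' where 1: "step v (c # cs1, sg) = return_pmf (ds @ cs1, sg')"
  "ALL cs'. step w (reloc c # cs', s) = return_pmf (map reloc ds @ cs', s')"
  "sim v R sg' s'" "sim_frame v R s s'" "\<forall>d\<in>set ds. deterministic d & cmd_regs d \<subseteq> {..<R}"
  using sim_step[OF Suc.prems(2) v Suc.prems(3), of c cs1] Suc.prems(4) Cons by auto
 have "run v t (ds @ cs1, sg') = return_pmf ([], sgf)"
  using Suc.prems(1) Cons 1(1) by (simp add: bind_return_pmf)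
 moreover have "regs s' RB + 2 * 2 ^ v <= 2 ^ w"
  using 1(4) Suc.prems(3) by (simp add: sim_frame_def)
 moreover have "\<forall>c\<in>set (ds @ cs1). deterministic c & cmd_regs c \<subseteq> {..<R}"
  using 1(5) Suc.prems(4) Cons by auto
 ultimately obtain t' s'' where 2: "t' <= t" "ALL rest. run w t' (map reloc (ds @ cs1) @ rest, s') = return_pmf (rest, s'')"
  "sim v R sgf s''" "sim_frame v R s' s''"
  using Suc.IH[OF _ 1(3)] by blast
 have "ALL rest. run w (Suc t') (map reloc cs @ rest, s) = return_pmf (rest, s'')"
  using 2(2) 1(2) Cons by (simp add: bind_return_pmf)
 then show ?thesis using 2 sim_frame_trans[OF 1(4) 2(4)] by (intro exI[of _ "Suc t'"] exI[of _ s'']) auto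
 qed
qed

lemma deterministic_run:
 assumes "\<forall>c\<in>set cs. deterministic c"
 shows "EX x. run v t (cs, sg) = return_pmf x"
 using assms
proof (induction t arbitrary: cs sg)
 case (Suc t)
 show ?case
 proof (cases cs)
 case (Cons c cs1)
 have "EX cs' sg'. step v (c # cs1, sg) = return_pmf (cs', sg') & (\<forall>c\<in>set cs'. deterministic c)"
  using Suc.prems Cons by (cases c) (auto simp: return_pmf_inj)
 then show ?thesis using Suc.IH Cons by (force simp: bind_return_pmf)
 qed (simp add: run_halted bind_return_pmf)
qed simp

lemma length_mat_words: "length (mat_words A) = dim_row A * dim_col A"
proof -
 have "length (concat (map (%i. map (g i) [0..<m]) xs)) = length xs * m" for g :: "nat => nat => nat" and m and xs :: "nat list"
 by (induction xs) auto
 then show ?thesis by (simp add: mat_words_def)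
qed

lemma concat_rows: "concat (map (%i. map (%j. f i j) [0..<m]) [0..<n]) = map (%i. f (i div m) (i mod m)) [0..<n * m]"
proof (induction n)
 case (Suc n)
 have "[0..<Suc n * m] = [0..<n * m] @ map (%j. n * m + j) [0..<m]"
 using upt_add_eq_append[of 0 "n * m" m] map_add_upt[of "n * m" m] by (simp add: add.commute)
 moreover have "map (%j. f ((n * m + j) div m) ((n * m + j) mod m)) [0..<m] = map (%j. f n j) [0..<m]"
 by (rule map_cong) auto
 ultimately show ?case using Suc by (simp add: comp_def)
qed simp

lemma mat_words_conv: "mat_words A = map (%i. A $$ (i div dim_col A, i mod dim_col A)) [0..<dim_row A * dim_col A]"
 unfolding mat_words_def by (rule concat_rows)

text \<open>The simulated program starts with zero registers, but the registers from 100 on may hold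
  leftovers of an earlier product.\<close>

fun zero_regs :: "nat => cmd" where
 "zero_regs 0 = Skip"
| "zero_regs (Suc n) = Seq (Assign (n + 100) (Const 0)) (zero_regs n)"

lemma exec_zero_regs:
 "\<exists>t\<le>2 * n + 1. exec w (zero_regs n) s t (s\<lparr>regs := %r. if 100 <= r & r < 100 + n then 0 else regs s r\<rparr>)"
proof (induction n arbitrary: s)
 case 0
 have "s\<lparr>regs := %r. if 100 <= r & r < 100 + 0 then 0 else regs s r\<rparr> = s" by (cases s) auto
 then show ?case using exec_Skip[of w s] by auto
next
 case (Suc n)
 obtain t where t: "t <= 2 * n + 1" "exec w (zero_regs n) (upd s (n + 100) 0) t
  (upd s (n + 100) 0\<lparr>regs := %r. if 100 <= r & r < 100 + n then 0 else regs (upd s (n + 100) 0) r\<rparr>)"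
 using Suc by blast
 moreover have "upd s (n + 100) 0\<lparr>regs := %r. if 100 <= r & r < 100 + n then 0 else regs (upd s (n + 100) 0) r\<rparr>
  = s\<lparr>regs := %r. if 100 <= r & r < 100 + Suc n then 0 else regs s r\<rparr>"
 by (cases s) (auto simp: upd_def fun_eq_iff)
 moreover have 1: "exec w (Assign (n + 100) (Const 0)) s 1 (upd s (n + 100) 0)"
 using exec_Assign[of w "n + 100" "Const 0" s] by simp
 ultimately show ?case using exec_Seq[OF 1 t(2)] by (intro exI[of _ "1 + 1 + t"]) simp
qed

section \<open>Products of residue matrices through the relocated program\<close>

definition Ite :: "expr => expr => expr => expr" where
 "Ite c a b = Add (Mul c a) (Mul (Sub (Const 1) c) b)"

text \<open>A conditional without branching: both arms are evaluated and one of them is multiplied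
  by zero. An arm may thus load from a meaningless address, as every address is readable.\<close>

lemma evn_Ite [simp]: "evn s (Ite (Less x y) a b) = (if evn s x < evn s y then evn s a else evn s b)"
 by (simp add: Ite_def)

lemma weight_Ite [simp]: "weight (Ite c a b) = 2 * weight c + weight a + weight b + 1"
 "consts_le n (Ite c a b) \<longleftrightarrow> 1 <= n & consts_le n c & consts_le n a & consts_le n b"
 by (auto simp: Ite_def)

definition mul_input :: "nat => nat => expr" where
 "mul_input x y = Ite (Less (Reg TI) (Const 1)) (Reg DM)
  (Ite (Less (Reg TI) (Const 2)) (Reg PR)
  (Ite (Less (Reg TI) (Add (Const 2) (Mul (Reg DM) (Reg DM))))
  (Load (Add (Reg x) (Sub (Reg TI) (Const 2))))
  (Load (Add (Reg y) (Sub (Sub (Reg TI) (Const 2)) (Mul (Reg DM) (Reg DM)))))))"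

text \<open>The heap pointer jumps to \<open>RB + 2 * RW\<close>, so each product takes a whole
  block that is still zero behind its input. The result is reduced modulo \<open>p\<close> while
  being copied out of the block.\<close>

definition mul :: "cmd => nat => nat => nat => nat => cmd" where
 "mul P R r x y =
  Seq (tab RB (Add (Const 2) (Mul (Const 2) (Mul (Reg DM) (Reg DM)))) (mul_input x y))
 (Seq (Assign HP (Add (Reg RB) (Mul (Const 2) (Reg RW))))
 (Seq (zero_regs R)
 (Seq (reloc P)
  (tab r (Mul (Reg DM) (Reg DM)) (Mod (Load (Add (Add (Reg RB) (Reg 100)) (Reg TI))) (Reg PR))))))"

text \<open>\<open>mt d\<close> is the running time of \<open>P\<close> on order \<open>d\<close>.
  The condition on \<open>Dmax\<close> makes the whole input fit below address \<open>2 ^ v\<close>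
  of the block, and a result that starts below \<open>2 ^ v\<close> then ends below
  \<open>2 * 2 ^ v\<close>.\<close>

locale matmul_ram = ram w B V for w B V +
 fixes P :: cmd and R v p Dmax :: nat and mt :: "nat => nat"
 assumes det: "deterministic P" and regsP: "cmd_regs P \<subseteq> {..<R}" and R_pos: "1 <= R"
 and v: "1 <= v" "v <= w" and V_eq: "V = 2 * 2 ^ v"
 and p: "2 <= p" "p < 2 ^ v" and Dmax: "2 + 2 * (Dmax * Dmax) <= 2 ^ v"
 and mult: "!!d A C. 1 <= d ==> d <= Dmax ==> A \<in> carrier_mat d d ==> C \<in> carrier_mat d d ==>
  (ALL i<d. ALL j<d. A $$ (i, j) < p & C $$ (i, j) < p) ==>
  \<forall>x \<in> set_pmf (run v (mt d) (start P ([d, p] @ mat_words A @ mat_words C))). has_output x (mat_words (A * C))"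
begin

text \<open>The matrix is integral and memory holds its residues. Inversion and Schur complements
  can then be argued as identities over the integers, with \<open>p\<close> entering only through
  divisibility.\<close>

definition mat_at :: "state => nat => nat => int mat => bool" where
 "mat_at s a d M \<longleftrightarrow> M \<in> carrier_mat d d & a + d * d <= regs s HP &
  (ALL i<d * d. int (mem s (a + i)) = M $$ (i div d, i mod d) mod int p)"

definition params :: "state => bool" where
 "params s \<longleftrightarrow> regs s PR = p & regs s RW = 2 ^ v"

lemma exec_reloc_mult:
 assumes d: "1 <= d" "d <= Dmax"
 and A: "A \<in> carrier_mat d d" "C \<in> carrier_mat d d"
 and lt: "ALL i<d. ALL j<d. A $$ (i, j) < p & C $$ (i, j) < p"
 and rw: "regs s RW = 2 ^ v" and room: "regs s RB + 2 * 2 ^ v <= 2 ^ w"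
 and zr: "ALL r<R. regs s (r + 100) = 0"
 and inp: "arr (mem s) (regs s RB) (2 + 2 * (d * d)) (%i. ([d, p] @ mat_words A @ mat_words C) ! i)"
 and z: "\<forall>a \<ge> regs s RB + (2 + 2 * (d * d)). mem s a = 0"
 shows "EX t s' r0. t <= mt d & exec w (reloc P) s t s' & sim_frame v R s s' &
  (ALL r. 100 <= r & r < 100 + R --> regs s' r < 2 ^ v) &
  (ALL a<2 * 2 ^ v. mem s' (regs s RB + a) < 2 ^ v) &
  regs s' 100 = r0 & r0 < 2 ^ v &
  (ALL i<d * d. mem s' (regs s RB + r0 + i) = (A * C) $$ (i div d, i mod d))"
proof -
 define xs where "xs = [d, p] @ mat_words A @ mat_words C"
 define sg where "sg = snd (start P xs)"
 have st: "start P xs = ([P], sg)" by (simp add: start_def sg_def)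
 have len: "length xs = 2 + 2 * (d * d)" using A by (simp add: xs_def length_mat_words)
 have D2: "d * d <= Dmax * Dmax" using d by (intro mult_mono) auto
 then have len_le: "length xs <= 2 ^ v" using len Dmax by linarith
 have "d < 2 ^ v" 
 proof -
 have "d <= d * d" by simp
 then show ?thesis using D2 Dmax by linarith
 qed
 moreover have "x < 2 ^ v" if "x \<in> set (mat_words A @ mat_words C)" for x
 proof -
 have "x < p" 
  using that lt A d by (auto simp: mat_words_def)
 then show ?thesis using p by simp
 qed
 ultimately have xs_lt: "\<forall>x\<in>set xs. x < 2 ^ v" using p by (auto simp: xs_def)
 then have mem_lt: "mem sg a < 2 ^ v" for a
 by (auto simp: sg_def start_def)
 have simi: "sim v R sg s" unfolding sim_def
 proof (intro conjI allI impI)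
 fix a assume "a < 2 * (2::nat) ^ v"
 show "mem s (regs s RB + a) = mem sg a"
 proof (cases "a < length xs")
  case True
  then show ?thesis using inp len unfolding arr_def xs_def[symmetric] by (simp add: sg_def start_def)
 next
  case False
  then show ?thesis using z len by (simp add: sg_def start_def)
 qed
 qed (use rw zr mem_lt in "auto simp: sg_def start_def")
 have "\<forall>c\<in>set [P]. deterministic c" using det by simp
 from deterministic_run[OF this] obtain x where x: "run v (mt d) ([P], sg) = return_pmf x" by blast
 then have out: "has_output x (mat_words (A * C))"
 using mult[OF d A lt] st unfolding xs_def[symmetric] by simp
 then obtain sgf where xf: "x = ([], sgf)" by (cases x) (auto simp: has_output_def halted_def)
 have fin: "ALL i<d * d. mem sgf (regs sgf 0 + i) = (A * C) $$ (i div d, i mod d)"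
 using out A unfolding has_output_def xf mat_words_conv by auto
 moreover have "EX t' s'. t' <= mt d & (ALL rest. run w t' (map reloc [P] @ rest, s) = return_pmf (rest, s')) &
 sim v R sgf s' & sim_frame v R s s'"
 using sim_run[OF x[unfolded xf] simi v room] det regsP by simp
 ultimately obtain t' s' where *: "t' <= mt d" "exec w (reloc P) s t' s'" "sim v R sgf s'" "sim_frame v R s s'"
 by (auto simp: exec_def)
 have RB: "regs s' RB = regs s RB" using *(4) by (simp add: sim_frame_def)
 have r0: "regs s' 100 = regs sgf 0" "regs sgf 0 < 2 ^ v" using *(3) R_pos by (auto simp: sim_def)
 show ?thesis
 proof (intro exI conjI allI impI)
 show "t' <= mt d" "exec w (reloc P) s t' s'" "sim_frame v R s s'" using * by auto
 show "regs s' r < 2 ^ v" if "100 <= r & r < 100 + R" for r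
  using *(3) that unfolding sim_def by (metis add.commute le_add_diff_inverse nat_add_left_cancel_less)
 show mlt: "mem s' (regs s RB + a) < 2 ^ v" if "a < 2 * 2 ^ v" for a
  using *(3) that RB by (simp add: sim_def)
 show "mem s' (regs s RB + regs sgf 0 + i) = (A * C) $$ (i div d, i mod d)" if "i < d * d" for i
 proof -
  \<comment> \<open>The end of the output may lie beyond the addressable range of the simulated
    machine, hence the factor 2.\<close>
  have "regs sgf 0 + i < 2 * 2 ^ v" using r0 that D2 Dmax by linarith
  then have "mem s' (regs s RB + (regs sgf 0 + i)) = mem sgf (regs sgf 0 + i)"
  using *(3) RB unfolding sim_def by metis
  then show ?thesis using fin that by (simp add: add.assoc)
 qed
 qed (use r0 in auto)
qed

lemma mat_mult_mod:
 assumes "A \<in> carrier_mat d d" "C \<in> carrier_mat d d" "i < d" "j < d"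
 shows "int ((mat d d (%x. nat (A $$ x mod int p)) * mat d d (%x. nat (C $$ x mod int p))) $$ (i, j)) mod int p
 = (A * C) $$ (i, j) mod int p"
proof -
 have "int ((mat d d (%x. nat (A $$ x mod int p)) * mat d d (%x. nat (C $$ x mod int p))) $$ (i, j))
 = (\<Sum>k = 0..<d. (A $$ (i, k) mod int p) * (C $$ (k, j) mod int p))"
 using assms p by (simp add: scalar_prod_def)
 also have "... mod int p = (\<Sum>k = 0..<d. A $$ (i, k) * C $$ (k, j)) mod int p"
 proof -
 have "(\<Sum>k = 0..<d. (A $$ (i, k) mod int p) * (C $$ (k, j) mod int p)) mod int p
  = (\<Sum>k = 0..<d. (A $$ (i, k) mod int p) * (C $$ (k, j) mod int p) mod int p) mod int p"
  by (simp add: mod_sum_eq)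
 also have "... = (\<Sum>k = 0..<d. A $$ (i, k) * C $$ (k, j) mod int p) mod int p"
  by (simp add: mod_mult_eq)
 finally show ?thesis by (simp add: mod_sum_eq)
 qed
 finally show ?thesis using assms by (simp add: scalar_prod_def)
qed

lemma call_mul:
 assumes r: "r ~: {HP, TI, TL, RB, RW, DM, PR}" "x ~: {HP, TI, TL, RB}" "y ~: {HP, TI, TL, RB}"
  "r < 100" "x < 100" "y < 100"
 and F: "{r, HP, TI, TL, RB} \<union> {100..<100 + R} \<subseteq> F"
 and s: "params s" "regs s DM = d" "1 <= d" "d <= Dmax"
 and A: "mat_at s (regs s x) d A" and C: "mat_at s (regs s y) d C"
 and T: "20 * (d * d) + mt d + 2 * R + 60 <= T"
 and Q: "!!s'. ok s ==> fr ({r, HP, TI, TL, RB} \<union> {100..<100 + R}) s s' ==> mat_at s' (regs s' r) d (A * C) ==> Q s'"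
 shows "call F T (mul P R r x y) s Q"
proof (rule callI)
 assume 1: "ok s" "regs s HP + T * V <= B"
 define hp where "hp = regs s HP"
 define L where "L = 2 + 2 * (d * d)"
 define T1 where "T1 = 5 * L + 15"
 define T3 where "T3 = 5 * (d * d) + 15"
 have D2: "d * d <= Dmax * Dmax" using s by (intro mult_mono) auto
 have Lv: "L <= 2 ^ v" using D2 Dmax by (simp add: L_def)
 have Ts: "1 + (T1 + T3) <= T" "1 + T3 <= T" "T1 <= T" "1 + d * d <= T"
 using T by (auto simp: T1_def T3_def L_def)
 have TV: "(1 + (T1 + T3)) * V <= T * V" "(1 + T3) * V <= T * V" "T1 * V <= T * V" "(1 + d * d) * V <= T * V"
 using Ts mult_le_mono1 by blast+
 have carr: "A \<in> carrier_mat d d" "C \<in> carrier_mat d d" using A C by (auto simp: mat_at_def)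
 define A' where "A' = mat d d (%x. nat (A $$ x mod int p))"
 define C' where "C' = mat d d (%x. nat (C $$ x mod int p))"
 have carr': "A' \<in> carrier_mat d d" "C' \<in> carrier_mat d d" by (auto simp: A'_def C'_def)
 have lt': "ALL i<d. ALL j<d. A' $$ (i, j) < p & C' $$ (i, j) < p"
 using p by (auto simp: A'_def C'_def nat_less_iff)
 have idx: "i div d < d" "i mod d < d" if "i < d * d" for i
 using that s(3) by (auto simp: less_mult_imp_div_less)
 define f where "f = (%i. ([d, p] @ mat_words A' @ mat_words C') ! i)"
 have Ai: "mem s (regs s x + i) = nat (A $$ (i div d, i mod d) mod int p)" 
 "mem s (regs s y + i) = nat (C $$ (i div d, i mod d) mod int p)" if "i < d * d" for i
 using A C that unfolding mat_at_def by (metis nat_int)+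
 have fA: "f (i + 2) = mem s (regs s x + i)" "f (i + 2 + d * d) = mem s (regs s y + i)" if "i < d * d" for i
 using that Ai idx carr' unfolding f_def
 by (auto simp: nth_append length_mat_words mat_words_conv A'_def C'_def)
 have f0: "f 0 = d" "f 1 = p" by (auto simp: f_def)
 have hx: "regs s x + d * d <= hp" "regs s y + d * d <= hp" using A C by (auto simp: mat_at_def hp_def)
 have "call {RB, HP, TI, TL} T1 (tab RB (Add (Const 2) (Mul (Const 2) (Mul (Reg DM) (Reg DM)))) (mul_input x y)) s
 (%s'. fr {RB, HP, TI, TL} s s' & regs s' = (regs s)(RB := hp, TL := L, TI := L, HP := hp + L) & arr (mem s') hp L f)"
 proof (rule call_tab[where L = L and f = f])
 show "evn s' (mul_input x y) = f i & f i <= B"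
  if i: "i < L" and reg: "regs s' = (regs s)(RB := regs s HP, TL := L, TI := i)"
  and mm: "ALL a<regs s HP. mem s' a = mem s a" for i s'
 proof -
  have R: "regs s' TI = i" "regs s' DM = d" "regs s' PR = p" "regs s' x = regs s x" "regs s' y = regs s y"
  using reg r s by (auto simp: params_def)
  consider "i = 0" | "i = 1" | j where "i = j + 2" "j < d * d" | j where "i = j + 2 + d * d" "j < d * d"
  proof -
  have "i = 0 | i = 1 | (i = (i - 2) + 2 & i - 2 < d * d) | (i = (i - 2 - d * d) + 2 + d * d & i - 2 - d * d < d * d)"
  using i by (auto simp: L_def)
  then show thesis using that by blast
  qed
  then show ?thesis
  proof cases
  case 1
  then show ?thesis using R f0 ok_regs[OF \<open>ok s\<close>, of DM] s by (simp add: mul_input_def)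
  next
  case 2
  then show ?thesis using R f0 ok_regs[OF \<open>ok s\<close>, of PR] s by (simp add: mul_input_def params_def)
  next
  case 3
  then have "mem s' (regs s x + j) = mem s (regs s x + j)" using mm hx by (auto simp: hp_def)
  then show ?thesis using R fA(1)[OF 3(2)] 3 ok_mem[OF \<open>ok s\<close>] by (simp add: mul_input_def)
  next
  case 4
  then have "mem s' (regs s y + j) = mem s (regs s y + j)" using mm hx by (auto simp: hp_def)
  then show ?thesis using R fA(2)[OF 4(2)] 4 ok_mem[OF \<open>ok s\<close>] by (simp add: mul_input_def)
  qed
 qed
 qed (use s B20 in "auto simp: small_def mul_input_def L_def T1_def hp_def")
 note c1 = this
 have b1: "regs s HP + T1 * V <= B" using 1(2) TV(3) by linarith
 obtain t1 s1 where s1: "t1 <= T1"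
 "exec w (tab RB (Add (Const 2) (Mul (Const 2) (Mul (Reg DM) (Reg DM)))) (mul_input x y)) s t1 s1"
 "fr {RB, HP, TI, TL} s s1" "regs s1 = (regs s)(RB := hp, TL := L, TI := L, HP := hp + L)" "arr (mem s1) hp L f"
 using callD[OF c1 1(1) b1] by blast
 have ok1: "ok s1" using s1(3) by (rule fr_ok)
 have VB: "hp + V + T3 * V <= B" "hp + V <= B" "2 ^ v <= B" using TV(2) 1(2) by (auto simp: hp_def V_eq algebra_simps)
 have rw: "regs s RW = 2 ^ v" using s by (simp add: params_def)
 define s2 where "s2 = upd s1 HP (hp + V)"
 have ok2: "ok s2" unfolding s2_def
 using ok1 VB Lv s1(4) by (intro ok_upd_HP) (auto simp: V_eq)
 have e2: "exec w (Assign HP (Add (Reg RB) (Mul (Const 2) (Reg RW)))) s1 1 s2"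
 proof -
 have "eval w s1 (Add (Reg RB) (Mul (Const 2) (Reg RW))) = hp + V"
  using eval_evn[OF ok1, of "Add (Reg RB) (Mul (Const 2) (Reg RW))"] B20 s1(4) rw by (simp add: small_def V_eq)
 then show ?thesis using exec_Assign[of w HP "Add (Reg RB) (Mul (Const 2) (Reg RW))" s1] unfolding s2_def by simp
 qed
 define s3 where "s3 = s2\<lparr>regs := %r. if 100 <= r & r < 100 + R then 0 else regs s2 r\<rparr>"
 obtain t3 where e3: "t3 <= 2 * R + 1" "exec w (zero_regs R) s2 t3 s3"
 using exec_zero_regs[of R w s2] unfolding s3_def by blast
 have ok3: "ok s3" using ok2 unfolding s3_def ok_def by auto
 have r3: "regs s3 RB = hp" "regs s3 RW = 2 ^ v" "regs s3 HP = hp + V" using s1(4) rw by (auto simp: s3_def s2_def)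
 have m3: "mem s3 = mem s1" by (simp add: s3_def s2_def)
 have "hp + 2 * 2 ^ v <= 2 ^ w"
 proof -
 have "B ^ 1 <= B ^ 200" using B20 by (intro power_increasing) auto
 then show ?thesis using VB word by (simp add: V_eq)
 qed
 then obtain t4 s4 r0 where s4: "t4 <= mt d" "exec w (reloc P) s3 t4 s4" "sim_frame v R s3 s4"
  "ALL r. 100 <= r & r < 100 + R --> regs s4 r < 2 ^ v"
  "ALL a<2 * 2 ^ v. mem s4 (hp + a) < 2 ^ v" "regs s4 100 = r0" "r0 < 2 ^ v"
  "ALL i<d * d. mem s4 (hp + r0 + i) = (A' * C') $$ (i div d, i mod d)"
 using exec_reloc_mult[OF s(3,4) carr' lt' r3(2), unfolded r3(1)] s1(4,5) m3 ok1
 by (auto simp: s3_def f_def L_def ok_def)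
 have reg4: "regs s4 z = regs s3 z" if "z < 100 | 100 + R <= z" for z
 using s4(3) that unfolding sim_frame_def by blast
 \<comment> \<open>The simulated program leaves garbage in its block, but this lies below the raised
   heap pointer and is bounded by \<open>2 ^ v <= B\<close>.\<close>
 have ok4: "ok s4" unfolding ok_def
 proof (intro conjI allI impI)
 show "regs s4 z <= B" for z using reg4[of z] s4(4) VB(3) ok_regs[OF ok3, of z] by (cases "100 <= z & z < 100 + R") (auto simp: not_le not_less intro: less_imp_le order.strict_trans1[of _ "2 ^ v"] order.strict_trans2)
 show "mem s4 a <= B" for a
 proof (cases "hp <= a & a < hp + 2 ^ v")
  case True
  then obtain b where "a = hp + b" "b < 2 ^ v" by (metis le_add_diff_inverse nat_add_left_cancel_less)
  then have "mem s4 a < 2 ^ v" using s4(5) by simp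
  then show ?thesis using VB(3) by linarith
 next
  case False
  then show ?thesis using s4(3) r3 ok_mem[OF ok3, of a] by (auto simp: sim_frame_def)
 qed
 show "mem s4 a = 0" if "regs s4 HP <= a" for a
  using that reg4[of HP] r3 s4(3) ok_zero[OF ok3, of a] by (simp add: sim_frame_def V_eq)
 qed
 let ?F0 = "{r, HP, TI, TL, RB} \<union> {100..<100 + R}"
 have fr4: "fr ?F0 s s4" unfolding fr_def
 proof (intro conjI allI impI ok4)
 show "regs s HP <= regs s4 HP" using reg4[of HP] r3 by (simp add: hp_def)
 show "mem s4 a = mem s a" if "a < regs s HP" for a
  using s4(3) that r3 m3 s1(3) by (simp add: sim_frame_def fr_def hp_def)
 show "regs s4 z = regs s z" if "z ~: ?F0" for z
  using that reg4[of z] s1(4) by (auto simp: s3_def s2_def not_less)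
 qed
 have p4: "regs s4 DM = d" "regs s4 PR = p" "regs s4 HP = hp + V" "regs s4 RB = hp"
 using reg4[of DM] reg4[of PR] reg4[of HP] reg4[of RB] s s1(4) by (auto simp: s3_def s2_def params_def)
 let ?f = "%i. (A' * C') $$ (i div d, i mod d) mod p"
 have "call ?F0 T3 (tab r (Mul (Reg DM) (Reg DM)) (Mod (Load (Add (Add (Reg RB) (Reg 100)) (Reg TI))) (Reg PR))) s4
  (%s'. regs s' r = regs s4 HP & regs s' HP = regs s4 HP + d * d & arr (mem s') (regs s4 HP) (d * d) ?f)"
 proof (rule call_tab[where L = "d * d" and f = ?f])
 show "evn s' (Mod (Load (Add (Add (Reg RB) (Reg 100)) (Reg TI))) (Reg PR)) = ?f i & ?f i <= B"
  if i: "i < d * d" and reg: "regs s' = (regs s4)(r := regs s4 HP, TL := d * d, TI := i)"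
  and mm: "ALL a<regs s4 HP. mem s' a = mem s4 a" for i s'
 proof -
  have "mem s' (hp + r0 + i) = mem s4 (hp + r0 + i)"
  using mm i Lv s4(7) p4 by (auto simp: L_def V_eq)
  then have "mem s' (hp + r0 + i) = (A' * C') $$ (i div d, i mod d)"
  using i s4(8) by simp
  moreover have "regs s' RB = hp" "regs s' 100 = r0" "regs s' PR = p" "regs s' TI = i"
  using reg p4 r s4(6) by auto
  moreover have "z mod p <= B" for z using p VB(3) mod_less_divisor[of p z] by linarith
  ultimately show ?thesis by simp
 qed
 qed (use r p4 B20 in "auto simp: small_def T3_def")
 note c5 = this
 have b5: "regs s4 HP + T3 * V <= B" using VB(1) p4(3) by simp
 obtain t5 s5 where s5: "t5 <= T3" 
 "exec w (tab r (Mul (Reg DM) (Reg DM)) (Mod (Load (Add (Add (Reg RB) (Reg 100)) (Reg TI))) (Reg PR))) s4 t5 s5"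
 "fr ?F0 s4 s5" "regs s5 r = hp + V" "regs s5 HP = hp + V + d * d" "arr (mem s5) (hp + V) (d * d) ?f"
 using callD[OF c5 ok4 b5] unfolding p4(3) by blast
 have ex: "exec w (mul P R r x y) s (1 + t1 + (1 + 1 + (1 + t3 + (1 + t4 + t5)))) s5"
 unfolding mul_def
 by (rule exec_Seq[OF s1(2) exec_Seq[OF e2 exec_Seq[OF e3(2) exec_Seq[OF s4(2) s5(2)]]]])
 have fr5: "fr ?F0 s s5" using fr_trans[OF fr4 s5(3)] .
 have "mat_at s5 (regs s5 r) d (A * C)" unfolding mat_at_def
 proof (intro conjI allI impI)
 show "A * C \<in> carrier_mat d d" using carr by simp
 show "regs s5 r + d * d <= regs s5 HP" using s5 by simp
 show "int (mem s5 (regs s5 r + i)) = (A * C) $$ (i div d, i mod d) mod int p" if "i < d * d" for i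
  using s5(4,6) that mat_mult_mod[OF carr idx[OF that]] by (simp add: arr_def zmod_int A'_def C'_def)
 qed
 then have "Q s5" using Q 1 fr5 by blast
 moreover have "1 + t1 + (1 + 1 + (1 + t3 + (1 + t4 + t5))) <= T"
 using s1(1) e3(1) s4(1) s5(1) T by (simp add: T1_def T3_def L_def)
 moreover have "regs s5 HP <= regs s HP + T * V"
 proof -
 have "d * d <= d * d * V" using V_pos by simp
 then have "V + d * d <= (1 + d * d) * V" by (simp add: algebra_simps)
 then show ?thesis using s5(5) TV(4) unfolding hp_def by linarith
 qed
 ultimately show "EX t s'. t <= T & exec w (mul P R r x y) s t s' & fr F s s' & regs s' HP <= regs s HP + T * V & Q s'"
 using ex fr_mono[OF fr5 F] by blast
qed

end

section \<open>Division-free inversion by blocks\<close>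

text \<open>Block column elimination with \<open>B\<close> in the role of \<open>d\<close> times the
  inverse of \<open>A\<close>; scaling the right block column by \<open>d\<close> replaces the
  division.\<close>

lemma schur_block:
 fixes A :: "int mat"
 assumes A: "A \<in> carrier_mat n n" and Q: "Q \<in> carrier_mat n m" and P: "P \<in> carrier_mat m n"
 and E: "E \<in> carrier_mat m m" and B: "B \<in> carrier_mat n n" and AB: "A * B = d \<cdot>\<^sub>m 1\<^sub>m n"
 shows "four_block_mat A Q P E * four_block_mat (1\<^sub>m n) (-1 \<cdot>\<^sub>m (B * Q)) (0\<^sub>m m n) (d \<cdot>\<^sub>m 1\<^sub>m m)
 = four_block_mat A (0\<^sub>m n m) P (d \<cdot>\<^sub>m E - P * (B * Q))"
proof -
 have BQ: "B * Q \<in> carrier_mat n m" using B Q by simp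
 have c: "-1 \<cdot>\<^sub>m (B * Q) \<in> carrier_mat n m" "d \<cdot>\<^sub>m 1\<^sub>m m \<in> carrier_mat m m" using BQ by auto
 have "A * (B * Q) = d \<cdot>\<^sub>m Q"
 using assoc_mult_mat[OF A B Q] AB mult_smult_assoc_mat[of "1\<^sub>m n" n n Q m d] Q by simp
 then have 2: "A * (-1 \<cdot>\<^sub>m (B * Q)) + Q * (d \<cdot>\<^sub>m 1\<^sub>m m) = 0\<^sub>m n m"
 using mult_smult_distrib[OF A BQ, of "-1"] mult_smult_distrib[OF Q one_carrier_mat, of d] Q
 by (intro eq_matI) auto
 have 4: "P * (-1 \<cdot>\<^sub>m (B * Q)) + E * (d \<cdot>\<^sub>m 1\<^sub>m m) = d \<cdot>\<^sub>m E - P * (B * Q)"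
 using mult_smult_distrib[OF P BQ, of "-1"] mult_smult_distrib[OF E one_carrier_mat, of d] E P BQ
 by (intro eq_matI) auto
 have 1: "A * 1\<^sub>m n + Q * 0\<^sub>m m n = A" and 3: "P * 1\<^sub>m n + E * 0\<^sub>m m n = P"
 using A Q P E by auto
 show ?thesis
 using mult_four_block_mat[OF A Q P E one_carrier_mat c(1) zero_carrier_mat c(2)] 1 2 3 4 by simp
qed

text \<open>The right factor of \<open>schur_block\<close> is block triangular with determinant
  \<open>d ^ m\<close>, which accounts for the power of \<open>d\<close>.\<close>

lemma schur_det:
 fixes A :: "int mat"
 assumes A: "A \<in> carrier_mat n n" and Q: "Q \<in> carrier_mat n m" and P: "P \<in> carrier_mat m n"
 and E: "E \<in> carrier_mat m m" and B: "B \<in> carrier_mat n n" and AB: "A * B = d \<cdot>\<^sub>m 1\<^sub>m n"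
 shows "det (four_block_mat A Q P E) * d ^ m = det A * det (d \<cdot>\<^sub>m E - P * (B * Q))"
proof -
 let ?N = "four_block_mat (1\<^sub>m n) (-1 \<cdot>\<^sub>m (B * Q)) (0\<^sub>m m n) (d \<cdot>\<^sub>m 1\<^sub>m m)"
 have c: "-1 \<cdot>\<^sub>m (B * Q) \<in> carrier_mat n m" "d \<cdot>\<^sub>m 1\<^sub>m m \<in> carrier_mat m m" 
  "d \<cdot>\<^sub>m E - P * (B * Q) \<in> carrier_mat m m" using B Q P E by auto
 have "det ?N = d ^ m"
 using det_four_block_mat_lower_left_zero[OF one_carrier_mat c(1) refl c(2)] by simp
 moreover have "det (four_block_mat A Q P E * ?N) = det (four_block_mat A Q P E) * det ?N"
 by (rule det_mult[of _ "n + m"]) (use A E c in auto)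
 ultimately show ?thesis
 using schur_block[OF assms] det_four_block_mat_upper_right_zero[OF A refl P c(3)] by simp
qed

text \<open>The first factor \<open>?N1\<close> makes the matrix block lower triangular, and the
  second factor \<open>?N2\<close> inverts the result up to the scalar \<open>d1 * d2\<close>. The
  displayed blocks are the product of the two factors.\<close>

lemma block_inverse:
 fixes A :: "int mat"
 assumes A: "A \<in> carrier_mat n n" and Q: "Q \<in> carrier_mat n m" and P: "P \<in> carrier_mat m n"
 and E: "E \<in> carrier_mat m m" and B: "B \<in> carrier_mat n n" and AB: "A * B = d1 \<cdot>\<^sub>m 1\<^sub>m n"
 and B2: "B2 \<in> carrier_mat m m" and SB: "(d1 \<cdot>\<^sub>m E - P * (B * Q)) * B2 = d2 \<cdot>\<^sub>m 1\<^sub>m m"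
 shows "four_block_mat A Q P E * four_block_mat
  (d2 \<cdot>\<^sub>m B + ((B * Q) * B2) * (P * B)) (- d1 \<cdot>\<^sub>m ((B * Q) * B2))
  (- d1 \<cdot>\<^sub>m (B2 * (P * B))) ((d1 * d1) \<cdot>\<^sub>m B2) = (d1 * d2) \<cdot>\<^sub>m 1\<^sub>m (n + m)"
proof -
 define U where "U = B * Q"
 define Y where "Y = P * B"
 define S where "S = d1 \<cdot>\<^sub>m E - P * U"
 have c: "U \<in> carrier_mat n m" "Y \<in> carrier_mat m n" "S \<in> carrier_mat m m" using A Q P E B by (auto simp: U_def Y_def S_def)
 let ?M = "four_block_mat A Q P E"
 let ?N1 = "four_block_mat (1\<^sub>m n) (-1 \<cdot>\<^sub>m U) (0\<^sub>m m n) (d1 \<cdot>\<^sub>m 1\<^sub>m m)"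
 let ?N2 = "four_block_mat (d2 \<cdot>\<^sub>m B) (0\<^sub>m n m) (-1 \<cdot>\<^sub>m (B2 * Y)) (d1 \<cdot>\<^sub>m B2)"
 have B2Y: "B2 * Y \<in> carrier_mat m n" using B2 c by simp
 have N12: "?N1 * ?N2 = four_block_mat (d2 \<cdot>\<^sub>m B + (U * B2) * Y) (- d1 \<cdot>\<^sub>m (U * B2))
  (- d1 \<cdot>\<^sub>m (B2 * Y)) ((d1 * d1) \<cdot>\<^sub>m B2)"
 proof -
 have "1\<^sub>m n * (d2 \<cdot>\<^sub>m B) + (-1 \<cdot>\<^sub>m U) * (-1 \<cdot>\<^sub>m (B2 * Y)) = d2 \<cdot>\<^sub>m B + (U * B2) * Y"
 proof -
  have "(-1 \<cdot>\<^sub>m U) * (-1 \<cdot>\<^sub>m (B2 * Y)) = -1 \<cdot>\<^sub>m (U * (-1 \<cdot>\<^sub>m (B2 * Y)))"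
  by (rule mult_smult_assoc_mat[OF c(1) smult_carrier_mat[OF B2Y]])
  also have "U * (-1 \<cdot>\<^sub>m (B2 * Y)) = -1 \<cdot>\<^sub>m (U * (B2 * Y))"
  by (rule mult_smult_distrib[OF c(1) B2Y])
  also have "-1 \<cdot>\<^sub>m (-1 \<cdot>\<^sub>m (U * (B2 * Y))) = U * (B2 * Y)" using c B2Y by (intro eq_matI) auto
  also have "... = (U * B2) * Y" using assoc_mult_mat[OF c(1) B2 c(2)] by simp
  finally show ?thesis using B by simp
 qed
 moreover have "1\<^sub>m n * 0\<^sub>m n m + (-1 \<cdot>\<^sub>m U) * (d1 \<cdot>\<^sub>m B2) = - d1 \<cdot>\<^sub>m (U * B2)"
 proof -
  have "(-1 \<cdot>\<^sub>m U) * (d1 \<cdot>\<^sub>m B2) = -1 \<cdot>\<^sub>m (U * (d1 \<cdot>\<^sub>m B2))"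
  by (rule mult_smult_assoc_mat[OF c(1) smult_carrier_mat[OF B2]])
  also have "U * (d1 \<cdot>\<^sub>m B2) = d1 \<cdot>\<^sub>m (U * B2)"
  by (rule mult_smult_distrib[OF c(1) B2])
  finally show ?thesis using c B2 by (intro eq_matI) auto
 qed
 moreover have "0\<^sub>m m n * (d2 \<cdot>\<^sub>m B) + (d1 \<cdot>\<^sub>m 1\<^sub>m m) * (-1 \<cdot>\<^sub>m (B2 * Y)) = - d1 \<cdot>\<^sub>m (B2 * Y)"
 proof -
  have "(d1 \<cdot>\<^sub>m 1\<^sub>m m) * (-1 \<cdot>\<^sub>m (B2 * Y)) = d1 \<cdot>\<^sub>m (1\<^sub>m m * (-1 \<cdot>\<^sub>m (B2 * Y)))"
  by (rule mult_smult_assoc_mat[OF one_carrier_mat smult_carrier_mat[OF B2Y]])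
  moreover have "1\<^sub>m m * (-1 \<cdot>\<^sub>m (B2 * Y)) = -1 \<cdot>\<^sub>m (B2 * Y)"
  by (rule left_mult_one_mat[OF smult_carrier_mat[OF B2Y]])
  ultimately show ?thesis using B B2Y by (intro eq_matI) auto
 qed
 moreover have "0\<^sub>m m n * 0\<^sub>m n m + (d1 \<cdot>\<^sub>m 1\<^sub>m m) * (d1 \<cdot>\<^sub>m B2) = (d1 * d1) \<cdot>\<^sub>m B2"
 proof -
  have "(d1 \<cdot>\<^sub>m 1\<^sub>m m) * (d1 \<cdot>\<^sub>m B2) = d1 \<cdot>\<^sub>m (1\<^sub>m m * (d1 \<cdot>\<^sub>m B2))"
  by (rule mult_smult_assoc_mat[OF one_carrier_mat smult_carrier_mat[OF B2]])
  moreover have "1\<^sub>m m * (d1 \<cdot>\<^sub>m B2) = d1 \<cdot>\<^sub>m B2" using B2 by simp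
  ultimately show ?thesis using B2 by (intro eq_matI) auto
 qed
 ultimately show ?thesis
  using mult_four_block_mat[OF one_carrier_mat smult_carrier_mat[OF c(1), of "-1"] zero_carrier_mat smult_carrier_mat[OF one_carrier_mat, of d1]
  smult_carrier_mat[OF B, of d2] zero_carrier_mat smult_carrier_mat[OF B2Y, of "-1"] smult_carrier_mat[OF B2, of d1]]
  by (simp only:)
 qed
 have L: "four_block_mat A (0\<^sub>m n m) P S * ?N2 = (d1 * d2) \<cdot>\<^sub>m 1\<^sub>m (n + m)"
 proof -
 have 1: "A * (d2 \<cdot>\<^sub>m B) + 0\<^sub>m n m * (-1 \<cdot>\<^sub>m (B2 * Y)) = (d1 * d2) \<cdot>\<^sub>m 1\<^sub>m n"
  unfolding left_mult_zero_mat[OF smult_carrier_mat[OF B2Y]] mult_smult_distrib[OF A B] AB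
  by (intro eq_matI) auto
 have 3: "P * (d2 \<cdot>\<^sub>m B) + S * (-1 \<cdot>\<^sub>m (B2 * Y)) = 0\<^sub>m m n"
 proof -
  have "S * (B2 * Y) = d2 \<cdot>\<^sub>m Y"
  using assoc_mult_mat[OF c(3) B2 c(2)] SB mult_smult_assoc_mat[of "1\<^sub>m m" m m Y n d2] c
  by (simp add: S_def U_def)
  then have "P * (d2 \<cdot>\<^sub>m B) + S * (-1 \<cdot>\<^sub>m (B2 * Y)) = d2 \<cdot>\<^sub>m Y + -1 \<cdot>\<^sub>m (d2 \<cdot>\<^sub>m Y)"
  using mult_smult_distrib[OF P B, of d2] mult_smult_distrib[OF c(3) B2Y, of "-1"]
  by (simp add: Y_def)
  also have "... = 0\<^sub>m m n" using carrier_matD[OF c(2)] by (intro eq_matI) auto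
  finally show ?thesis .
 qed
 have 2: "A * 0\<^sub>m n m + 0\<^sub>m n m * (d1 \<cdot>\<^sub>m B2) = 0\<^sub>m n m" using A B2 by auto
 have 4: "P * 0\<^sub>m n m + S * (d1 \<cdot>\<^sub>m B2) = (d1 * d2) \<cdot>\<^sub>m 1\<^sub>m m"
  using mult_smult_distrib[OF c(3) B2, of d1] SB P by (intro eq_matI) (auto simp: S_def U_def)
 have "four_block_mat A (0\<^sub>m n m) P S * ?N2 =
  four_block_mat ((d1 * d2) \<cdot>\<^sub>m 1\<^sub>m n) (0\<^sub>m n m) (0\<^sub>m m n) ((d1 * d2) \<cdot>\<^sub>m 1\<^sub>m m)"
  using mult_four_block_mat[OF A zero_carrier_mat P c(3) smult_carrier_mat[OF B, of d2] zero_carrier_mat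
  smult_carrier_mat[OF B2Y, of "-1"] smult_carrier_mat[OF B2, of d1]] unfolding 1 2 3 4 .
 also have "... = (d1 * d2) \<cdot>\<^sub>m 1\<^sub>m (n + m)" by (intro eq_matI) auto
 finally show ?thesis .
 qed
 have "?M * (?N1 * ?N2) = (?M * ?N1) * ?N2"
 by (rule assoc_mult_mat[symmetric, of _ "n + m" "n + m" _ "n + m" _ "n + m"]) (use A E c B B2 in auto)
 also have "?M * ?N1 = four_block_mat A (0\<^sub>m n m) P S"
 using schur_block[OF A Q P E B AB] by (simp add: U_def S_def)
 finally show ?thesis using L N12 by (simp add: U_def Y_def)
qed

section \<open>Leading minors and recursive halving\<close>

definition lead :: "'a mat => nat => 'a mat" where
 "lead M i = mat i i (%x. M $$ x)"

definition quad :: "nat => nat => nat => 'a mat => 'a mat" where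
 "quad h a b M = mat h h (%(i, j). M $$ (a * h + i, b * h + j))"

lemma quad_carrier [simp]: "quad h a b M \<in> carrier_mat h h" "dim_row (quad h a b M) = h" "dim_col (quad h a b M) = h"
 by (auto simp: quad_def)

text \<open>The result is the number of leading principal minors, counted up to the first one divisible by
 \<open>p\<close>, and, if there is none, a matrix \<open>B\<close> and a scalar \<open>d\<close> with \<open>M * B = d\<close>. Keeping \<open>d\<close> separate
 avoids divisions.\<close>

fun pinv :: "int => nat => int mat => nat \<times> int mat \<times> int" where
 "pinv p 0 M = (if p dvd M $$ (0, 0) then 0 else 1, 1\<^sub>m 1, M $$ (0, 0))"
| "pinv p (Suc e) M = (let h = 2 ^ e; (c1, B1, d1) = pinv p e (quad h 0 0 M);
  U = B1 * quad h 0 1 M; Y = quad h 1 0 M * B1;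
  (c2, B2, d2) = pinv p e (d1 \<cdot>\<^sub>m quad h 1 1 M - quad h 1 0 M * U)
 in (if c1 < h then c1 else h + c2,
  four_block_mat (d2 \<cdot>\<^sub>m B1 + (U * B2) * Y) (- d1 \<cdot>\<^sub>m (U * B2)) (- d1 \<cdot>\<^sub>m (B2 * Y)) ((d1 * d1) \<cdot>\<^sub>m B2),
  d1 * d2))"

lemma quad_four_block:
 assumes "M \<in> carrier_mat (h + h) (h + h)"
 shows "M = four_block_mat (quad h 0 0 M) (quad h 0 1 M) (quad h 1 0 M) (quad h 1 1 M)"
 using assms by (intro eq_matI) (auto simp: quad_def)

text \<open>Up to factors prime to \<open>p\<close>, the leading minor of order \<open>h + i\<close>
  is the leading minor of order \<open>i\<close> of the Schur complement \<open>S\<close>. A failure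
  in the first half therefore decides the count, and otherwise the count of \<open>S\<close>
  continues it. After a failure the returned matrix is meaningless, which is why it is described
  only for \<open>c = 2 ^ e\<close>.\<close>

lemma pinv_correct:
 assumes "prime p" "M \<in> carrier_mat (2 ^ e) (2 ^ e)" "pinv p e M = (c, B, d)"
 shows "c <= 2 ^ e & (\<forall>i\<le>c. ~ p dvd det (lead M i)) & (c < 2 ^ e --> p dvd det (lead M (Suc c))) &
 (c = 2 ^ e --> B \<in> carrier_mat (2 ^ e) (2 ^ e) & M * B = d \<cdot>\<^sub>m 1\<^sub>m (2 ^ e) & ~ p dvd d)"
 using assms(2,3)
proof (induction e arbitrary: M c B d)
 case 0
 have l0: "det (lead M 0) = 1" by (simp add: lead_def det_def)
 have l1: "lead M (Suc 0) = mat 1 1 (%_. M $$ (0,0))" by (auto simp: lead_def)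
 then have l1: "det (lead M (Suc 0)) = M $$ (0, 0)" by (simp add: det_def)
 have "~ p dvd 1" using assms(1) by auto
 moreover have "M * 1\<^sub>m 1 = M $$ (0, 0) \<cdot>\<^sub>m 1\<^sub>m 1" using 0 by (intro eq_matI) auto
 ultimately show ?case using 0 l0 l1 by (auto simp: le_Suc_eq split: if_splits)
next
 case (Suc e)
 define h :: nat where "h = 2 ^ e"
 obtain c1 B1 d1 where 1: "pinv p e (quad h 0 0 M) = (c1, B1, d1)" by (metis prod_cases3)
 define U where "U = B1 * quad h 0 1 M"
 define Y where "Y = quad h 1 0 M * B1"
 define S where "S = d1 \<cdot>\<^sub>m quad h 1 1 M - quad h 1 0 M * U"
 obtain c2 B2 d2 where 2: "pinv p e S = (c2, B2, d2)" by (metis prod_cases3)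
 have M: "M \<in> carrier_mat (h + h) (h + h)" using Suc.prems by (simp add: h_def mult_2)
 have res: "c = (if c1 < h then c1 else h + c2)"
 "B = four_block_mat (d2 \<cdot>\<^sub>m B1 + (U * B2) * Y) (- d1 \<cdot>\<^sub>m (U * B2)) (- d1 \<cdot>\<^sub>m (B2 * Y)) ((d1 * d1) \<cdot>\<^sub>m B2)"
 "d = d1 * d2"
 using Suc.prems(2) 1 2
 by (simp_all del: One_nat_def add: Let_def h_def[symmetric] U_def[symmetric] Y_def[symmetric] S_def[symmetric])
 note IH1 = Suc.IH[folded h_def, OF quad_carrier(1) 1]
 have lead1: "lead M i = lead (quad h 0 0 M) i" if "i <= h" for i
 using that by (auto simp: lead_def quad_def)
 show ?case
 proof (cases "c1 < h")
 case True
 then have "c = c1" "c < 2 ^ Suc e" using res by (auto simp: h_def)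
 then show ?thesis using IH1 True lead1 by (auto simp: h_def)
 next
 case False
 then have c1: "c1 = h" using IH1 by simp
 have B1: "B1 \<in> carrier_mat h h" "quad h 0 0 M * B1 = d1 \<cdot>\<^sub>m 1\<^sub>m h" "~ p dvd d1"
  and A11: "~ p dvd det (quad h 0 0 M)"
 proof -
  have "lead (quad h 0 0 M) h = quad h 0 0 M" by (auto simp: lead_def quad_def)
  then show "~ p dvd det (quad h 0 0 M)" using IH1 c1 by (metis le_refl)
 qed (use IH1 c1 in auto)
 have S: "S \<in> carrier_mat h h" using B1 by (auto simp: S_def U_def)
 note IH2 = Suc.IH[folded h_def, OF S 2]
 \<comment> \<open>Bordering the first block with only \<open>i\<close> rows and columns makes
   \<open>schur_det\<close> speak of a leading minor of \<open>S\<close> and not just of its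
   determinant.\<close>
 have lead2: "p dvd det (lead M (h + i)) \<longleftrightarrow> p dvd det (lead S i)" if i: "i <= h" for i
 proof -
  define Q where "Q = mat h i (%(x, y). M $$ (x, h + y))"
  define P where "P = mat i h (%(x, y). M $$ (h + x, y))"
  define E where "E = mat i i (%(x, y). M $$ (h + x, h + y))"
  have c: "Q \<in> carrier_mat h i" "P \<in> carrier_mat i h" "E \<in> carrier_mat i i" by (auto simp: Q_def P_def E_def)
  have "lead M (h + i) = four_block_mat (quad h 0 0 M) Q P E"
  by (intro eq_matI) (auto simp: lead_def quad_def Q_def P_def E_def)
  moreover have "d1 \<cdot>\<^sub>m E - P * (B1 * Q) = lead S i"
  proof (intro eq_matI)
  fix x y assume xy: "x < dim_row (lead S i)" "y < dim_col (lead S i)"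
  then have xy: "x < i" "y < i" by (auto simp: lead_def)
  have "col (B1 * Q) y = col U y"
  using xy i B1 by (intro eq_vecI) (auto simp: U_def Q_def quad_def scalar_prod_def)
  moreover have "row P x = row (quad h 1 0 M) x"
  using xy i by (intro eq_vecI) (auto simp: P_def quad_def)
  ultimately show "(d1 \<cdot>\<^sub>m E - P * (B1 * Q)) $$ (x, y) = lead S i $$ (x, y)"
  using xy i c B1 by (simp add: lead_def S_def U_def E_def quad_def[of h "Suc 0" "Suc 0"])
  qed (use c B1 in "auto simp: lead_def")
  ultimately have "det (lead M (h + i)) * d1 ^ i = det (quad h 0 0 M) * det (lead S i)"
  using schur_det[OF quad_carrier(1) c B1(1,2)] by simp
  moreover have "~ p dvd d1 ^ i" using B1(3) assms(1) prime_dvd_power by blast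
  ultimately show ?thesis using assms(1) A11 by (metis prime_dvd_mult_iff)
 qed
 have c: "c = h + c2" using res False by simp
 have "~ p dvd det (lead M i)" if "i <= c" for i
 proof (cases "i <= h")
  case True
  then show ?thesis using lead1 IH1 c1 by simp
 next
  case False
  then have "i = h + (i - h)" "i - h <= c2" using that c by auto
  then show ?thesis using lead2[of "i - h"] IH2 by (metis le_trans)
 qed
 moreover have "p dvd det (lead M (Suc c))" if "c < 2 ^ Suc e"
 proof -
  have "c2 < h" using that c by (simp add: h_def)
  then show ?thesis using lead2[of "Suc c2"] IH2 c by simp
 qed
 moreover have "B \<in> carrier_mat (2 ^ Suc e) (2 ^ Suc e) & M * B = d \<cdot>\<^sub>m 1\<^sub>m (2 ^ Suc e) & ~ p dvd d" if "c = 2 ^ Suc e"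
 proof -
  have hh: "2 ^ Suc e = h + h" by (simp add: h_def)
  then have c2: "c2 = h" using that c by simp
  then have B2: "B2 \<in> carrier_mat h h" "S * B2 = d2 \<cdot>\<^sub>m 1\<^sub>m h" "~ p dvd d2" using IH2 by auto
  have "B \<in> carrier_mat (h + h) (h + h)" unfolding res using B1 B2 by (intro four_block_carrier_mat) (auto simp: U_def Y_def)
  moreover have "M * B = d \<cdot>\<^sub>m 1\<^sub>m (h + h)"
  unfolding res
  using block_inverse[of "quad h 0 0 M" h "quad h 0 1 M" h "quad h 1 0 M" "quad h 1 1 M" B1 d1 B2 d2]
  quad_four_block[OF M] B1 B2 by (simp add: U_def Y_def S_def)
  ultimately show ?thesis using hh B1(3) B2(3) assms(1) res(3) by (simp add: prime_dvd_mult_iff)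
 qed
 ultimately show ?thesis using IH2 c by (simp add: h_def)
 qed
qed

section \<open>Assertions about registers and arrays\<close>

definition rvf :: "(nat \<times> nat) list => state => bool" where
 "rvf rv s \<longleftrightarrow> (\<forall>(r, x)\<in>set rv. regs s r = x)"

definition hsf :: "(nat \<times> nat \<times> (nat => nat)) list => state => bool" where
 "hsf hs s \<longleftrightarrow> (\<forall>(r, L, f)\<in>set hs. ALL i<L. mem s (regs s r + i) = f i)"

lemma rvfD: "rvf rv s ==> (r, x) \<in> set rv ==> regs s r = x"
 by (auto simp: rvf_def)

lemma hsfD: "hsf hs s ==> (r, L, f) \<in> set hs ==> i < L ==> mem s (regs s r + i) = f i"
 by (auto simp: hsf_def)

definition avoid :: "nat set => (nat \<times> nat) list => (nat \<times> nat \<times> (nat => nat)) list => bool" where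
 "avoid X rv hs \<longleftrightarrow> (\<forall>(r, x)\<in>set rv. r ~: X) & (\<forall>(r, L, f)\<in>set hs. r ~: X)"

context ram
begin

text \<open>Assertions are relative to a fixed earlier state \<open>s0\<close>, whose heap is still
  intact. An array is named by the register that holds its address, so overwriting the register
  forgets the array but does not destroy it.\<close>

definition asrt :: "nat set => state => (nat \<times> nat) list => (nat \<times> nat \<times> (nat => nat)) list => state => bool" where
 "asrt F s0 rv hs s \<longleftrightarrow> fr F s0 s & rvf rv s & (\<forall>(r, L, f)\<in>set hs. regs s r + L <= regs s HP & arr (mem s) (regs s r) L f)"

definition tri :: "nat set => nat => (state => bool) => cmd => (state => bool) => bool" where
 "tri F T P c Q \<longleftrightarrow> (ALL s. P s --> call F T c s Q)"

abbreviation "asu == asrt UNIV"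
abbreviation "tru == tri UNIV"

lemma asrt_hsf: "asrt F s0 rv hs s ==> hsf hs s"
 by (auto simp: asrt_def hsf_def arr_def)

lemma asrt_rvf: "asrt F s0 rv hs s ==> rvf rv s"
 by (auto simp: asrt_def)

lemma asrt_fr: "asrt F s0 rv hs s ==> fr F s0 s"
 by (auto simp: asrt_def)

lemma asrt_ok: "asrt F s0 rv hs s ==> ok s"
 by (auto simp: asrt_def intro: fr_ok)

lemma tri_Seq: "tri F T1 P c P1 ==> tri F T2 P1 d Q ==> tri F (1 + T1 + T2) P (Seq c d) Q"
 unfolding tri_def by (auto intro: call_Seq)

lemma tri_conseq: "tri F T P c Q ==> T <= T' ==> (!!s. P' s ==> P s) ==> (!!s. Q s ==> Q' s) ==> tri F T' P' c Q'"
 unfolding tri_def by (auto intro: call_conseq)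

text \<open>Gives a name to the unknown content of a register, so that a later assertion can say
  that a stack frame contains it.\<close>

lemma tri_fix_reg:
 "(!!x. x <= B ==> tri F T (asrt F s0 ((r, x) # rv) hs) c Q) ==> tri F T (asrt F s0 rv hs) c Q"
 unfolding tri_def
proof (intro allI impI)
 fix s assume *: "!!x. x <= B ==> ALL s. asrt F s0 ((r, x) # rv) hs s --> call F T c s Q" "asrt F s0 rv hs s"
 then have "asrt F s0 ((r, regs s r) # rv) hs s" by (auto simp: asrt_def rvf_def)
 then show "call F T c s Q" using * ok_regs[OF asrt_ok] by blast
qed

lemma tri_tab_HP:
 assumes r: "r ~: {HP, TI, TL}" and F: "{r, HP, TI, TL} \<subseteq> F" and l: "small l" and e: "small e"
 and av: "avoid {r, HP, TI, TL} rv hs"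
 and L: "!!s. ok s ==> rvf rv s ==> hsf hs s ==> evn s l = L"
 and f: "!!i s. i < L ==> regs s TI = i ==> rvf rv s ==> hsf hs s ==> evn s e = f i & f i <= B"
 and a: "asrt F s0 rv hs s"
 shows "call F (5 * L + 15) (tab r l e) s (%s'. asrt F s0 rv ((r, L, f) # hs) s' &
  fr {r, HP, TI, TL} s s' & regs s' HP = regs s HP + L & regs s' r = regs s HP)"
proof -
 have ok: "ok s" using asrt_ok[OF a] .
 have bd: "regs s q + M <= regs s HP" if "(q, M, g) \<in> set hs" for q M g
 using a that by (auto simp: asrt_def)
 show ?thesis
 proof (rule call_tab[where L = L and f = f])
 show "evn (upd s r (regs s HP)) l = L"
 proof (rule L)
  show "ok (upd s r (regs s HP))" using ok r ok_regs[OF ok] by (auto intro: ok_upd)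
  show "rvf rv (upd s r (regs s HP))" using asrt_rvf[OF a] av by (auto simp: rvf_def avoid_def)
  show "hsf hs (upd s r (regs s HP))" using asrt_hsf[OF a] av unfolding hsf_def avoid_def by fastforce
 qed
 show "evn s' e = f i & f i <= B" if i: "i < L" and reg: "regs s' = (regs s)(r := regs s HP, TL := L, TI := i)"
  and m: "ALL a<regs s HP. mem s' a = mem s a" for i s'
 proof (rule f[OF i])
  show "regs s' TI = i" using reg r by simp
  show "rvf rv s'" using asrt_rvf[OF a] av reg by (auto simp: rvf_def avoid_def)
  show "hsf hs s'" unfolding hsf_def
  proof clarify
  fix q M g j assume q: "(q, M, g) \<in> set hs" "j < M"
  then have "regs s' q = regs s q" using av reg by (auto simp: avoid_def)
  moreover have "regs s q + j < regs s HP" using bd[OF q(1)] q(2) by simp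
  ultimately show "mem s' (regs s' q + j) = g j" using m hsfD[OF asrt_hsf[OF a] q] by simp
  qed
 qed
 fix s' assume fr: "fr {r, HP, TI, TL} s s'"
  and reg: "regs s' = (regs s)(r := regs s HP, TL := L, TI := L, HP := regs s HP + L)"
  and ar: "arr (mem s') (regs s HP) L f"
 have "asrt F s0 rv ((r, L, f) # hs) s'" unfolding asrt_def
 proof (intro conjI)
  show "fr F s0 s'" using fr_trans[OF asrt_fr[OF a] fr_mono[OF fr F]] .
  show "rvf rv s'" using asrt_rvf[OF a] av reg by (auto simp: rvf_def avoid_def)
  show "\<forall>(q, M, g)\<in>set ((r, L, f) # hs). regs s' q + M <= regs s' HP & arr (mem s') (regs s' q) M g"
  proof clarify
  fix q M g assume q: "(q, M, g) \<in> set ((r, L, f) # hs)"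
  show "regs s' q + M <= regs s' HP & arr (mem s') (regs s' q) M g"
  proof (cases "(q, M, g) \<in> set hs")
  case True
  then have e: "regs s' q = regs s q" using av reg by (auto simp: avoid_def)
  moreover have "arr (mem s) (regs s q) M g" using a True by (auto simp: asrt_def)
  ultimately show ?thesis using fr_arr[OF fr _ bd[OF True]] bd[OF True] reg by simp
  next
  case False
  then show ?thesis using q reg ar r by auto
  qed
  qed
 qed
 then show "asrt F s0 rv ((r, L, f) # hs) s' & fr {r, HP, TI, TL} s s' & regs s' HP = regs s HP + L & regs s' r = regs s HP"
  using fr reg r by simp
 qed (use r F l e in auto)
qed

lemma tri_tab:
 assumes r: "r ~: {HP, TI, TL}" and F: "{r, HP, TI, TL} \<subseteq> F" and l: "small l" and e: "small e"
 and av: "avoid {r, HP, TI, TL} rv hs"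
 and L: "!!s. ok s ==> rvf rv s ==> hsf hs s ==> evn s l = L"
 and f: "!!i s. i < L ==> regs s TI = i ==> rvf rv s ==> hsf hs s ==> evn s e = f i & f i <= B"
 shows "tri F (5 * L + 15) (asrt F s0 rv hs) (tab r l e) (asrt F s0 rv ((r, L, f) # hs))"
 unfolding tri_def
proof (intro allI impI)
 fix s assume "asrt F s0 rv hs s"
 from tri_tab_HP[OF r F l e av L f this] show "call F (5 * L + 15) (tab r l e) s (asrt F s0 rv ((r, L, f) # hs))"
 by (rule call_conseq) auto
qed

lemma tri_Assign:
 assumes r: "r ~= HP" "r \<in> F" and e: "small e"
 and x: "!!s. ok s ==> rvf rv s ==> hsf hs s ==> evn s e = x & x <= B"
 and sub: "set rv' \<subseteq> set rv" "set hs' \<subseteq> set hs" and av: "avoid {r} rv' hs'"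
 shows "tri F 1 (asrt F s0 rv hs) (Assign r e) (asrt F s0 ((r, x) # rv') hs')"
 unfolding tri_def
proof (intro allI impI)
 fix s assume a: "asrt F s0 rv hs s"
 have ev: "evn s e = x" "x <= B" using x[OF asrt_ok[OF a] asrt_rvf[OF a] asrt_hsf[OF a]] by auto
 have oku: "ok (upd s r x)" using asrt_ok[OF a] r ev by (intro ok_upd) auto
 have "asrt F s0 ((r, x) # rv') hs' (upd s r x)" unfolding asrt_def
 proof (intro conjI)
 show "fr F s0 (upd s r x)"
  using asrt_fr[OF a] r oku unfolding fr_def by auto
 show "rvf ((r, x) # rv') (upd s r x)" unfolding rvf_def
 proof clarify
  fix q z assume "(q, z) \<in> set ((r, x) # rv')"
  then consider "q = r" "z = x" | "(q, z) \<in> set rv'" "q ~= r" using av by (auto simp: avoid_def)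
  then show "regs (upd s r x) q = z" using rvfD[OF asrt_rvf[OF a], of q z] sub(1) by cases auto
 qed
 show "\<forall>(q, M, g)\<in>set hs'. regs (upd s r x) q + M <= regs (upd s r x) HP & arr (mem (upd s r x)) (regs (upd s r x) q) M g"
 proof clarify
  fix q M g assume q: "(q, M, g) \<in> set hs'"
  then have "q ~= r" "(q, M, g) \<in> set hs" using av sub(2) by (auto simp: avoid_def)
  then show "regs (upd s r x) q + M <= regs (upd s r x) HP & arr (mem (upd s r x)) (regs (upd s r x) q) M g"
  using a r(1) unfolding asrt_def by auto
 qed
 qed
 then show "call F 1 (Assign r e) s (asrt F s0 ((r, x) # rv') hs')"
 using r e ev by (intro call_Assign) auto
qed

text \<open>Copying an address makes an array available under a second register without touching
  memory.\<close>

lemma tri_copy: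
 assumes r: "r ~= HP" "r \<in> F"
 and sub: "set rv' \<subseteq> set rv" and av: "avoid {r} rv' []"
 and hs': "!!q L f. (q, L, f) \<in> set hs' ==> if q = r then (y, L, f) \<in> set hs else (q, L, f) \<in> set hs"
 shows "tri F 1 (asrt F s0 rv hs) (Assign r (Reg y)) (asrt F s0 rv' hs')"
 unfolding tri_def
proof (intro allI impI)
 fix s assume a: "asrt F s0 rv hs s"
 have oku: "ok (upd s r (regs s y))" using asrt_ok[OF a] r ok_regs[OF asrt_ok[OF a]] by (intro ok_upd) auto
 have "asrt F s0 rv' hs' (upd s r (regs s y))" unfolding asrt_def
 proof (intro conjI)
 show "fr F s0 (upd s r (regs s y))"
  using asrt_fr[OF a] r oku unfolding fr_def by auto
 show "rvf rv' (upd s r (regs s y))" unfolding rvf_def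
 proof clarify
  fix q z assume q: "(q, z) \<in> set rv'"
  then have "q ~= r" using av by (auto simp: avoid_def)
  then show "regs (upd s r (regs s y)) q = z" using rvfD[OF asrt_rvf[OF a], of q z] sub q by auto
 qed
 show "\<forall>(q, M, g)\<in>set hs'. regs (upd s r (regs s y)) q + M <= regs (upd s r (regs s y)) HP &
  arr (mem (upd s r (regs s y))) (regs (upd s r (regs s y)) q) M g"
 proof clarify
  fix q M g assume "(q, M, g) \<in> set hs'"
  from hs'[OF this] show "regs (upd s r (regs s y)) q + M <= regs (upd s r (regs s y)) HP &
  arr (mem (upd s r (regs s y))) (regs (upd s r (regs s y)) q) M g"
  using a r(1) unfolding asrt_def by (auto split: if_splits)
 qed
 qed
 then show "call F 1 (Assign r (Reg y)) s (asrt F s0 rv' hs')"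
 using r ok_regs by (intro call_Assign) (auto simp: small_def)
qed

lemma tri_Branch:
 assumes "small e" "!!s. P s ==> ok s ==> evn s e = x" "tri F T P (if x ~= 0 then c else d) Q"
 shows "tri F (1 + T) P (Branch e c d) Q"
 using assms unfolding tri_def by (auto intro!: call_Branch split: if_splits)

lemma asrt_weaken: "asrt F s0 rv hs s ==> set rv' \<subseteq> set rv ==> set hs' \<subseteq> set hs ==> asrt F s0 rv' hs' s"
 unfolding asrt_def rvf_def by (meson subsetD)

lemma asrt_old:
 assumes "asrt F s0 rv hs s" "(r, a) \<in> set rv" "arr (mem s0) a L f" "a + L <= regs s0 HP"
 shows "asrt F s0 rv ((r, L, f) # hs) s"
proof -
 have "regs s r = a" using assms rvfD asrt_rvf by blast
 then show ?thesis using assms fr_arr[OF asrt_fr[OF assms(1)] assms(3,4)] fr_HP[OF asrt_fr[OF assms(1)]]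
 unfolding asrt_def by auto
qed

text \<open>Recovers an array whose address comes out of a stack frame: it was there in
  \<open>s0\<close>, and old cells never change.\<close>

lemma tri_old:
 assumes "(r, a) \<in> set rv" "arr (mem s0) a L f" "a + L <= regs s0 HP"
 "tri F T (asrt F s0 rv ((r, L, f) # hs)) c Q"
 shows "tri F T (asrt F s0 rv hs) c Q"
 using assms asrt_old unfolding tri_def by blast

lemma asrt_start: "ok s ==> rvf rv s ==> (\<forall>(r, L, f)\<in>set hs. regs s r + L <= regs s HP & arr (mem s) (regs s r) L f)
 ==> asrt F s rv hs s"
 by (auto simp: asrt_def fr_refl)

end

section \<open>Residue arithmetic modulo the prime\<close>

context matmul_ram
begin

definition rs :: "int => nat" where
 "rs x = nat (x mod int p)"

definition mf :: "nat => int mat => nat => nat" where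
 "mf d M i = rs (M $$ (i div d, i mod d))"

lemma rs_less: "rs x < p"
 using p by (simp add: rs_def nat_less_iff)

lemma int_rs: "int (rs x) = x mod int p"
 using p by (simp add: rs_def)

lemma rs_eqI: "int a mod int p = x mod int p ==> a mod p = rs x"
 by (simp add: rs_def zmod_int[symmetric])

lemma int_neg_rs: "int (p - rs y) = int p - y mod int p"
 using rs_less[of y] int_rs[of y] by (simp add: of_nat_diff)

lemma rs_mult: "(rs x * rs y) mod p = rs (x * y)"
 by (rule rs_eqI) (simp add: int_rs mod_mult_eq)

text \<open>Writing a residue as \<open>x + int p * k\<close> turns the congruences below into
  polynomial identities.\<close>

lemma mod_repr: "EX k. x mod int p = x + int p * k"
 by (metis add_uminus_conv_diff minus_mult_div_eq_mod mult_minus_right)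

lemma rs_add: "(rs x * rs y + rs z) mod p = rs (x * y + z)"
proof (rule rs_eqI)
 obtain i j k where "x mod int p = x + int p * i" "y mod int p = y + int p * j" "z mod int p = z + int p * k"
 using mod_repr by meson
 then have "int (rs x * rs y + rs z) = x * y + z + int p * (x * j + y * i + int p * i * j + k)"
 by (simp add: int_rs algebra_simps)
 then show "int (rs x * rs y + rs z) mod int p = (x * y + z) mod int p" by simp
qed

text \<open>Word subtraction truncates at zero, so a residue is negated as \<open>p - rs z\<close>,
  which is exact since \<open>rs z < p\<close>.\<close>

lemma rs_sub: "(rs x * rs y + (p - rs z)) mod p = rs (x * y - z)"
proof (rule rs_eqI)
 obtain i j k where "x mod int p = x + int p * i" "y mod int p = y + int p * j" "z mod int p = z + int p * k"
 using mod_repr by meson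
 then have "int (rs x * rs y + (p - rs z)) = x * y - z + int p * (x * j + y * i + int p * i * j + 1 - k)"
 by (simp add: int_rs int_neg_rs algebra_simps)
 then show "int (rs x * rs y + (p - rs z)) mod int p = (x * y - z) mod int p" by simp
qed

lemma rs_neg: "(rs x * (p - rs y)) mod p = rs (- x * y)"
proof (rule rs_eqI)
 obtain i j where "x mod int p = x + int p * i" "y mod int p = y + int p * j"
 using mod_repr by meson
 then have "int (rs x * (p - rs y)) = - x * y + int p * (x * (1 - j) + i * (int p - y - int p * j))"
 by (simp only: of_nat_mult int_rs int_neg_rs) (simp add: algebra_simps)
 then show "int (rs x * (p - rs y)) mod int p = (- x * y) mod int p" by (simp only: mod_mult_self2)
qed

lemma mat_at_mf: "mat_at s a d M \<longleftrightarrow> M \<in> carrier_mat d d & a + d * d <= regs s HP & arr (mem s) a (d * d) (mf d M)"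
proof -
 have "int x = y mod int p \<longleftrightarrow> x = rs y" for x y using int_rs[of y] by auto
 then show ?thesis by (simp add: mat_at_def arr_def mf_def)
qed

lemma tri_mul:
 assumes r: "r ~: {HP, TI, TL, RB, RW, DM, PR}" "x ~: {HP, TI, TL, RB}" "y ~: {HP, TI, TL, RB}"
  "r < 100" "x < 100" "y < 100"
 and F: "{r, HP, TI, TL, RB} \<union> {100..<100 + R} \<subseteq> F"
 and av: "avoid ({r, HP, TI, TL, RB} \<union> {100..}) rv hs"
 and s: "(PR, p) \<in> set rv" "(RW, 2 ^ v) \<in> set rv" "(DM, d) \<in> set rv" "1 <= d" "d <= Dmax"
 and A: "A \<in> carrier_mat d d" "(x, d * d, mf d A) \<in> set hs" and C: "C \<in> carrier_mat d d" "(y, d * d, mf d C) \<in> set hs"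
 shows "tri F (20 * (d * d) + mt d + 2 * R + 60) (asrt F s0 rv hs) (mul P R r x y)
 (asrt F s0 rv ((r, d * d, mf d (A * C)) # hs))"
 unfolding tri_def
proof (intro allI impI)
 fix s assume a: "asrt F s0 rv hs s"
 have hs: "regs s q + M <= regs s HP" "arr (mem s) (regs s q) M g" if "(q, M, g) \<in> set hs" for q M g
 using a that by (auto simp: asrt_def)
 let ?F0 = "{r, HP, TI, TL, RB} \<union> {100..<100 + R}"
 show "call F (20 * (d * d) + mt d + 2 * R + 60) (mul P R r x y) s (asrt F s0 rv ((r, d * d, mf d (A * C)) # hs))"
 proof (rule call_mul[OF r F])
 show "params s" "regs s DM = d" using rvfD[OF asrt_rvf[OF a]] s by (auto simp: params_def)
 show "mat_at s (regs s x) d A" "mat_at s (regs s y) d C" using A C hs by (auto simp: mat_at_mf)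
 fix s' assume fr: "fr ?F0 s s'" and m: "mat_at s' (regs s' r) d (A * C)"
 have keep: "regs s' q = regs s q" if "q ~: {r, HP, TI, TL, RB} \<union> {100..}" for q
  using fr_regs[OF fr, of q] that by auto
 show "asrt F s0 rv ((r, d * d, mf d (A * C)) # hs) s'" unfolding asrt_def
 proof (intro conjI)
  show "fr F s0 s'" using fr_trans[OF asrt_fr[OF a] fr_mono[OF fr F]] .
  show "rvf rv s'" using asrt_rvf[OF a] av keep unfolding rvf_def avoid_def by fastforce
  show "\<forall>(q, M, g)\<in>set ((r, d * d, mf d (A * C)) # hs). regs s' q + M <= regs s' HP & arr (mem s') (regs s' q) M g"
  proof clarify
  fix q M g assume q: "(q, M, g) \<in> set ((r, d * d, mf d (A * C)) # hs)"
  show "regs s' q + M <= regs s' HP & arr (mem s') (regs s' q) M g"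
  proof (cases "(q, M, g) \<in> set hs")
  case True
  then have "regs s' q = regs s q" using av keep unfolding avoid_def by fastforce
  then show ?thesis using fr_arr[OF fr hs(2,1)[OF True]] hs[OF True] fr_HP[OF fr] by simp
  next
  case False
  then show ?thesis using q m by (auto simp: mat_at_mf)
  qed
  qed
 qed
 qed (use s in auto)
qed

end

section \<open>The inversion program\<close>

abbreviation (input) "RUN == 10 :: nat"
abbreviation (input) "MODE == 11 :: nat"
abbreviation (input) "MA == 12 :: nat"
abbreviation (input) "MH == 13 :: nat"
abbreviation (input) "ST == 14 :: nat"
abbreviation (input) "RES == 15 :: nat"
abbreviation (input) "RD == 16 :: nat"
abbreviation (input) "CNT == 17 :: nat"
abbreviation (input) "FP == 18 :: nat"
abbreviation (input) "X1 == 19 :: nat"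
abbreviation (input) "X2 == 20 :: nat"
abbreviation (input) "X3 == 21 :: nat"
abbreviation (input) "X4 == 22 :: nat"
abbreviation (input) "X5 == 23 :: nat"
abbreviation (input) "X6 == 24 :: nat"
abbreviation (input) "X7 == 25 :: nat"
abbreviation (input) "X8 == 26 :: nat"
abbreviation (input) "X9 == 27 :: nat"

text \<open>Picks entry number \<open>TI\<close> from a list of expressions, which lets
  \<open>tab\<close> write a record with a different expression in each field.\<close>

fun sel :: "nat => expr list => expr" where
 "sel n [] = Const 0"
| "sel n (e # es) = Ite (Less (Reg TI) (Const (n + 1))) e (sel (n + 1) es)"

lemma evn_sel: "n <= regs s TI ==> regs s TI < n + length es ==> evn s (sel n es) = evn s (es ! (regs s TI - n))"
proof (induction es arbitrary: n)
 case (Cons e es)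
 then show ?case by (cases "regs s TI = n") (auto simp: nth_Cons' Suc_diff_le)
qed simp

definition quad_expr :: "nat => nat => expr" where
 "quad_expr a b = Load (Add (Reg MA)
  (Add (Mul (Add (Mul (Const a) (Reg DM)) (Div (Reg TI) (Reg DM))) (Reg MH))
  (Add (Mul (Const b) (Reg DM)) (Mod (Reg TI) (Reg DM)))))"

definition cell :: "nat => expr => expr" where
 "cell r i = Load (Add (Reg r) i)"

definition schur_expr :: expr where
 "schur_expr = Mod (Add (Mul (Reg RD) (cell X3 (Reg TI))) (Sub (Reg PR) (cell X6 (Reg TI)))) (Reg PR)"

definition block_index :: expr where
 "block_index = Add (Mul (Mod (Div (Reg TI) (Reg MH)) (Reg DM)) (Reg DM)) (Mod (Mod (Reg TI) (Reg MH)) (Reg DM))"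

text \<open>The four cases are the blocks of \<open>block_inverse\<close>. \<open>X2\<close> holds
  the residue of \<open>d1\<close> and \<open>RD\<close> that of \<open>d2\<close>; a factor of the
  form \<open>p - x\<close> supplies each minus sign.\<close>

definition join_expr :: expr where
 "join_expr = Ite (Less (Div (Reg TI) (Reg MH)) (Reg DM))
  (Ite (Less (Mod (Reg TI) (Reg MH)) (Reg DM))
  (Mod (Add (Mul (Reg RD) (cell X1 block_index)) (cell X7 block_index)) (Reg PR))
  (Mod (Mul (Reg X2) (Sub (Reg PR) (cell X6 block_index))) (Reg PR)))
  (Ite (Less (Mod (Reg TI) (Reg MH)) (Reg DM))
  (Mod (Mul (Reg X2) (Sub (Reg PR) (cell X8 block_index))) (Reg PR))
  (Mod (Mul (Mod (Mul (Reg X2) (Reg X2)) (Reg PR)) (cell RES block_index)) (Reg PR)))"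

lemma evn_cell [simp]: "evn s (cell r i) = mem s (regs s r + evn s i)"
 by (simp add: cell_def)

lemma weight_cell [simp]: "weight (cell r i) = weight i + 2" "consts_le n (cell r i) = consts_le n i"
 by (auto simp: cell_def)

text \<open>The leaves are the successive pivots in the order of the diagonal. A vanishing pivot
  clears \<open>RUN\<close> and so abandons the whole recursion: \<open>CNT\<close>, the number of
  leaves passed, is then already the order of the last leading minor before the first vanishing
  one.\<close>

definition leaf_cmd :: cmd where
 "leaf_cmd = Branch (Load (Reg MA))
  (Seq (Assign CNT (Add (Reg CNT) (Const 1)))
  (Seq (Assign RD (Load (Reg MA)))
  (Seq (tab RES (Const 1) (Const 1))
  (Assign MODE (Const 1)))))
  (Assign RUN (Const 0))"

definition split_cmd :: cmd where
 "split_cmd =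
  Seq (tab FP (Const 4) (sel 0 [Reg ST, Reg MA, Reg MH, Const 0]))
 (Seq (Assign ST (Reg FP))
 (Seq (Assign DM (Div (Reg MH) (Const 2)))
 (Seq (tab X1 (Mul (Reg DM) (Reg DM)) (quad_expr 0 0))
 (Seq (Assign MA (Reg X1))
  (Assign MH (Reg DM))))))"

definition ret1_cmd :: "cmd => nat => cmd" where
 "ret1_cmd P R =
  Seq (Assign MA (cell ST (Const 1)))
 (Seq (Assign MH (cell ST (Const 2)))
 (Seq (Assign DM (Div (Reg MH) (Const 2)))
 (Seq (tab X1 (Mul (Reg DM) (Reg DM)) (quad_expr 0 1))
 (Seq (tab X2 (Mul (Reg DM) (Reg DM)) (quad_expr 1 0))
 (Seq (tab X3 (Mul (Reg DM) (Reg DM)) (quad_expr 1 1))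
 (Seq (mul P R X4 RES X1)
 (Seq (mul P R X5 X2 RES)
 (Seq (mul P R X6 X2 X4)
 (Seq (tab X7 (Mul (Reg DM) (Reg DM)) schur_expr)
 (Seq (tab FP (Const 7) (sel 0 [Load (Reg ST), Reg RES, Reg MH, Const 1, Reg RD, Reg X4, Reg X5]))
 (Seq (Assign ST (Reg FP))
 (Seq (Assign MA (Reg X7))
 (Seq (Assign MH (Reg DM))
  (Assign MODE (Const 0)))))))))))))))"

definition ret2_cmd :: "cmd => nat => cmd" where
 "ret2_cmd P R =
  Seq (Assign X1 (cell ST (Const 1)))
 (Seq (Assign MH (cell ST (Const 2)))
 (Seq (Assign X2 (cell ST (Const 4)))
 (Seq (Assign X4 (cell ST (Const 5)))
 (Seq (Assign X5 (cell ST (Const 6)))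
 (Seq (Assign DM (Div (Reg MH) (Const 2)))
 (Seq (mul P R X6 X4 RES)
 (Seq (mul P R X7 X6 X5)
 (Seq (mul P R X8 RES X5)
 (Seq (tab X9 (Mul (Reg MH) (Reg MH)) join_expr)
 (Seq (Assign RD (Mod (Mul (Reg RD) (Reg X2)) (Reg PR)))
 (Seq (Assign RES (Reg X9))
  (Assign ST (Load (Reg ST))))))))))))))"

text \<open>Recursion with an explicit stack. \<open>MODE\<close> 0 enters a call and
  \<open>MODE\<close> 1 returns from one. On return, the tag in field 3 of the top frame tells
  whether the first half (tag 0) or the second half (tag 1) was finished; tag 2 marks the bottom of
  the stack.\<close>

definition inv_body :: "cmd => nat => cmd" where
 "inv_body P R = Branch (Reg MODE)
  (Branch (Less (cell ST (Const 3)) (Const 2))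
  (Branch (cell ST (Const 3)) (ret2_cmd P R) (ret1_cmd P R))
  (Assign RUN (Const 0)))
  (Branch (Less (Reg MH) (Const 2)) leaf_cmd split_cmd)"

definition inv_cmd :: "cmd => nat => cmd" where
 "inv_cmd P R =
  Seq (tab ST (Const 4) (sel 0 [Const 0, Const 0, Const 0, Const 2]))
 (Seq (Assign CNT (Const 0))
 (Seq (Assign MODE (Const 0))
 (Seq (Assign RUN (Const 1))
  (While (Reg RUN) (inv_body P R)))))"

text \<open>Fields: link to the parent frame, address and order of the matrix, tag.\<close>

definition frame1 :: "nat => nat => nat => nat => nat" where
 "frame1 st a m i = [st, a, m, 0] ! i"

text \<open>Fields: link to the parent frame, address of \<open>B1\<close>, order, tag, residue of
  \<open>d1\<close>, addresses of \<open>U\<close> and \<open>Y\<close>.\<close>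

definition frame2 :: "nat => nat => nat => nat => nat => nat => nat => nat" where
 "frame2 st b m d x y i = [st, b, m, 1, d, x, y] ! i"

locale inv_ram = matmul_ram +
 assumes block_le: "2 * 2 ^ v <= B"
begin

definition Fm :: "nat set" where
 "Fm = {HP, TI, TL, RB, DM} \<union> {10..27} \<union> {100..<100 + R}"

lemma rs_le_B: "rs x <= B"
 using rs_less[of x] p block_le by linarith

lemma mf_le_B: "mf d M i <= B"
 by (simp add: mf_def rs_le_B)

lemma quad_index:
 assumes "1 <= h" "a <= 1" "b <= 1" "i < h * h"
 shows "(a * h + i div h) * (2 * h) + (b * h + i mod h) < (2 * h) * (2 * h)"
 and "mf (2 * h) M ((a * h + i div h) * (2 * h) + (b * h + i mod h)) = mf h (quad h a b M) i"
proof -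
 have i: "i div h < h" "i mod h < h" using assms by (auto simp: less_mult_imp_div_less)
 have a: "a * h + i div h < 2 * h" "b * h + i mod h < 2 * h"
 using i mult_le_mono1[OF assms(2), of h] mult_le_mono1[OF assms(3), of h] by linarith+
 have "(a * h + i div h) * (2 * h) + (b * h + i mod h) < Suc (a * h + i div h) * (2 * h)" using a by simp
 also have "... <= (2 * h) * (2 * h)" using a by (intro mult_le_mono1) simp
 finally show "(a * h + i div h) * (2 * h) + (b * h + i mod h) < (2 * h) * (2 * h)" .
 have "((a * h + i div h) * (2 * h) + (b * h + i mod h)) div (2 * h) = a * h + i div h"
 "((a * h + i div h) * (2 * h) + (b * h + i mod h)) mod (2 * h) = b * h + i mod h"
 using a assms(1) by auto
 then show "mf (2 * h) M ((a * h + i div h) * (2 * h) + (b * h + i mod h)) = mf h (quad h a b M) i"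
 using i by (simp add: mf_def quad_def)
qed

lemma evn_quad_expr:
 assumes "rvf rv s" "hsf hs s" "(MA, (2 * h) * (2 * h), mf (2 * h) M) \<in> set hs" "(DM, h) \<in> set rv" "(MH, 2 * h) \<in> set rv"
 "regs s TI = i" "1 <= h" "a <= 1" "b <= 1" "i < h * h"
 shows "evn s (quad_expr a b) = mf h (quad h a b M) i & mf h (quad h a b M) i <= B"
 using hsfD[OF assms(2,3) quad_index(1)[OF assms(7-10)]] rvfD[OF assms(1,4)] rvfD[OF assms(1,5)] assms(6)
 quad_index(2)[OF assms(7-10)] mf_le_B by (simp add: quad_expr_def)

lemma tri_quad:
 assumes "r ~: {HP, TI, TL}" "{r, HP, TI, TL} \<subseteq> F" "avoid {r, HP, TI, TL} rv hs"
 "(MA, (2 * h) * (2 * h), mf (2 * h) M) \<in> set hs" "(DM, h) \<in> set rv" "(MH, 2 * h) \<in> set rv"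
 "1 <= h" "a <= 1" "b <= 1"
 shows "tri F (5 * (h * h) + 15) (asrt F s0 rv hs) (tab r (Mul (Reg DM) (Reg DM)) (quad_expr a b))
 (asrt F s0 rv ((r, h * h, mf h (quad h a b M)) # hs))"
proof (rule tri_tab[OF assms(1,2) _ _ assms(3)])
 show "small (Mul (Reg DM) (Reg DM))" "small (quad_expr a b)"
 using B20 assms(8,9) by (auto simp: small_def quad_expr_def)
 show "evn s (Mul (Reg DM) (Reg DM)) = h * h" if "rvf rv s" for s
 using rvfD[OF that assms(5)] by simp
 show "evn s (quad_expr a b) = mf h (quad h a b M) i & mf h (quad h a b M) i <= B"
 if "i < h * h" "regs s TI = i" "rvf rv s" "hsf hs s" for i s
 using evn_quad_expr[OF that(3,4) assms(4-6) that(2) assms(7-9) that(1)] .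
qed

lemma tri_split:
 assumes h: "1 <= h" and st: "st <= B" "a <= B" "2 * h <= B"
 shows "tri Fm (5 * (h * h) + 100)
  (asrt Fm s0 [(PR, p), (RW, 2 ^ v), (MODE, 0), (RUN, 1), (CNT, c), (MH, 2 * h), (MA, a), (ST, st)]
  [(MA, (2 * h) * (2 * h), mf (2 * h) M)])
  split_cmd
  (asrt Fm s0 [(DM, h), (PR, p), (RW, 2 ^ v), (MODE, 0), (RUN, 1), (CNT, c), (MH, h)]
  [(MA, h * h, mf h (quad h 0 0 M)), (ST, 4, frame1 st a (2 * h))])"
proof -
 let ?rv0 = "[(PR, p), (RW, 2 ^ v), (MODE, 0), (RUN, 1), (CNT, c), (MH, 2 * h), (MA, a), (ST, st)]"
 let ?rv1 = "[(PR, p), (RW, 2 ^ v), (MODE, 0), (RUN, 1), (CNT, c), (MH, 2 * h)]"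
 let ?rv2 = "(DM, h) # ?rv1"
 let ?rv3 = "[(DM, h), (PR, p), (RW, 2 ^ v), (MODE, 0), (RUN, 1), (CNT, c)]"
 let ?M = "(MA, (2 * h) * (2 * h), mf (2 * h) M)"
 let ?fr = "frame1 st a (2 * h)"
 let ?Q = "mf h (quad h 0 0 M)"
 have 1: "tri Fm (5 * 4 + 15) (asrt Fm s0 ?rv0 [?M]) (tab FP (Const 4) (sel 0 [Reg ST, Reg MA, Reg MH, Const 0]))
 (asrt Fm s0 ?rv0 [(FP, 4, ?fr), ?M])"
 proof (rule tri_tab)
 fix i s assume i: "i < 4" "regs s TI = i" "rvf ?rv0 s"
 then have "i = 0 | i = 1 | i = 2 | i = 3" by auto
 then show "evn s (sel 0 [Reg ST, Reg MA, Reg MH, Const 0]) = ?fr i & ?fr i <= B"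
  using i st evn_sel[of 0 s "[Reg ST, Reg MA, Reg MH, Const 0]"] by (auto simp: rvf_def frame1_def)
 qed (use B20 in "auto simp: Fm_def avoid_def small_def")
 have 2: "tri Fm 1 (asrt Fm s0 ?rv0 [(FP, 4, ?fr), ?M]) (Assign ST (Reg FP))
 (asrt Fm s0 ?rv1 [(ST, 4, ?fr), ?M])"
 by (rule tri_copy) (auto simp: Fm_def avoid_def)
 have 3: "tri Fm 1 (asrt Fm s0 ?rv1 [(ST, 4, ?fr), ?M]) (Assign DM (Div (Reg MH) (Const 2)))
 (asrt Fm s0 ?rv2 [(ST, 4, ?fr), ?M])"
 by (rule tri_Assign) (use B20 st in "auto simp: Fm_def avoid_def small_def rvf_def")
 have 4: "tri Fm (5 * (h * h) + 15) (asrt Fm s0 ?rv2 [(ST, 4, ?fr), ?M]) (tab X1 (Mul (Reg DM) (Reg DM)) (quad_expr 0 0))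
 (asrt Fm s0 ?rv2 [(X1, h * h, ?Q), (ST, 4, ?fr), ?M])"
 by (rule tri_quad) (use h in "auto simp: Fm_def avoid_def")
 have 5: "tri Fm 1 (asrt Fm s0 ?rv2 [(X1, h * h, ?Q), (ST, 4, ?fr), ?M]) (Assign MA (Reg X1))
 (asrt Fm s0 ?rv2 [(MA, h * h, ?Q), (ST, 4, ?fr)])"
 by (rule tri_copy) (auto simp: Fm_def avoid_def)
 have 6: "tri Fm 1 (asrt Fm s0 ?rv2 [(MA, h * h, ?Q), (ST, 4, ?fr)]) (Assign MH (Reg DM))
 (asrt Fm s0 ((MH, h) # ?rv3) [(MA, h * h, ?Q), (ST, 4, ?fr)])"
 by (rule tri_Assign) (use B20 st in "auto simp: Fm_def avoid_def small_def rvf_def")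
 show ?thesis unfolding split_cmd_def
 by (rule tri_conseq[OF tri_Seq[OF 1 tri_Seq[OF 2 tri_Seq[OF 3 tri_Seq[OF 4 tri_Seq[OF 5 6]]]]]])
  (auto elim!: asrt_weaken)
qed

text \<open>No register keeps the matrix \<open>M\<close> during the first recursive call; only its
  address survives in the frame. Its content is therefore assumed of the heap of \<open>s0\<close>,
  from where \<open>tri_old\<close> recovers it.\<close>

lemma tri_ret1:
 fixes d1 :: int
 assumes h: "1 <= h" "h <= Dmax" and bnd: "2 * h <= B" "a <= B" "b <= B" "st <= B"
 and M: "M \<in> carrier_mat (2 * h) (2 * h)" and B1: "B1 \<in> carrier_mat h h"
 and old: "arr (mem s0) a ((2 * h) * (2 * h)) (mf (2 * h) M)" "a + (2 * h) * (2 * h) <= regs s0 HP"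
 defines "U == B1 * quad h 0 1 M" and "Y == quad h 1 0 M * B1"
 defines "S == d1 \<cdot>\<^sub>m quad h 1 1 M - quad h 1 0 M * U"
 shows "tri Fm (80 * (h * h) + 3 * mt h + 6 * R + 400)
  (asrt Fm s0 [(PR, p), (RW, 2 ^ v), (MODE, 1), (RUN, 1), (CNT, c), (RES, b), (RD, rs d1)]
  [(ST, 4, frame1 st a (2 * h)), (RES, h * h, mf h B1)])
  (ret1_cmd P R)
  (%s. EX x y. asrt Fm s0 [(PR, p), (RW, 2 ^ v), (MODE, 0), (RUN, 1), (CNT, c), (MH, h), (RES, b), (X4, x), (X5, y)]
  [(MA, h * h, mf h S), (ST, 7, frame2 st b (2 * h) (rs d1) x y), (RES, h * h, mf h B1),
  (X4, h * h, mf h U), (X5, h * h, mf h Y)] s)"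
 (is "tri _ _ _ _ ?Post")
proof -
 let ?c = "[(PR, p), (RW, 2 ^ v), (MODE, 1), (RUN, 1), (CNT, c), (RES, b), (RD, rs d1)]"
 let ?m = "(MA, (2 * h) * (2 * h), mf (2 * h) M)"
 let ?f = "(ST, 4, frame1 st a (2 * h))"
 let ?b = "(RES, h * h, mf h B1)"
 let ?rv1 = "(MA, a) # ?c" let ?rv2 = "(MH, 2 * h) # ?c" let ?rv3 = "(DM, h) # ?rv2"
 let ?x1 = "(X1, h * h, mf h (quad h 0 1 M))"
 let ?x2 = "(X2, h * h, mf h (quad h 1 0 M))"
 let ?x3 = "(X3, h * h, mf h (quad h 1 1 M))"
 let ?x4 = "(X4, h * h, mf h U)"
 let ?x5 = "(X5, h * h, mf h Y)"
 let ?V = "quad h 1 0 M * U"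
 let ?x6 = "(X6, h * h, mf h ?V)"
 let ?x7 = "(X7, h * h, mf h S)"
 have cU: "U \<in> carrier_mat h h" and cY: "Y \<in> carrier_mat h h" and cV: "?V \<in> carrier_mat h h"
 using B1 by (auto simp: U_def Y_def)
 have 1: "tri Fm 1 (asrt Fm s0 ?c [?f, ?b]) (Assign MA (cell ST (Const 1))) (asrt Fm s0 ?rv1 [?f, ?b])"
 proof (rule tri_Assign)
 show "evn s (cell ST (Const 1)) = a & a <= B" if "hsf [?f, ?b] s" for s
  using hsfD[OF that, of ST 4 _ 1] bnd by (simp add: frame1_def)
 qed (use B20 in "auto simp: Fm_def avoid_def small_def")
 have 2: "tri Fm 1 (asrt Fm s0 ?rv1 [?f, ?b]) (Assign MH (cell ST (Const 2))) (asrt Fm s0 ?rv2 [?m, ?f, ?b])"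
 proof (rule tri_old[OF _ old])
 show "tri Fm 1 (asrt Fm s0 ?rv1 [?m, ?f, ?b]) (Assign MH (cell ST (Const 2))) (asrt Fm s0 ?rv2 [?m, ?f, ?b])"
 proof (rule tri_Assign)
  show "evn s (cell ST (Const 2)) = 2 * h & 2 * h <= B" if "hsf [?m, ?f, ?b] s" for s
  using hsfD[OF that, of ST 4 _ 2] bnd by (simp add: frame1_def)
 qed (use B20 in "auto simp: Fm_def avoid_def small_def")
 qed simp
 have 3: "tri Fm 1 (asrt Fm s0 ?rv2 [?m, ?f, ?b]) (Assign DM (Div (Reg MH) (Const 2))) (asrt Fm s0 ?rv3 [?m, ?f, ?b])"
 by (rule tri_Assign) (use B20 bnd in "auto simp: Fm_def avoid_def small_def rvf_def")
 have 4: "tri Fm (5 * (h * h) + 15) (asrt Fm s0 ?rv3 [?m, ?f, ?b]) (tab X1 (Mul (Reg DM) (Reg DM)) (quad_expr 0 1))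
 (asrt Fm s0 ?rv3 [?x1, ?m, ?f, ?b])"
 by (rule tri_quad) (use h in "auto simp: Fm_def avoid_def")
 have 5: "tri Fm (5 * (h * h) + 15) (asrt Fm s0 ?rv3 [?x1, ?m, ?f, ?b]) (tab X2 (Mul (Reg DM) (Reg DM)) (quad_expr 1 0))
 (asrt Fm s0 ?rv3 [?x2, ?x1, ?m, ?f, ?b])"
 by (rule tri_quad) (use h in "auto simp: Fm_def avoid_def")
 have 6: "tri Fm (5 * (h * h) + 15) (asrt Fm s0 ?rv3 [?x2, ?x1, ?m, ?f, ?b]) (tab X3 (Mul (Reg DM) (Reg DM)) (quad_expr 1 1))
 (asrt Fm s0 ?rv3 [?x3, ?x2, ?x1, ?m, ?f, ?b])"
 by (rule tri_quad) (use h in "auto simp: Fm_def avoid_def")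
 have 7: "tri Fm (20 * (h * h) + mt h + 2 * R + 60) (asrt Fm s0 ?rv3 [?x3, ?x2, ?x1, ?m, ?f, ?b]) (mul P R X4 RES X1)
 (asrt Fm s0 ?rv3 [?x4, ?x3, ?x2, ?x1, ?m, ?f, ?b])"
 unfolding U_def by (rule tri_mul) (use h B1 in "auto simp: Fm_def avoid_def")
 have 8: "tri Fm (20 * (h * h) + mt h + 2 * R + 60) (asrt Fm s0 ?rv3 [?x4, ?x3, ?x2, ?x1, ?m, ?f, ?b]) (mul P R X5 X2 RES)
 (asrt Fm s0 ?rv3 [?x5, ?x4, ?x3, ?x2, ?x1, ?m, ?f, ?b])"
 unfolding Y_def by (rule tri_mul) (use h B1 in "auto simp: Fm_def avoid_def")
 have 9: "tri Fm (20 * (h * h) + mt h + 2 * R + 60) (asrt Fm s0 ?rv3 [?x5, ?x4, ?x3, ?x2, ?x1, ?m, ?f, ?b]) (mul P R X6 X2 X4)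
 (asrt Fm s0 ?rv3 [?x6, ?x5, ?x4, ?x3, ?x2, ?x1, ?m, ?f, ?b])"
 by (rule tri_mul) (use h cU in "auto simp: Fm_def avoid_def")
 have 10: "tri Fm (5 * (h * h) + 15) (asrt Fm s0 ?rv3 [?x6, ?x5, ?x4, ?x3, ?x2, ?x1, ?m, ?f, ?b])
  (tab X7 (Mul (Reg DM) (Reg DM)) schur_expr)
 (asrt Fm s0 ?rv3 [?x7, ?x6, ?x5, ?x4, ?x3, ?x2, ?x1, ?m, ?f, ?b])"
 proof (rule tri_tab)
 fix i s assume i: "i < h * h" "regs s TI = i" and rv: "rvf ?rv3 s"
  and hs: "hsf [?x6, ?x5, ?x4, ?x3, ?x2, ?x1, ?m, ?f, ?b] s"
 have ih: "i div h < h" "i mod h < h" using i h by (auto simp: less_mult_imp_div_less)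
 have "evn s schur_expr = (rs d1 * mf h (quad h 1 1 M) i + (p - mf h ?V i)) mod p"
  using i rv hsfD[OF hs, of X3 "h * h" _ i] hsfD[OF hs, of X6 "h * h" _ i] by (simp add: schur_expr_def rvf_def)
 also have "... = mf h S i" using ih cU unfolding mf_def rs_sub by (simp add: S_def)
 finally show "evn s schur_expr = mf h S i & mf h S i <= B" using mf_le_B by simp
 qed (use B20 in "auto simp: Fm_def avoid_def small_def rvf_def schur_expr_def")
 let ?hs = "[?x7, ?x6, ?x5, ?x4, ?x3, ?x2, ?x1, ?m, ?f, ?b]"
 let ?fe = "sel 0 [Load (Reg ST), Reg RES, Reg MH, Const 1, Reg RD, Reg X4, Reg X5]"
 define rest where "rest =
  Seq (tab FP (Const 7) ?fe) (Seq (Assign ST (Reg FP)) (Seq (Assign MA (Reg X7))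
 (Seq (Assign MH (Reg DM)) (Assign MODE (Const 0)))))"
 have 11: "tri Fm 60 (asrt Fm s0 ?rv3 ?hs) rest ?Post"
 proof (rule tri_fix_reg[where r = X4], rule tri_fix_reg[where r = X5])
 fix x y assume xy: "x <= B" "y <= B"
 let ?rv4 = "(X5, y) # (X4, x) # ?rv3"
 let ?g = "frame2 st b (2 * h) (rs d1) x y"
 let ?rv5 = "[(X5, y), (X4, x), (DM, h), (PR, p), (RW, 2 ^ v), (MODE, 1), (RUN, 1), (CNT, c), (RES, b), (RD, rs d1)]"
 let ?rv6 = "[(MH, h), (X5, y), (X4, x), (DM, h), (PR, p), (RW, 2 ^ v), (RUN, 1), (CNT, c), (RES, b), (RD, rs d1)]"
 have 1: "tri Fm (5 * 7 + 15) (asrt Fm s0 ?rv4 ?hs) (tab FP (Const 7) ?fe) (asrt Fm s0 ?rv4 ((FP, 7, ?g) # ?hs))"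
 proof (rule tri_tab)
  fix i s assume i: "i < 7" "regs s TI = i" and rv: "rvf ?rv4 s" and hs: "hsf ?hs s"
  then have "i = 0 | i = 1 | i = 2 | i = 3 | i = 4 | i = 5 | i = 6" by auto
  moreover have "mem s (regs s ST) = st" using hsfD[OF hs, of ST 4 _ 0] by (simp add: frame1_def)
  ultimately show "evn s ?fe = ?g i & ?g i <= B"
  using i bnd xy rs_le_B[of d1] B20 rv evn_sel[of 0 s "[Load (Reg ST), Reg RES, Reg MH, Const 1, Reg RD, Reg X4, Reg X5]"]
  by (auto simp: rvf_def frame2_def nth_Cons')
 qed (use B20 in "auto simp: Fm_def avoid_def small_def")
 have 2: "tri Fm 1 (asrt Fm s0 ?rv4 ((FP, 7, ?g) # ?hs)) (Assign ST (Reg FP))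
  (asrt Fm s0 ?rv4 [(ST, 7, ?g), ?x7, ?x5, ?x4, ?b])"
  by (rule tri_copy) (auto simp: Fm_def avoid_def)
 have 3: "tri Fm 1 (asrt Fm s0 ?rv4 [(ST, 7, ?g), ?x7, ?x5, ?x4, ?b]) (Assign MA (Reg X7))
  (asrt Fm s0 ?rv4 [(ST, 7, ?g), (MA, h * h, mf h S), ?x5, ?x4, ?b])"
  by (rule tri_copy) (auto simp: Fm_def avoid_def)
 have 4: "tri Fm 1 (asrt Fm s0 ?rv4 [(ST, 7, ?g), (MA, h * h, mf h S), ?x5, ?x4, ?b]) (Assign MH (Reg DM))
  (asrt Fm s0 ((MH, h) # ?rv5) [(ST, 7, ?g), (MA, h * h, mf h S), ?x5, ?x4, ?b])"
  by (rule tri_Assign) (use B20 bnd in "auto simp: Fm_def avoid_def small_def rvf_def")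
 have 5: "tri Fm 1 (asrt Fm s0 ((MH, h) # ?rv5) [(ST, 7, ?g), (MA, h * h, mf h S), ?x5, ?x4, ?b]) (Assign MODE (Const 0))
  (asrt Fm s0 ((MODE, 0) # ?rv6) [(ST, 7, ?g), (MA, h * h, mf h S), ?x5, ?x4, ?b])"
  by (rule tri_Assign) (use B20 bnd in "auto simp: Fm_def avoid_def small_def rvf_def")
 show "tri Fm 60 (asrt Fm s0 ?rv4 ?hs) rest ?Post" unfolding rest_def
 proof (rule tri_conseq[OF tri_Seq[OF 1 tri_Seq[OF 2 tri_Seq[OF 3 tri_Seq[OF 4 5]]]]])
  fix s assume "asrt Fm s0 ((MODE, 0) # ?rv6) [(ST, 7, ?g), (MA, h * h, mf h S), ?x5, ?x4, ?b] s"
  from asrt_weaken[OF this] show "?Post s" by (intro exI[of _ x] exI[of _ y]) simp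
 qed simp_all
 qed
 show ?thesis unfolding ret1_cmd_def
 by (rule tri_conseq[OF tri_Seq[OF 1 tri_Seq[OF 2 tri_Seq[OF 3 tri_Seq[OF 4 tri_Seq[OF 5 tri_Seq[OF 6
  tri_Seq[OF 7 tri_Seq[OF 8 tri_Seq[OF 9 tri_Seq[OF 10 11[unfolded rest_def]]]]]]]]]]]]) auto
qed

lemma block_index:
 assumes "1 <= h" "k < (2 * h) * (2 * h)" "evn s (Reg TI) = k" "regs s MH = 2 * h" "regs s DM = h"
 shows "evn s block_index < h * h" "evn s block_index div h = (k div (2 * h)) mod h"
 "evn s block_index mod h = (k mod (2 * h)) mod h"
proof -
 have e: "evn s block_index = ((k div (2 * h)) mod h) * h + (k mod (2 * h)) mod h"
 using assms by (simp add: block_index_def)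
 have lt: "(k div (2 * h)) mod h < h" "(k mod (2 * h)) mod h < h" using assms by auto
 have "((k div (2 * h)) mod h) * h + (k mod (2 * h)) mod h < Suc ((k div (2 * h)) mod h) * h" using lt by simp
 also have "... <= h * h" using lt(1) by (intro mult_le_mono1) (simp only: Suc_le_eq)
 finally show "evn s block_index < h * h" using e by simp
 show "evn s block_index div h = (k div (2 * h)) mod h" "evn s block_index mod h = (k mod (2 * h)) mod h"
 using e lt by auto
qed

lemma tri_ret2:
 fixes d1 d2 :: int
 assumes h: "1 <= h" "h <= Dmax" and bnd: "2 * h <= B" "b <= B" "st <= B" "x <= B" "y <= B"
 and B1: "B1 \<in> carrier_mat h h" and B2: "B2 \<in> carrier_mat h h" and U: "U \<in> carrier_mat h h" and Y: "Y \<in> carrier_mat h h"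
 and old: "arr (mem s0) b (h * h) (mf h B1)" "b + h * h <= regs s0 HP"
  "arr (mem s0) x (h * h) (mf h U)" "x + h * h <= regs s0 HP"
  "arr (mem s0) y (h * h) (mf h Y)" "y + h * h <= regs s0 HP"
 defines "N == four_block_mat (d2 \<cdot>\<^sub>m B1 + (U * B2) * Y) (- d1 \<cdot>\<^sub>m (U * B2)) (- d1 \<cdot>\<^sub>m (B2 * Y)) ((d1 * d1) \<cdot>\<^sub>m B2)"
 shows "tri Fm (100 * (h * h) + 3 * mt h + 6 * R + 400)
  (asrt Fm s0 [(PR, p), (RW, 2 ^ v), (MODE, 1), (RUN, 1), (CNT, c), (RD, rs d2)]
  [(ST, 7, frame2 st b (2 * h) (rs d1) x y), (RES, h * h, mf h B2)])
  (ret2_cmd P R)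
  (asrt Fm s0 [(PR, p), (RW, 2 ^ v), (MODE, 1), (RUN, 1), (CNT, c), (MH, 2 * h), (ST, st), (RD, rs (d1 * d2))]
  [(RES, (2 * h) * (2 * h), mf (2 * h) N)])"
proof -
 let ?c = "[(PR, p), (RW, 2 ^ v), (MODE, 1), (RUN, 1), (CNT, c)]"
 let ?cd = "[(PR, p), (RW, 2 ^ v), (MODE, 1), (RUN, 1), (CNT, c), (RD, rs d2)]"
 let ?f = "(ST, 7, frame2 st b (2 * h) (rs d1) x y)"
 let ?r = "(RES, h * h, mf h B2)"
 let ?x1 = "(X1, h * h, mf h B1)"
 let ?x4 = "(X4, h * h, mf h U)"
 let ?x5 = "(X5, h * h, mf h Y)"
 let ?x6 = "(X6, h * h, mf h (U * B2))"
 let ?x7 = "(X7, h * h, mf h ((U * B2) * Y))"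
 let ?x8 = "(X8, h * h, mf h (B2 * Y))"
 let ?x9 = "(X9, (2 * h) * (2 * h), mf (2 * h) N)"
 let ?rv6 = "(DM, h) # (X5, y) # (X4, x) # (X2, rs d1) # (MH, 2 * h) # (X1, b) # ?cd"
 let ?rv9 = "(DM, h) # (X2, rs d1) # (MH, 2 * h) # ?cd"
 let ?rv10 = "(DM, h) # (X2, rs d1) # (MH, 2 * h) # ?c"
 have cm: "U * B2 \<in> carrier_mat h h" "(U * B2) * Y \<in> carrier_mat h h" "B2 * Y \<in> carrier_mat h h"
 using U Y B2 by auto
 have ld: "tri Fm 1 (asrt Fm s0 rv [?f, ?r]) (Assign q (cell ST (Const j))) (asrt Fm s0 ((q, z) # rv) [?f, ?r])"
 if "q \<in> {MH, X1, X2, X4, X5}" "avoid {q} rv []" "j < 7" "frame2 st b (2 * h) (rs d1) x y j = z" "z <= B" for rv q j z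
 proof (rule tri_Assign)
 show "evn s (cell ST (Const j)) = z & z <= B" if "hsf [?f, ?r] s" for s
  using hsfD[OF that, of ST 7 _ j] \<open>j < 7\<close> \<open>z <= B\<close> \<open>_ = z\<close> by simp
 qed (use that B20 in "auto simp: Fm_def avoid_def small_def")
 have 1: "tri Fm 1 (asrt Fm s0 ?cd [?f, ?r]) (Assign X1 (cell ST (Const 1))) (asrt Fm s0 ((X1, b) # ?cd) [?f, ?r])"
 by (rule ld) (use bnd in "auto simp: avoid_def frame2_def")
 have 2: "tri Fm 1 (asrt Fm s0 ((X1, b) # ?cd) [?f, ?r]) (Assign MH (cell ST (Const 2)))
 (asrt Fm s0 ((MH, 2 * h) # (X1, b) # ?cd) [?f, ?r])"
 by (rule ld) (use bnd in "auto simp: avoid_def frame2_def")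
 have 3: "tri Fm 1 (asrt Fm s0 ((MH, 2 * h) # (X1, b) # ?cd) [?f, ?r]) (Assign X2 (cell ST (Const 4)))
 (asrt Fm s0 ((X2, rs d1) # (MH, 2 * h) # (X1, b) # ?cd) [?f, ?r])"
 by (rule ld) (use bnd rs_le_B in "auto simp: avoid_def frame2_def nth_Cons'")
 have 4: "tri Fm 1 (asrt Fm s0 ((X2, rs d1) # (MH, 2 * h) # (X1, b) # ?cd) [?f, ?r]) (Assign X4 (cell ST (Const 5)))
 (asrt Fm s0 ((X4, x) # (X2, rs d1) # (MH, 2 * h) # (X1, b) # ?cd) [?f, ?r])"
 by (rule ld) (use bnd rs_le_B in "auto simp: avoid_def frame2_def nth_Cons'")
 have 5: "tri Fm 1 (asrt Fm s0 ((X4, x) # (X2, rs d1) # (MH, 2 * h) # (X1, b) # ?cd) [?f, ?r]) (Assign X5 (cell ST (Const 6)))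
 (asrt Fm s0 ((X5, y) # (X4, x) # (X2, rs d1) # (MH, 2 * h) # (X1, b) # ?cd) [?f, ?r])"
 by (rule ld) (use bnd rs_le_B in "auto simp: avoid_def frame2_def nth_Cons'")
 have 6: "tri Fm 1 (asrt Fm s0 ((X5, y) # (X4, x) # (X2, rs d1) # (MH, 2 * h) # (X1, b) # ?cd) [?f, ?r])
 (Assign DM (Div (Reg MH) (Const 2))) (asrt Fm s0 ?rv6 [?f, ?r])"
 by (rule tri_Assign) (use B20 bnd in "auto simp: Fm_def avoid_def small_def rvf_def")
 have 7: "tri Fm (20 * (h * h) + mt h + 2 * R + 60) (asrt Fm s0 ?rv6 [?f, ?r]) (mul P R X6 X4 RES)
 (asrt Fm s0 ?rv6 [?x6, ?x1, ?x5, ?x4, ?f, ?r])"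
 proof (rule tri_old[where r = X4, OF _ old(3,4)], simp, rule tri_old[where r = X5, OF _ old(5,6)], simp,
  rule tri_old[where r = X1, OF _ old(1,2)], simp)
 show "tri Fm (20 * (h * h) + mt h + 2 * R + 60) (asrt Fm s0 ?rv6 [?x1, ?x5, ?x4, ?f, ?r]) (mul P R X6 X4 RES)
  (asrt Fm s0 ?rv6 [?x6, ?x1, ?x5, ?x4, ?f, ?r])"
  by (rule tri_mul) (use h U B2 in "auto simp: Fm_def avoid_def")
 qed
 have 8: "tri Fm (20 * (h * h) + mt h + 2 * R + 60) (asrt Fm s0 ?rv6 [?x6, ?x1, ?x5, ?x4, ?f, ?r]) (mul P R X7 X6 X5)
 (asrt Fm s0 ?rv6 [?x7, ?x6, ?x1, ?x5, ?x4, ?f, ?r])"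
 by (rule tri_mul) (use h cm Y in "auto simp: Fm_def avoid_def")
 have 9: "tri Fm (20 * (h * h) + mt h + 2 * R + 60) (asrt Fm s0 ?rv6 [?x7, ?x6, ?x1, ?x5, ?x4, ?f, ?r]) (mul P R X8 RES X5)
 (asrt Fm s0 ?rv6 [?x8, ?x7, ?x6, ?x1, ?x5, ?x4, ?f, ?r])"
 by (rule tri_mul) (use h B2 Y in "auto simp: Fm_def avoid_def")
 let ?hs = "[?x8, ?x7, ?x6, ?x1, ?x5, ?x4, ?f, ?r]"
 have 10: "tri Fm (5 * ((2 * h) * (2 * h)) + 15) (asrt Fm s0 ?rv6 ?hs) (tab X9 (Mul (Reg MH) (Reg MH)) join_expr)
 (asrt Fm s0 ?rv6 (?x9 # ?hs))"
 proof (rule tri_tab)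
 fix k s assume k: "k < (2 * h) * (2 * h)" "regs s TI = k" and rv: "rvf ?rv6 s" and hs: "hsf ?hs s"
 have rg: "regs s MH = 2 * h" "regs s DM = h" "regs s RD = rs d2" "regs s X2 = rs d1" "regs s PR = p"
  using rv by (auto simp: rvf_def)
 define i j where "i = k div (2 * h)" and "j = k mod (2 * h)"
 have ij: "i < 2 * h" "j < 2 * h" using k h by (auto simp: i_def j_def less_mult_imp_div_less)
 define l where "l = evn s block_index"
 note bi = block_index[of h k s, OF h(1) k(1) _ rg(1,2), folded l_def i_def j_def]
 have l: "l < h * h" "l div h = i mod h" "l mod h = j mod h" using bi k(2) by auto
 have ld: "mem s (regs s X1 + l) = mf h B1 l" "mem s (regs s X7 + l) = mf h ((U * B2) * Y) l"
  "mem s (regs s X6 + l) = mf h (U * B2) l" "mem s (regs s X8 + l) = mf h (B2 * Y) l" "mem s (regs s RES + l) = mf h B2 l"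
  using hsfD[OF hs, of X1 "h * h" _ l] hsfD[OF hs, of X7 "h * h" _ l] hsfD[OF hs, of X6 "h * h" _ l]
  hsfD[OF hs, of X8 "h * h" _ l] hsfD[OF hs, of RES "h * h" _ l] l(1) by auto
 have ih: "i mod h = (if i < h then i else i - h)" "j mod h = (if j < h then j else j - h)"
  using ij by (auto simp: le_mod_geq)
 have ev: "evn s join_expr = (if i < h then if j < h then (rs d2 * mf h B1 l + mf h ((U * B2) * Y) l) mod p
  else (rs d1 * (p - mf h (U * B2) l)) mod p
  else if j < h then (rs d1 * (p - mf h (B2 * Y) l)) mod p
  else (((rs d1 * rs d1) mod p) * mf h B2 l) mod p)"
  using k(2) rg ld by (simp add: join_expr_def l_def[symmetric] i_def[symmetric] j_def[symmetric])
 have mN: "mf (2 * h) N k = rs (N $$ (i, j))" by (simp add: mf_def i_def j_def)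
 have "evn s join_expr = rs (N $$ (i, j))"
  unfolding ev mf_def l(2,3) rs_add rs_neg rs_mult N_def using ij ih B1 B2 U Y cm
  by (auto simp: not_less)
 then show "evn s join_expr = mf (2 * h) N k & mf (2 * h) N k <= B" using mN rs_le_B by simp
 qed (use B20 in "auto simp: Fm_def avoid_def small_def rvf_def join_expr_def block_index_def")
 have 11: "tri Fm 1 (asrt Fm s0 ?rv6 (?x9 # ?hs)) (Assign RD (Mod (Mul (Reg RD) (Reg X2)) (Reg PR)))
 (asrt Fm s0 ((RD, rs (d1 * d2)) # ?rv10) [?x9, ?f])"
 by (rule tri_Assign) (use B20 rs_le_B in "auto simp: Fm_def avoid_def small_def rvf_def rs_mult mult.commute")
 have 12: "tri Fm 1 (asrt Fm s0 ((RD, rs (d1 * d2)) # ?rv10) [?x9, ?f]) (Assign RES (Reg X9))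
 (asrt Fm s0 ((RD, rs (d1 * d2)) # ?rv10) [(RES, (2 * h) * (2 * h), mf (2 * h) N), ?f])"
 by (rule tri_copy) (auto simp: Fm_def avoid_def)
 have 13: "tri Fm 1 (asrt Fm s0 ((RD, rs (d1 * d2)) # ?rv10) [(RES, (2 * h) * (2 * h), mf (2 * h) N), ?f]) (Assign ST (Load (Reg ST)))
 (asrt Fm s0 ((ST, st) # (RD, rs (d1 * d2)) # ?rv10) [(RES, (2 * h) * (2 * h), mf (2 * h) N)])"
 proof (rule tri_Assign)
 show "evn s (Load (Reg ST)) = st & st <= B" if "hsf [(RES, (2 * h) * (2 * h), mf (2 * h) N), ?f] s" for s
  using hsfD[OF that, of ST 7 _ 0] bnd by (simp add: frame2_def)
 qed (use B20 in "auto simp: Fm_def avoid_def small_def")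
 show ?thesis unfolding ret2_cmd_def
 by (rule tri_conseq[OF tri_Seq[OF 1 tri_Seq[OF 2 tri_Seq[OF 3 tri_Seq[OF 4 tri_Seq[OF 5 tri_Seq[OF 6
  tri_Seq[OF 7 tri_Seq[OF 8 tri_Seq[OF 9 tri_Seq[OF 10 tri_Seq[OF 11 tri_Seq[OF 12 13]]]]]]]]]]]]])
  (auto elim!: asrt_weaken)
qed

end

section \<open>The recursion as segments of one loop\<close>

context inv_ram
begin

lemma rs_eq_0: "rs x = 0 \<longleftrightarrow> int p dvd x"
 using int_rs[of x] by (auto simp: mod_eq_0_iff_dvd)

lemma tri_leaf_fail:
 assumes "int p dvd M $$ (0, 0)"
 shows "tri Fm 2 (asrt Fm s0 [(CNT, c)] [(MA, 1, mf 1 M)]) leaf_cmd (asrt Fm s0 [(RUN, 0), (CNT, c)] [])"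
proof -
 let ?P = "asrt Fm s0 [(CNT, c)] [(MA, 1, mf 1 M)]"
 have 1: "tri Fm 1 ?P (Assign RUN (Const 0)) (asrt Fm s0 [(RUN, 0), (CNT, c)] [])"
 by (rule tri_Assign) (use B20 in "auto simp: Fm_def avoid_def small_def")
 show ?thesis unfolding leaf_cmd_def
 proof (rule tri_conseq[OF tri_Branch[where x = 0 and T = 1]])
 show "evn s (Load (Reg MA)) = 0" if "?P s" for s
  using hsfD[OF asrt_hsf[OF that], of MA 1 _ 0] assms by (simp add: mf_def rs_eq_0)
 qed (use 1 in "auto simp: small_def")
qed

lemma tri_leaf:
 assumes "~ int p dvd M $$ (0, 0)" "c + 1 <= B"
 shows "tri Fm 40 (asrt Fm s0 [(PR, p), (RW, 2 ^ v), (MODE, 0), (RUN, 1), (CNT, c), (MH, 1), (ST, st)] [(MA, 1, mf 1 M)])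
 leaf_cmd (asrt Fm s0 [(RUN, 1), (MODE, 1), (CNT, c + 1), (MH, 1), (ST, st), (RD, rs (M $$ (0, 0)))]
  [(RES, 1, mf 1 (1\<^sub>m 1))])"
proof -
 let ?m = "(MA, 1, mf 1 M)"
 let ?z = "rs (M $$ (0, 0))"
 let ?rv0 = "[(PR, p), (RW, 2 ^ v), (MODE, 0), (RUN, 1), (CNT, c), (MH, 1), (ST, st)]"
 let ?rv1 = "[(CNT, c + 1), (PR, p), (RW, 2 ^ v), (RUN, 1), (MH, 1), (ST, st)]"
 let ?rv2 = "(RD, ?z) # ?rv1"
 have 1: "tri Fm 1 (asrt Fm s0 ?rv0 [?m]) (Assign CNT (Add (Reg CNT) (Const 1))) (asrt Fm s0 ?rv1 [?m])"
 by (rule tri_Assign) (use B20 assms in "auto simp: Fm_def avoid_def small_def rvf_def")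
 have 2: "tri Fm 1 (asrt Fm s0 ?rv1 [?m]) (Assign RD (Load (Reg MA))) (asrt Fm s0 ?rv2 [?m])"
 proof (rule tri_Assign)
 show "evn s (Load (Reg MA)) = ?z & ?z <= B" if "hsf [?m] s" for s
  using hsfD[OF that, of MA 1 _ 0] rs_le_B by (simp add: mf_def)
 qed (use B20 in "auto simp: Fm_def avoid_def small_def")
 have 3: "tri Fm (5 * 1 + 15) (asrt Fm s0 ?rv2 [?m]) (tab RES (Const 1) (Const 1)) (asrt Fm s0 ?rv2 [(RES, 1, mf 1 (1\<^sub>m 1)), ?m])"
 proof (rule tri_tab)
 have "rs 1 = 1" using p by (simp add: rs_def)
 then show "evn s (Const 1) = mf 1 (1\<^sub>m 1) i & mf 1 (1\<^sub>m 1) i <= B" if "i < 1" for i s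
  using that B20 by (simp add: mf_def)
 qed (use B20 in "auto simp: Fm_def avoid_def small_def")
 have 4: "tri Fm 1 (asrt Fm s0 ?rv2 [(RES, 1, mf 1 (1\<^sub>m 1)), ?m]) (Assign MODE (Const 1))
 (asrt Fm s0 ((MODE, 1) # ?rv2) [(RES, 1, mf 1 (1\<^sub>m 1))])"
 by (rule tri_Assign) (use B20 assms in "auto simp: Fm_def avoid_def small_def rvf_def")
 have z: "?z ~= 0" using assms by (simp add: rs_eq_0)
 note all = tri_Seq[OF 1 tri_Seq[OF 2 tri_Seq[OF 3 4]]]
 show ?thesis unfolding leaf_cmd_def
 proof (rule tri_conseq[OF tri_Branch[where x = ?z]])
 show "evn s (Load (Reg MA)) = ?z" if "asrt Fm s0 ?rv0 [?m] s" for s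
  using hsfD[OF asrt_hsf[OF that], of MA 1 _ 0] by (simp add: mf_def)
 show "tri Fm (1 + 1 + (1 + 1 + (1 + (5 * 1 + 15) + 1))) (asrt Fm s0 ?rv0 [?m]) (if ?z ~= 0 then
  Seq (Assign CNT (Add (Reg CNT) (Const 1))) (Seq (Assign RD (Load (Reg MA))) (Seq (tab RES (Const 1) (Const 1)) (Assign MODE (Const 1))))
  else Assign RUN (Const 0)) (asrt Fm s0 ((MODE, 1) # ?rv2) [(RES, 1, mf 1 (1\<^sub>m 1))])"
  using all z by simp
 show "asrt Fm s0 [(RUN, 1), (MODE, 1), (CNT, c + 1), (MH, 1), (ST, st), (RD, rs (M $$ (0, 0)))] [(RES, 1, mf 1 (1\<^sub>m 1))] s"
  if "asrt Fm s0 ((MODE, 1) # ?rv2) [(RES, 1, mf 1 (1\<^sub>m 1))] s" for s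
  using asrt_weaken[OF that] by simp
 qed (auto simp: small_def)
qed

lemma tri_body_call:
 assumes "tri Fm T (asrt Fm s0 rv hs) (if m < 2 then leaf_cmd else split_cmd) Q" "(MODE, 0) \<in> set rv" "(MH, m) \<in> set rv"
 shows "tri Fm (2 + T) (asrt Fm s0 rv hs) (inv_body P R) Q"
proof -
 have 1: "tri Fm (1 + T) (asrt Fm s0 rv hs) (Branch (Less (Reg MH) (Const 2)) leaf_cmd split_cmd) Q"
 proof (rule tri_Branch)
 show "evn s (Less (Reg MH) (Const 2)) = (if m < 2 then 1 else 0)" if "asrt Fm s0 rv hs s" for s
  using rvfD[OF asrt_rvf[OF that] assms(3)] by simp
 qed (use assms B20 in "auto simp: small_def")
 have "tri Fm (1 + (1 + T)) (asrt Fm s0 rv hs) (inv_body P R) Q" unfolding inv_body_def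
 proof (rule tri_Branch)
 show "evn s (Reg MODE) = 0" if "asrt Fm s0 rv hs s" for s
  using rvfD[OF asrt_rvf[OF that] assms(2)] by simp
 qed (use 1 in "auto simp: small_def")
 then show ?thesis by simp
qed

lemma tri_body_ret:
 assumes "tri Fm T (asrt Fm s0 rv hs) (if f 3 = 0 then ret1_cmd P R else ret2_cmd P R) Q" "f 3 < 2"
 "(MODE, 1) \<in> set rv" "(ST, L, f) \<in> set hs" "3 < L"
 shows "tri Fm (3 + T) (asrt Fm s0 rv hs) (inv_body P R) Q"
proof -
 have m: "mem s (regs s ST + 3) = f 3" if "asrt Fm s0 rv hs s" for s
 using hsfD[OF asrt_hsf[OF that] assms(4,5)] .
 have 1: "tri Fm (1 + T) (asrt Fm s0 rv hs) (Branch (cell ST (Const 3)) (ret2_cmd P R) (ret1_cmd P R)) Q"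
 proof (rule tri_Branch)
 show "evn s (cell ST (Const 3)) = f 3" if "asrt Fm s0 rv hs s" for s
  using m[OF that] by simp
 qed (use assms B20 in "auto simp: small_def")
 have 2: "tri Fm (1 + (1 + T)) (asrt Fm s0 rv hs) (Branch (Less (cell ST (Const 3)) (Const 2))
  (Branch (cell ST (Const 3)) (ret2_cmd P R) (ret1_cmd P R))
  (Assign RUN (Const 0))) Q"
 proof (rule tri_Branch)
 show "evn s (Less (cell ST (Const 3)) (Const 2)) = 1" if "asrt Fm s0 rv hs s" for s
  using m[OF that] assms(2) by simp
 qed (use 1 B20 in "auto simp: small_def")
 have "tri Fm (1 + (1 + (1 + T))) (asrt Fm s0 rv hs) (inv_body P R) Q" unfolding inv_body_def
 proof (rule tri_Branch)
 show "evn s (Reg MODE) = 1" if "asrt Fm s0 rv hs s" for s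
  using rvfD[OF asrt_rvf[OF that] assms(3)] by simp
 qed (use 2 in "auto simp: small_def")
 then show ?thesis by (simp add: numeral_3_eq_3)
qed

text \<open>A recursive call is a stretch of iterations of a single loop and not a run of it to the
  end; hence a relation between two states at the loop head.\<close>

definition reach :: "state => nat => state => bool" where
 "reach s t s' \<longleftrightarrow> (ALL cs. run w t (While (Reg RUN) (inv_body P R) # cs, s) =
  return_pmf (While (Reg RUN) (inv_body P R) # cs, s'))"

lemma reach_trans: "reach s t1 s1 ==> reach s1 t2 s2 ==> reach s (t1 + t2) s2"
 by (simp add: reach_def run_add bind_return_pmf)

lemma reach_exec: "reach s t1 s1 ==> exec w (While (Reg RUN) (inv_body P R)) s1 t2 s2 ==>
 exec w (While (Reg RUN) (inv_body P R)) s (t1 + t2) s2"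
 by (simp add: reach_def exec_def run_add bind_return_pmf)

lemma reach_step:
 assumes "tri Fm T (asrt Fm s rv hs) (inv_body P R) Q" "asrt Fm s rv hs s" "(RUN, 1) \<in> set rv"
 "regs s HP + T * V <= B"
 obtains t s' where "t <= T + 1" "reach s t s'" "fr Fm s s'" "regs s' HP <= regs s HP + T * V" "Q s'"
proof -
 have "call Fm T (inv_body P R) s Q" using assms(1,2) by (simp add: tri_def)
 from callD[OF this asrt_ok[OF assms(2)] assms(4)] obtain t s' where
 1: "t <= T" "exec w (inv_body P R) s t s'" "fr Fm s s'" "regs s' HP <= regs s HP + T * V" "Q s'" .
 have "regs s RUN = 1" using rvfD[OF asrt_rvf[OF assms(2)] assms(3)] .
 then have "reach s (1 + t) s'"
 using 1(2) by (simp add: reach_def exec_def bind_return_pmf)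
 then show thesis using that[of "1 + t" s'] 1 by simp
qed

text \<open>Six products of half the order per level, three after each of the two recursive calls;
  the quadratic term pays for cutting and joining blocks.\<close>

fun inv_time :: "nat => nat" where
 "inv_time 0 = 100"
| "inv_time (Suc e) = 2 * inv_time e + (300 * (2 ^ e * 2 ^ e) + 6 * mt (2 ^ e) + 12 * R + 1200)"

text \<open>The stack is used in a balanced way, which is the content of the induction: between
  entering a call and returning from it the stack pointer is restored, unless a vanishing minor
  clears \<open>RUN\<close> on the way. The start count \<open>c0\<close> is arbitrary because the
  second half continues the count of the first.\<close>

lemma inv_loop:
 assumes "prime (int p)"
 shows "ok s ==> rvf [(PR, p), (RW, 2 ^ v), (MODE, 0), (RUN, 1), (CNT, c0), (MH, 2 ^ e)] s ==>
 mat_at s (regs s MA) (2 ^ e) M ==> 2 ^ e <= Dmax ==> c0 + 2 ^ e <= B ==> regs s HP + inv_time e * V <= B ==>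
 pinv (int p) e M = (c, N, d) ==>
 EX t s'. t <= inv_time e & reach s t s' & fr Fm s s' & regs s' HP <= regs s HP + inv_time e * V &
  regs s' CNT = c0 + c &
  (if c = 2 ^ e then rvf [(MODE, 1), (RUN, 1), (MH, 2 ^ e), (ST, regs s ST), (RD, rs d)] s' &
  mat_at s' (regs s' RES) (2 ^ e) N
  else regs s' RUN = 0)"
proof (induction e arbitrary: s c0 M c N d)
 case 0
 note s = 0
 have M: "arr (mem s) (regs s MA) 1 (mf 1 M)" "regs s MA + 1 <= regs s HP" using s(3) by (auto simp: mat_at_mf)
 have V100: "2 * V <= inv_time 0 * V" "42 * V <= inv_time 0 * V" "4 * V <= inv_time 0 * V" by simp_all
 show ?case
 proof (cases "int p dvd M $$ (0, 0)")
 case True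
 let ?rv = "[(MODE, 0), (RUN, 1), (MH, 1), (CNT, c0)]"
 have a: "asrt Fm s ?rv [(MA, 1, mf 1 M)] s"
  using s M by (intro asrt_start) (auto simp: rvf_def)
 have "tri Fm 2 (asrt Fm s ?rv [(MA, 1, mf 1 M)]) (if (1::nat) < 2 then leaf_cmd else split_cmd) (asrt Fm s [(RUN, 0), (CNT, c0)] [])"
  using tri_conseq[OF tri_leaf_fail[OF True, of s c0] order_refl asrt_weaken] by simp
 from tri_body_call[OF this] have "tri Fm (2 + 2) (asrt Fm s ?rv [(MA, 1, mf 1 M)]) (inv_body P R) (asrt Fm s [(RUN, 0), (CNT, c0)] [])"
  by simp
 from reach_step[OF this a] s(6) V100 obtain t s' where 1: "t <= 2 + 2 + 1" "reach s t s'" "fr Fm s s'"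
  "regs s' HP <= regs s HP + (2 + 2) * V" "asrt Fm s [(RUN, 0), (CNT, c0)] [] s'" by auto
 have "regs s' RUN = 0" "regs s' CNT = c0" using asrt_rvf[OF 1(5)] by (auto simp: rvf_def)
 then show ?thesis using 1 True s(7) V100 by (intro exI[of _ t] exI[of _ s']) auto
 next
 case False
 let ?rv = "[(PR, p), (RW, 2 ^ v), (MODE, 0), (RUN, 1), (CNT, c0), (MH, 1), (ST, regs s ST)]"
 have a: "asrt Fm s ?rv [(MA, 1, mf 1 M)] s"
  using s M by (intro asrt_start) (auto simp: rvf_def)
 let ?Q = "asrt Fm s [(RUN, 1), (MODE, 1), (CNT, c0 + 1), (MH, 1), (ST, regs s ST), (RD, rs (M $$ (0, 0)))]
  [(RES, 1, mf 1 (1\<^sub>m 1))]"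
 have "tri Fm 40 (asrt Fm s ?rv [(MA, 1, mf 1 M)]) (if (1::nat) < 2 then leaf_cmd else split_cmd) ?Q"
  using tri_leaf[OF False] s(5) by simp
 from tri_body_call[OF this] have "tri Fm (2 + 40) (asrt Fm s ?rv [(MA, 1, mf 1 M)]) (inv_body P R) ?Q"
  by simp
 from reach_step[OF this a] s(6) V100 obtain t s' where 1: "t <= 2 + 40 + 1" "reach s t s'" "fr Fm s s'"
  "regs s' HP <= regs s HP + (2 + 40) * V" "?Q s'" by auto
 have "mat_at s' (regs s' RES) 1 (1\<^sub>m 1)"
  using 1(5) by (simp add: mat_at_mf asrt_def)
 then show ?thesis using 1 False s(7) V100 asrt_rvf[OF 1(5)]
  by (intro exI[of _ t] exI[of _ s']) (auto simp: rvf_def)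
 qed
next
 case (Suc e)
 note s = Suc.prems
 define h :: nat where "h = 2 ^ e"
 have h1: "1 <= h" by (simp add: h_def)
 have hh: "2 ^ Suc e = 2 * h" by (simp add: h_def)
 define T1 where "T1 = 2 + (5 * (h * h) + 100)"
 define T2 where "T2 = 3 + (80 * (h * h) + 3 * mt h + 6 * R + 400)"
 define T3 where "T3 = 3 + (100 * (h * h) + 3 * mt h + 6 * R + 400)"
 define Te where "Te = inv_time e"
 have TT: "(T1 + 1) + Te + (T2 + 1) + Te + (T3 + 1) <= inv_time (Suc e)"
 by (simp add: T1_def T2_def T3_def Te_def h_def)
 then have "(T1 + Te + T2 + Te + T3) * V <= inv_time (Suc e) * V" by (intro mult_le_mono1) simp
 then have TV: "T1 * V + Te * V + T2 * V + Te * V + T3 * V <= inv_time (Suc e) * V" by (simp add: algebra_simps)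
 define a where "a = regs s MA"
 define st where "st = regs s ST"
 have hB: "2 * h <= B" using rvfD[OF s(2), of MH "2 ^ Suc e"] ok_regs[OF s(1), of MH] hh by simp
 have hD: "h <= Dmax" "2 * h <= Dmax" using s(4) hh by simp_all
 have aB: "a <= B" "st <= B" using ok_regs[OF s(1)] by (auto simp: a_def st_def)
 have M: "M \<in> carrier_mat (2 * h) (2 * h)" "arr (mem s) a ((2 * h) * (2 * h)) (mf (2 * h) M)"
 "a + (2 * h) * (2 * h) <= regs s HP" using s(3) unfolding hh mat_at_mf a_def by auto
 obtain c1 B1 d1 where p1: "pinv (int p) e (quad h 0 0 M) = (c1, B1, d1)" by (metis prod_cases3)
 define U where "U = B1 * quad h 0 1 M"
 define Y where "Y = quad h 1 0 M * B1"
 define S where "S = d1 \<cdot>\<^sub>m quad h 1 1 M - quad h 1 0 M * U"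
 obtain c2 B2 d2 where p2: "pinv (int p) e S = (c2, B2, d2)" by (metis prod_cases3)
 have res: "c = (if c1 < h then c1 else h + c2)"
 "N = four_block_mat (d2 \<cdot>\<^sub>m B1 + (U * B2) * Y) (- d1 \<cdot>\<^sub>m (U * B2)) (- d1 \<cdot>\<^sub>m (B2 * Y)) ((d1 * d1) \<cdot>\<^sub>m B2)"
 "d = d1 * d2"
 using s(7) p1 p2
 by (simp_all del: One_nat_def add: Let_def h_def[symmetric] U_def[symmetric] Y_def[symmetric] S_def[symmetric])
 note pc1 = pinv_correct[OF assms, of "quad h 0 0 M" e c1 B1 d1, folded h_def, OF quad_carrier(1) p1]

 let ?rv0 = "[(PR, p), (RW, 2 ^ v), (MODE, 0), (RUN, 1), (CNT, c0), (MH, 2 * h), (MA, a), (ST, st)]"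
 let ?hs0 = "[(MA, (2 * h) * (2 * h), mf (2 * h) M)]"
 have a0: "asrt Fm s ?rv0 ?hs0 s"
 using s(1,2) M hh by (intro asrt_start) (auto simp: rvf_def a_def st_def)
 let ?rv1 = "[(DM, h), (PR, p), (RW, 2 ^ v), (MODE, 0), (RUN, 1), (CNT, c0), (MH, h)]"
 let ?hs1 = "[(MA, h * h, mf h (quad h 0 0 M)), (ST, 4, frame1 st a (2 * h))]"
 have "tri Fm T1 (asrt Fm s ?rv0 ?hs0) (inv_body P R) (asrt Fm s ?rv1 ?hs1)"
 unfolding T1_def
 by (rule tri_body_call[where m = "2 * h"]) (use tri_split[OF h1 aB(2,1) hB, of s c0 M] h1 in auto)
 from reach_step[OF this a0] TV s(6) obtain t1 s1 where s1: "t1 <= T1 + 1" "reach s t1 s1" "fr Fm s s1"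
 "regs s1 HP <= regs s HP + T1 * V" "asrt Fm s ?rv1 ?hs1 s1" by auto
 have st1: "regs s1 ST + 4 <= regs s1 HP" "arr (mem s1) (regs s1 ST) 4 (frame1 st a (2 * h))"
 "mat_at s1 (regs s1 MA) (2 ^ e) (quad h 0 0 M)"
 using s1(5) by (auto simp: asrt_def mat_at_mf h_def[symmetric])
 have "EX t s'. t <= inv_time e & reach s1 t s' & fr Fm s1 s' & regs s' HP <= regs s1 HP + inv_time e * V &
  regs s' CNT = c0 + c1 &
  (if c1 = 2 ^ e then rvf [(MODE, 1), (RUN, 1), (MH, 2 ^ e), (ST, regs s1 ST), (RD, rs d1)] s' &
  mat_at s' (regs s' RES) (2 ^ e) B1
  else regs s' RUN = 0)"
 proof (rule Suc.IH[OF asrt_ok[OF s1(5)] _ st1(3) _ _ _ p1])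
 show "rvf [(PR, p), (RW, 2 ^ v), (MODE, 0), (RUN, 1), (CNT, c0), (MH, 2 ^ e)] s1"
  using asrt_rvf[OF s1(5)] by (simp add: rvf_def h_def)
 show "2 ^ e <= Dmax" "c0 + 2 ^ e <= B" using hD s(5) by (simp_all add: h_def[symmetric] hh)
 show "regs s1 HP + inv_time e * V <= B" using s1(4) TV s(6) unfolding Te_def[symmetric] by linarith
 qed
 then obtain t2 s2 where s2: "t2 <= Te" "reach s1 t2 s2" "fr Fm s1 s2" "regs s2 HP <= regs s1 HP + Te * V"
 "regs s2 CNT = c0 + c1"
 "if c1 = h then rvf [(MODE, 1), (RUN, 1), (MH, h), (ST, regs s1 ST), (RD, rs d1)] s2 & mat_at s2 (regs s2 RES) h B1
  else regs s2 RUN = 0" unfolding Te_def h_def by blast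
 have r2: "reach s (t1 + t2) s2" using reach_trans[OF s1(2) s2(2)] .
 have f2: "fr Fm s s2" using fr_trans[OF s1(3) s2(3)] .
 show ?case
 proof (cases "c1 < h")
 case True
 then have "c = c1" "c1 ~= h" "c1 ~= 2 ^ Suc e" using res hh by auto
 then show ?thesis using r2 f2 s1(1,4) s2 TT TV
  by (intro exI[of _ "t1 + t2"] exI[of _ s2]) auto
 next
 case False
 then have c1: "c1 = h" using pc1 by simp
 then have B1: "B1 \<in> carrier_mat h h" using pc1 by simp
 have S: "S \<in> carrier_mat h h" and U: "U \<in> carrier_mat h h" and Y: "Y \<in> carrier_mat h h"
  using B1 by (auto simp: S_def U_def Y_def)
 note pc2 = pinv_correct[OF assms, of S e c2 B2 d2, folded h_def, OF S p2]
 define b where "b = regs s2 RES"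
 have q2: "rvf [(MODE, 1), (RUN, 1), (MH, h), (ST, regs s1 ST), (RD, rs d1)] s2" "mat_at s2 b h B1"
  using s2(6) c1 by (auto simp: b_def)
 have bB: "b <= B" using ok_regs[OF fr_ok[OF f2]] by (simp add: b_def)
 have fix2: "regs s2 PR = p" "regs s2 RW = 2 ^ v"
  using fr_regs[OF f2, of PR] fr_regs[OF f2, of RW] s(2) by (auto simp: rvf_def Fm_def)
 have old2: "arr (mem s2) a ((2 * h) * (2 * h)) (mf (2 * h) M)" "a + (2 * h) * (2 * h) <= regs s2 HP"
  using fr_arr[OF f2 M(2,3)] fr_HP[OF f2] M(3) by auto
 have st2: "arr (mem s2) (regs s2 ST) 4 (frame1 st a (2 * h))" "regs s2 ST + 4 <= regs s2 HP"
  using fr_arr[OF s2(3) st1(2,1)] fr_HP[OF s2(3)] st1(1) q2(1) by (auto simp: rvf_def)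
 let ?rv2 = "[(PR, p), (RW, 2 ^ v), (MODE, 1), (RUN, 1), (CNT, c0 + h), (RES, b), (RD, rs d1)]"
 let ?hs2 = "[(ST, 4, frame1 st a (2 * h)), (RES, h * h, mf h B1)]"
 have a2: "asrt Fm s2 ?rv2 ?hs2 s2"
  using fr_ok[OF f2] q2 fix2 st2 s2(5) c1 by (intro asrt_start) (auto simp: rvf_def b_def mat_at_mf)
 have "tri Fm T2 (asrt Fm s2 ?rv2 ?hs2) (inv_body P R) (%s. EX x y. asrt Fm s2
  [(PR, p), (RW, 2 ^ v), (MODE, 0), (RUN, 1), (CNT, c0 + h), (MH, h), (RES, b), (X4, x), (X5, y)]
  [(MA, h * h, mf h S), (ST, 7, frame2 st b (2 * h) (rs d1) x y), (RES, h * h, mf h B1),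
  (X4, h * h, mf h U), (X5, h * h, mf h Y)] s)"
  unfolding T2_def
  by (rule tri_body_ret[where f = "frame1 st a (2 * h)" and L = 4])
  (use tri_ret1[where ?d1.0 = d1 and c = "c0 + h", OF h1 hD(1) hB aB(1) bB aB(2) M(1) B1 old2, folded U_def Y_def, folded S_def]
  in "auto simp: frame1_def")
 note tri2 = this
 have bud2: "regs s2 HP + T2 * V <= B" using TV s(6) s1(4) s2(4) by linarith
 obtain t3 s3 where s3: "t3 <= T2 + 1" "reach s2 t3 s3" "fr Fm s2 s3" "regs s3 HP <= regs s2 HP + T2 * V"
  and s3x: "EX x y. asrt Fm s2
  [(PR, p), (RW, 2 ^ v), (MODE, 0), (RUN, 1), (CNT, c0 + h), (MH, h), (RES, b), (X4, x), (X5, y)]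
  [(MA, h * h, mf h S), (ST, 7, frame2 st b (2 * h) (rs d1) x y), (RES, h * h, mf h B1),
  (X4, h * h, mf h U), (X5, h * h, mf h Y)] s3"
  by (rule reach_step[OF tri2 a2 _ bud2]) simp_all
 then obtain x y where "asrt Fm s2
  [(PR, p), (RW, 2 ^ v), (MODE, 0), (RUN, 1), (CNT, c0 + h), (MH, h), (RES, b), (X4, x), (X5, y)]
  [(MA, h * h, mf h S), (ST, 7, frame2 st b (2 * h) (rs d1) x y), (RES, h * h, mf h B1),
  (X4, h * h, mf h U), (X5, h * h, mf h Y)] s3" by blast
 note s3 = s3 this
 have xy: "x <= B" "y <= B" "regs s3 X4 = x" "regs s3 X5 = y" "regs s3 RES = b"
  using ok_regs[OF asrt_ok[OF s3(5)], of X4] ok_regs[OF asrt_ok[OF s3(5)], of X5] asrt_rvf[OF s3(5)] by (auto simp: rvf_def)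
 have m3: "mat_at s3 (regs s3 MA) (2 ^ e) S" using s3(5) S by (auto simp: asrt_def mat_at_mf h_def[symmetric])
 have st3: "arr (mem s3) (regs s3 ST) 7 (frame2 st b (2 * h) (rs d1) x y)" "regs s3 ST + 7 <= regs s3 HP"
  "arr (mem s3) b (h * h) (mf h B1)" "b + h * h <= regs s3 HP"
  "arr (mem s3) x (h * h) (mf h U)" "x + h * h <= regs s3 HP"
  "arr (mem s3) y (h * h) (mf h Y)" "y + h * h <= regs s3 HP"
  using s3(5) xy(3-5) by (auto simp: asrt_def)
 have "EX t s'. t <= inv_time e & reach s3 t s' & fr Fm s3 s' & regs s' HP <= regs s3 HP + inv_time e * V &
  regs s' CNT = c0 + h + c2 &
  (if c2 = 2 ^ e then rvf [(MODE, 1), (RUN, 1), (MH, 2 ^ e), (ST, regs s3 ST), (RD, rs d2)] s' &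
  mat_at s' (regs s' RES) (2 ^ e) B2
  else regs s' RUN = 0)"
 proof (rule Suc.IH[OF asrt_ok[OF s3(5)] _ m3 _ _ _ p2])
  show "rvf [(PR, p), (RW, 2 ^ v), (MODE, 0), (RUN, 1), (CNT, c0 + h), (MH, 2 ^ e)] s3"
  using asrt_rvf[OF s3(5)] by (simp add: rvf_def h_def)
  show "2 ^ e <= Dmax" "c0 + h + 2 ^ e <= B" using hD s(5) by (simp_all add: h_def[symmetric] hh)
  show "regs s3 HP + inv_time e * V <= B" using s1(4) s2(4) s3(4) TV s(6) unfolding Te_def[symmetric] by linarith
 qed
 then obtain t4 s4 where s4: "t4 <= Te" "reach s3 t4 s4" "fr Fm s3 s4" "regs s4 HP <= regs s3 HP + Te * V"
  "regs s4 CNT = c0 + h + c2"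
  "if c2 = h then rvf [(MODE, 1), (RUN, 1), (MH, h), (ST, regs s3 ST), (RD, rs d2)] s4 & mat_at s4 (regs s4 RES) h B2
  else regs s4 RUN = 0" unfolding Te_def h_def by blast
 have r4: "reach s (t1 + t2 + t3 + t4) s4" using reach_trans[OF reach_trans[OF r2 s3(2)] s4(2)] .
 have f4: "fr Fm s s4" using fr_trans[OF fr_trans[OF f2 s3(3)] s4(3)] .
 have c: "c = h + c2" using res False by simp
 show ?thesis
 proof (cases "c2 = h")
  case False
  then have "c ~= 2 ^ Suc e" using c hh by simp
  then show ?thesis using r4 f4 s1(1,4) s2(1,4) s3(1,4) s4 TT TV c False
  by (intro exI[of _ "t1 + t2 + t3 + t4"] exI[of _ s4]) auto
 next
  case True
  then have B2: "B2 \<in> carrier_mat h h" using pc2 by simp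
  have q4: "rvf [(MODE, 1), (RUN, 1), (MH, h), (ST, regs s3 ST), (RD, rs d2)] s4" "mat_at s4 (regs s4 RES) h B2"
  using s4(6) True by auto
  have fix4: "regs s4 PR = p" "regs s4 RW = 2 ^ v"
  using fr_regs[OF f4, of PR] fr_regs[OF f4, of RW] s(2) by (auto simp: rvf_def Fm_def)
  have old4: "arr (mem s4) b (h * h) (mf h B1)" "b + h * h <= regs s4 HP"
  "arr (mem s4) x (h * h) (mf h U)" "x + h * h <= regs s4 HP"
  "arr (mem s4) y (h * h) (mf h Y)" "y + h * h <= regs s4 HP"
  using fr_arr[OF s4(3) st3(3,4)] fr_arr[OF s4(3) st3(5,6)] fr_arr[OF s4(3) st3(7,8)] fr_HP[OF s4(3)] st3(4,6,8) by auto
  have st4: "arr (mem s4) (regs s4 ST) 7 (frame2 st b (2 * h) (rs d1) x y)" "regs s4 ST + 7 <= regs s4 HP"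
  using fr_arr[OF s4(3) st3(1,2)] fr_HP[OF s4(3)] st3(2) q4(1) by (auto simp: rvf_def)
  let ?rv4 = "[(PR, p), (RW, 2 ^ v), (MODE, 1), (RUN, 1), (CNT, c0 + h + h), (RD, rs d2)]"
  let ?hs4 = "[(ST, 7, frame2 st b (2 * h) (rs d1) x y), (RES, h * h, mf h B2)]"
  have a4: "asrt Fm s4 ?rv4 ?hs4 s4"
  using fr_ok[OF f4] q4 fix4 st4 s4(5) True by (intro asrt_start) (auto simp: rvf_def mat_at_mf)
  let ?Q4 = "asrt Fm s4 [(PR, p), (RW, 2 ^ v), (MODE, 1), (RUN, 1), (CNT, c0 + h + h), (MH, 2 * h), (ST, st), (RD, rs (d1 * d2))]
  [(RES, (2 * h) * (2 * h), mf (2 * h) N)]"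
  have "tri Fm T3 (asrt Fm s4 ?rv4 ?hs4) (inv_body P R) ?Q4"
  unfolding T3_def
  by (rule tri_body_ret[where f = "frame2 st b (2 * h) (rs d1) x y" and L = 7])
  (use tri_ret2[where ?d1.0 = d1 and ?d2.0 = d2 and c = "c0 + h + h", OF h1 hD(1) hB bB aB(2) xy(1,2) B1 B2 U Y old4, folded res(2)]
  in "auto simp: frame2_def nth_Cons'")
  from reach_step[OF this a4] TV s(6) s1(4) s2(4) s3(4) s4(4) obtain t5 s5 where s5: "t5 <= T3 + 1" "reach s4 t5 s5"
  "fr Fm s4 s5" "regs s5 HP <= regs s4 HP + T3 * V" "?Q4 s5" by auto
  have "reach s (t1 + t2 + t3 + t4 + t5) s5" using reach_trans[OF r4 s5(2)] .
  moreover have "fr Fm s s5" using fr_trans[OF f4 s5(3)] .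
  moreover have "N \<in> carrier_mat (2 * h) (2 * h)"
  using pinv_correct[OF assms _ s(7)] M(1) c True unfolding hh by simp
  then have "mat_at s5 (regs s5 RES) (2 * h) N" using s5(5) by (auto simp: asrt_def mat_at_mf)
  moreover have "rvf [(MODE, 1), (RUN, 1), (MH, 2 * h), (ST, regs s ST), (RD, rs d)] s5" "regs s5 CNT = c0 + c"
  using asrt_rvf[OF s5(5)] c True by (auto simp: rvf_def st_def res(3))
  moreover have "c = 2 * h" using c True by simp
  moreover have "t1 + t2 + t3 + t4 + t5 <= inv_time (Suc e)"
  using s1(1) s2(1) s3(1) s4(1) s5(1) TT by linarith
  moreover have "regs s5 HP <= regs s HP + inv_time (Suc e) * V"
  using s1(4) s2(4) s3(4) s4(4) s5(4) TV by linarith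
  ultimately show ?thesis unfolding hh by (intro exI[of _ "t1 + t2 + t3 + t4 + t5"] exI[of _ s5]) simp
 qed
 qed
qed

lemma call_inv:
 assumes pr: "prime (int p)" and s: "rvf [(PR, p), (RW, 2 ^ v), (MH, 2 ^ e)] s" "mat_at s (regs s MA) (2 ^ e) M" "2 ^ e <= Dmax"
 and pi: "pinv (int p) e M = (c, N, d)"
 shows "call Fm (inv_time e + 100) (inv_cmd P R) s (%s'. regs s' CNT = c &
  (c = 2 ^ e --> regs s' RD = rs d & mat_at s' (regs s' RES) (2 ^ e) N))"
proof (rule call_ok)
 assume ok: "ok s"
 let ?c = "[(PR, p), (RW, 2 ^ v), (MH, 2 ^ e)]"
 let ?m = "(MA, 2 ^ e * 2 ^ e, mf (2 ^ e) M)"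
 \<comment> \<open>Bottom frame with tag 2: returning to it means that the outermost call is
   done.\<close>
 define f0 :: "nat => nat" where "f0 i = [0, 0, 0, 2] ! i" for i
 let ?f = "(ST, 4, f0)"
 have M: "M \<in> carrier_mat (2 ^ e) (2 ^ e)" using s by (simp add: mat_at_mf)
 have a: "asrt Fm s ?c [?m] s" using ok s by (intro asrt_start) (auto simp: mat_at_mf)
 have 1: "tri Fm (5 * 4 + 15) (asrt Fm s ?c [?m]) (tab ST (Const 4) (sel 0 [Const 0, Const 0, Const 0, Const 2])) (asrt Fm s ?c [?f, ?m])"
 proof (rule tri_tab)
 fix i :: nat and s :: state assume i: "i < 4" "regs s TI = i"
 then have "i = 0 | i = 1 | i = 2 | i = 3" by auto
 then show "evn s (sel 0 [Const 0, Const 0, Const 0, Const 2]) = f0 i & f0 i <= B"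
  using i B20 evn_sel[of 0 s "[Const 0, Const 0, Const 0, Const 2]"] by (auto simp: f0_def)
 qed (use B20 in "auto simp: Fm_def avoid_def small_def")
 have 2: "tri Fm 1 (asrt Fm s ?c [?f, ?m]) (Assign CNT (Const 0)) (asrt Fm s ((CNT, 0) # ?c) [?f, ?m])"
 by (rule tri_Assign) (use B20 in "auto simp: Fm_def avoid_def small_def rvf_def")
 have 3: "tri Fm 1 (asrt Fm s ((CNT, 0) # ?c) [?f, ?m]) (Assign MODE (Const 0)) (asrt Fm s ((MODE, 0) # (CNT, 0) # ?c) [?f, ?m])"
 by (rule tri_Assign) (use B20 in "auto simp: Fm_def avoid_def small_def rvf_def")
 have 4: "tri Fm 1 (asrt Fm s ((MODE, 0) # (CNT, 0) # ?c) [?f, ?m]) (Assign RUN (Const 1))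
 (asrt Fm s ((RUN, 1) # (MODE, 0) # (CNT, 0) # ?c) [?f, ?m])"
 by (rule tri_Assign) (use B20 in "auto simp: Fm_def avoid_def small_def rvf_def")
 let ?Q = "%s'. regs s' CNT = c & (c = 2 ^ e --> regs s' RD = rs d & mat_at s' (regs s' RES) (2 ^ e) N)"
 have 5: "tri Fm (inv_time e + 6) (asrt Fm s ((RUN, 1) # (MODE, 0) # (CNT, 0) # ?c) [?f, ?m]) (While (Reg RUN) (inv_body P R)) ?Q"
 unfolding tri_def
 proof (intro allI impI callI)
 fix s1 assume a1: "asrt Fm s ((RUN, 1) # (MODE, 0) # (CNT, 0) # ?c) [?f, ?m] s1"
  and ok1: "ok s1" and bud: "regs s1 HP + (inv_time e + 6) * V <= B"
 have V6: "inv_time e * V + 6 * V = (inv_time e + 6) * V" by (simp add: algebra_simps)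
 have r1: "rvf [(PR, p), (RW, 2 ^ v), (MODE, 0), (RUN, 1), (CNT, 0), (MH, 2 ^ e)] s1"
  using asrt_rvf[OF a1] by (auto simp: rvf_def)
 have m1: "mat_at s1 (regs s1 MA) (2 ^ e) M" using a1 M by (auto simp: asrt_def mat_at_mf)
 have st1: "arr (mem s1) (regs s1 ST) 4 f0" "regs s1 ST + 4 <= regs s1 HP" using a1 by (auto simp: asrt_def)
 have eB: "0 + 2 ^ e <= B" using ok_regs[OF ok1, of MH] r1 by (simp add: rvf_def)
 obtain t2 s2 where s2: "t2 <= inv_time e" "reach s1 t2 s2" "fr Fm s1 s2" "regs s2 HP <= regs s1 HP + inv_time e * V"
  "regs s2 CNT = 0 + c" "if c = 2 ^ e then rvf [(MODE, 1), (RUN, 1), (MH, 2 ^ e), (ST, regs s1 ST), (RD, rs d)] s2 &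
  mat_at s2 (regs s2 RES) (2 ^ e) N else regs s2 RUN = 0"
  using inv_loop[OF pr ok1 r1 m1 s(3) eB _ pi] bud V6 by auto
 show "EX t s'. t <= inv_time e + 6 & exec w (While (Reg RUN) (inv_body P R)) s1 t s' & fr Fm s1 s' &
  regs s' HP <= regs s1 HP + (inv_time e + 6) * V & ?Q s'"
 proof (cases "c = 2 ^ e")
  case False
  then have "exec w (While (Reg RUN) (inv_body P R)) s2 1 s2" using s2(6) by (intro exec_While_stop) simp
  from reach_exec[OF s2(2) this] show ?thesis using s2 False V6
  by (intro exI[of _ "t2 + 1"] exI[of _ s2]) auto
 next
  case True
  have q2: "rvf [(MODE, 1), (RUN, 1), (MH, 2 ^ e), (ST, regs s1 ST), (RD, rs d)] s2" "mat_at s2 (regs s2 RES) (2 ^ e) N"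
  using s2(6) True by auto
  have N: "N \<in> carrier_mat (2 ^ e) (2 ^ e)" using q2 by (simp add: mat_at_mf)
  let ?rv = "[(MODE, 1), (RUN, 1), (RD, rs d), (CNT, c)]"
  let ?hs = "[(ST, 4, f0), (RES, 2 ^ e * 2 ^ e, mf (2 ^ e) N)]"
  have "arr (mem s2) (regs s1 ST) 4 f0" using fr_arr[OF s2(3) st1] .
  then have a2: "asrt Fm s2 ?rv ?hs s2"
  using fr_ok[OF s2(3)] q2 s2(5) st1(2) fr_HP[OF s2(3)] by (intro asrt_start) (auto simp: rvf_def mat_at_mf)
  let ?rv3 = "[(RUN, 0), (RD, rs d), (CNT, c)]"
  have "tri Fm 1 (asrt Fm s2 ?rv ?hs) (Assign RUN (Const 0)) (asrt Fm s2 ?rv3 ?hs)"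
  by (rule tri_Assign) (use B20 in "auto simp: Fm_def avoid_def small_def rvf_def")
  then have "tri Fm (1 + 1) (asrt Fm s2 ?rv ?hs) (Branch (Less (cell ST (Const 3)) (Const 2))
  (Branch (cell ST (Const 3)) (ret2_cmd P R) (ret1_cmd P R)) (Assign RUN (Const 0))) (asrt Fm s2 ?rv3 ?hs)"
  proof (intro tri_Branch[where x = 0])
  show "evn s (Less (cell ST (Const 3)) (Const 2)) = 0" if "asrt Fm s2 ?rv ?hs s" for s
  using hsfD[OF asrt_hsf[OF that], of ST 4 _ 3] by (simp add: f0_def)
  qed (use B20 in "auto simp: small_def")
  then have "tri Fm (1 + (1 + 1)) (asrt Fm s2 ?rv ?hs) (inv_body P R) (asrt Fm s2 ?rv3 ?hs)"
  unfolding inv_body_def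
  proof (intro tri_Branch[where x = 1])
  show "evn s (Reg MODE) = 1" if "asrt Fm s2 ?rv ?hs s" for s
  using asrt_rvf[OF that] by (simp add: rvf_def)
  qed (auto simp: small_def)
  note tri3 = this
  have "(1 + (1 + 1)) * V <= 6 * V" by (intro mult_le_mono1) simp
  then have bud3: "regs s2 HP + (1 + (1 + 1)) * V <= B" using bud s2(4) V6 by linarith
  obtain t3 s3 where s3: "t3 <= 1 + (1 + 1) + 1" "reach s2 t3 s3" "fr Fm s2 s3"
  "regs s3 HP <= regs s2 HP + (1 + (1 + 1)) * V" "asrt Fm s2 ?rv3 ?hs s3"
  by (rule reach_step[OF tri3 a2 _ bud3]) simp_all
  have "exec w (While (Reg RUN) (inv_body P R)) s3 1 s3"
  using asrt_rvf[OF s3(5)] by (intro exec_While_stop) (simp add: rvf_def)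
  from reach_exec[OF reach_trans[OF s2(2) s3(2)] this]
  have "exec w (While (Reg RUN) (inv_body P R)) s1 (t2 + t3 + 1) s3" .
  moreover have "?Q s3" using s3(5) N by (auto simp: asrt_def rvf_def mat_at_mf)
  ultimately show ?thesis using s2(1,4) s3 fr_trans[OF s2(3) s3(3)] V6
  by (intro exI[of _ "t2 + t3 + 1"] exI[of _ s3]) auto
 qed
 qed
 have "tri Fm (inv_time e + 100) (asrt Fm s ?c [?m]) (inv_cmd P R) ?Q"
 unfolding inv_cmd_def
 by (rule tri_conseq[OF tri_Seq[OF 1 tri_Seq[OF 2 tri_Seq[OF 3 tri_Seq[OF 4 5]]]]]) auto
 then show "call Fm (inv_time e + 100) (inv_cmd P R) s ?Q" using a by (simp add: tri_def)
qed

end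

section \<open>Disjoint paths and permutations\<close>

text \<open>Only paths with an inner vertex are counted here. The arc from \<open>s\<close> to
  \<open>t\<close> would belong to the zero block where border rows meet border columns; it is added
  to the count separately.\<close>

definition inner_path :: "('a \<times> 'a) set => 'a => 'a => 'a list => bool" where
 "inner_path E s t vs \<longleftrightarrow> vs ~= [] & distinct (s # vs @ [t]) & successively (%u v. (u, v) \<in> E) (s # vs @ [t])"

definition npaths :: "('a \<times> 'a) set => 'a => 'a => nat => bool" where
 "npaths E s t i \<longleftrightarrow> (\<exists>vs :: nat => 'a list. (ALL j<i. inner_path E s t (vs j)) &
  (ALL j<i. ALL j'<i. j ~= j' --> set (vs j) \<inter> set (vs j') = {}))"

lemma npaths_mono: "npaths E s t i ==> i' <= i ==> npaths E s t i'"
 unfolding npaths_def by (meson order_less_le_trans)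

section \<open>Paths as arc lists and as vertex lists\<close>

definition arc_list :: "'a => 'a list => 'a => ('a \<times> 'a) list" where
 "arc_list s vs t = zip (s # vs) (vs @ [t])"

lemma arc_list_simps [simp]: "arc_list s [] t = [(s, t)]" "arc_list s (v # vs) t = (s, v) # arc_list v vs t"
 by (auto simp: arc_list_def)

lemma pawalk_verts_arc_list: "pawalk_verts u (arc_list s vs t) = s # vs @ [t]"
 by (induction vs arbitrary: s u) auto

lemma map_fst_arc_list: "map fst (arc_list s vs t) = s # vs"
 by (induction vs arbitrary: s) auto

lemma inner_verts_arc_list: "pre_digraph.inner_verts (with_proj G) (arc_list s vs t) = vs"
 by (simp add: inner_verts_with_proj_def map_fst_arc_list)

lemma arc_list_inj: "arc_list s vs t = arc_list s vs' t ==> vs = vs'"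
 by (drule arg_cong[where f = "map fst"]) (simp only: map_fst_arc_list list.inject)

lemma pcas_last: "pcas u q t ==> t \<in> set (pawalk_verts u q)"
 by (induction q arbitrary: u) auto

context pair_fin_digraph
begin

lemma apath_arc_list:
 assumes "distinct (s # vs @ [t])" "successively (%u v. (u, v) \<in> parcs G) (s # vs @ [t])"
 shows "apath s (arc_list s vs t) t"
 using assms
proof (induction vs arbitrary: s)
 case Nil
 then show ?case using in_arcsD2 by (auto simp: apath_simps)
next
 case (Cons v vs)
 then have "apath v (arc_list v vs t) t" by auto
 then show ?case using Cons.prems by (auto simp: apath_simps pawalk_verts_arc_list)
qed

lemma apath_obtain_list:
 assumes "apath s q t" "s ~= t"
 obtains vs where "q = arc_list s vs t" "distinct (s # vs @ [t])" "successively (%u v. (u, v) \<in> parcs G) (s # vs @ [t])"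
proof -
 have "EX vs. q = arc_list s vs t & distinct (s # vs @ [t]) & successively (%u v. (u, v) \<in> parcs G) (s # vs @ [t])"
 using assms
 proof (induction q arbitrary: s)
 case Nil
 then show ?case by (simp add: apath_simps)
 next
 case (Cons e q)
 obtain u where e: "e = (s, u)" "(s, u) \<in> parcs G" "apath u q t" "s ~: set (pawalk_verts u q)"
  using Cons.prems by (cases e) (auto simp: apath_simps)
 show ?case
 proof (cases "u = t")
  case True
  have "q = []"
  proof (rule ccontr)
  assume "q ~= []"
  then obtain e' q' where q: "q = e' # q'" by (cases q) auto
  then have "fst e' = t" "t ~: set (pawalk_verts (snd e') q')" "apath (snd e') q' t"
  using e(3) True by (auto simp: apath_simps)
  moreover have "t \<in> set (pawalk_verts (snd e') q')" using \<open>apath (snd e') q' t\<close>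
  by (intro pcas_last) (simp add: apath_def awalk_def)
  ultimately show False by simp
  qed
  then show ?thesis using e True Cons.prems(2) by (intro exI[of _ "[]"]) auto
 next
  case False
  then obtain vs where vs: "q = arc_list u vs t" "distinct (u # vs @ [t])"
  "successively (%u v. (u, v) \<in> parcs G) (u # vs @ [t])" using Cons.IH[OF e(3)] by auto
  then show ?thesis using e Cons.prems(2)
  by (intro exI[of _ "u # vs"]) (auto simp: pawalk_verts_arc_list)
 qed
 qed
 then show thesis using that by blast
qed

lemma finite_card_disjoint_paths: "finite {card Q | Q. int_disjoint_paths G s t Q}"
proof -
 have "finite (card ` Pow {q. apath s q t})" using apaths_finite by blast
 then show ?thesis by (rule finite_subset[rotated]) (auto simp: int_disjoint_paths_def)
qed

lemma vertex_cut_value_ge: "int_disjoint_paths G s t Q ==> card Q <= vertex_cut_value G s t"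
 unfolding vertex_cut_value_def using finite_card_disjoint_paths by (intro Max_ge) auto

lemma vertex_cut_value_attained: "EX Q. int_disjoint_paths G s t Q & vertex_cut_value G s t = card Q"
proof -
 have "int_disjoint_paths G s t {}" by (simp add: int_disjoint_paths_def)
 then have "{card Q | Q. int_disjoint_paths G s t Q} ~= {}" by blast
 from Max_in[OF finite_card_disjoint_paths this] show ?thesis unfolding vertex_cut_value_def by auto
qed

text \<open>The arc has no inner vertices, hence is disjoint from every other path and can always be
  added to a family.\<close>

lemma npaths_le_vertex_cut_value:
 assumes "npaths (parcs G) s t i" "s ~= t"
 shows "i + of_bool ((s, t) \<in> parcs G) <= vertex_cut_value G s t"
proof -
 obtain vs where vs: "ALL j<i. inner_path (parcs G) s t (vs j)"
 "ALL j<i. ALL j'<i. j ~= j' --> set (vs j) \<inter> set (vs j') = {}"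
 using assms(1) unfolding npaths_def by blast
 define Q where "Q = (%j. arc_list s (vs j) t) ` {..<i}"
 define D where "D = (if (s, t) \<in> parcs G then {arc_list s [] t} else {})"
 have "inj_on (%j. arc_list s (vs j) t) {..<i}"
 proof (rule inj_onI)
 fix j j' assume j: "j \<in> {..<i}" "j' \<in> {..<i}" "arc_list s (vs j) t = arc_list s (vs j') t"
 have eq: "vs j = vs j'" by (rule arc_list_inj[OF j(3)])
 have "vs j ~= []" using vs(1) j by (auto simp: inner_path_def)
 then have "set (vs j) \<inter> set (vs j') ~= {}" using eq by simp
 then show "j = j'" using vs(2) j(1,2) by blast
 qed
 then have "card Q = i" by (simp add: Q_def card_image)
 moreover have "Q \<inter> D = {}"
 proof -
 have "arc_list s [] t ~= arc_list s (vs j) t" if "j < i" for j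
  using arc_list_inj[of s "[]" t "vs j"] vs(1) that by (auto simp: inner_path_def)
 then show ?thesis unfolding Q_def D_def by (cases "(s, t) \<in> parcs G") (auto simp del: arc_list_simps)
 qed
 ultimately have card: "card (Q \<union> D) = i + of_bool ((s, t) \<in> parcs G)"
 by (subst card_Un_disjoint) (auto simp: Q_def D_def)
 have "int_disjoint_paths G s t (Q \<union> D)" unfolding int_disjoint_paths_def
 proof (intro conjI ballI)
 fix q assume "q \<in> Q \<union> D"
 then show "apath s q t"
 proof
  assume "q \<in> Q"
  then obtain j where "j < i" "q = arc_list s (vs j) t" by (auto simp: Q_def)
  then show ?thesis using vs(1) apath_arc_list[of s "vs j" t] by (simp add: inner_path_def)
 next
  assume "q \<in> D"
  then have "q = arc_list s [] t" "(s, t) \<in> parcs G" unfolding D_def by (metis empty_iff singletonD)+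
  then show ?thesis using apath_arc_list[of s "[]" t] assms(2) by simp
 qed
 next
 show "pairwise (%p q. disjnt (set (inner_verts p)) (set (inner_verts q))) (Q \<union> D)"
  unfolding pairwise_def
 proof (intro ballI impI)
  fix q q' assume q: "q \<in> Q \<union> D" "q' \<in> Q \<union> D" "q ~= q'"
  have "EX us. q'' = arc_list s us t & (us = [] | (EX j<i. us = vs j))" if "q'' \<in> Q \<union> D" for q''
  using that
  proof
  assume "q'' \<in> Q"
  then show ?thesis unfolding Q_def by blast
  next
  assume "q'' \<in> D"
  then have "q'' = arc_list s [] t" unfolding D_def by (metis empty_iff singletonD)
  then show ?thesis by blast
  qed
  then obtain us us' where us: "q = arc_list s us t" "us = [] | (EX j<i. us = vs j)"
  "q' = arc_list s us' t" "us' = [] | (EX j<i. us' = vs j)" using q by meson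
  then have "us ~= us'" using q(3) by blast
  then have "set us \<inter> set us' = {}" using us(2,4) vs(2) by (metis empty_set inf_bot_left inf_bot_right)
  then show "disjnt (set (inner_verts q)) (set (inner_verts q'))"
  using us(1,3) by (simp only: inner_verts_arc_list disjnt_def)
 qed
 qed
 from vertex_cut_value_ge[OF this] card show ?thesis by simp
qed

text \<open>A maximum family contains the arc if there is one, since otherwise the arc could be
  added. Removing it leaves paths that all have inner vertices.\<close>

lemma vertex_cut_value_npaths:
 assumes "s ~= t"
 shows "EX i. npaths (parcs G) s t i & vertex_cut_value G s t = i + of_bool ((s, t) \<in> parcs G)"
proof -
 obtain Q where Q: "int_disjoint_paths G s t Q" "vertex_cut_value G s t = card Q"
 using vertex_cut_value_attained by blast
 let ?d = "arc_list s [] t"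
 have fin: "finite Q" by (rule finite_subset[OF _ apaths_finite[of s t]]) (use Q(1) in "auto simp: int_disjoint_paths_def")
 have ap: "apath s q t" if "q \<in> Q" for q using Q(1) that by (auto simp: int_disjoint_paths_def)
 have d: "?d \<in> Q \<longleftrightarrow> (s, t) \<in> parcs G"
 proof
 assume "?d \<in> Q"
 then show "(s, t) \<in> parcs G" by (auto simp: apath_simps dest!: ap)
 next
 assume st: "(s, t) \<in> parcs G"
 show "?d \<in> Q"
 proof (rule ccontr)
  assume "?d ~: Q"
  have "int_disjoint_paths G s t (insert ?d Q)"
  using Q(1) apath_arc_list[of s "[]" t] st assms
  by (auto simp: int_disjoint_paths_def pairwise_insert inner_verts_with_proj_def)
  from vertex_cut_value_ge[OF this] show False using Q(2) \<open>?d ~: Q\<close> fin by simp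
 qed
 qed
 define Q' where "Q' = Q - {?d}"
 obtain f where f: "bij_betw f {..<card Q'} Q'"
 using ex_bij_betw_nat_finite[of Q'] fin by (auto simp: Q'_def atLeast0LessThan)
 define vs where "vs j = inner_verts (f j)" for j
 have fj: "f j = arc_list s (vs j) t & inner_path (parcs G) s t (vs j)" if "j < card Q'" for j
 proof -
 have j: "f j \<in> Q'" using f that by (auto simp: bij_betw_def)
 then obtain us where us: "f j = arc_list s us t" "distinct (s # us @ [t])"
  "successively (%u v. (u, v) \<in> parcs G) (s # us @ [t])"
  using apath_obtain_list[OF ap assms] by (auto simp: Q'_def)
 then have "vs j = us" using inner_verts_arc_list by (simp add: vs_def)
 moreover have "us ~= []" using us(1) j by (auto simp: Q'_def)
 ultimately show ?thesis using us by (simp add: inner_path_def)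
 qed
 have "set (vs j) \<inter> set (vs j') = {}" if "j < card Q'" "j' < card Q'" "j ~= j'" for j j'
 proof -
 have "f j \<in> Q" "f j' \<in> Q" "f j ~= f j'"
  using f that by (auto simp: bij_betw_def Q'_def inj_on_def)
 then show ?thesis using Q(1) unfolding int_disjoint_paths_def pairwise_def disjnt_def vs_def by blast
 qed
 then have "npaths (parcs G) s t (card Q')" unfolding npaths_def using fj by blast
 moreover have "card Q = card Q' + of_bool ((s, t) \<in> parcs G)"
 proof (cases "(s, t) \<in> parcs G")
 case True
 then have "?d \<in> Q" using d by blast
 from card.remove[OF fin this] True show ?thesis by (simp add: Q'_def)
 next
 case False
 then have "Q' = Q" using d unfolding Q'_def by blast
 then show ?thesis using False by simp
 qed
 ultimately show ?thesis using Q(2) by auto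
qed

end

text \<open>The nonzero pattern of the matrix with blocks \<open>A\<close>, \<open>Q\<close>, \<open>P\<close> and \<open>0\<close>, where \<open>A\<close> is the adjacency
 matrix with a full diagonal. Border row and column 0 belong to \<open>s\<close> alone and border row and column 1 to
 \<open>t\<close> alone, which keeps the paths away from \<open>s\<close> and \<open>t\<close>; the other border rows hit the successors of \<open>s\<close>
 and the other border columns the predecessors of \<open>t\<close>.\<close>

definition pattern :: "(nat \<times> nat) set => nat => nat => nat => nat => nat => bool" where
 "pattern E s t D x y \<longleftrightarrow>
  (if x < D then
  if y < D then x = y | (x, y) \<in> E else if y = D then x = s else if y = D + 1 then x = t else (x, t) \<in> E
  else y < D & (if x = D then y = s else if x = D + 1 then y = t else (s, y) \<in> E))"

text \<open>Follow the permutation from each further border row \<open>D + 2 + j\<close> until it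
  leaves \<open>{..<D}\<close> again. The first vertex is a successor of \<open>s\<close>,
  consecutive vertices are joined by arcs, and the exit through a border column happens at a
  predecessor of \<open>t\<close>. The values \<open>s\<close> and \<open>t\<close> are already
  taken by the rows \<open>D\<close> and \<open>D + 1\<close>, so no path meets them.\<close>

lemma permutation_npaths:
 assumes E: "E \<subseteq> {..<D} \<times> {..<D}" and st: "s < D" "t < D" "s ~= t"
 and pi: "pm permutes {0..<D + (2 + i)}" and pat: "ALL x<D + (2 + i). pattern E s t D x (pm x)"
 shows "npaths E s t i"
proof -
 let ?n = "D + (2 + i)"
 have inj: "pm x = pm y ==> x = y" for x y using permutes_inj[OF pi] by (auto dest: injD)
 have injn: "(pm ^^ l) x = (pm ^^ l) y ==> x = y" for l x y
 using inj_fn[OF permutes_inj[OF pi]] by (auto dest: injD)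
 have pD: "pm D = s" "pm (D + 1) = t" using pat[rule_format, of D] pat[rule_format, of "D + 1"]
 by (auto simp: pattern_def)
 \<comment> \<open>Column \<open>D\<close> has its only nonzero entry in row \<open>s\<close>, so
   surjectivity forces this value. With the same argument for \<open>t\<close>, no path can leave
   through these two columns.\<close>
 have ps: "pm s = D"
 proof -
 have "D \<in> pm ` {0..<?n}" unfolding permutes_image[OF pi] by simp
 then obtain z where z: "pm z = D" "z < ?n" by auto
 then have "z = s" using pat[rule_format, of z] by (auto simp: pattern_def split: if_splits)
 then show ?thesis using z by simp
 qed
 have pt: "pm t = D + 1"
 proof -
 have "D + 1 \<in> pm ` {0..<?n}" unfolding permutes_image[OF pi] by simp
 then obtain z where z: "pm z = D + 1" "z < ?n" by auto
 then have "z = t" using pat[rule_format, of z] by (auto simp: pattern_def split: if_splits)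
 then show ?thesis using z by simp
 qed
 \<comment> \<open>Some power is the identity, so each walk does come back to an index that is at
   least \<open>D\<close>.\<close>
 have "EX m. pm ^^ m = id & m > 0" using permutation_is_nilpotent permutation_permutes pi finite_atLeastLessThan by metis
 then obtain m where m: "pm ^^ m = id" "m > 0" by blast
 define x where "x j = D + 2 + j" for j
 define r where "r j = (LEAST l. 1 <= l & D <= (pm ^^ l) (x j))" for j
 have r: "1 <= r j" "D <= (pm ^^ r j) (x j)" "!!l. 1 <= l ==> l < r j ==> (pm ^^ l) (x j) < D" for j
 proof -
 have "1 <= m & D <= (pm ^^ m) (x j)" using m by (simp add: x_def)
 from LeastI[of "%l. 1 <= l & D <= (pm ^^ l) (x j)", OF this]
 show "1 <= r j" "D <= (pm ^^ r j) (x j)" by (auto simp: r_def)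
 show "(pm ^^ l) (x j) < D" if "1 <= l" "l < r j" for l
  using not_less_Least[of l "%l. 1 <= l & D <= (pm ^^ l) (x j)"] that by (auto simp: r_def not_le)
 qed
 have xn: "x j < ?n" "D <= x j" if "j < i" for j using that by (auto simp: x_def)
 have in_n: "(pm ^^ l) (x j) < ?n" if "j < i" for l j
 using permutes_in_funpow_image[OF pi, of "x j" l] xn[OF that] by auto
 have patl: "pattern E s t D ((pm ^^ l) (x j)) ((pm ^^ Suc l) (x j))" if "j < i" for l j
 using pat[rule_format, OF in_n[OF that, of l]] by simp
 \<comment> \<open>By injectivity, two equal vertices can be pulled back in parallel until one of
   them is a start \<open>x j\<close>. This is at least \<open>D\<close>, whereas all vertices on
   the way are below \<open>D\<close>.\<close>
 have uniq: "a = b & j = j'" if "(pm ^^ a) (x j) = (pm ^^ b) (x j')" "a < r j" "b < r j'" "a \<ge> 1" "b \<ge> 1" "j < i" "j' < i" for a b j j'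
 proof -
 have *: "a = b & j = j'" if "a <= b" "(pm ^^ a) (x j) = (pm ^^ b) (x j')" "b < r j'" "j < i" "j' < i" for a b j j'
 proof -
  have "(pm ^^ b) (x j') = (pm ^^ a) ((pm ^^ (b - a)) (x j'))"
  using that(1) by (metis comp_apply funpow_add le_add_diff_inverse)
  then have eq: "x j = (pm ^^ (b - a)) (x j')" using that(2) injn by metis
  show ?thesis
  proof (cases "b = a")
  case True
  then show ?thesis using eq by (simp add: x_def)
  next
  case False
  then have "(pm ^^ (b - a)) (x j') < D" using that r(3)[of "b - a" j'] by auto
  then show ?thesis using eq xn[OF that(4)] by simp
  qed
 qed
 show ?thesis using *[of a b j j'] *[of b a j' j] that by (cases "a <= b") auto
 qed
 define vs where "vs j = map (%l. (pm ^^ l) (x j)) [1..<r j]" for j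
 have r2: "2 <= r j" if "j < i" for j
 proof (rule ccontr)
 assume "~ 2 <= r j"
 then have "r j = 1" using r(1)[of j] by simp
 then have "D <= pm (x j)" using r(2)[of j] by simp
 then show False using patl[OF that, of 0] xn[OF that] by (auto simp: pattern_def)
 qed
 have x0: "x j ~= D" "x j ~= D + 1" for j by (auto simp: x_def)
 have nst: "(pm ^^ l) (x j) ~= s" "(pm ^^ l) (x j) ~= t" if jl: "j < i" "1 <= l" "l < r j" for l j
 proof -
 obtain l' where "l = Suc l'" using jl(2) by (cases l) auto
 then have *: "(pm ^^ l) (x j) = pm ((pm ^^ (l - 1)) (x j))" by simp
 have "(pm ^^ (l - 1)) (x j) ~= D & (pm ^^ (l - 1)) (x j) ~= D + 1"
 proof (cases "l = 1")
  case False
  then have "1 <= l - 1" "l - 1 < r j" using jl by linarith+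
  then show ?thesis using r(3)[of "l - 1" j] by auto
 qed (use x0[of j] in auto)
 then show "(pm ^^ l) (x j) ~= s" "(pm ^^ l) (x j) ~= t"
  using inj[of "(pm ^^ (l - 1)) (x j)" D] inj[of "(pm ^^ (l - 1)) (x j)" "D + 1"] unfolding * pD by auto
 qed
 have path: "inner_path E s t (vs j)" if j: "j < i" for j
 proof -
 have len: "length (vs j) = r j - 1" by (simp add: vs_def)
 have nth: "vs j ! l = (pm ^^ Suc l) (x j)" if "l < r j - 1" for l
  using that by (simp add: vs_def nth_map)
 have ne: "vs j ~= []" using r2[OF j] len by auto
 have dist: "distinct (vs j)" unfolding vs_def distinct_map
  using uniq[OF _ _ _ _ _ j j] by (auto simp: inj_on_def)
 have set: "set (vs j) = {(pm ^^ l) (x j) | l. 1 <= l & l < r j}" by (auto simp: vs_def)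
 have "s ~: set (vs j)" "t ~: set (vs j)" using nst[OF j] unfolding set by blast+
 moreover have "successively (%u v. (u, v) \<in> E) (vs j)"
  unfolding successively_conv_nth
 proof (intro allI impI)
  fix l assume l: "Suc l < length (vs j)"
  let ?u = "(pm ^^ Suc l) (x j)" and ?v = "(pm ^^ Suc (Suc l)) (x j)"
  have lr: "Suc (Suc l) < r j" "Suc l < r j" using l len by linarith+
  then have "?u < D" "?v < D" using r(3)[of "Suc l" j] r(3)[of "Suc (Suc l)" j] by auto
  \<comment> \<open>This excludes the diagonal of the pattern and leaves an arc.\<close>
  moreover have "?u ~= ?v" using uniq[of "Suc l" j "Suc (Suc l)" j] lr j by fastforce
  ultimately have "(?u, ?v) \<in> E" using patl[OF j, of "Suc l"] by (auto simp: pattern_def)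
  then show "(vs j ! l, vs j ! Suc l) \<in> E" using nth[of l] nth[of "Suc l"] l len by simp
 qed
 moreover have "(s, hd (vs j)) \<in> E"
 proof -
  have "hd (vs j) = pm (x j)" using ne nth[of 0] len r2[OF j] by (simp add: hd_conv_nth)
  moreover have "pm (x j) < D" using r(3)[of 1 j] r2[OF j] by simp
  ultimately show ?thesis using patl[OF j, of 0] xn[OF j] x0[of j] by (auto simp: pattern_def)
 qed
 moreover have "(last (vs j), t) \<in> E"
 proof -
  let ?u = "(pm ^^ (r j - 1)) (x j)"
  have "last (vs j) = ?u" using ne nth[of "r j - 2"] len r2[OF j] by (simp add: last_conv_nth numeral_2_eq_2 Suc_diff_Suc)
  moreover have u: "?u < D" "?u ~= s" "?u ~= t" using r(3)[of "r j - 1" j] nst[OF j, of "r j - 1"] r2[OF j] by auto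
  moreover have "pattern E s t D ?u ((pm ^^ r j) (x j))" using patl[OF j, of "r j - 1"] r(1)[of j] by simp
  ultimately show ?thesis using r(2)[of j] by (auto simp: pattern_def split: if_splits)
 qed
 ultimately show ?thesis using ne dist st by (auto simp: inner_path_def successively_append_iff successively_Cons)
 qed
 have "set (vs j) \<inter> set (vs j') = {}" if "j < i" "j' < i" "j ~= j'" for j j'
 using uniq[of _ j _ j'] that by (auto simp: vs_def)
 then show ?thesis unfolding npaths_def using path by blast
qed

text \<open>Vertices outside the paths stay fixed, which the full diagonal permits. Each path is
  inserted as one cycle through its new border index. For this the permutation built so far has to
  fix the vertices of the new path, and the last conjunct carries that through the
  induction.\<close>

lemma npaths_permutation_aux:
 assumes E: "E \<subseteq> {..<D} \<times> {..<D}" and st: "s < D" "t < D" "s ~= t"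
 and vs: "ALL j<i. inner_path E s t (vs j)" "ALL j<i. ALL j'<i. j ~= j' --> set (vs j) \<inter> set (vs j') = {}"
 shows "\<exists>pm. pm permutes {0..<D + (2 + i)} & (ALL x<D + (2 + i). pattern E s t D x (pm x)) &
 (ALL x<D. x ~= s & x ~= t & x ~: (\<Union>j<i. set (vs j)) --> pm x = x)"
 using vs
proof (induction i)
 case 0
 \<comment> \<open>Without further paths, border index 0 is exchanged with \<open>s\<close> and
   border index 1 with \<open>t\<close>.\<close>
 define pm where "pm = Transposition.transpose D s \<circ> Transposition.transpose (D + 1) t"
 have "pm permutes {0..<D + 2}" unfolding pm_def
 using st by (intro permutes_compose permutes_swap_id) auto
 moreover have "pattern E s t D x (pm x)" if "x < D + 2" for x
 using that st by (auto simp: pattern_def pm_def Transposition.transpose_def)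
 moreover have "ALL x<D. x ~= s & x ~= t --> pm x = x"
 using st by (auto simp: pm_def Transposition.transpose_def)
 ultimately show ?case by (intro exI[of _ pm]) auto
next
 case (Suc i)
 obtain pm where pm: "pm permutes {0..<D + (2 + i)}" "ALL x<D + (2 + i). pattern E s t D x (pm x)"
 "ALL x<D. x ~= s & x ~= t & x ~: (\<Union>j<i. set (vs j)) --> pm x = x"
 using Suc by force
 let ?x = "D + (2 + i)"
 define us where "us = vs i"
 have us: "us ~= []" "distinct (s # us @ [t])" "successively (%u v. (u, v) \<in> E) (s # us @ [t])"
 using Suc.prems(1) by (auto simp: us_def inner_path_def)
 have sub: "u < D" if u: "u \<in> set us" for u
 proof -
 obtain l where l: "l < length us" "us ! l = u" using u by (auto simp: in_set_conv_nth)
 then have "((s # us @ [t]) ! l, (s # us @ [t]) ! Suc l) \<in> E"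
  using us(3) unfolding successively_conv_nth by auto
 then show ?thesis using E l by (auto simp: nth_append)
 qed
 \<comment> \<open>The cycle leads from the border index into the first vertex, along the path, and
   from the last vertex back to the border index.\<close>
 define c where "c = cycle_of_list (?x # us)"
 have dist: "distinct (?x # us)" using us(2) sub by force
 have cmap: "map c (?x # us) = us @ [?x]"
 using cyclic_rotation[OF dist, of 1] by (simp add: c_def)
 have cnth: "c ((?x # us) ! l) = (us @ [?x]) ! l" if "l < length (?x # us)" for l
 using cmap that by (metis nth_map)
 have cperm: "c permutes set (?x # us)" unfolding c_def by (rule cycle_permutes)
 have fix_us: "pm y = y" if "y \<in> set (?x # us)" for y
 proof (cases "y = ?x")
 case True
 then show ?thesis using pm(1) by (simp add: permutes_not_in)
 next
 case False
 then have y: "y \<in> set us" using that by simp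
 have "y ~: set (vs j)" if "j < i" for j
  using Suc.prems(2)[rule_format, of i j] that y unfolding us_def by auto
 then have "y ~: (\<Union>j<i. set (vs j))" by auto
 then show ?thesis using pm(3) sub[OF y] us(2) y by auto
 qed
 define pm' where "pm' = pm \<circ> c"
 have in_c: "pm' y = c y" if "y \<in> set (?x # us)" for y
 using fix_us[of "c y"] permutes_in_image[OF cperm, of y] that by (simp add: pm'_def)
 have out_c: "pm' y = pm y" if "y ~: set (?x # us)" for y
 using permutes_not_in[OF cperm that] by (simp add: pm'_def)
 have "pm' permutes {0..<D + (2 + Suc i)}" unfolding pm'_def
 proof (rule permutes_compose)
 show "c permutes {0..<D + (2 + Suc i)}" by (rule permutes_subset[OF cperm]) (use sub in force)
 show "pm permutes {0..<D + (2 + Suc i)}" by (rule permutes_subset[OF pm(1)]) auto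
 qed
 moreover have "pattern E s t D y (pm' y)" if y: "y < D + (2 + Suc i)" for y
 proof (cases "y \<in> set (?x # us)")
 case False
 then have "y < D + (2 + i)" using y by auto
 then show ?thesis using pm(2) out_c[OF False] by simp
 next
 case True
 then obtain l where l: "l < length (?x # us)" "(?x # us) ! l = y" by (metis in_set_conv_nth)
 have py: "pm' y = (us @ [?x]) ! l" using in_c[OF True] cnth[OF l(1)] l(2) by simp
 have e: "((s # us @ [t]) ! l, (s # us @ [t]) ! Suc l) \<in> E"
  using us(3) l unfolding successively_conv_nth by auto
 have us0: "0 < length us" using us(1) by simp
 consider "l = 0" | "0 < l" "l < length us" | "l = length us" using l by fastforce
 then show ?thesis
 proof cases
  case 1
  then have "y = ?x" "pm' y = us ! 0" "(s, us ! 0) \<in> E" using l py e us0 by (auto simp: nth_append)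
  then show ?thesis using sub[of "us ! 0"] us0 by (simp add: pattern_def)
 next
  case 2
  then have "l - 1 < length us" by linarith
  with 2 have "y = us ! (l - 1)" "pm' y = us ! l" "(us ! (l - 1), us ! l) \<in> E" using l py e by (auto simp: nth_append nth_Cons')
  then show ?thesis using sub[of y] sub[of "us ! l"] 2 by (simp add: pattern_def)
 next
  case 3
  then have "y = us ! (l - 1)" "pm' y = ?x" "(us ! (l - 1), t) \<in> E" using l py e us0 by (auto simp: nth_append nth_Cons')
  then show ?thesis using sub[of y] 3 us0 by (simp add: pattern_def)
 qed
 qed
 moreover have "pm' y = y" if "y < D" "y ~= s" "y ~= t" "y ~: (\<Union>j<Suc i. set (vs j))" for y
 proof -
 have "y ~: set (?x # us)" using that by (auto simp: us_def)
 then show ?thesis using out_c pm(3) that by auto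
 qed
 ultimately show ?case by blast
qed

text \<open>Orders 0 and 1 are included because a count of leading minors has to get past every
  smaller order first.\<close>

lemma npaths_permutation:
 assumes E: "E \<subseteq> {..<D} \<times> {..<D}" and st: "s < D" "t < D" "s ~= t"
 and np: "npaths E s t i" and m: "m <= 2 + i"
 shows "\<exists>pm. pm permutes {0..<D + m} & (ALL x<D + m. pattern E s t D x (pm x))"
proof -
 consider "m = 0" | "m = 1" | j where "m = 2 + j" "j <= i" using m
 by (metis One_nat_def add_le_cancel_left le_add_diff_inverse less_2_cases not_less)
 then show ?thesis
 proof cases
 case 1
 then show ?thesis by (intro exI[of _ id]) (auto simp: permutes_id pattern_def)
 next
 case 2
 then show ?thesis using st
  by (intro exI[of _ "Transposition.transpose D s"]) (auto simp: pattern_def Transposition.transpose_def intro!: permutes_swap_id)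
 next
 case 3
 obtain vs where "ALL j'<j. inner_path E s t (vs j')" "ALL k<j. ALL k'<j. k ~= k' --> set (vs k) \<inter> set (vs k') = {}"
  using npaths_mono[OF np 3(2)] unfolding npaths_def by blast
 from npaths_permutation_aux[OF E st this] show ?thesis using 3(1) by blast
 qed
qed

section \<open>Random matrices\<close>

lemma prob_bind_le:
 assumes "!!x. x \<in> set_pmf M ==> x ~: X ==> measure_pmf.prob (N x) A <= b" "0 <= b"
 shows "measure_pmf.prob (bind_pmf M N) A <= measure_pmf.prob M X + b"
proof -
 have "emeasure (measure_pmf (bind_pmf M N)) A = (\<integral>\<^sup>+x. emeasure (measure_pmf (N x)) A \<partial>measure_pmf M)"
 by (rule emeasure_bind_pmf)
 also have "... <= (\<integral>\<^sup>+x. indicator X x + ennreal b \<partial>measure_pmf M)"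
 proof (rule nn_integral_mono_AE, rule AE_pmfI)
 fix x assume x: "x \<in> set_pmf M"
 show "emeasure (measure_pmf (N x)) A <= indicator X x + ennreal b"
 proof (cases "x \<in> X")
  case True
  then show ?thesis using measure_pmf.emeasure_le_1[of "N x" A] by (simp add: add_increasing2)
 next
  case False
  then show ?thesis using assms(1)[OF x] by (simp add: measure_pmf.emeasure_eq_measure ennreal_leI)
 qed
 qed
 also have "... = emeasure (measure_pmf M) X + ennreal b"
 by (simp add: nn_integral_add)
 also have "... = ennreal (measure_pmf.prob M X + b)"
 using assms(2) by (simp add: measure_pmf.emeasure_eq_measure ennreal_plus)
 finally have "ennreal (measure_pmf.prob (bind_pmf M N) A) <= ennreal (measure_pmf.prob M X + b)"
 by (simp only: measure_pmf.emeasure_eq_measure)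
 then show ?thesis
 using assms(2) by (subst (asm) ennreal_le_iff) simp_all
qed

definition rnd_cells :: "'c set => nat => ('c => nat) pmf" where
 "rnd_cells C N = Pi_pmf C 0 (%_. pmf_of_set {..<N})"

lemma prob_uniform:
 assumes "0 < N"
 shows "measure_pmf.prob (pmf_of_set {..<N :: nat}) X = card {x. x < N & x \<in> X} / N"
proof -
 have "{..<N} \<inter> X = {x. x < N & x \<in> X}" by auto
 moreover have "{..<N} ~= {}" using assms by auto
 ultimately show ?thesis using measure_pmf_of_set[of "{..<N}" X] by simp
qed

text \<open>The cells are independent, so cell \<open>c\<close> may be drawn last; the bound then
  holds conditionally on all the others.\<close>

lemma single_cell:
 assumes C: "finite C" "c \<in> C" and N: "0 < N" and b: "0 <= b"
 and bad: "!!f. real (card {x. x < N & Bad (f(c := x))}) <= b * N"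
 shows "measure_pmf.prob (rnd_cells C N) {f. Bad f} <= b"
proof -
 let ?U = "pmf_of_set {..<N}"
 have eq: "rnd_cells C N = bind_pmf (rnd_cells (C - {c}) N) (%f. map_pmf (%x. f(c := x)) ?U)"
 proof -
 have "rnd_cells C N = Pi_pmf (insert c (C - {c})) 0 (%_. ?U)"
  using C by (simp add: rnd_cells_def insert_absorb)
 also have "... = bind_pmf ?U (%y. bind_pmf (rnd_cells (C - {c}) N) (%f. return_pmf (f(c := y))))"
  unfolding rnd_cells_def by (rule Pi_pmf_insert') (use C in auto)
 also have "... = bind_pmf (rnd_cells (C - {c}) N) (%f. bind_pmf ?U (%y. return_pmf (f(c := y))))"
  by (rule bind_commute_pmf)
 finally show ?thesis by (simp add: map_pmf_def)
 qed
 have "measure_pmf.prob (map_pmf (%x. f(c := x)) ?U) {f. Bad f} <= b" for f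
 proof -
 have "measure_pmf.prob (map_pmf (%x. f(c := x)) ?U) {f. Bad f} = measure_pmf.prob ?U {x. Bad (f(c := x))}"
  by (simp add: vimage_def)
 also have "... = card {x. x < N & Bad (f(c := x))} / N" using prob_uniform[OF N] by simp
 also have "... <= b" using bad[of f] N by (simp add: divide_le_eq)
 finally show ?thesis .
 qed
 then have "measure_pmf.prob (rnd_cells C N) {f. Bad f} <= measure_pmf.prob (rnd_cells (C - {c}) N) {} + b"
 unfolding eq by (intro prob_bind_le b) auto
 then show ?thesis by simp
qed

text \<open>The solutions lie in one residue class modulo \<open>p\<close>. As \<open>N\<close> is
  in general no multiple of \<open>p\<close>, the class may have \<open>N div p + 1\<close> members
  below \<open>N\<close>, and \<open>p <= N\<close> turns the excess into the factor 2.\<close>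

lemma residue_count:
 fixes a b :: int and p N :: nat
 assumes "prime p" "p <= N" "~ int p dvd a"
 shows "real (card {x. x < N & int p dvd int x * a + b}) <= 2 / p * N"
proof -
 let ?S = "{x. x < N & int p dvd int x * a + b}"
 have p: "0 < p" "prime (int p)" using assms(1) by (auto simp: prime_gt_0_nat)
 have eq: "x mod p = y mod p" if "x \<in> ?S" "y \<in> ?S" for x y
 proof -
 have "int p dvd (int x * a + b) - (int y * a + b)" using that by (intro dvd_diff) auto
 then have "int p dvd (int x - int y) * a" by (simp add: algebra_simps)
 then have "int p dvd int x - int y" using p(2) assms(3) prime_dvd_mult_iff by blast
 then have "int x mod int p = int y mod int p" by (simp add: mod_eq_dvd_iff)
 then show ?thesis by (metis of_nat_eq_iff zmod_int)
 qed
 have "inj_on (%x. x div p) ?S"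
 proof (rule inj_onI)
 fix x y assume "x \<in> ?S" "y \<in> ?S" "x div p = y div p"
 then show "x = y" using eq[of x y] by (metis div_mult_mod_eq)
 qed
 moreover have "(%x. x div p) ` ?S \<subseteq> {..N div p}" by (auto intro: div_le_mono)
 ultimately have "card ?S <= N div p + 1" using card_inj_on_le[of _ ?S "{..N div p}"] by simp
 then have "card ?S * p <= (N div p + 1) * p" by (rule mult_le_mono1)
 also have "... <= 2 * N"
 proof -
 have "(N div p + 1) * p = N div p * p + p" by (simp only: add_mult_distrib mult_1)
 then show ?thesis using div_times_less_eq_dividend[of N p] assms(2) by linarith
 qed
 finally have "real (card ?S * p) <= real (2 * N)" by (rule of_nat_mono)
 then show ?thesis using p(1) by (simp add: field_simps)
qed

section \<open>Minors of matrices with independent entries\<close>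

definition random_mat :: "(nat => nat => bool) => (nat => nat => 'c) => nat => ('c => nat) => int mat" where
 "random_mat E pos m f = mat m m (%(x, y). if E x y then int (f (pos x y)) else 0)"

lemma lead_random_mat: "i <= m ==> lead (random_mat E pos m f) i = random_mat E pos i f"
 by (auto simp: lead_def random_mat_def)

text \<open>Laplace expansion along the last row. Because no other entry uses the cell of the
  corner, neither the cofactors of this row nor the remaining entries of the row depend on
  it.\<close>

lemma det_random_mat_step:
 assumes inj: "!!x y x' y'. x <= i ==> y <= i ==> x' <= i ==> y' <= i ==> E x y ==> E x' y' ==>
  pos x y = pos x' y' ==> x = x' & y = y'"
 and E: "E i i"
 shows "det (random_mat E pos (Suc i) (f(pos i i := z))) =
 int z * det (random_mat E pos i f) + det (random_mat E pos (Suc i) (f(pos i i := 0)))"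
 and "det (random_mat E pos i (f(pos i i := z))) = det (random_mat E pos i f)"
proof -
 define A where "A z = random_mat E pos (Suc i) (f(pos i i := z))" for z
 have A: "A z \<in> carrier_mat (Suc i) (Suc i)" for z by (simp add: A_def random_mat_def)
 have dA: "dim_row (A z) = Suc i" "dim_col (A z) = Suc i" for z using A[of z] by auto
 have entry: "A z $$ (x, y) = A 0 $$ (x, y)" if "x <= i" "y <= i" "(x, y) ~= (i, i)" for x y z
 using that inj[of x y i i] E by (auto simp: A_def random_mat_def)
 have ne: "pos x y ~= pos i i" if "x < i" "y < i" "E x y" for x y
 using inj[of x y i i] that E by auto
 have small: "random_mat E pos i (f(pos i i := z)) = random_mat E pos i f" for z
 unfolding random_mat_def using ne by (intro cong_mat) auto
 then show "det (random_mat E pos i (f(pos i i := z))) = det (random_mat E pos i f)" by simp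
 have del: "mat_delete (A z) i j = mat_delete (A 0) i j" if "j <= i" for j z
 using that by (intro eq_matI) (auto simp: mat_delete_def dA intro!: entry)
 have cof: "cofactor (A z) i j = cofactor (A 0) i j" if "j <= i" for j z
 using del[OF that, of z] by (simp add: cofactor_def)
 have dii: "cofactor (A 0) i i = det (random_mat E pos i f)"
 proof -
 have "mat_delete (A 0) i i = random_mat E pos i (f(pos i i := 0))"
  by (intro eq_matI) (auto simp: mat_delete_def A_def random_mat_def insert_index_def)
 then show ?thesis using small[of 0] by (simp add: cofactor_def)
 qed
 have Aii: "A z $$ (i, i) = int z" for z using E by (simp add: A_def random_mat_def)
 have ex: "det (A z) = int z * det (random_mat E pos i f) + (\<Sum>j<i. A 0 $$ (i, j) * cofactor (A 0) i j)" for z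
 proof -
 have "det (A z) = (\<Sum>j<Suc i. A z $$ (i, j) * cofactor (A z) i j)" by (rule laplace_expansion_row[OF A]) simp
 also have "... = (\<Sum>j<i. A z $$ (i, j) * cofactor (A z) i j) + A z $$ (i, i) * cofactor (A z) i i"
  by (rule sum.lessThan_Suc)
 also have "A z $$ (i, i) * cofactor (A z) i i = int z * det (random_mat E pos i f)"
  unfolding Aii cof[OF order_refl, of z] dii ..
 also have "(\<Sum>j<i. A z $$ (i, j) * cofactor (A z) i j) = (\<Sum>j<i. A 0 $$ (i, j) * cofactor (A 0) i j)"
 proof (rule sum.cong[OF refl])
  fix j assume "j \<in> {..<i}"
  then show "A z $$ (i, j) * cofactor (A z) i j = A 0 $$ (i, j) * cofactor (A 0) i j"
  using cof[of j z] entry[of i j z] by auto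
 qed
 finally show ?thesis by simp
 qed
 show "det (random_mat E pos (Suc i) (f(pos i i := z))) =
 int z * det (random_mat E pos i f) + det (random_mat E pos (Suc i) (f(pos i i := 0)))"
 using ex[of z] ex[of 0] unfolding A_def by (simp only: of_nat_0 mult_zero_left add_0)
qed

text \<open>Conditioned on the minor of order \<open>i\<close>, the next one is an affine function of the diagonal entry
 with nonzero slope.\<close>

lemma lead_generic:
 fixes m p N :: nat
 assumes C: "finite C" "!!x y. x < m ==> y < m ==> E x y ==> pos x y \<in> C"
 and inj: "!!x y x' y'. x < m ==> y < m ==> x' < m ==> y' < m ==> E x y ==> E x' y' ==>
  pos x y = pos x' y' ==> x = x' & y = y'"
 and E: "!!x. x < m ==> E x x" and p: "prime p" "p <= N"
 shows "measure_pmf.prob (rnd_cells C N) {f. \<exists>i\<le>m. int p dvd det (random_mat E pos i f)} <= 2 * m / p"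
proof -
 let ?D = "%i f. det (random_mat E pos i f)"
 let ?B = "%i. {f. ~ int p dvd ?D i f & int p dvd ?D (Suc i) f}"
 have p0: "0 < p" "0 < N" using p prime_gt_0_nat[OF p(1)] by auto
 have D0: "?D 0 f = 1" for f by (simp add: random_mat_def det_def)
 have np: "~ int p dvd 1" using p(1) by (metis of_nat_dvd_iff of_nat_1 not_prime_unit nat_dvd_1_iff_1 not_prime_1)
 \<comment> \<open>Take the first vanishing minor. Its order is not 0, where the determinant is 1,
   so the minor just before it exists and does not vanish.\<close>
 have sub: "{f. \<exists>i\<le>m. int p dvd ?D i f} \<subseteq> (\<Union>i<m. ?B i)"
 proof
 fix f assume "f \<in> {f. \<exists>i\<le>m. int p dvd ?D i f}"
 then have ex: "EX i. i <= m & int p dvd ?D i f" by blast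
 define i where "i = (LEAST i. i <= m & int p dvd ?D i f)"
 have i: "i <= m" "int p dvd ?D i f" using LeastI_ex[OF ex] by (auto simp: i_def)
 have "i ~= 0"
 proof
  assume "i = 0"
  then have "int p dvd ?D 0 f" using i(2) by simp
  then show False using np unfolding D0 by simp
 qed
 then obtain j where j: "i = Suc j" by (cases i) auto
 then have "~ (j <= m & int p dvd ?D j f)" using not_less_Least[of j "%i. i <= m & int p dvd ?D i f"] by (simp add: i_def)
 then show "f \<in> (\<Union>i<m. ?B i)" using i j by auto
 qed
 have Bi: "measure_pmf.prob (rnd_cells C N) (?B i) <= 2 / p" if i: "i < m" for i
 proof (rule single_cell[OF C(1) C(2)[OF i i E[OF i]] p0(2)])
 fix f
 have inj': "x = x' & y = y'" if "x <= i" "y <= i" "x' <= i" "y' <= i" "E x y" "E x' y'" "pos x y = pos x' y'" for x y x' y'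
  using inj[of x y x' y'] that i by simp
 have s1: "?D (Suc i) (f(pos i i := x)) = int x * ?D i f + ?D (Suc i) (f(pos i i := 0))" for x
  by (rule det_random_mat_step(1)[where i = i and E = E and pos = pos, OF inj' E[OF i]])
 have s2: "?D i (f(pos i i := x)) = ?D i f" for x
  by (rule det_random_mat_step(2)[where i = i and E = E and pos = pos, OF inj' E[OF i]])
 show "real (card {x. x < N & ~ int p dvd ?D i (f(pos i i := x)) & int p dvd ?D (Suc i) (f(pos i i := x))}) <= 2 / p * N"
 proof (cases "int p dvd ?D i f")
  case True
  then show ?thesis unfolding s2 by simp
 next
  case False
  have "{x. x < N & ~ int p dvd ?D i (f(pos i i := x)) & int p dvd ?D (Suc i) (f(pos i i := x))}
  = {x. x < N & int p dvd int x * ?D i f + ?D (Suc i) (f(pos i i := 0))}"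
  proof (intro Collect_cong)
  fix x
  show "(x < N & ~ int p dvd ?D i (f(pos i i := x)) & int p dvd ?D (Suc i) (f(pos i i := x))) =
  (x < N & int p dvd int x * ?D i f + ?D (Suc i) (f(pos i i := 0)))"
  unfolding s2 s1[of x] using False by blast
  qed
  then show ?thesis using residue_count[OF p False, of "?D (Suc i) (f(pos i i := 0))"] by (simp only:)
 qed
 qed (use p0 in auto)
 have "measure_pmf.prob (rnd_cells C N) {f. \<exists>i\<le>m. int p dvd ?D i f} <= measure_pmf.prob (rnd_cells C N) (\<Union>i<m. ?B i)"
 by (rule measure_pmf.finite_measure_mono[OF sub]) simp
 also have "... <= (\<Sum>i<m. measure_pmf.prob (rnd_cells C N) (?B i))"
 by (rule measure_pmf.finite_measure_subadditive_finite) auto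
 also have "... <= (\<Sum>i<m. 2 / p)" by (rule sum_mono) (use Bi in auto)
 finally show ?thesis by (simp add: mult.commute)
qed

text \<open>Permuting rows moves the given permutation to the diagonal and changes the determinant
  only by a sign, so \<open>lead_generic\<close> applies.\<close>

lemma det_generic:
 fixes m p N :: nat
 assumes C: "finite C" "!!x y. x < m ==> y < m ==> E x y ==> pos x y \<in> C"
 and inj: "!!x y x' y'. x < m ==> y < m ==> x' < m ==> y' < m ==> E x y ==> E x' y' ==>
  pos x y = pos x' y' ==> x = x' & y = y'"
 and pm: "pm permutes {0..<m}" "!!x. x < m ==> E x (pm x)" and p: "prime p" "p <= N"
 shows "measure_pmf.prob (rnd_cells C N) {f. int p dvd det (random_mat E pos m f)} <= 2 * m / p"
proof -
 obtain sg where sg: "sg permutes {0..<m}" "!!x. pm (sg x) = x"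
 proof
 show "inv_into UNIV pm permutes {0..<m}" by (rule permutes_inv[OF pm(1)])
 show "pm (inv_into UNIV pm x) = x" for x by (rule permutes_inverses(1)[OF pm(1)])
 qed
 have sgm: "sg x < m" if "x < m" for x using permutes_in_image[OF sg(1), of x] that by simp
 have sginj: "sg x = sg y ==> x = y" for x y using sg(2) by metis
 let ?E = "%x y. E (sg x) y" and ?pos = "%x y. pos (sg x) y"
 have det: "det (random_mat ?E ?pos m f) = signof sg * det (random_mat E pos m f)" for f
 proof -
 have "random_mat ?E ?pos m f = mat m m (%(i, j). random_mat E pos m f $$ (sg i, j))"
  using sgm by (intro eq_matI) (auto simp: random_mat_def)
 then show ?thesis using det_permute_rows[OF _ sg(1), of "random_mat E pos m f"] by (simp add: random_mat_def)
 qed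
 have "measure_pmf.prob (rnd_cells C N) {f. int p dvd det (random_mat E pos m f)}
 <= measure_pmf.prob (rnd_cells C N) {f. \<exists>i\<le>m. int p dvd det (random_mat ?E ?pos i f)}"
 by (rule measure_pmf.finite_measure_mono) (auto intro!: exI[of _ m] simp: det)
 also have "... <= 2 * m / p"
 proof (rule lead_generic[OF C(1) _ _ _ p])
 show "?E x x" if "x < m" for x using pm(2)[OF sgm[OF that]] sg(2) by simp
 show "?pos x y \<in> C" if "x < m" "y < m" "?E x y" for x y using C(2) sgm that by blast
 show "x = x' & y = y'" if "x < m" "y < m" "x' < m" "y' < m" "?E x y" "?E x' y'" "?pos x y = ?pos x' y'" for x y x' y'
  using inj[OF sgm[OF that(1)] that(2) sgm[OF that(3)] that(4-7)] sginj by blast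
 qed
 finally show ?thesis .
qed

lemma det_nonzero_permutation:
 assumes "A \<in> carrier_mat m m" "~ (p :: int) dvd det A"
 shows "\<exists>pm. pm permutes {0..<m} & (ALL x<m. A $$ (x, pm x) ~= 0)"
proof (rule ccontr)
 assume no: "~ ?thesis"
 have z: "(\<Prod>i = 0..<m. A $$ (i, pm i)) = 0" if per: "pm permutes {0..<m}" for pm
 proof -
 obtain x where "x < m" "A $$ (x, pm x) = 0" using no per by blast
 then show ?thesis by (intro prod_zero) auto
 qed
 have "det A = 0" unfolding det_def'[OF assms(1)]
 by (rule sum.neutral) (use z in "simp del: prod_eq_1_iff prod_zero_iff")
 then show False using assms(2) by simp
qed

section \<open>Many primes below a power of two\<close>

text \<open>Nair's argument: by the recursion of the Leibniz harmonic triangle, \<open>k * (n choose k)\<close> divides the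
 least common multiple of \<open>1, ..., n\<close>.\<close>

lemma binomial_dvd_Lcm:
 assumes "1 <= k" "k <= n"
 shows "k * (n choose k) dvd Lcm {1..n :: nat}"
 using assms
proof (induction "n - k" arbitrary: n k)
 case 0
 then show ?case by (auto intro: dvd_Lcm)
next
 case (Suc d)
 define L where "L = real (Lcm {1..n})"
 have kn: "k < n" using Suc.hyps(2) by simp
 have "k * ((n - 1) choose k) dvd Lcm {1..n - 1}" using Suc kn by (intro Suc.hyps(1)) auto
 also have "Lcm {1..n - 1} dvd Lcm {1..n}" by (intro Lcm_subset) auto
 finally obtain a where a: "Lcm {1..n} = k * ((n - 1) choose k) * a" by (elim dvdE)
 have "(k + 1) * (n choose (k + 1)) dvd Lcm {1..n}" using Suc kn by (intro Suc.hyps(1)) auto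
 then obtain b where b: "Lcm {1..n} = (k + 1) * (n choose (k + 1)) * b" by (elim dvdE)
 define c where "c = real (n choose k)"
 have c0: "c > 0" using kn by (simp add: c_def)
 have e1: "real (n - k) * c = real n * real ((n - 1) choose k)"
 unfolding c_def using binomial_absorb_comp[of n k] unfolding of_nat_mult[symmetric] by (simp only:)
 have e2: "real (k + 1) * real (n choose (k + 1)) = real (n - k) * c"
 using binomial_absorption[of k n] e1 unfolding of_nat_mult[symmetric] by (simp only: Suc_eq_plus1)
 have n0: "real n > 0" "real k > 0" "real (n - k) > 0" using kn Suc.prems by auto
 have La: "L * real n = real k * real (n - k) * c * real a"
 using e1 unfolding L_def a by (simp add: algebra_simps)
 have Lb: "L = real (n - k) * c * real b"
 using e2 unfolding L_def b by (simp only: of_nat_mult)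
 \<comment> \<open>The harmonic triangle in the form \<open>L / (k * c) = a - b\<close>: the
   quotients by the two neighbouring multiples are integers, hence so is the new one.\<close>
 have "L * real (n - k) = L * real n - L * real k" using kn by (simp add: of_nat_diff algebra_simps)
 also have "... = real (n - k) * (real k * c * (real a - real b))"
 unfolding La by (subst Lb) (simp add: algebra_simps)
 finally have Lk: "L = real k * c * (real a - real b)" using n0 by simp
 then have "int (Lcm {1..n}) = int (k * (n choose k)) * (int a - int b)"
 proof -
 have "of_int (int (Lcm {1..n})) = (of_int (int (k * (n choose k)) * (int a - int b)) :: real)"
  using Lk unfolding L_def c_def by simp
 then show ?thesis by (simp only: of_int_eq_iff)
 qed
 then have "int (k * (n choose k)) dvd int (Lcm {1..n})" by simp
 then show ?case by (simp only: of_nat_dvd_iff)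
qed

text \<open>Passing from \<open>m\<close> to \<open>m + 1\<close> multiplies the right side by
  \<open>2 * (2 * m + 1) / m\<close>, which is at least 4.\<close>

lemma central_binomial_ge: "1 <= m ==> 2 ^ (2 * m - 1) <= m * (2 * m choose m)"
proof (induction m rule: dec_induct)
 case base
 then show ?case by simp
next
 case (step m)
 have "Suc m * (2 * Suc m choose Suc m) = (2 * Suc m) * ((2 * m + 1) choose m)"
 using binomial_absorption[of m "2 * Suc m"] by simp
 also have "... = 2 * (Suc m * ((2 * m + 1) choose m))" by simp
 also have "Suc m * ((2 * m + 1) choose m) = (2 * m + 1) * (2 * m choose m)"
 using binomial_absorb_comp[of "2 * m + 1" m] by simp
 finally have "Suc m * (2 * Suc m choose Suc m) \<ge> 2 * (2 * m * (2 * m choose m))" by simp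
 also have "2 * (2 * m * (2 * m choose m)) = 4 * (m * (2 * m choose m))" by simp
 finally have "4 * (m * (2 * m choose m)) <= Suc m * (2 * Suc m choose Suc m)" .
 moreover have "(2::nat) ^ (2 * Suc m - 1) = 4 * 2 ^ (2 * m - 1)"
 using step(1) by (cases m) auto
 ultimately show ?case using step.IH by linarith
qed

text \<open>Every prime contributes to the least common multiple only its largest power not
  exceeding \<open>n\<close>, so each of the primes accounts for a factor of at most
  \<open>n\<close>.\<close>

lemma Lcm_le_power_primes:
 assumes "1 <= n"
 shows "Lcm {1..n :: nat} <= n ^ card {q. prime q & q <= n}"
proof -
 let ?S = "{q. prime q & q <= n}"
 have fin: "finite ?S" by simp
 define f where "f q = (GREATEST e. q ^ e <= n)" for q :: nat
 have bound: "ALL y. q ^ y <= n --> y <= n" if "prime q" for q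
 proof (intro allI impI)
 fix y assume "q ^ y <= n"
 moreover have "y < 2 ^ y" by (rule less_exp)
 moreover have "(2 :: nat) ^ y <= q ^ y" using prime_ge_2_nat[OF that] by (intro power_mono) auto
 ultimately show "y <= n" by linarith
 qed
 have f1: "q ^ f q <= n" if "prime q" for q
 unfolding f_def
 proof (rule GreatestI_nat)
 show "q ^ 0 <= n" using assms by simp
 show "y <= n" if "q ^ y <= n" for y using bound[OF \<open>prime q\<close>] that by blast
 qed
 have f2: "e <= f q" if "prime q" "q ^ e <= n" for q e
 unfolding f_def
 proof (rule Greatest_le_nat)
 show "q ^ e <= n" by (rule that(2))
 show "y <= n" if "q ^ y <= n" for y using bound[OF \<open>prime q\<close>] that by blast
 qed
 define X where "X = (\<Prod>q\<in>?S. q ^ f q)"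
 have X0: "X ~= 0" using fin by (auto simp: X_def prime_gt_0_nat)
 have dv: "i dvd X" if i: "i \<in> {1..n}" for i
 proof (rule multiplicity_le_imp_dvd)
 fix q :: nat assume q: "prime q"
 have m: "q ^ multiplicity q i <= n"
 proof -
  have "q ^ multiplicity q i <= i" using i multiplicity_dvd[of q i] by (intro dvd_imp_le) auto
  then show ?thesis using i by simp
 qed
 show "multiplicity q i <= multiplicity q X"
 proof (cases "q \<in> ?S")
  case True
  have "multiplicity q X = f q" unfolding X_def
  by (subst multiplicity_prod_prime_powers[OF fin _ q]) (use True in simp_all)
  then show ?thesis using f2[OF q m] by simp
 next
  case False
  then have "n < q" using q by auto
  then have "~ q dvd i" using i by (auto dest: dvd_imp_le)
  then have "multiplicity q i = 0" by (rule not_dvd_imp_multiplicity_0)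
  then show ?thesis by simp
 qed
 qed (use i in auto)
 have "Lcm {1..n} dvd X" by (rule Lcm_least) (rule dv)
 then have "Lcm {1..n} <= X" by (rule dvd_imp_le) (use X0 in "simp only: neq0_conv")
 also have "X <= (\<Prod>q\<in>?S. n)" unfolding X_def by (intro prod_mono) (use f1 in auto)
 also have "... = n ^ card ?S" by simp
 finally show ?thesis .
qed

text \<open>For \<open>n = 2 ^ e\<close> the two bounds on the least common multiple give
  \<open>2 ^ (n - 1) <= n ^ r = 2 ^ (e * r)\<close>, where \<open>r\<close> counts the primes up to
  \<open>n\<close>; comparing exponents yields the claim. As \<open>2 ^ e\<close> is composite,
  these primes lie strictly below it.\<close>

lemma many_primes:
 assumes "2 <= e"
 shows "2 ^ e - 1 <= e * card {q :: nat. prime q & q < 2 ^ e}"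
proof -
 let ?n = "2 ^ e :: nat"
 define m :: nat where "m = 2 ^ (e - 1)"
 have m: "2 * m = ?n" "1 <= m"
 using assms power_Suc[of "2 :: nat" "e - 1"] by (simp_all add: m_def)
 have "~ prime ?n" using assms by (simp add: prime_power_iff)
 then have S: "{q. prime q & q <= ?n} = {q. prime q & q < ?n}" using order_le_less by auto
 have "2 ^ (?n - 1) <= m * (?n choose m)" using central_binomial_ge[OF m(2)] m(1) by simp
 also have "... <= Lcm {1..?n}"
 proof (rule dvd_imp_le)
 show "m * (?n choose m) dvd Lcm {1..?n}" by (rule binomial_dvd_Lcm) (use m in auto)
 have "Lcm {1..?n} ~= 0" by (subst Lcm_0_iff) auto
 then show "0 < Lcm {1..?n}" by (simp only: neq0_conv)
 qed
 also have "... <= ?n ^ card {q. prime q & q <= ?n}" by (rule Lcm_le_power_primes) simp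
 also have "... = 2 ^ (e * card {q. prime q & q < ?n})" unfolding S by (simp add: power_mult)
 finally show ?thesis by (rule power_le_imp_le_exp[rotated]) simp
qed

section \<open>The random matrices of an instance\<close>

lemma flat_inj: "y < (d::nat) ==> y' < d ==> x * d + y = x' * d + y' ==> x = x' & y = y'"
 by (metis div_mult_self3 div_less add.right_neutral add_right_imp_eq mult.commute less_nat_zero_code bot_nat_0.extremum_strict add_left_imp_eq)

lemma flat_less: "x < (d::nat) ==> y < d ==> x * d + y < d * d"
proof -
 assume "x < d" "y < d"
 then have "x * d + y < Suc x * d" by simp
 also have "... <= d * d" using \<open>x < d\<close> by (intro mult_le_mono1) simp
 finally show ?thesis .
qed

text \<open>The order is a power of two for the sake of halving. It leaves room for \<open>n\<close>
  vertices and, behind them, for \<open>k\<close> further rows per source and \<open>k\<close>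
  further columns per sink.\<close>

locale instance_data =
 fixes n k q :: nat and E :: "(nat \<times> nat) set" and Sl Tl :: "nat list"
 assumes E: "E \<subseteq> {..<n} \<times> {..<n}" and Sl: "set Sl \<subseteq> {..<n}" and Tl: "set Tl \<subseteq> {..<n}" and k_pos: "1 <= k"
 and size: "n + (length Sl + length Tl) * k <= 2 ^ q" and n_pos: "1 <= n"
begin

definition D :: nat where "D = 2 ^ q"

definition EA :: "nat => nat => bool" where
 "EA u y \<longleftrightarrow> u = y | (u, y) \<in> E"

text \<open>Border rows for all pairs at once. A row \<open>r < n\<close> is the unit pattern of
  vertex \<open>r\<close>, ready to serve as border row 0 or 1; behind these follow \<open>k\<close>
  copies of the out-neighbourhood of each source, with separate cells. \<open>EQ\<close> does the
  same with columns and sinks.\<close>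

definition EP :: "nat => nat => bool" where
 "EP r y \<longleftrightarrow> (if r < n then r = y else r < n + length Sl * k & (Sl ! ((r - n) div k), y) \<in> E)"

definition EQ :: "nat => nat => bool" where
 "EQ x c \<longleftrightarrow> (if c < n then c = x else c < n + length Tl * k & (x, Tl ! ((c - n) div k)) \<in> E)"

definition Amat :: "(nat => nat) => int mat" where
 "Amat f = mat D D (%(x, y). if EA x y then int (f (x * D + y)) else 0)"

definition Pmat :: "(nat => nat) => int mat" where
 "Pmat f = mat D D (%(x, y). if EP x y then int (f (D * D + (x * D + y))) else 0)"

definition Qmat :: "(nat => nat) => int mat" where
 "Qmat f = mat D D (%(x, y). if EQ x y then int (f (2 * (D * D) + (x * D + y))) else 0)"

definition row_index :: "nat => nat => nat => nat => nat" where
 "row_index s t i x = (if x = 0 then s else if x = 1 then t else n + i * k + (x - 2))"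

definition bpattern :: "nat => nat => nat => nat => bool" where
 "bpattern i j x y \<longleftrightarrow> (let s = Sl ! i; t = Tl ! j in
  if x < D then if y < D then EA x y else EQ x (row_index s t j (y - D))
  else y < D & EP (row_index s t i (x - D)) y)"

definition bpos :: "nat => nat => nat => nat => nat" where
 "bpos i j x y = (let s = Sl ! i; t = Tl ! j in
  if x < D then if y < D then x * D + y else 2 * (D * D) + (x * D + row_index s t j (y - D))
  else D * D + (row_index s t i (x - D) * D + y))"

definition bordered :: "nat => nat => nat => (nat => nat) => int mat" where
 "bordered i j m f = random_mat (bpattern i j) (bpos i j) (D + m) f"

definition matchable :: "nat => nat => nat => bool" where
 "matchable s t m \<longleftrightarrow> (\<exists>pm. pm permutes {0..<D + m} & (ALL x<D + m. pattern E s t D x (pm x)))"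

text \<open>Only those bordered determinants are required not to vanish for which a permutation
  within the pattern exists; the others are zero for every choice of cells.\<close>

definition good_cells :: "nat => (nat => nat) => bool" where
 "good_cells p f \<longleftrightarrow> (\<forall>i\<le>D. ~ int p dvd det (lead (Amat f) i)) &
  (ALL i<length Sl. ALL j<length Tl. Sl ! i ~= Tl ! j -->
  (\<forall>m\<le>k + 2. matchable (Sl ! i) (Tl ! j) m --> ~ int p dvd det (bordered i j m f)))"

lemma Sl_nth: "i < length Sl ==> Sl ! i < n" and Tl_nth: "j < length Tl ==> Tl ! j < n"
 using Sl Tl by (auto dest: nth_mem)

lemma n_le_D: "n <= D"
 using size unfolding D_def by linarith

lemma E_D: "E \<subseteq> {..<D} \<times> {..<D}"
 using E n_le_D by force

lemma row_bound:
 assumes "s < n" "t < n" "i < l" "n + l * k <= D" "x < k + 2"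
 shows "row_index s t i x < D" "2 <= x ==> row_index s t i x < n + l * k"
 "2 <= x ==> (row_index s t i x - n) div k = i" "2 <= x ==> n <= row_index s t i x"
proof -
 have *: "n + i * k + (x - 2) < n + l * k" if "2 <= x"
 proof -
 have "i * k + (x - 2) < Suc i * k" using that assms(5) k_pos by simp
 also have "... <= l * k" using assms(3) by (intro mult_le_mono1) simp
 finally show ?thesis by simp
 qed
 show "row_index s t i x < D"
 using * assms n_le_D by (auto simp: row_index_def)
 show "2 <= x ==> row_index s t i x < n + l * k" using * by (auto simp: row_index_def)
 have e: "row_index s t i x - n = i * k + (x - 2)" if "2 <= x"
 using that by (simp add: row_index_def)
 have "(i * k + (x - 2)) div k = i"
 using assms(5) k_pos div_mult_self3[of k i "x - 2"] by (simp del: div_mult_self3)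
 then show "2 <= x ==> (row_index s t i x - n) div k = i" using e by simp
 show "2 <= x ==> n <= row_index s t i x" by (auto simp: row_index_def)
qed

lemma sizes: "n + length Sl * k <= D" "n + length Tl * k <= D"
 using size unfolding D_def by (auto simp: add_mult_distrib)

lemma row_inj:
 assumes "s < n" "t < n" "s ~= t" "row_index s t i x = row_index s t i x'"
 shows "x = x'"
 using assms by (auto simp: row_index_def split: if_splits)

lemma bpattern_eq:
 assumes i: "i < length Sl" and j: "j < length Tl" and xy: "x < D + (k + 2)" "y < D + (k + 2)"
 shows "bpattern i j x y \<longleftrightarrow> pattern E (Sl ! i) (Tl ! j) D x y"
proof -
 let ?s = "Sl ! i" and ?t = "Tl ! j"
 have P: "EP (row_index ?s ?t i x') y \<longleftrightarrow> (if x' = 0 then y = ?s else if x' = 1 then y = ?t else (?s, y) \<in> E)" if "x' < k + 2" for x'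
 using row_bound[OF Sl_nth[OF i] Tl_nth[OF j] i sizes(1) that] Sl_nth[OF i] Tl_nth[OF j]
 by (cases "2 <= x'") (auto simp: EP_def row_index_def)
 have Q: "EQ x (row_index ?s ?t j y') \<longleftrightarrow> (if y' = 0 then x = ?s else if y' = 1 then x = ?t else (x, ?t) \<in> E)" if "y' < k + 2" for y'
 using row_bound[OF Sl_nth[OF i] Tl_nth[OF j] j sizes(2) that] Sl_nth[OF i] Tl_nth[OF j]
 by (cases "2 <= y'") (auto simp: EQ_def row_index_def)
 show ?thesis
 using P[of "x - D"] Q[of "y - D"] xy by (auto simp: bpattern_def pattern_def EA_def Let_def)
qed

text \<open>The three blocks read from three disjoint ranges of \<open>D * D\<close> cells, and for
  distinct endpoints the selected rows and columns are distinct. Different pairs do share cells,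
  which the later union bound tolerates.\<close>

lemma bpos_props:
 assumes i: "i < length Sl" and j: "j < length Tl" and ne: "Sl ! i ~= Tl ! j" and m: "m <= k + 2"
 shows "x < D + m ==> y < D + m ==> bpattern i j x y ==> bpos i j x y < 3 * (D * D)"
 and "x < D + m ==> y < D + m ==> x' < D + m ==> y' < D + m ==> bpattern i j x y ==> bpattern i j x' y' ==>
  bpos i j x y = bpos i j x' y' ==> x = x' & y = y'"
proof -
 let ?s = "Sl ! i" and ?t = "Tl ! j"
 have b: "row_index ?s ?t i (x - D) < D" "row_index ?s ?t j (x - D) < D" if "x < D + m" "D <= x" for x
 using row_bound(1)[OF Sl_nth[OF i] Tl_nth[OF j] i sizes(1), of "x - D"]
  row_bound(1)[OF Sl_nth[OF i] Tl_nth[OF j] j sizes(2), of "x - D"] that m by auto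
 define K where "K x y = (if x < D then if y < D then 0 else 2 else (1::nat))" for x y :: nat
 define a where "a x = (if x < D then x else row_index ?s ?t i (x - D))" for x
 define c where "c y = (if y < D then y else row_index ?s ?t j (y - D))" for y
 have form: "bpos i j x y = K x y * (D * D) + (a x * D + c y) & a x < D & c y < D"
 if "x < D + m" "y < D + m" "bpattern i j x y" for x y
 using b[of x] b[of y] that
 by (auto simp: bpos_def bpattern_def K_def a_def c_def Let_def)
 show "bpos i j x y < 3 * (D * D)" if "x < D + m" "y < D + m" "bpattern i j x y"
 proof -
 have "a x * D + c y < D * D" using form[OF that] flat_less by blast
 moreover have "K x y * (D * D) <= 2 * (D * D)" by (rule mult_le_mono1) (auto simp: K_def)
 ultimately show ?thesis using form[OF that] by linarith
 qed
 assume xy: "x < D + m" "y < D + m" "x' < D + m" "y' < D + m" and pat: "bpattern i j x y" "bpattern i j x' y'"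
 and eq: "bpos i j x y = bpos i j x' y'"
 note f = form[OF xy(1,2) pat(1)] form[OF xy(3,4) pat(2)]
 have lt: "a x * D + c y < D * D" "a x' * D + c y' < D * D" using f flat_less by blast+
 have "K x y * (D * D) + (a x * D + c y) = K x' y' * (D * D) + (a x' * D + c y')" using f eq by simp
 from flat_inj[OF lt this] have K: "K x y = K x' y'" and "a x * D + c y = a x' * D + c y'" by auto
 with flat_inj f have ac: "a x = a x'" "c y = c y'" by blast+
 have notboth: "x < D | y < D" "x' < D | y' < D" using pat by (auto simp: bpattern_def Let_def split: if_splits)
 have "x = x'"
 proof (cases "x < D")
 case True
 then have "x' < D" using K by (auto simp: K_def split: if_splits)
 then show ?thesis using True ac by (simp add: a_def)
 next
 case False
 then have "~ x' < D" using K by (auto simp: K_def split: if_splits)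
 then have "row_index ?s ?t i (x - D) = row_index ?s ?t i (x' - D)" using False ac(1) by (simp add: a_def)
 then have "x - D = x' - D" by (rule row_inj[OF Sl_nth[OF i] Tl_nth[OF j] ne])
 then show ?thesis using False \<open>~ x' < D\<close> by simp
 qed
 moreover have "y = y'"
 proof (cases "y < D")
 case True
 then have "y' < D" using K notboth by (auto simp: K_def split: if_splits)
 then show ?thesis using True ac by (simp add: c_def)
 next
 case False
 then have "~ y' < D" using K notboth by (auto simp: K_def split: if_splits)
 then have "row_index ?s ?t j (y - D) = row_index ?s ?t j (y' - D)" using False ac(2) by (simp add: c_def)
 then have "y - D = y' - D" by (rule row_inj[OF Sl_nth[OF i] Tl_nth[OF j] ne])
 then show ?thesis using False \<open>~ y' < D\<close> by simp
 qed
 ultimately show "x = x' & y = y'" ..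
qed

section \<open>Bordered determinants as minors of a Schur complement\<close>

lemma bordered_block:
 assumes i: "i < length Sl" and j: "j < length Tl" and m: "m <= k + 2"
 shows "bordered i j m f = four_block_mat (Amat f)
  (mat D m (%(x, y). Qmat f $$ (x, row_index (Sl ! i) (Tl ! j) j y)))
  (mat m D (%(x, y). Pmat f $$ (row_index (Sl ! i) (Tl ! j) i x, y))) (0\<^sub>m m m)"
proof -
 have b: "row_index (Sl ! i) (Tl ! j) i x < D" "row_index (Sl ! i) (Tl ! j) j x < D" if "x < m" for x
 using row_bound(1)[OF Sl_nth[OF i] Tl_nth[OF j] i sizes(1), of x]
  row_bound(1)[OF Sl_nth[OF i] Tl_nth[OF j] j sizes(2), of x] that m by auto
 show ?thesis
 by (intro eq_matI) (auto simp: bordered_def random_mat_def Amat_def Pmat_def Qmat_def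
  bpattern_def bpos_def Let_def b)
qed

text \<open>The matrix whose leading minors count the disjoint paths, with the identity as padding.\<close>

definition Wmat :: "nat => nat => nat => int mat => int mat" where
 "Wmat i j K Z = mat K K (%(x, y). if x < k + 2 & y < k + 2
  then Z $$ (row_index (Sl ! i) (Tl ! j) i x, row_index (Sl ! i) (Tl ! j) j y) else if x = y then 1 else 0)"

text \<open>\<open>schur_det\<close> with a zero lower right block: the bordered determinant times
  \<open>d ^ m\<close> is, up to sign, \<open>det (Amat f)\<close> times the minor of
  \<open>P * B * Q\<close>. All the other factors are prime to \<open>p\<close>.\<close>

lemma lead_Wmat:
 assumes i: "i < length Sl" and j: "j < length Tl" and m: "m <= k + 2" "k + 2 <= K"
 and p: "prime (int p)" and B: "B \<in> carrier_mat D D" "Amat f * B = d \<cdot>\<^sub>m 1\<^sub>m D" "~ int p dvd d"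
 shows "int p dvd det (lead (Wmat i j K (Pmat f * B * Qmat f)) m) \<longleftrightarrow> int p dvd det (bordered i j m f)"
proof -
 let ?r = "row_index (Sl ! i) (Tl ! j) i" and ?c = "row_index (Sl ! i) (Tl ! j) j"
 have b: "?r x < D" "?c x < D" if "x < m" for x
 using row_bound(1)[OF Sl_nth[OF i] Tl_nth[OF j] i sizes(1), of x]
  row_bound(1)[OF Sl_nth[OF i] Tl_nth[OF j] j sizes(2), of x] that m by auto
 define Q where "Q = mat D m (%(x, y). Qmat f $$ (x, ?c y))"
 define P where "P = mat m D (%(x, y). Pmat f $$ (?r x, y))"
 have c: "Amat f \<in> carrier_mat D D" "Q \<in> carrier_mat D m" "P \<in> carrier_mat m D"
 "Pmat f \<in> carrier_mat D D" "Qmat f \<in> carrier_mat D D" by (auto simp: Amat_def Q_def P_def Pmat_def Qmat_def)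
 have W: "lead (Wmat i j K (Pmat f * B * Qmat f)) m = P * (B * Q)"
 proof (intro eq_matI)
 fix x y assume "x < dim_row (P * (B * Q))" "y < dim_col (P * (B * Q))"
 then have xy: "x < m" "y < m" using c by auto
 have "P * (B * Q) = P * B * Q" using assoc_mult_mat[OF c(3) B(1) c(2)] by simp
 moreover have "row P x = row (Pmat f) (?r x)" using xy b c by (intro eq_vecI) (auto simp: P_def)
 moreover have "col Q y = col (Qmat f) (?c y)" using xy b c by (intro eq_vecI) (auto simp: Q_def)
 ultimately show "lead (Wmat i j K (Pmat f * B * Qmat f)) m $$ (x, y) = (P * (B * Q)) $$ (x, y)"
  using xy m b c B by (simp add: lead_def Wmat_def)
 qed (use c in "auto simp: lead_def")
 have PBQ: "P * (B * Q) \<in> carrier_mat m m" using c B by auto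
 have "d \<cdot>\<^sub>m 0\<^sub>m m m - P * (B * Q) = -1 \<cdot>\<^sub>m (P * (B * Q))" using carrier_matD[OF PBQ] by (intro eq_matI) auto
 then have "det (bordered i j m f) * d ^ m = det (Amat f) * ((-1) ^ m * det (P * (B * Q)))"
 using schur_det[OF c(1-3) zero_carrier_mat B(1,2)] bordered_block[OF i j m(1), of f] carrier_matD[OF PBQ]
 by (simp add: Q_def P_def)
 moreover have "~ int p dvd d ^ m" using B(3) p prime_dvd_power by blast
 moreover have "~ int p dvd det (Amat f)"
 proof
 assume "int p dvd det (Amat f)"
 moreover have "det (Amat f) * det B = d ^ D"
  using det_mult[OF c(1) B(1)] B(2) by simp
 ultimately have "int p dvd d ^ D" by (metis dvd_mult2)
 then show False using B(3) p prime_dvd_power by blast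
 qed
 moreover have "~ int p dvd (-1) ^ m"
 proof
 assume "int p dvd (-1) ^ m"
 then have "int p dvd -1" using p prime_dvd_power by blast
 then show False using p by auto
 qed
 ultimately show ?thesis unfolding W using p by (metis prime_dvd_mult_iff)
qed

text \<open>Two of the nonvanishing minors come from the border rows of \<open>s\<close> and
  \<open>t\<close> themselves, hence the shift by 2. Behind order \<open>k + 2\<close> the matrix is
  padded with the identity, so \<open>c\<close> is exact only below \<open>k + 2\<close>; from there
  on it merely shows that the value is at least \<open>k\<close>.\<close>

lemma count_correct:
 fixes G :: "nat pair_pre_digraph"
 assumes G: "pair_fin_digraph G" "parcs G = E"
 and i: "i < length Sl" and j: "j < length Tl" and ne: "Sl ! i ~= Tl ! j" and K: "k + 2 <= 2 ^ kp"
 and p: "prime (int p)" and good: "good_cells p f"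
 and B: "B \<in> carrier_mat D D" "Amat f * B = d \<cdot>\<^sub>m 1\<^sub>m D" "~ int p dvd d"
 and pi: "pinv (int p) kp (Wmat i j (2 ^ kp) (Pmat f * B * Qmat f)) = (c, N, e)"
 defines "val == vertex_cut_value G (Sl ! i) (Tl ! j)" and "ar == of_bool ((Sl ! i, Tl ! j) \<in> E)"
 shows "c + ar < k + 2 \<longleftrightarrow> val < k" "val < k ==> c + ar = val + 2"
proof -
 let ?s = "Sl ! i" and ?t = "Tl ! j"
 let ?W = "Wmat i j (2 ^ kp) (Pmat f * B * Qmat f)"
 have st: "?s < D" "?t < D" "?s ~= ?t" using Sl_nth[OF i] Tl_nth[OF j] n_le_D ne by auto
 have Wc: "?W \<in> carrier_mat (2 ^ kp) (2 ^ kp)" by (simp add: Wmat_def)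
 note pc = pinv_correct[OF p Wc pi]
 note lw = lead_Wmat[OF i j _ K p B]
 obtain i0 where i0: "npaths E ?s ?t i0" "val = i0 + ar"
 using pair_fin_digraph.vertex_cut_value_npaths[OF G(1) ne] unfolding val_def ar_def G(2) by auto
 \<comment> \<open>Here the good cells enter: as long as there are enough disjoint paths, the next
   minor cannot vanish.\<close>
 have lower: "min (2 + i0) (k + 2) <= c"
 proof (rule ccontr)
 assume "~ ?thesis"
 then have c: "Suc c <= 2 + i0" "Suc c <= k + 2" by auto
 have "matchable ?s ?t (Suc c)"
  unfolding matchable_def by (rule npaths_permutation[OF E_D st i0(1) c(1)])
 then have "~ int p dvd det (bordered i j (Suc c) f)" using good i j ne c(2) unfolding good_cells_def by blast
 then have "~ int p dvd det (lead ?W (Suc c))" using lw[OF c(2)] by simp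
 moreover have "c < 2 ^ kp" using c(2) K by linarith
 ultimately show False using pc by blast
 qed
 \<comment> \<open>This direction takes no luck: a nonzero determinant has a nonzero Leibniz term,
   and its permutation yields paths.\<close>
 have upper: "npaths E ?s ?t (m - 2)" if m: "m <= c" "m <= k + 2" "2 <= m" for m
 proof -
 have "~ int p dvd det (lead ?W m)" using pc m(1) by blast
 then have nd: "~ int p dvd det (bordered i j m f)" using lw[OF m(2)] by simp
 have "bordered i j m f \<in> carrier_mat (D + m) (D + m)" by (simp add: bordered_def random_mat_def)
 from det_nonzero_permutation[OF this nd] obtain pm where
  pm: "pm permutes {0..<D + m}" "ALL x<D + m. bordered i j m f $$ (x, pm x) ~= 0" by blast
 have "pattern E ?s ?t D x (pm x)" if x: "x < D + m" for x
 proof -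
  have "pm x < D + m" using permutes_in_image[OF pm(1), of x] x by simp
  then have "bpattern i j x (pm x)" using pm(2) x by (auto simp: bordered_def random_mat_def split: if_splits)
  then show ?thesis using bpattern_eq[OF i j, of x "pm x"] x \<open>pm x < D + m\<close> m(2) by simp
 qed
 moreover obtain l where l: "m = 2 + l" using le_Suc_ex[OF m(3)] by blast
 ultimately have "npaths E ?s ?t l" using permutation_npaths[OF E_D st, of pm l] pm(1) unfolding l by blast
 then show ?thesis using l by simp
 qed
 have up: "l + ar <= val" if "npaths E ?s ?t l" for l
 using pair_fin_digraph.npaths_le_vertex_cut_value[OF G(1), of ?s ?t l] that ne unfolding val_def ar_def G(2) by simp
 have eq: "c = 2 + i0" if "c < k + 2"
 proof -
 have "2 + i0 <= c" using lower that by linarith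
 moreover have "2 <= c" using calculation by simp
 moreover have "c - 2 + ar <= val" by (rule up, rule upper[OF order_refl]) (use that calculation in auto)
 ultimately show ?thesis using i0(2) by linarith
 qed
 have k2: "k <= i0" if "k + 2 <= c"
 using up[OF upper[of "k + 2"]] that i0(2) by simp
 show "c + ar < k + 2 \<longleftrightarrow> val < k"
 using eq k2 i0(2) by linarith
 show "c + ar = val + 2" if "val < k"
 using eq k2 i0(2) that by linarith
qed

text \<open>Union bound over the leading minors of \<open>Amat f\<close> and at most
  \<open>a * b * (k + 3)\<close> bordered matrices of order at most \<open>D + k + 2\<close>, each
  of which fails with probability at most twice its order over \<open>p\<close>.\<close>

lemma prob_bad_cells:
 assumes C: "finite C" "{..<3 * (D * D)} \<subseteq> C" and p: "prime p" "p <= N" "1024 * D ^ 3 <= p"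
 shows "measure_pmf.prob (rnd_cells C N) {f. ~ good_cells p f} <= 1 / 8"
proof -
 let ?Pr = "measure_pmf.prob (rnd_cells C N)"
 define a b where "a = length Sl" and "b = length Tl"
 define I where "I = {(i, j, m). i < a & j < b & m <= k + 2 & Sl ! i ~= Tl ! j & matchable (Sl ! i) (Tl ! j) m}"
 let ?A = "{f. \<exists>i\<le>D. int p dvd det (lead (Amat f) i)}"
 let ?N = "%(i, j, m). {f. int p dvd det (bordered i j m f)}"
 have p0: "0 < p" using p(1) prime_gt_0_nat by blast
 have A: "?Pr ?A <= 2 * real D / real p"
 proof -
 have "Amat f = random_mat EA (%x y. x * D + y) D f" for f by (auto simp: Amat_def random_mat_def)
 then have "?A = {f. \<exists>i\<le>D. int p dvd det (random_mat EA (%x y. x * D + y) i f)}"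
  using lead_random_mat[of _ D EA "%x y. x * D + y"] by (intro Collect_cong) (metis (no_types))
 also have "?Pr ... <= real (2 * D) / real p"
 proof (rule lead_generic[where m = D and E = EA and pos = "%x y. x * D + y" and C = C and p = p and N = N])
  show "x * D + y \<in> C" if "x < D" "y < D" for x y using flat_less[OF that] C(2) by force
  show "x = x' & y = y'" if "y < D" "y' < D" "x * D + y = x' * D + y'" for x y x' y'
  using flat_inj[OF that] .
 qed (use C(1) p in "simp_all add: EA_def")
 finally show ?thesis by simp
 qed
 have N: "?Pr (?N t) <= 2 * real (D + k + 2) / real p" if tI: "t \<in> I" for t
 proof -
 obtain i j m where t: "t = (i, j, m)" by (cases t) auto
 have h: "i < length Sl" "j < length Tl" "m <= k + 2" "Sl ! i ~= Tl ! j" using tI by (auto simp: t I_def a_def b_def)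
 obtain pm where pm: "pm permutes {0..<D + m}" "ALL x<D + m. pattern E (Sl ! i) (Tl ! j) D x (pm x)"
  using tI unfolding t I_def matchable_def by blast
 have "?Pr {f. int p dvd det (bordered i j m f)} <= real (2 * (D + m)) / real p"
  unfolding bordered_def
 proof (rule det_generic[where E = "bpattern i j" and pos = "bpos i j", OF C(1) _ _ pm(1) _ p(1,2)])
  show "bpos i j x y \<in> C" if "x < D + m" "y < D + m" "bpattern i j x y" for x y
  using bpos_props(1)[OF h(1,2,4,3) that] C(2) by blast
  show "x = x' & y = y'" if "x < D + m" "y < D + m" "x' < D + m" "y' < D + m" "bpattern i j x y"
  "bpattern i j x' y'" "bpos i j x y = bpos i j x' y'" for x y x' y'
  using bpos_props(2)[OF h(1,2,4,3) that] .
  show "bpattern i j x (pm x)" if "x < D + m" for x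
  proof -
  have "pm x < D + m" using permutes_in_image[OF pm(1), of x] that by simp
  then show ?thesis using bpattern_eq[OF h(1,2), of x "pm x"] that pm(2) h(3) by simp
  qed
 qed
 also have "... <= 2 * real (D + k + 2) / real p" using h(3) p0 by (intro divide_right_mono) auto
 finally show ?thesis by (simp add: t)
 qed
 have Isub: "I \<subseteq> {..<a} \<times> {..<b} \<times> {..k + 2}" by (auto simp: I_def)
 have finI: "finite I" by (rule finite_subset[OF Isub]) auto
 have cardI: "card I <= a * b * (k + 3)"
 using card_mono[OF _ Isub] by (simp add: card_cartesian_product algebra_simps)
 have sub: "{f. ~ good_cells p f} \<subseteq> ?A \<union> (\<Union>t\<in>I. ?N t)"
 proof
 fix f assume "f \<in> {f. ~ good_cells p f}"
 then have "~ good_cells p f" by simp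
 then consider "\<exists>i\<le>D. int p dvd det (lead (Amat f) i)"
  | i j m where "i < a" "j < b" "Sl ! i ~= Tl ! j" "m <= k + 2" "matchable (Sl ! i) (Tl ! j) m" "int p dvd det (bordered i j m f)"
  unfolding good_cells_def a_def b_def by blast
 then show "f \<in> ?A \<union> (\<Union>t\<in>I. ?N t)"
 proof cases
  case 2
  then have "(i, j, m) \<in> I" "f \<in> ?N (i, j, m)" by (auto simp: I_def)
  then show ?thesis by blast
 qed auto
 qed
 have "?Pr {f. ~ good_cells p f} <= ?Pr (?A \<union> (\<Union>t\<in>I. ?N t))"
 by (rule measure_pmf.finite_measure_mono[OF sub]) simp
 also have "... <= ?Pr ?A + ?Pr (\<Union>t\<in>I. ?N t)" by (rule measure_subadditive) auto
 also have "?Pr (\<Union>t\<in>I. ?N t) <= (\<Sum>t\<in>I. ?Pr (?N t))"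
 by (rule measure_pmf.finite_measure_subadditive_finite[OF finI]) auto
 also have "(\<Sum>t\<in>I. ?Pr (?N t)) <= card I * (2 * real (D + k + 2) / real p)"
 using sum_mono[OF N] by simp
 also have "card I * (2 * real (D + k + 2) / real p) <= real (a * b * (k + 3)) * (2 * real (D + k + 2) / real p)"
 using cardI by (intro mult_right_mono of_nat_mono) auto
 finally have le: "?Pr {f. ~ good_cells p f} <= 2 * real D / real p + real (a * b * (k + 3)) * (2 * real (D + k + 2) / real p)"
 using A by simp
 have D1: "1 <= D" by (simp add: D_def)
 \<comment> \<open>If there is a pair, \<open>a * k\<close> and \<open>b * k\<close> are at most
   \<open>D\<close>, so \<open>a * b * k <= D * D\<close> and the whole sum is cubic in
   \<open>D\<close>. The constant 1024 in the lower bound on \<open>p\<close> is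
   \<open>8 * 128\<close>.\<close>
 have bound: "2 * D + a * b * (k + 3) * (2 * (D + k + 2)) <= 128 * D ^ 3"
 proof (cases "a * b = 0")
 case True
 have "D * 1 <= D * (D * D)" using D1 by (intro mult_le_mono2) simp
 then show ?thesis using True by (auto simp: power3_eq_cube)
 next
 case False
 then have ab: "1 <= a" "1 <= b" by auto
 have s: "n + a * k + b * k <= D" using size by (simp add: D_def a_def b_def algebra_simps)
 have "1 * k <= a * k" "1 * k <= b * k" using ab by (intro mult_le_mono1; simp)+
 then have k: "D + k + 2 <= 3 * D" using s n_pos k_pos by linarith
 have "a * b * k <= (a * k) * (b * k)" using k_pos by (simp add: algebra_simps)
 also have "... <= D * D" using s by (intro mult_mono) auto
 finally have abk: "a * b * k <= D * D" .
 have "a * b * (k + 3) <= 4 * (a * b * k)" using k_pos by (simp add: algebra_simps)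
 then have "a * b * (k + 3) <= 4 * (D * D)" using abk by linarith
 from mult_le_mono[OF this mult_le_mono2[OF k, of 2]]
 have "a * b * (k + 3) * (2 * (D + k + 2)) <= (4 * (D * D)) * (2 * (3 * D))" .
 moreover have "D * 1 <= D * (D * D)" using D1 by (intro mult_le_mono2) simp
 then have "D <= D ^ 3" by (simp add: power3_eq_cube)
 moreover have "4 * (D * D) * (2 * (3 * D)) = 24 * D ^ 3" by (simp add: power3_eq_cube)
 ultimately show ?thesis by linarith
 qed
 have "2 * real D / real p + real (a * b * (k + 3)) * (2 * real (D + k + 2) / real p)
 = real (2 * D + a * b * (k + 3) * (2 * (D + k + 2))) / real p"
 unfolding of_nat_add of_nat_mult times_divide_eq_right add_divide_distrib[symmetric] by simp
 also have "... <= real (128 * D ^ 3) / real p" using bound p0 by (intro divide_right_mono of_nat_mono) auto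
 also have "... <= 1 / 8"
 proof -
 have "real (1024 * D ^ 3) <= real p" using p(3) by (rule of_nat_mono)
 then show ?thesis using p0 by (simp add: divide_le_eq)
 qed
 finally show ?thesis using le by linarith
qed

end

section \<open>Sampling the cells and a prime\<close>

abbreviation (input) "rN == 30 :: nat"
abbreviation (input) "rK == 31 :: nat"
abbreviation (input) "rSB == 32 :: nat"
abbreviation (input) "rTB == 33 :: nat"
abbreviation (input) "rAJ == 34 :: nat"
abbreviation (input) "rSL == 35 :: nat"
abbreviation (input) "rSA == 36 :: nat"
abbreviation (input) "rTS == 37 :: nat"
abbreviation (input) "rTA == 38 :: nat"
abbreviation (input) "rIX == 39 :: nat"
abbreviation (input) "rTMP == 40 :: nat"
abbreviation (input) "rD == 41 :: nat"
abbreviation (input) "rQ == 42 :: nat"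
abbreviation (input) "rH == 43 :: nat"
abbreviation (input) "rHC == 44 :: nat"
abbreviation (input) "rG == 45 :: nat"
abbreviation (input) "rE == 46 :: nat"
abbreviation (input) "rX == 47 :: nat"
abbreviation (input) "rLO == 48 :: nat"
abbreviation (input) "rLR == 49 :: nat"
abbreviation (input) "rRND == 50 :: nat"
abbreviation (input) "rCJ == 51 :: nat"
abbreviation (input) "rC == 52 :: nat"
abbreviation (input) "rFL == 53 :: nat"
abbreviation (input) "rDV == 54 :: nat"

text \<open>Reduction is free of bias when the modulus divides the range, as is the case for powers
  of two.\<close>

lemma uniform_mod:
 assumes "0 < a" "0 < b"
 shows "map_pmf (%x. x mod b) (pmf_of_set {..<a * b :: nat}) = pmf_of_set {..<b}"
proof (rule pmf_eqI)
 fix y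
 have "pmf (map_pmf (%x. x mod b) (pmf_of_set {..<a * b})) y = measure_pmf.prob (pmf_of_set {..<a * b}) {x. x mod b = y}"
 by (simp add: pmf_map vimage_def)
 also have "... = card {x. x < a * b & x mod b = y} / (a * b)"
 using prob_uniform[of "a * b" "{x. x mod b = y}"] assms by simp
 also have "{x. x < a * b & x mod b = y} = (if y < b then (%i. i * b + y) ` {..<a} else {})"
 proof (cases "y < b")
 case True
 have "x \<in> (%i. i * b + y) ` {..<a}" if "x < a * b" "x mod b = y" for x
  using that div_mult_mod_eq[of x b] by (intro image_eqI[of _ _ "x div b"]) (auto simp: less_mult_imp_div_less)
 moreover have "i * b + y < a * b" if "i < a" for i
 proof -
  have "i * b + y < Suc i * b" using True by simp
  also have "... <= a * b" using that by (intro mult_le_mono1) simp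
  finally show ?thesis .
 qed
 ultimately show ?thesis using True by auto
 next
 case False
 then show ?thesis using assms(2) by (auto simp: not_less) (meson mod_less_divisor not_le)
 qed
 also have "real (card (if y < b then (%i. i * b + y) ` {..<a} else {})) / (a * b) = pmf (pmf_of_set {..<b}) y"
 using assms by (auto simp: card_image inj_on_def lessThan_empty_iff)
 finally show "pmf (map_pmf (%x. x mod b) (pmf_of_set {..<a * b})) y = pmf (pmf_of_set {..<b}) y" .
qed

text \<open>A drawn word ranges over everything below \<open>2 ^ w\<close> and may exceed the bound
  \<open>B\<close> on registers, so it is reduced when stored and then erased from its register. The
  heap pointer stays put until all cells are filled.\<close>

definition rand_loop :: cmd where
 "rand_loop = While (Less (Reg rIX) (Reg rLR))
  (Seq (Rand rTMP)
  (Seq (Store (Add (Reg HP) (Reg rIX)) (Mod (Reg rTMP) (Reg RW)))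
  (Seq (Assign rTMP (Const 0)) (Assign rIX (Add (Reg rIX) (Const 1))))))"

definition rand_state :: "state => nat => (nat => nat) => state" where
 "rand_state s i f = \<lparr>regs = (regs s)(rIX := i, rTMP := 0),
  mem = %a. if regs s HP <= a & a < regs s HP + i then f (a - regs s HP) else mem s a\<rparr>"

lemma run_rand_body:
 assumes s: "regs s RW = 2 ^ v" "regs s rLR = L" "v <= w" "regs s HP + L < 2 ^ w" and i: "i < L"
 shows "run w 8 (rand_loop # cs, rand_state s i f) =
 map_pmf (%x. (rand_loop # cs, rand_state s (Suc i) (f(i := x)))) (pmf_of_set {..<2 ^ v})"
proof -
 have l: "regs s HP + i < 2 ^ w" "Suc i < 2 ^ w" using s i by linarith+
 have w0: "w ~= 0"
 proof
 assume "w = 0"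
 then show False using l by simp
 qed
 then have c: "1 mod 2 ^ w = (1 :: nat)" "(0 :: nat) mod 2 ^ w = 0" by simp_all
 \<comment> \<open>One iteration consists of the loop test, three unfoldings of \<open>Seq\<close>
   and four basic commands.\<close>
 have e8: "8 = Suc (Suc (Suc (Suc (Suc (Suc (Suc (Suc 0)))))))" by simp
 have eq: "rand_state s i f\<lparr>regs := (regs (rand_state s i f))(rTMP := 0, rIX := Suc i),
  mem := (mem (rand_state s i f))(regs s HP + i := x mod 2 ^ v)\<rparr> = rand_state s (Suc i) (f(i := x mod 2 ^ v))" for x
 by (auto simp: rand_state_def fun_eq_iff)
 have "run w 8 (rand_loop # cs, rand_state s i f) =
 map_pmf (%x. (rand_loop # cs, rand_state s i f\<lparr>regs := (regs (rand_state s i f))(rTMP := 0, rIX := Suc i),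
  mem := (mem (rand_state s i f))(regs s HP + i := x mod 2 ^ v)\<rparr>)) (pmf_of_set {..<2 ^ w})"
 unfolding e8
 using s i l c
 by (simp add: rand_loop_def rand_state_def bind_return_pmf bind_map_pmf map_pmf_def bind_assoc_pmf
  del: One_nat_def) (auto intro!: bind_pmf_cong simp: fun_eq_iff)
 also have "... = map_pmf (%x. (rand_loop # cs, rand_state s (Suc i) (f(i := x)))) (map_pmf (%x. x mod 2 ^ v) (pmf_of_set {..<2 ^ w}))"
 unfolding eq by (simp add: pmf.map_comp o_def)
 also have "map_pmf (%x. x mod 2 ^ v) (pmf_of_set {..<2 ^ w}) = pmf_of_set {..<2 ^ v :: nat}"
 using uniform_mod[of "2 ^ (w - v)" "2 ^ v"] s(3) by (simp add: power_add[symmetric])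
 finally show ?thesis .
qed

lemma run_rand_loop:
 assumes s: "regs s RW = 2 ^ v" "regs s rLR = L" "v <= w" "regs s HP + L < 2 ^ w" and i: "i <= L"
 shows "run w (8 * i) (rand_loop # cs, rand_state s 0 (%_. 0)) =
 map_pmf (%f. (rand_loop # cs, rand_state s i f)) (rnd_cells {..<i} (2 ^ v))"
 using i
proof (induction i)
 case 0
 then show ?case by (simp add: rnd_cells_def map_pmf_def bind_return_pmf)
next
 case (Suc i)
 have "run w (8 * Suc i) (rand_loop # cs, rand_state s 0 (%_. 0)) =
 bind_pmf (run w (8 * i) (rand_loop # cs, rand_state s 0 (%_. 0))) (run w 8)"
 using run_add[of w "8 * i" 8] by (simp add: add.commute)
 also have "... = bind_pmf (rnd_cells {..<i} (2 ^ v)) (%f. run w 8 (rand_loop # cs, rand_state s i f))"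
 using Suc by (simp add: bind_map_pmf)
 also have "... = bind_pmf (rnd_cells {..<i} (2 ^ v)) (%f.
 map_pmf (%x. (rand_loop # cs, rand_state s (Suc i) (f(i := x)))) (pmf_of_set {..<2 ^ v}))"
 using run_rand_body[OF s, of i] Suc.prems by simp
 also have "... = map_pmf (%f. (rand_loop # cs, rand_state s (Suc i) f)) (rnd_cells {..<Suc i} (2 ^ v))"
 unfolding rnd_cells_def lessThan_Suc
 by (subst Pi_pmf_insert) (simp_all add: map_pmf_def pair_pmf_def bind_assoc_pmf bind_return_pmf,
  subst bind_commute_pmf, simp)
 finally show ?case .
qed

text \<open>By \<open>many_primes\<close> there are about \<open>2 ^ e / e\<close> primes below
  \<open>2 ^ e\<close>, and excluding those below \<open>lo\<close> costs less than half of them. So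
  at least a fraction \<open>1 / (2 * e)\<close> of all candidates is suitable, and
  \<open>6 * e\<close> independent trials all fail with probability at most
  \<open>exp (- 3)\<close>.\<close>

lemma prob_no_prime:
 assumes e: "2 <= e" "2 + 2 * (e * lo) <= 2 ^ e" and J: "finite J" "card J = 6 * e" and a: "0 < a"
 shows "measure_pmf.prob (rnd_cells J (a * 2 ^ e)) {f. \<forall>j\<in>J. ~ (prime (f j mod 2 ^ e) & lo <= f j mod 2 ^ e)} <= 1 / 8"
proof -
 define X :: nat where "X = 2 ^ e"
 have X: "0 < X" by (simp add: X_def)
 let ?ok = "%x. prime x & lo <= (x :: nat)"
 let ?G = "{x. x < X & ?ok x}" and ?B = "{x. x < X & ~ ?ok x}"
 have "card {q. prime q & q < X} <= card (?G \<union> {..<lo})" by (intro card_mono) auto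
 also have "... <= card ?G + lo" using card_Un_le[of ?G "{..<lo}"] by simp
 finally have "e * card {q. prime q & q < X} <= e * card ?G + e * lo" by (metis add_mult_distrib2 mult_le_mono2)
 then have G: "X <= 2 * (e * card ?G)" using many_primes[OF e(1)] e(2) unfolding X_def by linarith
 have "card (?G \<union> ?B) = card ?G + card ?B" by (rule card_Un_disjoint) auto
 moreover have "?G \<union> ?B = {..<X}" by auto
 ultimately have GB: "card ?G + card ?B = X" by simp
 have "real X <= 2 * (real e * real (card ?G))" using of_nat_mono[OF G, where 'a = real] by simp
 then have "real (card ?G) \<ge> X / (2 * e)" using e(1) by (simp add: field_simps)
 moreover have "real (card ?G) + real (card ?B) = real X" using GB by (metis of_nat_add)
 ultimately have "real (card ?B) <= X * (1 - 1 / (2 * e))" by (simp add: algebra_simps)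
 then have B: "real (card ?B) / X <= 1 - 1 / (2 * e)" using X by (simp add: divide_le_eq mult.commute)
 have one: "measure_pmf.prob (pmf_of_set {..<a * X}) {x. ~ ?ok (x mod X)} = real (card ?B) / X"
 proof -
 have "measure_pmf.prob (pmf_of_set {..<a * X}) {x. ~ ?ok (x mod X)} =
  measure_pmf.prob (map_pmf (%x. x mod X) (pmf_of_set {..<a * X})) {x. ~ ?ok x}"
  by (simp add: vimage_def)
 then show ?thesis using uniform_mod[OF a X] prob_uniform[OF X, of "{x. ~ ?ok x}"] by simp
 qed
 have "{f. \<forall>j\<in>J. ~ ?ok (f j mod X)} = Pi J (%_. {x. ~ ?ok (x mod X)})" by (auto simp: Pi_def)
 then have "measure_pmf.prob (rnd_cells J (a * X)) {f. \<forall>j\<in>J. ~ ?ok (f j mod X)} = (real (card ?B) / X) ^ (6 * e)"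
 unfolding rnd_cells_def using measure_Pi_pmf_Pi[OF J(1), of 0 "%_. pmf_of_set {..<a * X}"] one J(2) by simp
 also have "... <= (exp (- (1 / (2 * e)))) ^ (6 * e)"
 using B exp_ge_add_one_self[of "- (1 / (2 * real e))"] by (intro power_mono) auto
 also have "... = exp (- 3)"
 using e(1) by (simp add: exp_of_nat_mult[symmetric])
 also have "... <= 1 / 8"
 proof -
 have "(2 :: real) ^ 3 <= exp 1 ^ 3" using exp_ge_add_one_self[of 1] by (intro power_mono) auto
 also have "... = exp 3" by (simp add: exp_of_nat_mult[symmetric])
 finally show ?thesis by (simp add: exp_minus field_simps)
 qed
 finally show ?thesis by (simp add: X_def)
qed

text \<open>The last suitable candidate wins, as in the loop of the program; 0 reports that there
  was none.\<close>

fun pick :: "(nat => nat) => nat => nat => nat" where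
 "pick g lo 0 = 0"
| "pick g lo (Suc j) = (if prime (g j) & lo <= g j then g j else pick g lo j)"

lemma pick_nonzero: "pick g lo m ~= 0 ==> prime (pick g lo m) & lo <= pick g lo m & (EX j<m. pick g lo m = g j)"
 by (induction m) (auto simp: less_Suc_eq split: if_splits)

lemma pick_zero: "pick g lo m = 0 ==> j < m ==> ~ (prime (g j) & lo <= g j)"
 by (induction m) (auto simp: less_Suc_eq split: if_splits)

lemma pick_cong: "(!!j. j < m ==> g j = h j) ==> pick g lo m = pick h lo m"
 by (induction m) auto

section \<open>Joint failure probability of prime and cells\<close>

context instance_data
begin

lemma good_cells_cong:
 assumes fg: "!!c. c < 3 * (D * D) ==> f c = g c"
 shows "good_cells p f \<longleftrightarrow> good_cells p g"
proof -
 have "f (x * D + y) = g (x * D + y)" if "x < D" "y < D" for x y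
 using flat_less[OF that] by (intro fg) linarith
 then have A: "Amat f = Amat g" by (auto simp: Amat_def)
 have "bordered i j m f = bordered i j m g"
 if "i < length Sl" "j < length Tl" "Sl ! i ~= Tl ! j" "m <= k + 2" for i j m
 unfolding bordered_def random_mat_def
 using fg[OF bpos_props(1)[OF that]] by auto
 then show ?thesis unfolding good_cells_def A by auto
qed

text \<open>The prime depends only on the candidate cells from \<open>3 * (D * D)\<close> on, and
  the minors only on the cells below. Once the candidates are fixed the prime is a constant, and
  \<open>prob_bad_cells\<close> applies to the independent rest.\<close>

lemma prob_failure:
 assumes e: "2 <= e" "2 + 2 * (e * (1024 * D ^ 3)) <= 2 ^ e" and a: "0 < a"
 shows "measure_pmf.prob (rnd_cells {..<3 * (D * D) + 6 * e} (a * 2 ^ e))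
 {f. let p = pick (%j. f (3 * (D * D) + j) mod 2 ^ e) (1024 * D ^ 3) (6 * e) in p = 0 \<or> ~ good_cells p f} <= 1 / 4"
proof -
 define m where "m = 3 * (D * D)"
 let ?N = "a * 2 ^ e" and ?lo = "1024 * D ^ 3"
 let ?A = "{..<m}" and ?C = "{m..<m + 6 * e}"
 let ?p = "%f. pick (%j. f (m + j) mod 2 ^ e) ?lo (6 * e)"
 let ?bad = "{f. ?p f = 0 \<or> ~ good_cells (?p f) f}"
 let ?X = "{g. \<forall>j\<in>?C. ~ (prime (g j mod 2 ^ e) & ?lo <= g j mod 2 ^ e)}"
 let ?mg = "%f g x. if x \<in> ?A then f x else g x"
 have dj: "?A \<inter> ?C = {}" by auto
 have "{..<m + 6 * e} = ?A \<union> ?C" by auto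
 then have "rnd_cells {..<m + 6 * e} ?N = map_pmf (%(f, g). ?mg f g) (pair_pmf (rnd_cells ?A ?N) (rnd_cells ?C ?N))"
 unfolding rnd_cells_def by (simp only: Pi_pmf_union[OF finite_lessThan finite_atLeastLessThan dj])
 also have "... = bind_pmf (rnd_cells ?C ?N) (%g. map_pmf (%f. ?mg f g) (rnd_cells ?A ?N))"
 unfolding pair_pmf_def map_pmf_def
 by (subst bind_commute_pmf) (simp add: bind_assoc_pmf bind_return_pmf)
 finally have eq: "rnd_cells {..<m + 6 * e} ?N = bind_pmf (rnd_cells ?C ?N) (%g. map_pmf (%f. ?mg f g) (rnd_cells ?A ?N))" .
 have "measure_pmf.prob (bind_pmf (rnd_cells ?C ?N) (%g. map_pmf (%f. ?mg f g) (rnd_cells ?A ?N))) ?bad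
 <= measure_pmf.prob (rnd_cells ?C ?N) ?X + 1 / 8"
 proof (rule prob_bind_le)
 fix g assume "g ~: ?X"
 then obtain j where "j \<in> ?C" "prime (g j mod 2 ^ e) & ?lo <= g j mod 2 ^ e" by blast
 then have ok: "j - m < 6 * e" "prime (g (m + (j - m)) mod 2 ^ e) & ?lo <= g (m + (j - m)) mod 2 ^ e" by auto
 define p where "p = ?p g"
 have "p ~= 0" using pick_zero[of "%j. g (m + j) mod 2 ^ e" ?lo "6 * e" "j - m"] ok unfolding p_def by blast
 then have p: "prime p" "?lo <= p" "EX j<6 * e. p = g (m + j) mod 2 ^ e"
  using pick_nonzero unfolding p_def by blast+
 have "p < 2 ^ e" using p(3) by auto
 moreover have "2 ^ e <= ?N" using a by simp
 ultimately have pN: "p <= ?N" by linarith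
 have pf: "?p (?mg f g) = p" for f unfolding p_def by (rule pick_cong) simp
 have "measure_pmf.prob (map_pmf (%f. ?mg f g) (rnd_cells ?A ?N)) ?bad =
  measure_pmf.prob (rnd_cells ?A ?N) {f. ~ good_cells p f}"
 proof -
  have "(%f. ?mg f g) -` ?bad = {f. ~ good_cells p f}"
  using good_cells_cong[of "?mg f g" f p for f] pf \<open>p ~= 0\<close> by (auto simp: m_def)
  then show ?thesis by simp
 qed
 also have "... <= 1 / 8" using prob_bad_cells[of ?A p ?N] p pN by (simp add: m_def)
 finally show "measure_pmf.prob (map_pmf (%f. ?mg f g) (rnd_cells ?A ?N)) ?bad <= 1 / 8" .
 qed simp
 also have "measure_pmf.prob (rnd_cells ?C ?N) ?X <= 1 / 8"
 by (rule prob_no_prime) (use e a in auto)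
 finally show ?thesis unfolding eq[symmetric] by (simp add: m_def Let_def)
qed

end

section \<open>The exponent is at least two\<close>

lemma step_changes:
 "x \<in> set_pmf (step w y) ==> EX a. ALL a'. a' ~= a --> mem (snd x) a' = mem (snd y) a'"
 by (cases "(w, y)" rule: step.cases) (auto split: if_splits)

lemma run_changes:
 "x \<in> set_pmf (run w t y) ==> EX S. finite S & card S <= t & (ALL a. a ~: S --> mem (snd x) a = mem (snd y) a)"
proof (induction t arbitrary: y)
 case 0
 then show ?case by (auto intro!: exI[of _ "{}"])
next
 case (Suc t)
 then obtain z where z: "z \<in> set_pmf (step w y)" "x \<in> set_pmf (run w t z)" by auto
 obtain a where a: "ALL a'. a' ~= a --> mem (snd z) a' = mem (snd y) a'" using step_changes[OF z(1)] by blast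
 obtain S where S: "finite S" "card S <= t" "ALL a. a ~: S --> mem (snd x) a = mem (snd z) a" using Suc.IH[OF z(2)] by blast
 have "card (insert a S) <= Suc t" using S by (simp add: card_insert_if)
 then show ?case using S a by (intro exI[of _ "insert a S"]) auto
qed

text \<open>Each step changes at most one cell. If all entries of the product exceed every number in
  the input, none of the \<open>n * n\<close> output cells can have its initial content, wherever
  the output is placed; so at least \<open>n * n\<close> steps are needed.\<close>

lemma matmul_time_ge_2:
 assumes "matmul_time \<tau>"
 shows "2 <= \<tau>"
proof (rule ccontr)
 assume "~ 2 <= \<tau>"
 then have \<tau>: "0 < 2 - \<tau>" by simp
 obtain P c C where H: "ALL n m w A B. 1 <= n & 1 <= m & (n + m) ^ c <= 2 ^ w
  & A \<in> carrier_mat n n & B \<in> carrier_mat n n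
  & (ALL i<n. ALL j<n. A $$ (i, j) < m & B $$ (i, j) < m) -->
  (\<forall>x \<in> set_pmf (run w (nat \<lfloor>C * real n powr \<tau>\<rfloor>)
  (start P ([n, m] @ mat_words A @ mat_words B))).
  has_output x (mat_words (A * B)))"
 using assms unfolding matmul_time_def by blast
 have key: "real (n * n) <= C * real n powr \<tau>" if n: "1 <= n" for n
 proof -
 \<comment> \<open>Two constant matrices with entry \<open>m - 1\<close> have a product with entries
   \<open>n * ((m - 1) * (m - 1)) > m\<close>, while no initial cell exceeds
   \<open>m\<close>.\<close>
 define m where "m = n + 3"
 define w where "w = (n + m) * c"
 define A :: "nat mat" where "A = mat n n (%_. m - 1)"
 define t where "t = nat \<lfloor>C * real n powr \<tau>\<rfloor>"
 have "n + m <= 2 ^ (n + m)" using less_exp[of "n + m"] by simp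
 then have "(n + m) ^ c <= 2 ^ w" unfolding w_def power_mult by (rule power_mono) simp
 then have all: "\<forall>x \<in> set_pmf (run w t (start P ([n, m] @ mat_words A @ mat_words A))). has_output x (mat_words (A * A))"
  unfolding t_def using n by (intro H[THEN spec, THEN spec, THEN spec, THEN spec, THEN spec, THEN mp]) (auto simp: A_def m_def)
 obtain x where x: "x \<in> set_pmf (run w t (start P ([n, m] @ mat_words A @ mat_words A)))" using set_pmf_not_empty by fast
 obtain S where S: "finite S" "card S <= t"
  "ALL a. a ~: S --> mem (snd x) a = mem (snd (start P ([n, m] @ mat_words A @ mat_words A))) a"
  using run_changes[OF x] by blast
 have out: "has_output x (mat_words (A * A))" using all x by blast
 have len: "length (mat_words (A * A)) = n * n" by (simp add: length_mat_words A_def)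
 have entry: "mat_words (A * A) ! i = n * ((m - 1) * (m - 1))" if i: "i < n * n" for i
 proof -
  have "i div n < n" "i mod n < n" using i n by (auto simp: less_mult_imp_div_less)
  then show ?thesis using i by (simp add: mat_words_conv A_def scalar_prod_def)
 qed
 have big: "m < n * ((m - 1) * (m - 1))"
 proof -
  have "1 * (3 * (n + 2)) <= n * ((m - 1) * (m - 1))" using n by (intro mult_le_mono) (auto simp: m_def)
  then show ?thesis by (simp add: m_def)
 qed
 have small: "mem (snd (start P ([n, m] @ mat_words A @ mat_words A))) a <= m" for a
 proof -
  have "z <= m" if "z \<in> set ([n, m] @ mat_words A @ mat_words A)" for z
  proof -
  have d: "dim_row A = n" "dim_col A = n" "!!i j. i < n ==> j < n ==> A $$ (i, j) = m - 1" by (auto simp: A_def)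
  have "z = n | z = m | z \<in> set (mat_words A)" using that by auto
  moreover have "z = m - 1" if zA: "z \<in> set (mat_words A)"
  proof -
  obtain i j where "i < n" "j < n" "z = A $$ (i, j)" using zA d(1,2) by (auto simp: mat_words_def)
  then show ?thesis using d(3) by simp
  qed
  ultimately show ?thesis by (auto simp: m_def)
  qed
  then have le: "z <= m" if "z \<in> set ([n, m] @ mat_words A @ mat_words A)" for z using that by blast
  define xs where "xs = [n, m] @ mat_words A @ mat_words A"
  have "xs ! a <= m" if "a < length xs" using le nth_mem[OF that] unfolding xs_def by blast
  then show ?thesis unfolding start_def snd_conv state.select_convs xs_def[symmetric] by simp
 qed
 have "{regs (snd x) 0..<regs (snd x) 0 + n * n} \<subseteq> S"
 proof
  fix a assume a: "a \<in> {regs (snd x) 0..<regs (snd x) 0 + n * n}"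
  then obtain i where i: "a = regs (snd x) 0 + i" "i < n * n" using le_Suc_ex[of "regs (snd x) 0" a] by auto
  have "mem (snd x) a = n * ((m - 1) * (m - 1))"
  using out len entry[OF i(2)] i unfolding has_output_def by metis
  then have "mem (snd x) a ~= mem (snd (start P ([n, m] @ mat_words A @ mat_words A))) a"
  using small[of a] big by linarith
  then show "a \<in> S" using S(3) by blast
 qed
 from card_mono[OF S(1) this] have "n * n <= card S" unfolding card_atLeastLessThan by linarith
 then have nt: "n * n <= t" using S(2) by simp
 moreover have "1 <= n * n" using n by simp
 ultimately have "1 <= t" by linarith
 then have "real t <= C * real n powr \<tau>" unfolding t_def by linarith
 moreover have "real (n * n) <= real t" using nt by (rule of_nat_mono)
 ultimately show ?thesis by linarith
 qed
 define M where "M = max C 0 + 1"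
 have M: "1 <= M" "C < M" by (auto simp: M_def)
 \<comment> \<open>Large enough for \<open>n powr (2 - \<tau>) >= M > C\<close>, which contradicts
   \<open>n * n <= C * n powr \<tau>\<close>.\<close>
 define n where "n = nat \<lceil>M powr (1 / (2 - \<tau>))\<rceil> + 1"
 have n1: "1 <= n" by (simp add: n_def)
 have nM: "M powr (1 / (2 - \<tau>)) <= real n" unfolding n_def by linarith
 have "M = (M powr (1 / (2 - \<tau>))) powr (2 - \<tau>)" using M \<tau> by (simp add: powr_powr)
 also have "... <= real n powr (2 - \<tau>)" using nM \<tau> by (intro powr_mono2) auto
 finally have "M * real n powr \<tau> <= real n powr (2 - \<tau>) * real n powr \<tau>" by (rule mult_right_mono) simp
 also have "... = real (n * n)" using n1 by (simp add: powr_add[symmetric] powr_realpow power2_eq_square)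
 also have "... <= C * real n powr \<tau>" using key[OF n1] .
 finally have "M * real n powr \<tau> <= C * real n powr \<tau>" .
 moreover have "0 < real n powr \<tau>" using n1 by simp
 ultimately show False using M(2) by (simp add: mult_le_cancel_right)
qed

section \<open>Loops\<close>

context ram
begin

lemma call_While_step:
 assumes b: "small b" "ok s ==> evn s b ~= 0"
 and c: "call F T c s Q1" "!!s1. fr F s s1 ==> Q1 s1 ==> call F T' (While b c) s1 Q"
 shows "call F (1 + T + T') (While b c) s Q"
proof (rule callI)
 assume 1: "ok s" "regs s HP + (1 + T + T') * V <= B"
 have V: "(1 + T + T') * V = V + T * V + T' * V" by (simp add: algebra_simps)
 then have b1: "regs s HP + T * V <= B" using 1 by linarith
 obtain t1 s1 where s1: "t1 <= T" "exec w c s t1 s1" "fr F s s1" "regs s1 HP <= regs s HP + T * V" "Q1 s1"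
 using callD[OF c(1) 1(1) b1] by blast
 have b2: "regs s1 HP + T' * V <= B" using 1 V s1(4) by linarith
 obtain t2 s2 where s2: "t2 <= T'" "exec w (While b c) s1 t2 s2" "fr F s1 s2" "regs s2 HP <= regs s1 HP + T' * V" "Q s2"
 using callD[OF c(2)[OF s1(3,5)] fr_ok[OF s1(3)] b2] by blast
 have "eval w s b ~= 0" using b eval_evn 1(1) by simp
 from exec_While_step[OF this s1(2) s2(2)] show
 "EX t s'. t <= 1 + T + T' & exec w (While b c) s t s' & fr F s s' & regs s' HP <= regs s HP + (1 + T + T') * V & Q s'"
 using s1 s2 fr_trans[OF s1(3) s2(3)] V by (intro exI[of _ "1 + t1 + t2"] exI[of _ s2]) auto
qed

lemma call_While_stop: "small b ==> (ok s ==> evn s b = 0) ==> Q s ==> call F 1 (While b c) s Q"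
 by (rule callI) (use exec_While_stop eval_evn fr_refl in "auto intro!: exI[of _ 1] exI[of _ s]")

lemma tri_loop:
 assumes b: "small b" and step: "!!i. i < M ==> tri F T (I i) c (I (Suc i))"
 and cond: "!!i s. i < M ==> ok s ==> I i s ==> evn s b ~= 0" "!!s. ok s ==> I M s ==> evn s b = 0"
 shows "tri F (M * (T + 1) + 1) (I 0) (While b c) (I M)"
proof -
 have "call F ((M - i) * (T + 1) + 1) (While b c) s (I M)" if "i <= M" "I i s" for i s
 using that
 proof (induction "M - i" arbitrary: i s)
 case 0
 then have "i = M" by simp
 then show ?case using call_While_stop[OF b, of s "I M" F c] cond(2) 0 by simp
 next
 case (Suc m)
 then have i: "i < M" "Suc i <= M" "m = M - Suc i" by auto
 have "call F (1 + T + ((M - Suc i) * (T + 1) + 1)) (While b c) s (I M)"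
 proof (rule call_While_step[OF b])
  show "evn s b ~= 0" if "ok s" using cond(1)[OF i(1) that Suc.prems(2)] .
  show "call F T c s (I (Suc i))" using step[OF i(1)] Suc.prems(2) by (simp add: tri_def)
  show "call F ((M - Suc i) * (T + 1) + 1) (While b c) s1 (I M)" if "I (Suc i) s1" for s1
  using Suc.hyps(1)[OF i(3,2) that] .
 qed
 moreover have "1 + T + ((M - Suc i) * (T + 1) + 1) = (M - i) * (T + 1) + 1"
 proof -
  have "M - i = Suc (M - Suc i)" using i by simp
  then show ?thesis by simp
 qed
 ultimately show ?case by simp
 qed
 from this[of 0] show ?thesis by (simp add: tri_def)
qed

lemma tri_mono: "tri F T P c Q ==> T <= T' ==> tri F T' P c Q"
 by (rule tri_conseq[of F T P c Q]) auto

lemma tri_pre: "tri F T P c Q ==> (!!s. P' s ==> P s) ==> tri F T P' c Q"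
 by (rule tri_conseq[of F T P c Q]) auto

lemma tri_post: "tri F T P c Q ==> (!!s. Q s ==> Q' s) ==> tri F T P c Q'"
 by (rule tri_conseq[of F T P c Q]) auto

lemma rvf_Cons: "rvf ((r, x) # rv) s \<longleftrightarrow> regs s r = x & rvf rv s"
 by (auto simp: rvf_def)

lemma rvf_Nil: "rvf [] s"
 by (auto simp: rvf_def)

end

definition Eq :: "expr => expr => expr" where
 "Eq a b = Sub (Const 1) (Add (Less a b) (Less b a))"

lemma evn_Eq [simp]: "evn s (Eq a b) = (if evn s a = evn s b then 1 else 0)"
 by (auto simp: Eq_def)

lemma weight_Eq [simp]: "weight (Eq a b) = 1 + 2 * (weight a + weight b)"
 "consts_le n (Eq a b) \<longleftrightarrow> 1 <= n & consts_le n a & consts_le n b"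
 by (auto simp: Eq_def)

section \<open>Listing the members of a vertex set\<close>

definition collect :: "nat => nat => nat => cmd" where
 "collect b l a =
  Seq (tab l (Const 0) (Const 0))
 (Seq (Assign a (Const 0))
 (Seq (Assign rIX (Const 0))
  (While (Less (Reg rIX) (Reg rN))
  (Seq (Branch (cell b (Reg rIX)) (Seq (tab rTMP (Const 1) (Reg rIX)) (Assign a (Add (Reg a) (Const 1)))) Skip)
  (Assign rIX (Add (Reg rIX) (Const 1)))))))"

context ram
begin

text \<open>The length of the list is unknown in advance, so the list starts empty at the heap
  pointer and grows cell by cell. The invariant \<open>regs s HP = regs s l + length (ys i)\<close>
  keeps it contiguous.\<close>

lemma tri_collect:
 assumes regs: "b ~: {HP, TI, TL, l, a, rIX, rTMP}" "l ~: {HP, TI, TL, a, rIX, rTMP, rN}" "a ~: {HP, TI, TL, rIX, rTMP, rN}"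
 and av: "avoid {l, a, rIX, rTMP, TI, TL, HP} rv hs" and n: "(rN, n) \<in> set rv" "n <= B"
 and bits: "(b, n, %i. of_bool (i \<in> X)) \<in> set hs"
 defines "xs == filter (%i. i \<in> X) [0..<n]"
 shows "tru (n * 30 + 30) (asu s0 rv hs) (collect b l a)
  (asu s0 ((a, length xs) # rv) ((l, length xs, %i. xs ! i) # hs))"
proof -
 define ys where "ys i = filter (%i. i \<in> X) [0..<i]" for i
 have yl: "length (ys i) <= i" for i unfolding ys_def using length_filter_le[of "%i. i \<in> X" "[0..<i]"] by simp
 define I where "I = (%i s. asu s0 ((rIX, i) # (a, length (ys i)) # rv) ((l, length (ys i), %j. ys i ! j) # hs) s
  & regs s HP = regs s l + length (ys i))"
 have loop: "tru (n * (28 + 1) + 1) (I 0) (While (Less (Reg rIX) (Reg rN))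
  (Seq (Branch (cell b (Reg rIX)) (Seq (tab rTMP (Const 1) (Reg rIX)) (Assign a (Add (Reg a) (Const 1)))) Skip)
  (Assign rIX (Add (Reg rIX) (Const 1))))) (I n)"
 proof (rule tri_loop)
 fix i assume i: "i < n"
 show "tru 28 (I i) (Seq (Branch (cell b (Reg rIX)) (Seq (tab rTMP (Const 1) (Reg rIX)) (Assign a (Add (Reg a) (Const 1)))) Skip)
  (Assign rIX (Add (Reg rIX) (Const 1)))) (I (Suc i))"
  unfolding tri_def
 proof (intro allI impI)
  fix s assume Is: "I i s"
  have as: "asu s0 ((rIX, i) # (a, length (ys i)) # rv) ((l, length (ys i), %j. ys i ! j) # hs) s"
  and hp: "regs s HP = regs s l + length (ys i)" using Is by (auto simp: I_def)
  have bit: "evn s (cell b (Reg rIX)) = of_bool (i \<in> X)"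
  using hsfD[OF asrt_hsf[OF as], of b n "%i. of_bool (i \<in> X)" i] bits i rvfD[OF asrt_rvf[OF as], of rIX i] by simp
  \<comment> \<open>Postcondition of the branch, phrased as the invariant after the pending
    increment of \<open>rIX\<close>, so that both arms can share it.\<close>
  define J where "J = (%s'. I (Suc i) (upd s' rIX (Suc i)) & regs s' rIX = i)"
  have sB: "Suc i <= B" using i n by simp
  have br: "call UNIV 24 (Branch (cell b (Reg rIX)) (Seq (tab rTMP (Const 1) (Reg rIX)) (Assign a (Add (Reg a) (Const 1)))) Skip) s J"
  proof (rule call_Branch[where T' = 23])
  assume "ok s" "evn s (cell b (Reg rIX)) ~= 0"
  then have iX: "i \<in> X" using bit by (auto split: if_splits)
  then have ysS: "ys (Suc i) = ys i @ [i]" by (simp add: ys_def)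
  show "call UNIV 23 (Seq (tab rTMP (Const 1) (Reg rIX)) (Assign a (Add (Reg a) (Const 1)))) s J"
  proof (rule call_Seq[where ?T1.0 = 20 and ?T2.0 = 1])
  show "call UNIV 20 (tab rTMP (Const 1) (Reg rIX)) s (%s'. fr {rTMP, HP, TI, TL} s s' &
  regs s' = (regs s)(rTMP := regs s HP, TL := 1, TI := 1, HP := regs s HP + 1) & mem s' (regs s HP) = i)"
  proof (rule call_tab[where L = 1 and f = "%_. i"])
  show "evn s' (Reg rIX) = i & i <= B" if "regs s' = (regs s)(rTMP := regs s HP, TL := 1, TI := j)" for j s'
  using that rvfD[OF asrt_rvf[OF as], of rIX i] sB by simp
  qed (use B20 in "auto simp: small_def arr_def")
  fix s1 assume s1: "fr {rTMP, HP, TI, TL} s s1 &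
  regs s1 = (regs s)(rTMP := regs s HP, TL := 1, TI := 1, HP := regs s HP + 1) & mem s1 (regs s HP) = i"
  have ra: "regs s1 a = length (ys i)" "regs s1 rIX = i" using s1 regs rvfD[OF asrt_rvf[OF as], of a] rvfD[OF asrt_rvf[OF as], of rIX] by auto
  show "call UNIV 1 (Assign a (Add (Reg a) (Const 1))) s1 J"
  proof (rule call_Assign)
  show "evn s1 (Add (Reg a) (Const 1)) <= B" using ra yl[of i] sB by simp
  assume ok1: "ok s1"
  define s2 where "s2 = upd (upd s1 a (evn s1 (Add (Reg a) (Const 1)))) rIX (Suc i)"
  have ok2: "ok s2" unfolding s2_def using ok1 regs sB ra yl[of i] by (intro ok_upd) auto
  have m2: "mem s2 = mem s1" by (simp add: s2_def)
  have keep: "regs s2 z = regs s z" if "z ~: {a, rIX, rTMP, TI, TL, HP}" for z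
  using s1 that by (simp add: s2_def)
  have arrk: "arr (mem s2) z L g" if "arr (mem s) z L g" "z + L <= regs s HP" for z L g
  using fr_arr[OF conjunct1[OF s1] that] m2 by simp
  have hp2: "regs s2 HP = Suc (regs s HP)" using s1 regs by (simp add: s2_def)
  have "asu s0 ((rIX, Suc i) # (a, length (ys (Suc i))) # rv) ((l, length (ys (Suc i)), %j. ys (Suc i) ! j) # hs) s2"
  unfolding asrt_def
  proof (intro conjI)
  have "fr UNIV s s2" using ok2 s1 m2 hp2 unfolding fr_def by auto
  then show "fr UNIV s0 s2" using fr_trans[OF asrt_fr[OF as]] by blast
  show "rvf ((rIX, Suc i) # (a, length (ys (Suc i))) # rv) s2" unfolding rvf_def
  proof clarify
  fix z x assume z: "(z, x) \<in> set ((rIX, Suc i) # (a, length (ys (Suc i))) # rv)"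
  show "regs s2 z = x"
  proof (cases "(z, x) \<in> set rv")
  case True
  then have "z ~: {a, rIX, rTMP, TI, TL, HP}" using av by (auto simp: avoid_def)
  then show ?thesis using keep rvfD[OF asrt_rvf[OF as], of z x] True by simp
  next
  case False
  then show ?thesis using z regs ra ysS by (auto simp: s2_def)
  qed
  qed
  have l2: "regs s2 l = regs s l" using keep[of l] regs by simp
  show "\<forall>(z, L, g)\<in>set ((l, length (ys (Suc i)), %j. ys (Suc i) ! j) # hs). regs s2 z + L <= regs s2 HP & arr (mem s2) (regs s2 z) L g"
  proof clarify
  fix z L g assume z: "(z, L, g) \<in> set ((l, length (ys (Suc i)), %j. ys (Suc i) ! j) # hs)"
  show "regs s2 z + L <= regs s2 HP & arr (mem s2) (regs s2 z) L g"
  proof (cases "(z, L, g) \<in> set hs")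
  case True
  then have "z ~: {a, rIX, rTMP, TI, TL, HP}" using av by (auto simp: avoid_def)
  moreover have "regs s z + L <= regs s HP" "arr (mem s) (regs s z) L g" using as True by (auto simp: asrt_def)
  ultimately show ?thesis using keep arrk hp2 by simp
  next
  case False
  then have z: "z = l" "L = length (ys (Suc i))" "g = (%j. ys (Suc i) ! j)" using z by auto
  have "arr (mem s) (regs s l) (length (ys i)) (%j. ys i ! j)" using as by (auto simp: asrt_def)
  then have "arr (mem s2) (regs s l) (length (ys i)) (%j. ys i ! j)" using arrk hp by simp
  moreover have "mem s2 (regs s l + length (ys i)) = i" using s1 m2 hp by simp
  ultimately have "arr (mem s2) (regs s2 l) (length (ys (Suc i))) (%j. ys (Suc i) ! j)"
  using l2 ysS by (auto simp: arr_def nth_append less_Suc_eq)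
  then show ?thesis using z l2 hp2 hp ysS by simp
  qed
  qed
  qed
  moreover have "regs s2 HP = regs s2 l + length (ys (Suc i))" using hp2 hp keep[of l] regs ysS by simp
  ultimately show "J (upd s1 a (evn s1 (Add (Reg a) (Const 1))))"
  using ra regs by (simp add: J_def I_def s2_def)
  qed (use regs B20 in "auto simp: small_def")
  qed simp
  next
  assume ok: "ok s" and "evn s (cell b (Reg rIX)) = 0"
  then have "i ~: X" using bit by (auto split: if_splits)
  then have ysS: "ys (Suc i) = ys i" by (simp add: ys_def)
  define s2 where "s2 = upd s rIX (Suc i)"
  have ok2: "ok s2" unfolding s2_def using ok sB by (intro ok_upd) auto
  have "asu s0 ((rIX, Suc i) # (a, length (ys (Suc i))) # rv) ((l, length (ys (Suc i)), %j. ys (Suc i) ! j) # hs) s2"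
  unfolding asrt_def
  proof (intro conjI)
  have "fr UNIV s s2" using ok2 unfolding fr_def s2_def by auto
  then show "fr UNIV s0 s2" using fr_trans[OF asrt_fr[OF as]] by blast
  show "rvf ((rIX, Suc i) # (a, length (ys (Suc i))) # rv) s2"
  using asrt_rvf[OF as] av regs ysS by (auto simp: rvf_def s2_def avoid_def)
  show "\<forall>(z, L, g)\<in>set ((l, length (ys (Suc i)), %j. ys (Suc i) ! j) # hs). regs s2 z + L <= regs s2 HP & arr (mem s2) (regs s2 z) L g"
  proof clarify
  fix z L g assume "(z, L, g) \<in> set ((l, length (ys (Suc i)), %j. ys (Suc i) ! j) # hs)"
  then have z: "(z, L, g) \<in> set ((l, length (ys i), %j. ys i ! j) # hs)" using ysS by simp
  then have "z ~= rIX" using av regs by (auto simp: avoid_def)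
  moreover have "regs s z + L <= regs s HP & arr (mem s) (regs s z) L g" using as z by (auto simp: asrt_def)
  ultimately show "regs s2 z + L <= regs s2 HP & arr (mem s2) (regs s2 z) L g" by (simp add: s2_def)
  qed
  qed
  then have "J s" using hp ysS regs rvfD[OF asrt_rvf[OF as], of rIX i] by (simp add: J_def I_def s2_def)
  then show "call UNIV 23 Skip s J" by (rule call_Skip) simp
  qed (use B20 in "auto simp: small_def")
  show "call UNIV 28 (Seq (Branch (cell b (Reg rIX)) (Seq (tab rTMP (Const 1) (Reg rIX)) (Assign a (Add (Reg a) (Const 1)))) Skip)
  (Assign rIX (Add (Reg rIX) (Const 1)))) s (I (Suc i))"
  proof (rule call_Seq[OF br])
  fix s1 assume "J s1"
  then show "call UNIV 1 (Assign rIX (Add (Reg rIX) (Const 1))) s1 (I (Suc i))"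
  using sB B20 by (intro call_Assign) (auto simp: J_def small_def)
  qed simp
 qed
 next
 show "evn s (Less (Reg rIX) (Reg rN)) ~= 0" if "i < n" "I i s" for i s
 proof -
  have as: "asu s0 ((rIX, i) # (a, length (ys i)) # rv) ((l, length (ys i), %j. ys i ! j) # hs) s" using that by (simp add: I_def)
  show ?thesis using rvfD[OF asrt_rvf[OF as], of rIX i] rvfD[OF asrt_rvf[OF as], of rN n] n that by simp
 qed
 show "evn s (Less (Reg rIX) (Reg rN)) = 0" if "I n s" for s
 proof -
  have as: "asu s0 ((rIX, n) # (a, length (ys n)) # rv) ((l, length (ys n), %j. ys n ! j) # hs) s" using that by (simp add: I_def)
  show ?thesis using rvfD[OF asrt_rvf[OF as], of rIX n] rvfD[OF asrt_rvf[OF as], of rN n] n by simp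
 qed
 qed (use B20 in "auto simp: small_def")
 have init: "tru 15 (asu s0 rv hs) (tab l (Const 0) (Const 0))
 (%s. asu s0 rv ((l, 0, %j. ys 0 ! j) # hs) s & regs s HP = regs s l)"
 unfolding tri_def
 proof (intro allI impI)
 fix s assume as: "asu s0 rv hs s"
 show "call UNIV 15 (tab l (Const 0) (Const 0)) s (%s. asu s0 rv ((l, 0, %j. ys 0 ! j) # hs) s & regs s HP = regs s l)"
 proof (rule call_tab[where L = 0 and f = "%_. 0"])
  fix s' assume fr: "fr {l, HP, TI, TL} s s'" and reg: "regs s' = (regs s)(l := regs s HP, TL := 0, TI := 0, HP := regs s HP + 0)"
  have keep: "regs s' z = regs s z" if "z ~: {l, TI, TL}" for z using reg that by simp
  have "asu s0 rv ((l, 0, %j. ys 0 ! j) # hs) s'" unfolding asrt_def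
  proof (intro conjI)
  show "fr UNIV s0 s'" using fr_trans[OF asrt_fr[OF as] fr_mono[OF fr]] by blast
  show "rvf rv s'" using asrt_rvf[OF as] av keep unfolding rvf_def avoid_def by fastforce
  show "\<forall>(z, L, g)\<in>set ((l, 0, %j. ys 0 ! j) # hs). regs s' z + L <= regs s' HP & arr (mem s') (regs s' z) L g"
  proof clarify
  fix z L g assume z: "(z, L, g) \<in> set ((l, 0, %j. ys 0 ! j) # hs)"
  show "regs s' z + L <= regs s' HP & arr (mem s') (regs s' z) L g"
  proof (cases "(z, L, g) \<in> set hs")
  case True
  then have "z ~: {l, TI, TL}" using av by (auto simp: avoid_def)
  moreover have "regs s z + L <= regs s HP" "arr (mem s) (regs s z) L g" using as True by (auto simp: asrt_def)
  ultimately show ?thesis using keep[of z] keep[of HP] fr_arr[OF fr] regs by auto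
  next
  case False
  then show ?thesis using z reg regs by (auto simp: arr_def)
  qed
  qed
  qed
  then show "asu s0 rv ((l, 0, %j. ys 0 ! j) # hs) s' & regs s' HP = regs s' l" using reg regs by auto
 qed (use regs B20 in "auto simp: small_def")
 qed
 have set0: "tru 1 (%s. asu s0 rv' hs' s & regs s HP = regs s l) (Assign r (Const 0))
  (%s. asu s0 ((r, 0) # rv') hs' s & regs s HP = regs s l)"
 if "r ~: {HP, l}" "avoid {r} rv' hs'" for rv' hs' r
 unfolding tri_def
 proof (intro allI impI)
 fix s assume as: "asu s0 rv' hs' s & regs s HP = regs s l"
 show "call UNIV 1 (Assign r (Const 0)) s (%s. asu s0 ((r, 0) # rv') hs' s & regs s HP = regs s l)"
 proof (rule call_Assign)
  assume ok: "ok s"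
  have "ok (upd s r 0)" using ok that by (intro ok_upd) auto
  then have fru: "fr UNIV s (upd s r 0)" using that by (auto simp: fr_def)
  have "asu s0 ((r, 0) # rv') hs' (upd s r 0)" unfolding asrt_def
  proof (intro conjI)
  show "fr UNIV s0 (upd s r 0)" using fr_trans[OF asrt_fr fru] as by blast
  show "rvf ((r, 0) # rv') (upd s r 0)" using as that by (auto simp: asrt_def rvf_def avoid_def)
  show "\<forall>(z, L, g)\<in>set hs'. regs (upd s r 0) z + L <= regs (upd s r 0) HP & arr (mem (upd s r 0)) (regs (upd s r 0) z) L g"
  using as that unfolding asrt_def avoid_def by fastforce
  qed
  then show "asu s0 ((r, 0) # rv') hs' (upd s r (evn s (Const 0))) &
  regs (upd s r (evn s (Const 0))) HP = regs (upd s r (evn s (Const 0))) l"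
  using as that by simp
 qed (use that B20 in "auto simp: small_def")
 qed
 have ys0: "ys 0 = []" by (simp add: ys_def)
 have I0: "tru (n * (28 + 1) + 1) (%s. asu s0 ((rIX, 0) # (a, 0) # rv) ((l, 0, %j. ys 0 ! j) # hs) s & regs s HP = regs s l)
 (While (Less (Reg rIX) (Reg rN))
  (Seq (Branch (cell b (Reg rIX)) (Seq (tab rTMP (Const 1) (Reg rIX)) (Assign a (Add (Reg a) (Const 1)))) Skip)
  (Assign rIX (Add (Reg rIX) (Const 1))))) (I n)"
 by (rule tri_pre[OF loop]) (simp add: I_def ys0)
 have all: "tru (1 + 15 + (1 + 1 + (1 + 1 + (n * (28 + 1) + 1)))) (asu s0 rv hs) (collect b l a) (I n)"
 unfolding collect_def
 by (rule tri_Seq[OF init tri_Seq[OF set0 tri_Seq[OF set0 I0]]]) (use regs av in "auto simp: avoid_def")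
 show ?thesis
 proof (rule tri_conseq[OF all])
 fix s assume "I n s"
 then have "asu s0 ((rIX, n) # (a, length (ys n)) # rv) ((l, length (ys n), %j. ys n ! j) # hs) s" by (simp add: I_def)
 moreover have "ys n = xs" by (simp add: ys_def xs_def)
 ultimately show "asu s0 ((a, length xs) # rv) ((l, length xs, %i. xs ! i) # hs) s"
  by (auto elim: asrt_weaken)
 qed auto
qed

end

section \<open>Starting the heap and appending to arrays\<close>

lemma exec_run:
 assumes "exec w c s t s'" "t <= T"
 shows "run w T ([c], s) = return_pmf ([], s')"
proof -
 have "run w (t + (T - t)) ([c], s) = return_pmf ([], s')"
 using assms(1) by (simp add: exec_def run_add bind_return_pmf run_halted)
 then show ?thesis using assms(2) by simp
qed

context ram
begin

text \<open>At the start the heap pointer is 0 although the input is nonzero, so \<open>ok\<close>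
  does not hold yet and the first assignment needs a rule of its own. The same situation returns
  after the random cells have been written.\<close>

lemma exec_init:
 assumes "ALL r. regs s r <= B" "ALL a. mem s a <= B" "small e" "evn s e = h" "h <= B" "\<forall>a\<ge>h. mem s a = 0"
 shows "exec w (Assign HP e) s 1 (upd s HP h) & ok (upd s HP h)"
proof -
 have "B ^ weight e <= B ^ 200" using assms(3) B20 unfolding small_def by (intro power_increasing) auto
 then have "eval w s e = h"
 using eval_evn_weight[of s B e w] word B20 assms unfolding small_def by auto
 then have "exec w (Assign HP e) s 1 (upd s HP h)" using exec_Assign[of w HP e s] by simp
 moreover have "ok (upd s HP h)" using assms by (auto simp: ok_def)
 ultimately show ?thesis ..
qed

lemma tri_local:
 assumes "!!s1. tri F T (asrt F s1 rv hs) c (asrt F s1 rv' hs')" "HP ~: F" "l ~: F"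
 shows "tru T (%s. asu s0 rv hs s & regs s HP = regs s l + L) c
 (%s. asu s0 rv' hs' s & regs s HP = regs s l + L)"
 unfolding tri_def
proof (intro allI impI)
 fix s assume a: "asu s0 rv hs s & regs s HP = regs s l + L"
 then have "asrt F s rv hs s" using fr_refl[OF asrt_ok] by (auto simp: asrt_def)
 then have "call F T c s (asrt F s rv' hs')" using assms(1) by (simp add: tri_def)
 then show "call UNIV T c s (%s. asu s0 rv' hs' s & regs s HP = regs s l + L)"
 proof (rule call_conseq)
 fix s' assume fr: "fr F s s'" and as: "asrt F s rv' hs' s'"
 have "fr UNIV s0 s'" using fr_trans[OF asrt_fr fr_mono[OF fr subset_UNIV]] a by blast
 then show "asu s0 rv' hs' s' & regs s' HP = regs s' l + L"
  using as a fr_regs[OF fr] assms(2,3) by (auto simp: asrt_def)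
 qed auto
qed

text \<open>If the last array ends at the heap pointer, a new table extends it.\<close>

lemma tri_push:
 assumes r: "r ~: {HP, TI, TL, l}" "l ~: {HP, TI, TL}" and lx: "small lx" and e: "small e"
 and av: "avoid {r, HP, TI, TL} rv hs"
 and L: "!!s. ok s ==> rvf rv s ==> hsf hs s ==> evn s lx = m"
 and f: "!!i s. i < m ==> regs s TI = i ==> rvf rv s ==> hsf hs s ==> evn s e = g (L + i) & g (L + i) <= B"
 shows "tru (5 * m + 15) (%s. asu s0 rv ((l, L, g) # hs) s & regs s HP = regs s l + L) (tab r lx e)
 (%s. asu s0 rv ((l, L + m, g) # hs) s & regs s HP = regs s l + (L + m))"
 unfolding tri_def
proof (intro allI impI)
 fix s assume a: "asu s0 rv ((l, L, g) # hs) s & regs s HP = regs s l + L"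
 then have as: "asu s0 rv ((l, L, g) # hs) s" and hp: "regs s HP = regs s l + L" by auto
 have "call UNIV (5 * m + 15) (tab r lx e) s (%s'. asu s0 rv ((r, m, %i. g (L + i)) # (l, L, g) # hs) s' &
  fr {r, HP, TI, TL} s s' & regs s' HP = regs s HP + m & regs s' r = regs s HP)"
 proof (rule tri_tab_HP[OF _ _ lx e _ _ _ as])
 show "evn s' lx = m" if "ok s'" "rvf rv s'" "hsf ((l, L, g) # hs) s'" for s'
  using L[of s'] that by (simp add: hsf_def)
 show "evn s' e = g (L + i) & g (L + i) <= B" if "i < m" "regs s' TI = i" "rvf rv s'" "hsf ((l, L, g) # hs) s'" for i s'
  using f[of i s'] that by (simp add: hsf_def)
 qed (use r av in "auto simp: avoid_def")
 then show "call UNIV (5 * m + 15) (tab r lx e) s (%s. asu s0 rv ((l, L + m, g) # hs) s & regs s HP = regs s l + (L + m))"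
 proof (rule call_conseq)
 fix s' assume 1: "asu s0 rv ((r, m, %i. g (L + i)) # (l, L, g) # hs) s' &
  fr {r, HP, TI, TL} s s' & regs s' HP = regs s HP + m & regs s' r = regs s HP"
 then have l: "regs s' l = regs s l" using r fr_regs[of _ s s' l] by auto
 have "mem s' (regs s' l + i) = g i" if "i < L + m" for i
 proof (cases "i < L")
  case True
  then show ?thesis using 1 by (auto simp: asrt_def arr_def)
 next
  case False
  have "ALL j<m. mem s' (regs s' r + j) = g (L + j)" using 1 unfolding asrt_def arr_def by auto
  moreover have "i - L < m" using False that by simp
  ultimately have "mem s' (regs s' r + (i - L)) = g (L + (i - L))" by blast
  moreover have "regs s' r + (i - L) = regs s' l + i" using 1 hp l False by simp
  ultimately show ?thesis using False by simp
 qed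
 then show "asu s0 rv ((l, L + m, g) # hs) s' & regs s' HP = regs s' l + (L + m)"
  using 1 hp l by (auto simp: asrt_def arr_def)
 qed auto
qed

end

section \<open>Schoolbook multiplication\<close>

text \<open>Some exponent has to be attainable, or the infimum \<open>omega\<close> would be that of
  the empty set and carry no information. The schoolbook method provides the exponent 3.\<close>

definition naive_body :: cmd where
 "naive_body =
  Seq (Assign 30 (cell 34 (Const 0)))
 (Seq (tab 0 (Const 0) (Const 0))
 (Seq (Assign 31 (Const 0))
  (While (Less (Reg 31) (Mul (Reg 30) (Reg 30)))
  (Seq (Assign 32 (Const 0))
  (Seq (Assign 33 (Const 0))
  (Seq (While (Less (Reg 33) (Reg 30))
  (Seq (Assign 32 (Add (Reg 32) (Mul
  (cell 34 (Add (Const 2) (Add (Mul (Div (Reg 31) (Reg 30)) (Reg 30)) (Reg 33))))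
  (cell 34 (Add (Add (Const 2) (Mul (Reg 30) (Reg 30))) (Add (Mul (Reg 33) (Reg 30)) (Mod (Reg 31) (Reg 30))))))))
  (Assign 33 (Add (Reg 33) (Const 1)))))
  (Seq (tab 36 (Const 1) (Reg 32))
  (Assign 31 (Add (Reg 31) (Const 1))))))))))"

definition naive :: cmd where
 "naive = Seq (Assign HP (Add (Const 2) (Mul (Const 2) (Mul (Load (Const 0)) (Load (Const 0)))))) naive_body"

lemma deterministic_naive: "deterministic naive"
 by (simp add: naive_def naive_body_def tab_def)

context ram
begin

lemma tri_naive_body:
 assumes n: "1 <= n" "n * n <= B" and inp0: "inp 0 = n"
 and bound: "!!i l. i < n * n ==> l <= n ==> (\<Sum>x<l. inp (2 + ((i div n) * n + x)) * inp (2 + n * n + (x * n + i mod n))) <= B"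
 defines "g == %i. \<Sum>x<n. inp (2 + ((i div n) * n + x)) * inp (2 + n * n + (x * n + i mod n))"
 shows "tru (n * n * (4 * n + 40) + 40) (asu s0 [] [(34, 2 + 2 * (n * n), inp)]) naive_body
 (asu s0 [] [(0, n * n, g)])"
proof -
 let ?cmda = "Add (Reg 32) (Mul (cell 34 (Add (Const 2) (Add (Mul (Div (Reg 31) (Reg 30)) (Reg 30)) (Reg 33)))) (cell 34 (Add (Add (Const 2) (Mul (Reg 30) (Reg 30))) (Add (Mul (Reg 33) (Reg 30)) (Mod (Reg 31) (Reg 30))))))"
 let ?in = "(34, 2 + 2 * (n * n), inp)"
 define acc where "acc i l = (\<Sum>x<l. inp (2 + ((i div n) * n + x)) * inp (2 + n * n + (x * n + i mod n)))" for i l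
 have nB: "n <= B" using n by (metis le_square le_trans)
 have B2: "1 <= B" "2 <= B" using B20 by auto
 define I where "I = (%i s. asu s0 [(31, i), (30, n)] [(0, i, g), ?in] s & regs s HP = regs s 0 + i)"
 let ?F = "{32, 33} :: nat set"
 have a1: "tri ?F 1 (asrt ?F s1 [(31, i), (30, n)] hs) (Assign 32 (Const 0)) (asrt ?F s1 [(32, 0), (31, i), (30, n)] hs)"
 if "avoid {32} [] hs" for s1 i hs
 by (rule tri_Assign) (use that in "auto simp: small_def avoid_def")
 have a2: "tri ?F 1 (asrt ?F s1 [(32, 0), (31, i), (30, n)] hs) (Assign 33 (Const 0)) (asrt ?F s1 [(33, 0), (32, acc i 0), (31, i), (30, n)] hs)"
 if "avoid {33} [] hs" for s1 i hs
 unfolding acc_def lessThan_0 sum.empty by (rule tri_Assign) (use that in "auto simp: small_def avoid_def")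
 let ?hs = "%i. [(0, i, g), ?in]"
 have a3: "tri ?F (n * (3 + 1) + 1) (asrt ?F s1 [(33, 0), (32, acc i 0), (31, i), (30, n)] (?hs i))
  (While (Less (Reg 33) (Reg 30))
  (Seq (Assign 32 ?cmda)
  (Assign 33 (Add (Reg 33) (Const 1)))))
  (asrt ?F s1 [(33, n), (32, acc i n), (31, i), (30, n)] (?hs i))" if i: "i < n * n" for s1 i
 proof (rule tri_loop)
 fix l assume l: "l < n"
 have dm: "i div n < n" "i mod n < n" using i n(1) by (auto simp: less_mult_imp_div_less)
 have ix: "2 + ((i div n) * n + l) < 2 + 2 * (n * n)" "2 + n * n + (l * n + i mod n) < 2 + 2 * (n * n)"
  using flat_less[OF dm(1) l] flat_less[OF l dm(2)] by auto
 have s1: "tri ?F 1 (asrt ?F s1 [(33, l), (32, acc i l), (31, i), (30, n)] (?hs i))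
  (Assign 32 ?cmda)
  (asrt ?F s1 [(32, acc i (Suc l)), (33, l), (31, i), (30, n)] (?hs i))"
 proof (rule tri_Assign)
  fix s assume s: "rvf [(33, l), (32, acc i l), (31, i), (30, n)] s" "hsf (?hs i) s"
  have "mem s (regs s 34 + (2 + ((i div n) * n + l))) = inp (2 + ((i div n) * n + l))"
  "mem s (regs s 34 + (2 + n * n + (l * n + i mod n))) = inp (2 + n * n + (l * n + i mod n))"
  by (rule hsfD[OF s(2) _ ix(1)], simp, rule hsfD[OF s(2) _ ix(2)], simp)
  then show "evn s ?cmda = acc i (Suc l) & acc i (Suc l) <= B"
  using s(1) bound[of i "Suc l"] l i by (simp add: acc_def rvf_Cons)
 qed (use B2 in "auto simp: small_def avoid_def")
 have s2: "tri ?F 1 (asrt ?F s1 [(32, acc i (Suc l)), (33, l), (31, i), (30, n)] (?hs i)) (Assign 33 (Add (Reg 33) (Const 1)))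
  (asrt ?F s1 [(33, Suc l), (32, acc i (Suc l)), (31, i), (30, n)] (?hs i))"
  by (rule tri_Assign) (use B2 l nB in "auto simp: small_def avoid_def rvf_Cons")
 show "tri ?F 3 (asrt ?F s1 [(33, l), (32, acc i l), (31, i), (30, n)] (?hs i)) (Seq (Assign 32 ?cmda)
  (Assign 33 (Add (Reg 33) (Const 1)))) (asrt ?F s1 [(33, Suc l), (32, acc i (Suc l)), (31, i), (30, n)] (?hs i))"
  by (rule tri_mono[OF tri_Seq[OF s1 s2]]) simp
 next
 show "evn s (Less (Reg 33) (Reg 30)) ~= 0" if "l < n" "asrt ?F s1 [(33, l), (32, acc i l), (31, i), (30, n)] (?hs i) s" for l s
  using asrt_rvf[OF that(2)] that(1) by (simp add: rvf_Cons)
 show "evn s (Less (Reg 33) (Reg 30)) = 0" if "asrt ?F s1 [(33, n), (32, acc i n), (31, i), (30, n)] (?hs i) s" for s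
  using asrt_rvf[OF that] by (simp add: rvf_Cons)
 qed (auto simp: small_def)
 have a4: "tru (5 * 1 + 15) (%s. asu s0 [(33, n), (32, acc i n), (31, i), (30, n)] (?hs i) s & regs s HP = regs s 0 + i)
 (tab 36 (Const 1) (Reg 32)) (%s. asu s0 [(33, n), (32, acc i n), (31, i), (30, n)] [(0, i + 1, g), ?in] s & regs s HP = regs s 0 + (i + 1))"
 if i: "i < n * n" for i
 using bound[OF i order_refl] B2
 by (intro tri_push) (auto simp: small_def avoid_def rvf_Cons g_def acc_def)
 let ?F2 = "{31} :: nat set"
 have a5: "tri ?F2 1 (asrt ?F2 s1 [(33, n), (32, acc i n), (31, i), (30, n)] (?hs (i + 1))) (Assign 31 (Add (Reg 31) (Const 1)))
  (asrt ?F2 s1 [(31, Suc i), (30, n)] (?hs (Suc i)))" if i: "i < n * n" for s1 i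
 by (rule tri_Assign) (use B2 i n in "auto simp: small_def avoid_def rvf_Cons")
 have av: "avoid {32} [] (?hs i)" "avoid {33} [] (?hs i)" for i by (auto simp: avoid_def)
 have body: "tru (4 * n + 30) (I i) (Seq (Assign 32 (Const 0))
  (Seq (Assign 33 (Const 0))
  (Seq (While (Less (Reg 33) (Reg 30))
  (Seq (Assign 32 ?cmda)
  (Assign 33 (Add (Reg 33) (Const 1)))))
  (Seq (tab 36 (Const 1) (Reg 32))
  (Assign 31 (Add (Reg 31) (Const 1))))))) (I (Suc i))" if i: "i < n * n" for i
 unfolding I_def
 by (rule tri_mono[OF tri_Seq[OF tri_local[OF a1[OF av(1)]] tri_Seq[OF tri_local[OF a2[OF av(2)]] tri_Seq[OF tri_local[OF a3[OF i]]
  tri_Seq[OF a4[OF i] tri_post[OF tri_local[OF a5[OF i], of 0 _ "i + 1"]]]]]]]) auto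
 have loop: "tru (n * n * (4 * n + 30 + 1) + 1) (I 0) (While (Less (Reg 31) (Mul (Reg 30) (Reg 30)))
  (Seq (Assign 32 (Const 0))
  (Seq (Assign 33 (Const 0))
  (Seq (While (Less (Reg 33) (Reg 30))
  (Seq (Assign 32 ?cmda)
  (Assign 33 (Add (Reg 33) (Const 1)))))
  (Seq (tab 36 (Const 1) (Reg 32))
  (Assign 31 (Add (Reg 31) (Const 1)))))))) (I (n * n))"
 proof (rule tri_loop[where I = I, OF _ body])
 show "evn s (Less (Reg 31) (Mul (Reg 30) (Reg 30))) ~= 0" if "i < n * n" "I i s" for i s
  using that asrt_rvf[of UNIV s0 "[(31, i), (30, n)]" _ s] by (auto simp: I_def rvf_Cons)
 show "evn s (Less (Reg 31) (Mul (Reg 30) (Reg 30))) = 0" if "I (n * n) s" for s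
  using that asrt_rvf[of UNIV s0 "[(31, n * n), (30, n)]" _ s] by (auto simp: I_def rvf_Cons)
 qed (auto simp: small_def)
 have b1: "tru 1 (asu s0 [] [?in]) (Assign 30 (cell 34 (Const 0))) (asu s0 [(30, n)] [?in])"
 proof (rule tri_Assign)
 fix s assume "hsf [?in] s"
 from hsfD[OF this, of 34 _ inp 0] show "evn s (cell 34 (Const 0)) = n & n <= B" using inp0 nB by simp
 qed (auto simp: small_def avoid_def)
 have b2: "tru 15 (asu s0 [(30, n)] [?in]) (tab 0 (Const 0) (Const 0))
  (%s. asu s0 [(30, n)] (?hs 0) s & regs s HP = regs s 0 + 0)"
 unfolding tri_def
 proof (intro allI impI)
 fix s assume s: "asu s0 [(30, n)] [?in] s"
 have "call UNIV (5 * 0 + 15) (tab 0 (Const 0) (Const 0)) s (%s'. asu s0 [(30, n)] ((0, 0, g) # [?in]) s' &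
  fr {0, HP, TI, TL} s s' & regs s' HP = regs s HP + 0 & regs s' 0 = regs s HP)"
  by (rule tri_tab_HP[OF _ _ _ _ _ _ _ s]) (auto simp: small_def avoid_def)
 then show "call UNIV 15 (tab 0 (Const 0) (Const 0)) s (%s. asu s0 [(30, n)] (?hs 0) s & regs s HP = regs s 0 + 0)"
  by (rule call_conseq) auto
 qed
 have b3: "tri {31} 1 (asrt {31} s1 [(30, n)] (?hs 0)) (Assign 31 (Const 0)) (asrt {31} s1 [(31, 0), (30, n)] (?hs 0))" for s1
 by (rule tri_Assign) (auto simp: small_def avoid_def)
 have "tru (1 + 1 + (1 + 15 + (1 + 1 + (n * n * (4 * n + 30 + 1) + 1)))) (asu s0 [] [?in]) naive_body (I (n * n))"
 unfolding naive_body_def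
 by (rule tri_Seq[OF b1 tri_Seq[OF b2 tri_Seq[OF tri_local[OF b3] tri_pre[OF loop]]]]) (auto simp: I_def)
 then show ?thesis
 proof (rule tri_conseq)
 have "n * n * (4 * n + 30 + 1) <= n * n * (4 * n + 40)" by (intro mult_le_mono2) simp
 then show "1 + 1 + (1 + 15 + (1 + 1 + (n * n * (4 * n + 30 + 1) + 1))) <= n * n * (4 * n + 40) + 40" by linarith
 show "asu s0 [] [(0, n * n, g)] s" if "I (n * n) s" for s
  using that by (auto simp: I_def elim: asrt_weaken)
 qed auto
qed

end

lemma matmul_time_3: "matmul_time 3"
 unfolding matmul_time_def
proof (intro exI[of _ naive] conjI deterministic_naive exI[of _ "4001 :: nat"] exI[of _ "200 :: real"] allI impI)
 fix n m w :: nat and A A' :: "nat mat"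
 assume H: "1 <= n & 1 <= m & (n + m) ^ 4001 <= 2 ^ w & A \<in> carrier_mat n n & A' \<in> carrier_mat n n
  & (ALL i<n. ALL j<n. A $$ (i, j) < m & A' $$ (i, j) < m)"
 define b where "b = n + m"
 have b: "2 <= b" "n <= b" "m <= b" using H by (auto simp: b_def)
 \<comment> \<open>The power 20 absorbs the constant \<open>2 ^ 17\<close> in front of a cubic term,
   and \<open>4001 = 20 * 200 + 1\<close> makes \<open>B ^ 200 < 2 ^ w\<close>.\<close>
 define B where "B = b ^ 20"
 have mono: "b ^ i <= b ^ j" if "i <= j" for i j using that b by (intro power_increasing) auto
 interpret ram w B 1
 proof
 have "b ^ 4000 < b ^ 4001" using b by (intro power_strict_increasing) auto
 then have "b ^ 4000 < 2 ^ w" using H unfolding b_def by linarith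
 then show "B ^ 200 < 2 ^ w" by (simp add: B_def power_mult[symmetric])
 show "2 ^ 20 <= B" unfolding B_def using b by (intro power_mono) auto
 qed simp
 define xs where "xs = [n, m] @ mat_words A @ mat_words A'"
 define inp where "inp i = xs ! i" for i
 define s where "s = snd (start naive xs)"
 have dims: "dim_row A = n" "dim_col A = n" "dim_row A' = n" "dim_col A' = n" using H by auto
 have lenxs: "length xs = 2 + 2 * (n * n)" using H by (auto simp: xs_def length_mat_words)
 have mem: "mem s a = (if a < 2 + 2 * (n * n) then inp a else 0)" for a
 using lenxs by (simp add: s_def start_def inp_def)
 have bB: "b <= B" using mono[of 1 20] by (simp add: B_def)
 have dm: "i div n < n" "i mod n < n" if "i < n * n" for i using that H by (auto simp: less_mult_imp_div_less)
 have A: "inp (2 + i) = A $$ (i div n, i mod n)" "inp (2 + n * n + i) = A' $$ (i div n, i mod n)" if "i < n * n" for i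
 using that H by (auto simp: inp_def xs_def nth_append length_mat_words) (auto simp: mat_words_conv)
 have inpm: "inp a <= b" if a: "a < 2 + 2 * (n * n)" for a
 proof -
 consider "a = 0" | "a = 1" | i where "a = 2 + i" "i < n * n" | i where "a = 2 + n * n + i" "i < n * n"
 proof -
  consider "a = 0 | a = 1" | "2 <= a" "a < 2 + n * n" | "2 + n * n <= a" by linarith
  then show thesis
  proof cases
  case 2
  then show thesis using that(3)[of "a - 2"] by auto
  next
  case 3
  then show thesis using that(4)[of "a - (2 + n * n)"] a by auto
  qed (use that in auto)
 qed
 then show ?thesis
 proof cases
  case (3 i)
  then have "inp a < m" using A(1) dm H by simp
  then show ?thesis using b by linarith
 next
  case (4 i)
  then have "inp a < m" using A(2) dm H by simp
  then show ?thesis using b by linarith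
 qed (use b in "auto simp: inp_def xs_def")
 qed
 have b17: "131072 * b ^ 3 <= B"
 proof -
 have "2 ^ 17 * b ^ 3 <= b ^ 17 * b ^ 3" using b by (intro mult_le_mono1 power_mono) auto
 also have "... = B" by (simp add: B_def power_add[symmetric])
 finally show ?thesis by simp
 qed
 have n3: "n * n * n <= b ^ 3" using b(2) power_mono[of n b 3] by (simp add: power3_eq_cube)
 have n2: "n * n <= n * n * n" "1 <= n * n * n" using H by auto
 define h where "h = 2 + 2 * (n * n)"
 have init: "exec w (Assign HP (Add (Const 2) (Mul (Const 2) (Mul (Load (Const 0)) (Load (Const 0)))))) s 1 (upd s HP h) & ok (upd s HP h)"
 proof (rule exec_init)
 show "ALL r. regs s r <= B" by (simp add: s_def start_def)
 show "ALL a. mem s a <= B" using mem inpm bB by (auto intro: le_trans)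
 show "h <= B" using b17 n3 n2 unfolding h_def by linarith
 show "evn s (Add (Const 2) (Mul (Const 2) (Mul (Load (Const 0)) (Load (Const 0))))) = h"
  using mem[of 0] by (simp add: h_def inp_def xs_def)
 show "\<forall>a\<ge>h. mem s a = 0" using mem by (simp add: h_def)
 qed (use B20 in "auto simp: small_def")
 let ?s = "upd s HP h"
 define g where "g = (%i. \<Sum>x<n. inp (2 + ((i div n) * n + x)) * inp (2 + n * n + (x * n + i mod n)))"
 have as: "asrt UNIV ?s [] [(34, 2 + 2 * (n * n), inp)] ?s"
 using init mem by (intro asrt_start) (auto simp: rvf_Nil arr_def h_def s_def start_def)
 have "tri UNIV (n * n * (4 * n + 40) + 40) (asrt UNIV ?s [] [(34, 2 + 2 * (n * n), inp)]) naive_body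
 (asrt UNIV ?s [] [(0, n * n, g)])"
 unfolding g_def
 proof (rule tri_naive_body)
 show "n * n <= B" using b17 n3 n2 by linarith
 show "inp 0 = n" by (simp add: inp_def xs_def)
 fix i l assume i: "i < n * n" and l: "l <= n"
 have "inp (2 + ((i div n) * n + x)) * inp (2 + n * n + (x * n + i mod n)) <= b * b" if "x < l" for x
 proof (intro mult_le_mono inpm)
  have "x < n" using that l by simp
  then show "2 + ((i div n) * n + x) < 2 + 2 * (n * n)" "2 + n * n + (x * n + i mod n) < 2 + 2 * (n * n)"
  using flat_less[OF dm(1)[OF i], of x] flat_less[of x n, OF _ dm(2)[OF i]] by auto
 qed
 then have "(\<Sum>x<l. inp (2 + ((i div n) * n + x)) * inp (2 + n * n + (x * n + i mod n))) <= card {..<l} * (b * b)"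
  by (intro sum_bounded_above[of "{..<l}" _ "b * b", simplified of_nat_id]) auto
 also have "... <= b * (b * b)" using l b by (intro mult_le_mono1) simp
 also have "... <= B" using b17 by (simp add: power3_eq_cube)
 finally show "(\<Sum>x<l. inp (2 + ((i div n) * n + x)) * inp (2 + n * n + (x * n + i mod n))) <= B" .
 qed (use H in simp)
 then have cl: "call UNIV (n * n * (4 * n + 40) + 40) naive_body ?s (asrt UNIV ?s [] [(0, n * n, g)])"
 using as unfolding tri_def by blast
 have "n * n * (4 * n + 40) = 4 * (n * n * n) + 40 * (n * n)" by (simp add: algebra_simps)
 then have T: "n * n * (4 * n + 40) + 40 + 2 <= 200 * (n * n * n)" using n2 by linarith
 have "h + (n * n * (4 * n + 40) + 40) <= B" unfolding h_def using T b17 n3 n2 by linarith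
 then have "regs ?s HP + (n * n * (4 * n + 40) + 40) * 1 <= B" by simp
 from callD[OF cl _ this] init obtain t s' where s': "t <= n * n * (4 * n + 40) + 40" "exec w naive_body ?s t s'"
 "asrt UNIV ?s [] [(0, n * n, g)] s'" by blast
 have ex: "exec w naive s (1 + 1 + t) s'" unfolding naive_def using exec_Seq init s'(2) by blast
 have tt: "nat \<lfloor>200 * real n powr 3\<rfloor> = 200 * (n * n * n)"
 proof -
 have "200 * real n powr 3 = real (200 * (n * n * n))" using H by (simp add: powr_numeral power3_eq_cube)
 then show ?thesis by (simp only: floor_of_nat nat_int)
 qed
 have "run w (200 * (n * n * n)) ([naive], s) = return_pmf ([], s')"
 by (rule exec_run[OF ex]) (use T s'(1) in linarith)
 moreover have "start naive xs = ([naive], s)" by (simp add: s_def start_def)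
 moreover have "has_output ([], s') (mat_words (A * A'))"
 proof -
 have "mem s' (regs s' 0 + i) = mat_words (A * A') ! i" if i: "i < n * n" for i
 proof -
  have "mem s' (regs s' 0 + i) = g i" using s'(3) i by (auto simp: asrt_def arr_def)
  also have "g i = (\<Sum>x<n. A $$ (i div n, x) * A' $$ (x, i mod n))" unfolding g_def
  proof (rule sum.cong[OF refl])
  fix x assume "x \<in> {..<n}"
  then have x: "x < n" by simp
  show "inp (2 + ((i div n) * n + x)) * inp (2 + n * n + (x * n + i mod n)) = A $$ (i div n, x) * A' $$ (x, i mod n)"
  using A(1)[OF flat_less[OF dm(1)[OF i] x]] A(2)[OF flat_less[OF x dm(2)[OF i]]] x dm(2)[OF i] by simp
  qed
  also have "... = mat_words (A * A') ! i"
  using i dm[OF i] dims by (simp add: mat_words_conv scalar_prod_def atLeast0LessThan)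
  finally show ?thesis .
 qed
 then show ?thesis using H by (auto simp: has_output_def halted_def length_mat_words)
 qed
 ultimately show "\<forall>x\<in>set_pmf (run w (nat \<lfloor>200 * real n powr 3\<rfloor>) (start naive ([n, m] @ mat_words A @ mat_words A'))). has_output x (mat_words (A * A'))"
 unfolding tt xs_def[symmetric] by simp
qed

text \<open>Strictly above the infimum there is an attainable exponent still below
  \<open>\<tau>\<close>; at the infimum itself attainability is part of the hypothesis.\<close>

lemma matmul_time_below:
 assumes "\<tau> > omega | (\<tau> = omega & matmul_time omega)"
 obtains \<tau>' where "matmul_time \<tau>'" "\<tau>' <= \<tau>" "2 <= \<tau>'"
proof -
 have ne: "{\<tau>. matmul_time \<tau>} ~= {}" using matmul_time_3 by blast
 have "\<exists>\<tau>'. matmul_time \<tau>' & \<tau>' <= \<tau>"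
 using assms cInf_lessD[OF ne, of \<tau>] unfolding omega_def by (auto intro: less_imp_le)
 then show thesis using that matmul_time_ge_2 by blast
qed

section \<open>The matrices of an instance and their inverses\<close>

abbreviation (input) "rPF == 55 :: nat"
abbreviation (input) "rQF == 56 :: nat"
abbreviation (input) "rZA == 57 :: nat"
abbreviation (input) "rZ == 58 :: nat"
abbreviation (input) "rKK == 59 :: nat"
abbreviation (input) "rW == 60 :: nat"
abbreviation (input) "rSI == 61 :: nat"
abbreviation (input) "rSJ == 62 :: nat"
abbreviation (input) "rS == 63 :: nat"
abbreviation (input) "rT == 64 :: nat"
abbreviation (input) "rV == 65 :: nat"
abbreviation (input) "rAM == 66 :: nat"
abbreviation (input) "rPT == 67 :: nat"
abbreviation (input) "rCN == 68 :: nat"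
abbreviation (input) "rNW == 69 :: nat"

definition xD :: expr where "xD = Div (Reg TI) (Reg rD)"
definition yD :: expr where "yD = Mod (Reg TI) (Reg rD)"

definition mask_A :: expr where
 "mask_A = Ite (Less xD (Reg rN))
  (Ite (Less yD (Reg rN)) (Less (Const 0) (Add (Eq xD yD) (cell rAJ (Add (Mul xD (Reg rN)) yD)))) (Eq xD yD)) (Eq xD yD)"

definition mask_P :: expr where
 "mask_P = Ite (Less xD (Reg rN)) (Eq xD yD)
  (Ite (Less xD (Add (Reg rN) (Mul (Reg rSA) (Reg rK))))
  (Ite (Less yD (Reg rN)) (cell rAJ (Add (Mul (cell rSL (Div (Sub xD (Reg rN)) (Reg rK))) (Reg rN)) yD)) (Const 0)) (Const 0))"

definition mask_Q :: expr where
 "mask_Q = Ite (Less yD (Reg rN)) (Eq yD xD)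
  (Ite (Less yD (Add (Reg rN) (Mul (Reg rTA) (Reg rK))))
  (Ite (Less xD (Reg rN)) (cell rAJ (Add (Mul xD (Reg rN)) (cell rTS (Div (Sub yD (Reg rN)) (Reg rK))))) (Const 0)) (Const 0))"

definition sample :: "expr => expr => expr" where
 "sample m z = Mul m (Mod (cell rRND (Add z (Reg TI))) (Reg PR))"

definition DD :: expr where "DD = Mul (Reg rD) (Reg rD)"

definition prep_cmd :: "cmd => nat => cmd" where
 "prep_cmd P R =
  Seq (tab rAM DD (sample mask_A (Const 0)))
 (Seq (tab rPF DD (sample mask_P DD))
 (Seq (tab rQF DD (sample mask_Q (Mul (Const 2) DD)))
 (Seq (Assign MH (Reg rD))
 (Seq (Assign MA (Reg rAM))
  (inv_cmd P R)))))"

definition row_expr :: "expr => expr => expr" where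
 "row_expr u i = Ite (Less u (Const 1)) (Reg rS) (Ite (Less u (Const 2)) (Reg rT) (Add (Add (Reg rN) (Mul i (Reg rK))) (Sub u (Const 2))))"

definition W_expr :: expr where
 "W_expr = (let x = Div (Reg TI) (Reg rKK); y = Mod (Reg TI) (Reg rKK); k2 = Add (Reg rK) (Const 2) in
  Ite (Less x k2) (Ite (Less y k2) (cell rZ (Add (Mul (row_expr x (Reg rSI)) (Reg rD)) (row_expr y (Reg rSJ)))) (Eq x y)) (Eq x y))"

definition pair_core :: "cmd => nat => cmd" where
 "pair_core P R =
  Seq (tab rW (Mul (Reg rKK) (Reg rKK)) W_expr)
 (Seq (Assign MH (Reg rKK))
 (Seq (Assign MA (Reg rW))
 (Seq (inv_cmd P R)
 (Seq (Assign rV (Add (Reg CNT) (cell rAJ (Add (Mul (Reg rS) (Reg rN)) (Reg rT)))))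
  (Branch (Less (Reg rV) (Add (Reg rK) (Const 2)))
  (Seq (tab rNW (Const 4) (sel 0 [Reg rS, Reg rT, Sub (Reg rV) (Const 2), Reg rPT]))
  (Seq (Assign rPT (Reg rNW))
  (Assign rCN (Add (Reg rCN) (Const 1)))))
  Skip)))))"

definition pair_cmd :: "cmd => nat => cmd" where
 "pair_cmd P R =
  Seq (Assign rSI (Div (Reg rIX) (Reg rTA)))
 (Seq (Assign rSJ (Mod (Reg rIX) (Reg rTA)))
 (Seq (Assign rS (cell rSL (Reg rSI)))
 (Seq (Assign rT (cell rTS (Reg rSJ)))
 (Seq (Branch (Eq (Reg rS) (Reg rT)) Skip (pair_core P R))
  (Assign rIX (Add (Reg rIX) (Const 1)))))))"

context inv_ram
begin

lemma tri_inv: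
 assumes pr: "prime (int p)" and rv: "{(PR, p), (RW, 2 ^ v), (MH, 2 ^ e)} \<subseteq> set rv" and e: "2 ^ e <= Dmax"
 and M: "M \<in> carrier_mat (2 ^ e) (2 ^ e)" "(MA, 2 ^ e * 2 ^ e, mf (2 ^ e) M) \<in> set hs"
 and pi: "pinv (int p) e M = (c, N, d)" and av: "avoid Fm rv' hs'" and sub: "set rv' \<subseteq> set rv" "set hs' \<subseteq> set hs"
 shows "tru (inv_time e + 100) (asu s0 rv hs) (inv_cmd P R)
 (%s. asu s0 ((CNT, c) # rv') hs' s &
  (c = 2 ^ e --> asu s0 ((CNT, c) # rv') ((RES, 2 ^ e * 2 ^ e, mf (2 ^ e) N) # hs') s))"
 unfolding tri_def
proof (intro allI impI)
 fix s assume a: "asu s0 rv hs s"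
 have hsA: "regs s r + L <= regs s HP & arr (mem s) (regs s r) L f" if "(r, L, f) \<in> set hs" for r L f
 using a that unfolding asrt_def by auto
 have "call Fm (inv_time e + 100) (inv_cmd P R) s (%s'. regs s' CNT = c &
  (c = 2 ^ e --> regs s' RD = rs d & mat_at s' (regs s' RES) (2 ^ e) N))"
 proof (rule call_inv[OF pr _ _ e pi])
 show "rvf [(PR, p), (RW, 2 ^ v), (MH, 2 ^ e)] s" using asrt_rvf[OF a] rv unfolding rvf_def by auto
 show "mat_at s (regs s MA) (2 ^ e) M" using M hsA[OF M(2)] by (simp add: mat_at_mf)
 qed
 then show "call UNIV (inv_time e + 100) (inv_cmd P R) s (%s. asu s0 ((CNT, c) # rv') hs' s &
  (c = 2 ^ e --> asu s0 ((CNT, c) # rv') ((RES, 2 ^ e * 2 ^ e, mf (2 ^ e) N) # hs') s))"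
 proof (rule call_conseq)
 fix s' assume fr: "fr Fm s s'" and q: "regs s' CNT = c & (c = 2 ^ e --> regs s' RD = rs d & mat_at s' (regs s' RES) (2 ^ e) N)"
 have f1: "fr UNIV s0 s'" using fr_trans[OF asrt_fr[OF a] fr_mono[OF fr]] by blast
 have f2: "rvf ((CNT, c) # rv') s'" unfolding rvf_def
 proof clarify
  fix r x assume "(r, x) \<in> set ((CNT, c) # rv')"
  then consider "r = CNT" "x = c" | "(r, x) \<in> set rv'" by auto
  then show "regs s' r = x"
  proof cases
  case 2
  then have "r ~: Fm" using av unfolding avoid_def by blast
  then show ?thesis using fr_regs[OF fr] rvfD[OF asrt_rvf[OF a]] 2 sub(1) by fastforce
  qed (use q in simp)
 qed
 have f3: "regs s' r + L <= regs s' HP & arr (mem s') (regs s' r) L f" if rLf: "(r, L, f) \<in> set hs'" for r L f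
 proof -
  have "r ~: Fm" using av rLf unfolding avoid_def by blast
  then have "regs s' r = regs s r" using fr_regs[OF fr] by blast
  moreover have "regs s r + L <= regs s HP & arr (mem s) (regs s r) L f" using hsA rLf sub(2) by blast
  ultimately show ?thesis using fr_arr[OF fr] fr_HP[OF fr] by auto
 qed
 show "asu s0 ((CNT, c) # rv') hs' s' &
  (c = 2 ^ e --> asu s0 ((CNT, c) # rv') ((RES, 2 ^ e * 2 ^ e, mf (2 ^ e) N) # hs') s')"
  using f1 f2 f3 q unfolding asrt_def by (auto simp: mat_at_mf)
 qed auto
qed

lemma rs_if: "rs (if c then int z else 0) = of_bool c * (z mod p)"
 by (simp add: rs_def flip: zmod_int)

end

text \<open>Cells \<open>f\<close> and prime \<open>p\<close> are fixed here: after sampling the run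
  is deterministic, and chance enters only through the question whether these numbers are
  good.\<close>

locale main_ram = inv_ram w B V P R v p "2 ^ q" mt + instance_data n k q E Sl Tl
 for w B V :: nat and P :: cmd and R v p q :: nat and mt :: "nat => nat" and n k :: nat
 and E :: "(nat \<times> nat) set" and Sl Tl :: "nat list" +
 fixes f :: "nat => nat" and l :: nat
 assumes prime_p: "prime (int p)" and nk_le: "n + k + 3 <= B" and pairs_le: "length Sl * length Tl <= B"
 and cells_le: "3 * (D * D) <= l"
begin

definition adj :: "nat => nat" where
 "adj i = of_bool ((i div n, i mod n) \<in> E)"

lemma adj_at: "x < n ==> y < n ==> adj (x * n + y) = of_bool ((x, y) \<in> E)"
 by (simp add: adj_def)

abbreviation main_rv :: "(nat \<times> nat) list" where
 "main_rv == [(PR, p), (RW, 2 ^ v), (rD, D), (rN, n), (rK, k), (rSA, length Sl), (rTA, length Tl)]"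

abbreviation main_hs :: "(nat \<times> nat \<times> (nat => nat)) list" where
 "main_hs == [(rSL, length Sl, %i. Sl ! i), (rTS, length Tl, %i. Tl ! i), (rAJ, n * n, adj)]"

lemma D_props: "1 <= D" "D <= B" "2 ^ q = D" "D * D <= B"
proof -
 show "1 <= D" by (simp add: D_def)
 show "2 ^ q = D" by (simp add: D_def)
 have "2 + 2 * (D * D) <= B" using Dmax block_le by (simp add: D_def)
 then show "D * D <= B" by simp
 then show "D <= B" by (metis le_square le_trans)
qed

lemma mask_sample:
 assumes "evn s m = of_bool c" "evn s z = y" "regs s TI = i" "regs s PR = p" "mem s (regs s rRND + (y + i)) = f (y + i)"
 shows "evn s (sample m z) = rs (if c then int (f (y + i)) else 0)"
 using assms by (simp add: sample_def rs_if)

lemma evn_masks: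
 assumes s: "rvf main_rv s" "hsf main_hs s" and i: "regs s TI = i" "i < D * D"
 shows "evn s mask_A = of_bool (EA (i div D) (i mod D))" "evn s mask_P = of_bool (EP (i div D) (i mod D))"
 "evn s mask_Q = of_bool (EQ (i div D) (i mod D))"
proof -
 define x y where "x = i div D" and "y = i mod D"
 have xy: "evn s xD = x" "evn s yD = y" using s(1) i by (auto simp: xD_def yD_def x_def y_def rvf_def)
 have r: "regs s rN = n" "regs s rK = k" "regs s rSA = length Sl" "regs s rTA = length Tl" using s(1) by (auto simp: rvf_def)
 have aj: "mem s (regs s rAJ + (u * n + u')) = of_bool ((u, u') \<in> E)" if "u < n" "u' < n" for u u'
 using hsfD[OF s(2), of rAJ "n * n" adj "u * n + u'"] flat_less[OF that] adj_at[OF that] by simp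
 have sl: "mem s (regs s rSL + u) = Sl ! u" if "u < length Sl" for u
 using hsfD[OF s(2), of rSL "length Sl" "%i. Sl ! i" u] that by simp
 have ts: "mem s (regs s rTS + u) = Tl ! u" if "u < length Tl" for u
 using hsfD[OF s(2), of rTS "length Tl" "%i. Tl ! i" u] that by simp
 have En: "(u, u') \<in> E ==> u < n & u' < n" for u u' using E by auto
 have dl: "(u - n) div k < L" if "n <= u" "u < n + L * k" for u L
 using that by (intro less_mult_imp_div_less) linarith
 show "evn s mask_A = of_bool (EA (i div D) (i mod D))"
 unfolding x_def[symmetric] y_def[symmetric] using En[of x y] aj[of x y] by (auto simp: mask_A_def xy r EA_def)
 show "evn s mask_P = of_bool (EP (i div D) (i mod D))"
 unfolding x_def[symmetric] y_def[symmetric]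
 proof (cases "n <= x & x < n + length Sl * k & y < n")
 case True
 then have u: "(x - n) div k < length Sl" using dl by blast
 have "Sl ! ((x - n) div k) < n" using Sl_nth[OF u] .
 then show "evn s mask_P = of_bool (EP x y)" using True sl[OF u] aj[of "Sl ! ((x - n) div k)" y] by (simp add: mask_P_def xy r EP_def)
 next
 case False
 then show "evn s mask_P = of_bool (EP x y)" using En[of "Sl ! ((x - n) div k)" y] by (auto simp: mask_P_def xy r EP_def)
 qed
 show "evn s mask_Q = of_bool (EQ (i div D) (i mod D))"
 unfolding x_def[symmetric] y_def[symmetric]
 proof (cases "n <= y & y < n + length Tl * k & x < n")
 case True
 then have u: "(y - n) div k < length Tl" using dl by blast
 have "Tl ! ((y - n) div k) < n" using Tl_nth[OF u] .
 then show "evn s mask_Q = of_bool (EQ x y)" using True ts[OF u] aj[of x "Tl ! ((y - n) div k)"] by (simp add: mask_Q_def xy r EQ_def)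
 next
 case False
 then show "evn s mask_Q = of_bool (EQ x y)" using En[of x "Tl ! ((y - n) div k)"] by (auto simp: mask_Q_def xy r EQ_def)
 qed
qed

lemma evn_samples:
 assumes s: "rvf main_rv s" "hsf ((rRND, l, f) # main_hs) s" and i: "regs s TI = i" "i < D * D"
 shows "evn s (sample mask_A (Const 0)) = mf D (Amat f) i" "evn s (sample mask_P DD) = mf D (Pmat f) i"
 "evn s (sample mask_Q (Mul (Const 2) DD)) = mf D (Qmat f) i"
proof -
 have h: "hsf main_hs s" using s(2) by (simp add: hsf_def)
 note m = evn_masks[OF s(1) h i]
 have rnd: "mem s (regs s rRND + u) = f u" if "u < 3 * (D * D)" for u
 using hsfD[OF s(2), of rRND l f u] that cells_le by simp
 have r: "regs s PR = p" "evn s DD = D * D" using s(1) by (auto simp: rvf_def DD_def)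
 have di: "i div D < D" "i mod D < D" "i div D * D + i mod D = i"
 using i D_props(1) by (auto simp: less_mult_imp_div_less)
 show "evn s (sample mask_A (Const 0)) = mf D (Amat f) i"
 using mask_sample[OF m(1) _ i(1) r(1), of "Const 0" 0] rnd[of i] i(2) di by (simp add: mf_def Amat_def)
 show "evn s (sample mask_P DD) = mf D (Pmat f) i"
 using mask_sample[OF m(2) r(2) i(1) r(1)] rnd[of "D * D + i"] i(2) di by (simp add: mf_def Pmat_def)
 show "evn s (sample mask_Q (Mul (Const 2) DD)) = mf D (Qmat f) i"
 using mask_sample[OF m(3) _ i(1) r(1), of "Mul (Const 2) DD" "2 * (D * D)"] rnd[of "2 * (D * D) + i"] i(2) di r
 by (simp add: mf_def Qmat_def)
qed

lemma small_exprs: "small (sample mask_A (Const 0))" "small (sample mask_P DD)" "small (sample mask_Q (Mul (Const 2) DD))" "small DD"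
 using B20 by (auto simp: small_def sample_def mask_A_def mask_P_def mask_Q_def xD_def yD_def DD_def)

lemma Fm_alt: "r \<in> Fm \<longleftrightarrow> r \<in> {HP, TI, TL, RB, DM} \<or> 10 <= r & r <= 27 \<or> 100 <= r & r < 100 + R"
 by (auto simp: Fm_def)

lemma tri_prep:
 assumes pi: "pinv (int p) q (Amat f) = (c, N, d)"
 shows "tru (15 * (D * D) + inv_time q + 200) (asu s0 main_rv ((rRND, l, f) # main_hs)) (prep_cmd P R)
 (%s. asu s0 ((CNT, c) # main_rv) main_hs s & (c = D --> asu s0 ((CNT, c) # main_rv)
  ((RES, D * D, mf D N) # (rQF, D * D, mf D (Qmat f)) # (rPF, D * D, mf D (Pmat f)) # main_hs) s))"
proof -
 note [simp] = rvf_Cons avoid_def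
 let ?h0 = "(rRND, l, f) # main_hs"
 have L: "evn s DD = D * D" if "rvf main_rv s" for s using that by (simp add: DD_def)
 have hh: "hsf ?h0 s" if "hsf (x # ?h0) s" for x s using that by (simp add: hsf_def)
 have hh2: "hsf ?h0 s" if "hsf (x # y # ?h0) s" for x y s using that by (simp add: hsf_def)
 have t1: "tru (5 * (D * D) + 15) (asu s0 main_rv ?h0) (tab rAM DD (sample mask_A (Const 0)))
 (asu s0 main_rv ((rAM, D * D, mf D (Amat f)) # ?h0))"
 by (rule tri_tab) (use small_exprs L evn_samples(1) mf_le_B in auto)
 have t2: "tru (5 * (D * D) + 15) (asu s0 main_rv ((rAM, D * D, mf D (Amat f)) # ?h0)) (tab rPF DD (sample mask_P DD))
 (asu s0 main_rv ((rPF, D * D, mf D (Pmat f)) # (rAM, D * D, mf D (Amat f)) # ?h0))"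
 by (rule tri_tab) (use small_exprs L evn_samples(2)[OF _ hh] mf_le_B in auto)
 have t3: "tru (5 * (D * D) + 15) (asu s0 main_rv ((rPF, D * D, mf D (Pmat f)) # (rAM, D * D, mf D (Amat f)) # ?h0)) (tab rQF DD (sample mask_Q (Mul (Const 2) DD)))
 (asu s0 main_rv ((rQF, D * D, mf D (Qmat f)) # (rPF, D * D, mf D (Pmat f)) # (rAM, D * D, mf D (Amat f)) # ?h0))"
 by (rule tri_tab) (use small_exprs L evn_samples(3)[OF _ hh2] mf_le_B in auto)
 let ?h3 = "(rQF, D * D, mf D (Qmat f)) # (rPF, D * D, mf D (Pmat f)) # (rAM, D * D, mf D (Amat f)) # ?h0"
 have t4: "tru 1 (asu s0 main_rv ?h3) (Assign MH (Reg rD)) (asu s0 ((MH, 2 ^ q) # main_rv) ?h3)"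
 by (rule tri_Assign) (use D_props in "auto simp: small_def")
 let ?h4 = "(rQF, D * D, mf D (Qmat f)) # (rPF, D * D, mf D (Pmat f)) # main_hs"
 have t5: "tru 1 (asu s0 ((MH, 2 ^ q) # main_rv) ?h3) (Assign MA (Reg rAM)) (asu s0 ((MH, 2 ^ q) # main_rv) ((MA, 2 ^ q * 2 ^ q, mf (2 ^ q) (Amat f)) # ?h4))"
 by (rule tri_copy) (use D_props in "auto simp: small_def")
 have t6: "tru (inv_time q + 100) (asu s0 ((MH, 2 ^ q) # main_rv) ((MA, 2 ^ q * 2 ^ q, mf (2 ^ q) (Amat f)) # ?h4)) (inv_cmd P R)
 (%s. asu s0 ((CNT, c) # main_rv) ?h4 s &
  (c = 2 ^ q --> asu s0 ((CNT, c) # main_rv) ((RES, 2 ^ q * 2 ^ q, mf (2 ^ q) N) # ?h4) s))"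
 by (rule tri_inv[OF prime_p _ _ _ _ pi]) (use D_props in "auto simp: Fm_alt Amat_def")
 show ?thesis unfolding prep_cmd_def
 by (rule tri_conseq[OF tri_Seq[OF t1 tri_Seq[OF t2 tri_Seq[OF t3 tri_Seq[OF t4 tri_Seq[OF t5 t6]]]]]])
  (use D_props(3) in "auto elim: asrt_weaken")
qed

end

section \<open>Processing the pairs\<close>

text \<open>The results are collected in a linked list, so that no cell of the heap is ever overwritten.\<close>

fun chain :: "state => nat => (nat \<times> nat \<times> nat) list => bool" where
 "chain s a [] \<longleftrightarrow> True"
| "chain s a ((x, y, z) # xs) \<longleftrightarrow> a + 4 <= regs s HP & mem s a = x & mem s (a + 1) = y & mem s (a + 2) = z & chain s (mem s (a + 3)) xs"

lemma (in ram) chain_fr: "fr F s s' ==> chain s a xs ==> chain s' a xs"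
proof (induction s a xs rule: chain.induct)
 case (2 s a x y z xs)
 then have h: "a + 4 <= regs s HP" by simp
 have m: "mem s' (a + j) = mem s (a + j)" if "j < 4" for j using fr_mem[OF 2(2), of "a + j"] h that by simp
 show ?case using 2 m[of 0] m[of 1] m[of 2] m[of 3] fr_HP[OF 2(2)] by auto
qed simp

context main_ram
begin

definition count :: "int mat => nat => nat => nat" where
 "count Z kp idx = fst (pinv (int p) kp (Wmat (idx div length Tl) (idx mod length Tl) (2 ^ kp) Z)) +
  of_bool ((Sl ! (idx div length Tl), Tl ! (idx mod length Tl)) \<in> E)"

definition hit :: "int mat => nat => nat => bool" where
 "hit Z kp idx \<longleftrightarrow> Sl ! (idx div length Tl) ~= Tl ! (idx mod length Tl) & count Z kp idx < k + 2"

definition triple :: "int mat => nat => nat => nat \<times> nat \<times> nat" where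
 "triple Z kp idx = (Sl ! (idx div length Tl), Tl ! (idx mod length Tl), count Z kp idx - 2)"

text \<open>In reverse order of discovery, since each new node is put in front of the linked
  list.\<close>

definition found :: "int mat => nat => nat => (nat \<times> nat \<times> nat) list" where
 "found Z kp idx = map (triple Z kp) (filter (hit Z kp) (rev [0..<idx]))"

lemma found_Suc: "found Z kp (Suc idx) = (if hit Z kp idx then [triple Z kp idx] else []) @ found Z kp idx"
 by (simp add: found_def)

lemma length_found: "length (found Z kp idx) <= idx"
 unfolding found_def using length_filter_le[of "hit Z kp" "rev [0..<idx]"] by simp

lemma evn_row: "regs s rS = Sl ! i ==> regs s rT = Tl ! j ==> regs s rN = n ==> regs s rK = k ==>
 evn s (row_expr u h) = row_index (Sl ! i) (Tl ! j) (evn s h) (evn s u)"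
 by (auto simp: row_expr_def row_index_def less_Suc_eq numeral_2_eq_2)

lemma evn_W:
 assumes r: "regs s rS = Sl ! i" "regs s rT = Tl ! j" "regs s rN = n" "regs s rK = k" "regs s rSI = i" "regs s rSJ = j"
  "regs s rD = D" "regs s rKK = K" "regs s TI = h" and h: "h < K * K" and ij: "i < length Sl" "j < length Tl"
 and Z: "!!u. u < D * D ==> mem s (regs s rZ + u) = mf D Z u"
 shows "evn s W_expr = mf K (Wmat i j K Z) h"
proof -
 have K: "0 < K" using h by (cases K) auto
 define x y where "x = h div K" and "y = h mod K"
 have xy: "x < K" "y < K" using h K by (auto simp: x_def y_def less_mult_imp_div_less)
 have one: "rs 1 = 1" using p by (simp add: rs_def)
 have zero: "rs 0 = 0" by (simp add: rs_def)
 let ?r = "row_index (Sl ! i) (Tl ! j) i x" and ?c = "row_index (Sl ! i) (Tl ! j) j y"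
 have zz: "mem s (regs s rZ + (?r * D + ?c)) = rs (Z $$ (?r, ?c))" if "x < k + 2" "y < k + 2"
 proof -
 have b: "?r < D" "?c < D"
  using row_bound(1)[OF Sl_nth[OF ij(1)] Tl_nth[OF ij(2)] ij(1) sizes(1) that(1)]
  row_bound(1)[OF Sl_nth[OF ij(1)] Tl_nth[OF ij(2)] ij(2) sizes(2) that(2)] by auto
 then show ?thesis using Z[OF flat_less[OF b]] by (simp add: mf_def)
 qed
 have "evn s W_expr = (if x < k + 2 & y < k + 2 then mem s (regs s rZ + (?r * D + ?c)) else if x = y then 1 else 0)"
 using r evn_row[OF r(1-4)] by (auto simp: W_expr_def Let_def x_def y_def)
 then show ?thesis using zz xy one zero by (auto simp: mf_def Wmat_def x_def[symmetric] y_def[symmetric])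
qed

lemma small_W: "small W_expr"
 using B20 by (auto simp: small_def W_expr_def row_expr_def Let_def)

end

section \<open>Driver program and output\<close>

definition kk_cmd :: cmd where
 "kk_cmd = Seq (Assign rKK (Const 1))
  (While (Mul (Less (Reg rKK) (Add (Reg rK) (Const 2))) (Less (Reg rKK) (Reg rD))) (Assign rKK (Add (Reg rKK) (Reg rKK))))"

text \<open>Register 0 ends up at the cell with the length, and the triples are pushed directly
  behind it, as the output format demands. Only three of the four cells of a node are copied; the
  fourth is its link.\<close>

definition emit_cmd :: cmd where
 "emit_cmd =
  Seq (tab 0 (Const 1) (Reg rCN))
 (Seq (Assign rIX (Const 0))
  (While (Less (Reg rIX) (Reg rCN))
  (Seq (tab rTMP (Const 3) (cell rPT (Reg TI)))
  (Seq (Assign rPT (cell rPT (Const 3)))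
  (Assign rIX (Add (Reg rIX) (Const 1)))))))"

definition rest_cmd :: "cmd => nat => cmd" where
 "rest_cmd P R =
  Seq (Assign DM (Reg rD))
 (Seq (mul P R rZA rPF RES)
 (Seq (mul P R rZ rZA rQF)
 (Seq kk_cmd
 (Seq (Assign rPT (Const 0))
 (Seq (Assign rCN (Const 0))
 (Seq (Assign rIX (Const 0))
 (Seq (While (Less (Reg rIX) (Mul (Reg rSA) (Reg rTA))) (pair_cmd P R))
  emit_cmd)))))))"

definition main_cmd :: "cmd => nat => cmd" where
 "main_cmd P R = Seq (prep_cmd P R) (Branch (Less (Reg CNT) (Reg rD)) Skip (rest_cmd P R))"

definition emitted :: "(nat \<times> nat \<times> nat) list => nat => nat" where
 "emitted L m = (if m = 0 then length L else case L ! ((m - 1) div 3) of (x, y, z) => [x, y, z] ! ((m - 1) mod 3))"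

context ram
begin

lemma asrt_self: "asrt F s0 rv hs s ==> asrt F' s rv hs s"
 using fr_refl[OF asrt_ok] by (auto simp: asrt_def)

lemma asrt_rebase: "asu s0 rv hs s ==> asrt F s rv' hs' s' ==> asu s0 rv' hs' s'"
 using fr_trans[OF _ fr_mono[of F s s' UNIV]] by (auto simp: asrt_def)

lemma asrt_reg: "asrt F s0 rv hs s ==> regs s r = x ==> asrt F s0 ((r, x) # rv) hs s"
 by (auto simp: asrt_def rvf_Cons)

lemma tri_frame:
 assumes "!!s1. tri F T (asrt F s1 rv hs) c (asrt F s1 rv' hs')" "!!s s'. fr F s s' ==> X s ==> X s'"
 shows "tru T (%s. asu s0 rv hs s & X s) c (%s. asu s0 rv' hs' s & X s)"
 unfolding tri_def
proof (intro allI impI)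
 fix s assume a: "asu s0 rv hs s & X s"
 then have "call F T c s (asrt F s rv' hs')" using assms(1) asrt_self[of UNIV s0 rv hs s F] by (simp add: tri_def)
 then show "call UNIV T c s (%s. asu s0 rv' hs' s & X s)"
 proof (rule call_conseq)
 fix s' assume "fr F s s'" "asrt F s rv' hs' s'"
 then show "asu s0 rv' hs' s' & X s'" using a assms(2) asrt_rebase by blast
 qed auto
qed

lemma tri_emit:
 assumes L: "length L <= B"
 shows "tru (length L * 45 + 45) (%s. asu s0 [(rCN, length L)] [] s & chain s (regs s rPT) L) emit_cmd
 (%s. ALL m<1 + 3 * length L. mem s (regs s 0 + m) = emitted L m)"
proof -
 note [simp] = small_def rvf_Cons avoid_def
 have B2: "4 <= B" using B20 by simp
 let ?X = "%i s. regs s HP = regs s 0 + (1 + 3 * i) & chain s (regs s rPT) (drop i L)"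
 \<comment> \<open>The list pointer itself advances along the links, so \<open>chain\<close> speaks
   of the remaining part \<open>drop i L\<close>.\<close>
 define J where "J = (%i s. asu s0 [(rIX, i), (rCN, length L)] [(0, 1 + 3 * i, emitted L)] s & ?X i s)"
 have e1: "tru 20 (%s. asu s0 [(rCN, length L)] [] s & chain s (regs s rPT) L) (tab 0 (Const 1) (Reg rCN))
 (%s. asu s0 [(rCN, length L)] [(0, 1, emitted L)] s & ?X 0 s)"
 unfolding tri_def
 proof (intro allI impI)
 fix s assume a: "asu s0 [(rCN, length L)] [] s & chain s (regs s rPT) L"
 then have as: "asu s0 [(rCN, length L)] [] s" by simp
 have "call UNIV (5 * 1 + 15) (tab 0 (Const 1) (Reg rCN)) s (%s'. asu s0 [(rCN, length L)] ((0, 1, emitted L) # []) s' &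
  fr {0, HP, TI, TL} s s' & regs s' HP = regs s HP + 1 & regs s' 0 = regs s HP)"
  by (rule tri_tab_HP[OF _ _ _ _ _ _ _ as]) (use B2 L in "auto simp: emitted_def")
 then show "call UNIV 20 (tab 0 (Const 1) (Reg rCN)) s (%s. asu s0 [(rCN, length L)] [(0, 1, emitted L)] s & ?X 0 s)"
 proof (rule call_conseq)
  fix s' assume "asu s0 [(rCN, length L)] ((0, 1, emitted L) # []) s' &
  fr {0, HP, TI, TL} s s' & regs s' HP = regs s HP + 1 & regs s' 0 = regs s HP"
  moreover from this have "regs s' rPT = regs s rPT" using fr_regs[of _ s s' rPT] by auto
  ultimately show "asu s0 [(rCN, length L)] [(0, 1, emitted L)] s' & ?X 0 s'"
  using chain_fr[of _ s s' "regs s rPT" L] a by auto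
 qed auto
 qed
 have X0: "?X 0 s'" if "fr {rIX} s s'" "?X 0 s" for s s' :: state
 using fr_regs[OF that(1)] chain_fr[OF that(1)] that(2) by auto
 have e2: "tru 1 (%s. asu s0 [(rCN, length L)] [(0, 1, emitted L)] s & ?X 0 s) (Assign rIX (Const 0)) (J 0)"
 unfolding J_def
 proof (rule tri_frame[where F = "{rIX}", OF _ X0])
 show "tri {rIX} 1 (asrt {rIX} s1 [(rCN, length L)] [(0, 1, emitted L)]) (Assign rIX (Const 0))
  (asrt {rIX} s1 [(rIX, 0), (rCN, length L)] [(0, 1 + 3 * 0, emitted L)])" for s1
  by (rule tri_Assign) auto
 qed auto
 let ?c = "Seq (tab rTMP (Const 3) (cell rPT (Reg TI))) (Seq (Assign rPT (cell rPT (Const 3))) (Assign rIX (Add (Reg rIX) (Const 1))))"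
 have body: "tru 40 (J i) ?c (J (Suc i))" if i: "i < length L" for i
 unfolding tri_def
 proof (intro allI impI)
 fix s assume Js: "J i s"
 obtain x y z where xyz: "L ! i = (x, y, z)" by (cases "L ! i") auto
 have dr: "drop i L = (x, y, z) # drop (Suc i) L" using Cons_nth_drop_Suc[OF i] xyz by simp
 define a where "a = mem s (regs s rPT + 3)"
 define node where "node h = [x, y, z, a] ! h" for h
 have ch: "regs s rPT + 4 <= regs s HP" "mem s (regs s rPT) = x" "mem s (regs s rPT + 1) = y" "mem s (regs s rPT + 2) = z"
  "chain s a (drop (Suc i) L)" and hp: "regs s HP = regs s 0 + (1 + 3 * i)"
  using Js dr by (auto simp: J_def a_def)
 have as0: "asu s0 [(rIX, i), (rCN, length L)] [(0, 1 + 3 * i, emitted L)] s" using Js by (simp add: J_def)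
 have node: "mem s (regs s rPT + h) = node h" if h4: "h < 4" for h
 proof -
  consider "h = 0" | "h = 1" | "h = 2" | "h = 3" using h4 by linarith
  then show ?thesis using ch by cases (auto simp: node_def a_def)
 qed
 have nB: "node h <= B" if "h < 4" for h using node[OF that] ok_mem[OF asrt_ok[OF as0]] by metis
 let ?rv = "[(rIX, i), (rCN, length L)]" and ?nd = "(rPT, 4, node)"
 have as: "asu s ?rv [(0, 1 + 3 * i, emitted L), ?nd] s"
  using asrt_self[OF as0, of UNIV] ch(1) node by (auto simp: asrt_def arr_def)
 have em: "emitted L (1 + 3 * i + h) = node h" if "h < 3" for h
 proof -
  have "(3 * i + h) div 3 = i" "(3 * i + h) mod 3 = h" using that by auto
  moreover have "[x, y, z] ! h = [x, y, z, a] ! h" using that by (auto simp: nth_Cons split: nat.split)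
  ultimately show ?thesis using xyz by (simp add: emitted_def node_def)
 qed
 have p1: "tru (5 * 3 + 15) (%s'. asu s ?rv ((0, 1 + 3 * i, emitted L) # [?nd]) s' & regs s' HP = regs s' 0 + (1 + 3 * i))
  (tab rTMP (Const 3) (cell rPT (Reg TI)))
  (%s'. asu s ?rv ((0, 1 + 3 * i + 3, emitted L) # [?nd]) s' & regs s' HP = regs s' 0 + (1 + 3 * i + 3))"
 proof (rule tri_push)
  fix h s' assume h: "h < 3" "regs s' TI = h" "hsf [?nd] s'"
  have "mem s' (regs s' rPT + h) = node h" using hsfD[OF h(3), of rPT 4 node h] h(1) by simp
  then show "evn s' (cell rPT (Reg TI)) = emitted L (1 + 3 * i + h) & emitted L (1 + 3 * i + h) <= B"
  using em[OF h(1)] h(1,2) nB[of h] by simp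
 qed (use B2 in auto)
 have p2: "tri {rPT} 1 (asrt {rPT} s1 ?rv [(0, 1 + 3 * i + 3, emitted L), ?nd]) (Assign rPT (cell rPT (Const 3)))
  (asrt {rPT} s1 ((rPT, a) # ?rv) [(0, 1 + 3 * i + 3, emitted L)])" for s1
 proof (rule tri_Assign)
  fix s' assume "hsf [(0, 1 + 3 * i + 3, emitted L), ?nd] s'"
  from hsfD[OF this, of rPT 4 node 3] show "evn s' (cell rPT (Const 3)) = a & a <= B"
  using nB[of 3] by (simp add: node_def numeral_3_eq_3)
 qed (use B2 in auto)
 have p3: "tri {rIX} 1 (asrt {rIX} s1 ((rPT, a) # ?rv) [(0, 1 + 3 * i + 3, emitted L)]) (Assign rIX (Add (Reg rIX) (Const 1)))
  (asrt {rIX} s1 ((rIX, Suc i) # [(rPT, a), (rCN, length L)]) [(0, 1 + 3 * i + 3, emitted L)])" for s1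
  by (rule tri_Assign) (use B2 L i in auto)
 have "tru (1 + (5 * 3 + 15) + (1 + 1 + 1)) (%s'. asu s ?rv [(0, 1 + 3 * i, emitted L), ?nd] s' & regs s' HP = regs s' 0 + (1 + 3 * i)) ?c
  (%s'. asu s ((rIX, Suc i) # [(rPT, a), (rCN, length L)]) [(0, 1 + 3 * i + 3, emitted L)] s' & regs s' HP = regs s' 0 + (1 + 3 * i + 3))"
  by (rule tri_Seq[OF p1 tri_Seq[OF tri_local[OF p2] tri_local[OF p3]]]) auto
 then have "call UNIV (1 + (5 * 3 + 15) + (1 + 1 + 1)) ?c s
  (%s'. asu s ((rIX, Suc i) # [(rPT, a), (rCN, length L)]) [(0, 1 + 3 * i + 3, emitted L)] s' & regs s' HP = regs s' 0 + (1 + 3 * i + 3))"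
  using as hp unfolding tri_def by blast
 then show "call UNIV 40 ?c s (J (Suc i))"
 proof (rule call_conseq)
  fix s' assume q: "asu s ((rIX, Suc i) # [(rPT, a), (rCN, length L)]) [(0, 1 + 3 * i + 3, emitted L)] s' & regs s' HP = regs s' 0 + (1 + 3 * i + 3)"
  have e: "1 + 3 * i + 3 = 1 + 3 * Suc i" by simp
  have "rvf ((rIX, Suc i) # [(rPT, a), (rCN, length L)]) s'" using q asrt_rvf by blast
  then have "regs s' rPT = a" by simp
  moreover have "chain s' a (drop (Suc i) L)" using chain_fr[OF _ ch(5)] q asrt_fr by blast
  moreover have "asu s0 ((rIX, Suc i) # [(rPT, a), (rCN, length L)]) [(0, 1 + 3 * i + 3, emitted L)] s'"
  using asrt_rebase[OF as0] q by blast
  then have "asu s0 [(rIX, Suc i), (rCN, length L)] [(0, 1 + 3 * i + 3, emitted L)] s'" by (rule asrt_weaken) auto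
  ultimately show "J (Suc i) s'" using q unfolding J_def e by simp
 qed auto
 qed
 have loop: "tru (length L * (40 + 1) + 1) (J 0) (While (Less (Reg rIX) (Reg rCN)) ?c) (J (length L))"
 proof (rule tri_loop[where I = J, OF _ body])
 show "evn s (Less (Reg rIX) (Reg rCN)) ~= 0" if "i < length L" "J i s" for i s
  using that asrt_rvf[of UNIV s0 "[(rIX, i), (rCN, length L)]" _ s] by (auto simp: J_def)
 show "evn s (Less (Reg rIX) (Reg rCN)) = 0" if "J (length L) s" for s
  using that asrt_rvf[of UNIV s0 "[(rIX, length L), (rCN, length L)]" _ s] by (auto simp: J_def)
 qed auto
 show ?thesis unfolding emit_cmd_def
 by (rule tri_conseq[OF tri_Seq[OF e1 tri_Seq[OF e2 loop]]]) (auto simp: J_def asrt_def arr_def)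
qed

end

lemma nth_triples:
 "m < 3 * length L ==> concat (map (%(s, t, v). [s, t, v]) L) ! m = (case L ! (m div 3) of (x, y, z) => [x, y, z] ! (m mod 3))"
proof (induction L arbitrary: m)
 case (Cons e L)
 obtain x y z where e: "e = (x, y, z)" by (cases e) auto
 show ?case
 proof (cases "m < 3")
 case True
 then consider "m = 0" | "m = 1" | "m = 2" by linarith
 then show ?thesis by cases (auto simp: e)
 next
 case False
 then obtain m' where m: "m = m' + 3" by (metis add.commute le_Suc_ex not_less)
 then have "m' < 3 * length L" using Cons.prems by simp
 from Cons.IH[OF this] show ?thesis by (simp add: m e nth_append)
 qed
qed simp

lemma answer_words_emitted:
 "length (answer_words L) = 1 + 3 * length L" "m < 1 + 3 * length L ==> answer_words L ! m = emitted L m"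
proof -
 have "length (concat (map (%(s, t, v). [s, t, v]) L)) = 3 * length L" by (induction L) auto
 then show "length (answer_words L) = 1 + 3 * length L" by (simp add: answer_words_def)
 show "answer_words L ! m = emitted L m" if "m < 1 + 3 * length L"
 using nth_triples[of "m - 1" L] that by (cases m) (auto simp: answer_words_def emitted_def)
qed

context main_ram
begin

text \<open>\<open>s0\<close> is meant to be the state at the start of this very iteration, so the
  list built so far lies in its heap and survives the inversion untouched. Only the address
  \<open>ptr\<close> has to be carried along.\<close>

lemma tri_pair:
 assumes idx: "idx < length Sl * length Tl" and kp: "k + 2 <= 2 ^ kp" "2 ^ kp <= D"
 and ch: "chain s0 ptr (found Z kp idx)" and ptr: "ptr <= B"
 defines "rv == (rKK, 2 ^ kp) # main_rv" and "hs == (rZ, D * D, mf D Z) # main_hs"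
 shows "tru (5 * (2 ^ kp * 2 ^ kp) + inv_time kp + 250)
 (asu s0 ((rIX, idx) # (rCN, length (found Z kp idx)) # (rPT, ptr) # rv) hs) (pair_cmd P R)
 (%s. asu s0 ((rIX, Suc idx) # (rCN, length (found Z kp (Suc idx))) # rv) hs s & chain s (regs s rPT) (found Z kp (Suc idx)))"
proof -
 let ?cmda = "tab rNW (Const 4) (sel 0 [Reg rS, Reg rT, Sub (Reg rV) (Const 2), Reg rPT])"
 let ?cmdb = "Seq (Assign rPT (Reg rNW)) (Assign rCN (Add (Reg rCN) (Const 1)))"
 note [simp] = rvf_Cons avoid_def rv_def hs_def
 have B2: "4 <= B" using B20 by simp
 have sm: "small e" if "weight e <= 50" "consts_le 4 e" for e
 proof -
 have "consts_le 4 x ==> consts_le B x" for x using B2 by (induction x) auto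
 then show ?thesis using that by (simp add: small_def)
 qed
 define K where "K = (2 :: nat) ^ kp"
 define i j where "i = idx div length Tl" and "j = idx mod length Tl"
 define s t where "s = Sl ! i" and "t = Tl ! j"
 define cn where "cn = length (found Z kp idx)"
 define W where "W = Wmat i j K Z"
 obtain c N d where pi: "pinv (int p) kp W = (c, N, d)" by (cases "pinv (int p) kp W") auto
 have Wc: "W \<in> carrier_mat (2 ^ kp) (2 ^ kp)" by (simp add: W_def Wmat_def K_def)
 have cK: "c <= K" using pinv_correct[OF prime_p Wc pi] by (simp add: K_def)
 have ij: "i < length Sl" "j < length Tl" using idx by (auto simp: i_def j_def less_mult_imp_div_less intro!: mod_less_divisor gr0I)
 have st: "s < n" "t < n" using Sl_nth[OF ij(1)] Tl_nth[OF ij(2)] by (auto simp: s_def t_def)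
 have nB: "s <= B" "t <= B" "k + 2 <= B" "n <= B" using st nk_le by auto
 have ijB: "i <= B" "j <= B" "idx + 1 <= B"
 proof -
 have "i <= idx" by (simp add: i_def)
 moreover have "j <= idx" by (simp add: j_def)
 ultimately show "i <= B" "j <= B" "idx + 1 <= B" using idx pairs_le by auto
 qed
 have cnB: "cn + 1 <= B" using length_found[of Z kp idx] ijB by (simp add: cn_def)
 have DB: "D + 1 <= B" "K <= B"
 proof -
 have "2 + 2 * (D * D) <= B" using Dmax block_le by (simp add: D_def)
 moreover have "D <= D * D" by simp
 ultimately show "D + 1 <= B" by linarith
 then show "K <= B" using kp(2) by (simp add: K_def)
 qed
 define V0 where "V0 = count Z kp idx"
 have V0: "V0 = c + of_bool ((s, t) \<in> E)" using pi by (simp add: V0_def count_def i_def j_def s_def t_def W_def K_def)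
 have V0B: "V0 <= B" using cK kp(2) DB(1) unfolding V0 K_def by auto
 let ?r0 = "(rIX, idx) # (rCN, cn) # (rPT, ptr) # rv"
 have t1: "tru 1 (asu s0 ?r0 hs) (Assign rSI (Div (Reg rIX) (Reg rTA))) (asu s0 ((rSI, i) # ?r0) hs)"
 by (rule tri_Assign) (use ijB in "auto simp: i_def intro!: sm")
 have t2: "tru 1 (asu s0 ((rSI, i) # ?r0) hs) (Assign rSJ (Mod (Reg rIX) (Reg rTA))) (asu s0 ((rSJ, j) # (rSI, i) # ?r0) hs)"
 by (rule tri_Assign) (use ijB in "auto simp: j_def intro!: sm")
 have t3: "tru 1 (asu s0 ((rSJ, j) # (rSI, i) # ?r0) hs) (Assign rS (cell rSL (Reg rSI))) (asu s0 ((rS, s) # (rSJ, j) # (rSI, i) # ?r0) hs)"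
 proof (rule tri_Assign)
 fix s' assume a: "rvf ((rSJ, j) # (rSI, i) # ?r0) s'" "hsf hs s'"
 show "evn s' (cell rSL (Reg rSI)) = s & s <= B"
  using hsfD[OF a(2), of rSL "length Sl" "%i. Sl ! i" i] a(1) ij nB by (simp add: s_def)
 qed (auto intro!: sm)
 have t4: "tru 1 (asu s0 ((rS, s) # (rSJ, j) # (rSI, i) # ?r0) hs) (Assign rT (cell rTS (Reg rSJ))) (asu s0 ((rT, t) # (rS, s) # (rSJ, j) # (rSI, i) # ?r0) hs)"
 proof (rule tri_Assign)
 fix s' assume a: "rvf ((rS, s) # (rSJ, j) # (rSI, i) # ?r0) s'" "hsf hs s'"
 show "evn s' (cell rTS (Reg rSJ)) = t & t <= B"
  using hsfD[OF a(2), of rTS "length Tl" "%i. Tl ! i" j] a(1) ij nB by (simp add: t_def)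
 qed (auto intro!: sm)
 let ?r4 = "(rT, t) # (rS, s) # (rSJ, j) # (rSI, i) # ?r0"
 define Q where "Q = (%s'. asu s0 ((rCN, length (found Z kp (Suc idx))) # (rIX, idx) # rv) hs s' & chain s' (regs s' rPT) (found Z kp (Suc idx)))"
 have skip: "tru 1 (asu s0 r hs) Skip Q" if nh: "~ hit Z kp idx" and r: "set ?r0 \<subseteq> set r" for r
 unfolding tri_def
 proof (intro allI impI)
 fix s' assume a: "asu s0 r hs s'"
 have e: "found Z kp (Suc idx) = found Z kp idx" using nh by (simp add: found_Suc)
 have "asu s0 ((rCN, cn) # (rIX, idx) # rv) hs s'" by (rule asrt_weaken[OF a]) (use r in auto)
 moreover have "regs s' rPT = ptr" using rvfD[OF asrt_rvf[OF a], of rPT ptr] r by auto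
 ultimately have "Q s'" using chain_fr[OF asrt_fr[OF a] ch] unfolding Q_def e cn_def by simp
 then show "call UNIV 1 Skip s' Q" by (rule call_Skip) simp
 qed
 let ?T = "5 * (K * K) + inv_time kp + 200"
 have core: "tru ?T (asu s0 ?r4 hs) (pair_core P R) Q" if ne: "s ~= t"
 proof -
 let ?w = "(rW, K * K, mf K W)"
 have c1: "tru (5 * (K * K) + 15) (asu s0 ?r4 hs) (tab rW (Mul (Reg rKK) (Reg rKK)) W_expr) (asu s0 ?r4 (?w # hs))"
 proof (rule tri_tab)
  fix h s' assume h: "h < K * K" "regs s' TI = h" "rvf ?r4 s'" "hsf hs s'"
  have Z: "mem s' (regs s' rZ + u) = mf D Z u" if "u < D * D" for u
  using hsfD[OF h(4), of rZ "D * D" "mf D Z" u] that by simp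
  show "evn s' W_expr = mf K W h & mf K W h <= B"
  using evn_W[of s' i j K h Z] h ij Z mf_le_B by (simp add: W_def s_def t_def K_def)
 qed (use small_W in "auto simp: K_def intro!: sm")
 have c2: "tru 1 (asu s0 ?r4 (?w # hs)) (Assign MH (Reg rKK)) (asu s0 ((MH, 2 ^ kp) # ?r4) (?w # hs))"
  by (rule tri_Assign) (use DB in "auto simp: K_def intro!: sm")
 have c3: "tru 1 (asu s0 ((MH, 2 ^ kp) # ?r4) (?w # hs)) (Assign MA (Reg rW))
  (asu s0 ((MH, 2 ^ kp) # ?r4) ((MA, 2 ^ kp * 2 ^ kp, mf (2 ^ kp) W) # hs))"
  by (rule tri_copy) (auto simp: K_def)
 have c4: "tru (inv_time kp + 100) (asu s0 ((MH, 2 ^ kp) # ?r4) ((MA, 2 ^ kp * 2 ^ kp, mf (2 ^ kp) W) # hs)) (inv_cmd P R)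
  (%s. asu s0 ((CNT, c) # ?r4) hs s &
  (c = 2 ^ kp --> asu s0 ((CNT, c) # ?r4) ((RES, 2 ^ kp * 2 ^ kp, mf (2 ^ kp) N) # hs) s))"
  by (rule tri_inv[OF prime_p _ _ Wc _ pi]) (use kp(2) in "auto simp: Fm_alt D_def")
 have c4': "tru (inv_time kp + 100) (asu s0 ((MH, 2 ^ kp) # ?r4) ((MA, 2 ^ kp * 2 ^ kp, mf (2 ^ kp) W) # hs)) (inv_cmd P R)
  (asu s0 ((CNT, c) # ?r4) hs)"
  by (rule tri_post[OF c4]) blast
 let ?r5 = "(rV, V0) # ?r4"
 have c5: "tru 1 (asu s0 ((CNT, c) # ?r4) hs) (Assign rV (Add (Reg CNT) (cell rAJ (Add (Mul (Reg rS) (Reg rN)) (Reg rT))))) (asu s0 ?r5 hs)"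
 proof (rule tri_Assign)
  fix s' assume a: "rvf ((CNT, c) # ?r4) s'" "hsf hs s'"
  show "evn s' (Add (Reg CNT) (cell rAJ (Add (Mul (Reg rS) (Reg rN)) (Reg rT)))) = V0 & V0 <= B"
  using hsfD[OF a(2), of rAJ "n * n" adj "s * n + t"] flat_less[OF st] adj_at[OF st] a(1) V0 V0B by simp
 qed (auto intro!: sm)
 have c6: "tru (1 + 40) (asu s0 ?r5 hs) (Branch (Less (Reg rV) (Add (Reg rK) (Const 2)))
  (Seq ?cmda
  ?cmdb) Skip) Q"
 proof (rule tri_Branch[where x = "if V0 < k + 2 then 1 else 0"])
  show "evn s' (Less (Reg rV) (Add (Reg rK) (Const 2))) = (if V0 < k + 2 then 1 else 0)" if "asu s0 ?r5 hs s'" for s'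
  using asrt_rvf[OF that] by simp
  show "tru 40 (asu s0 ?r5 hs) (if (if V0 < k + 2 then 1 else 0) ~= (0 :: nat)
  then Seq ?cmda
  ?cmdb else Skip) Q"
  proof (cases "V0 < k + 2")
  case False
  then have "~ hit Z kp idx" by (simp add: hit_def V0_def)
  from skip[OF this] have "tru 1 (asu s0 ?r5 hs) Skip Q" by auto
  then show ?thesis using False tri_mono[of UNIV 1 _ Skip Q 40] by simp
  next
  case True
  then have hit: "hit Z kp idx" using ne by (simp add: hit_def V0_def s_def t_def i_def j_def)
  then have fS: "found Z kp (Suc idx) = (s, t, V0 - 2) # found Z kp idx"
  by (simp add: found_Suc triple_def V0_def s_def t_def i_def j_def)
  define node where "node h = [s, t, V0 - 2, ptr] ! h" for h
  have d1: "tru (5 * 4 + 15) (asu s0 ?r5 hs) ?cmda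
  (asu s0 ?r5 ((rNW, 4, node) # hs))"
  proof (rule tri_tab)
  fix h s' assume h: "h < 4" "regs s' TI = h" "rvf ?r5 s'"
  consider "h = 0" | "h = 1" | "h = 2" | "h = 3" using h(1) by linarith
  then show "evn s' (sel 0 [Reg rS, Reg rT, Sub (Reg rV) (Const 2), Reg rPT]) = node h & node h <= B"
  using h(2,3) nB V0B ptr evn_sel[of 0 s' "[Reg rS, Reg rT, Sub (Reg rV) (Const 2), Reg rPT]"]
  by cases (simp_all add: node_def del: sel.simps)
  qed (use B2 in "auto simp: small_def")
  have d2: "tru 1 (asu s0 ?r5 ((rNW, 4, node) # hs)) (Assign rPT (Reg rNW))
  (asu s0 ((rIX, idx) # (rCN, cn) # rv) ((rPT, 4, node) # hs))"
  by (rule tri_copy) auto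
  have d3: "tru 1 (asu s0 ((rIX, idx) # (rCN, cn) # rv) ((rPT, 4, node) # hs)) (Assign rCN (Add (Reg rCN) (Const 1)))
  (asu s0 ((rCN, Suc cn) # (rIX, idx) # rv) ((rPT, 4, node) # hs))"
  by (rule tri_Assign) (use cnB in "auto intro!: sm")
  have "tru 40 (asu s0 ?r5 hs) (Seq ?cmda
  ?cmdb) Q"
  proof (rule tri_conseq[OF tri_Seq[OF d1 tri_Seq[OF d2 d3]]])
  fix s' assume a: "asu s0 ((rCN, Suc cn) # (rIX, idx) # rv) ((rPT, 4, node) # hs) s'"
  have 1: "asu s0 ((rCN, Suc cn) # (rIX, idx) # rv) hs s'" using a by (rule asrt_weaken) auto
  have m: "mem s' (regs s' rPT + h) = node h" if "h < 4" for h
  using hsfD[OF asrt_hsf[OF a], of rPT 4 node h] that by simp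
  have hp: "regs s' rPT + 4 <= regs s' HP" using a by (simp add: asrt_def)
  have "chain s' (regs s' rPT) ((s, t, V0 - 2) # found Z kp idx)"
  using m[of 0] m[of 1] m[of 2] m[of 3] hp chain_fr[OF asrt_fr[OF a] ch] by (simp add: node_def numeral_2_eq_2 numeral_3_eq_3)
  then show "Q s'" unfolding Q_def fS using 1 by (simp add: cn_def)
  qed auto
  then show ?thesis using True by simp
  qed
 qed (auto intro!: sm)
 show ?thesis unfolding pair_core_def
  by (rule tri_mono[OF tri_Seq[OF c1 tri_Seq[OF c2 tri_Seq[OF c3 tri_Seq[OF c4' tri_Seq[OF c5 c6]]]]]]) simp
 qed
 have t5: "tru (1 + ?T) (asu s0 ?r4 hs) (Branch (Eq (Reg rS) (Reg rT)) Skip (pair_core P R)) Q"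
 proof (rule tri_Branch[where x = "if s = t then 1 else 0"])
 show "evn s' (Eq (Reg rS) (Reg rT)) = (if s = t then 1 else 0)" if "asu s0 ?r4 hs s'" for s'
  using asrt_rvf[OF that] by simp
 show "tru ?T (asu s0 ?r4 hs) (if (if s = t then 1 else 0) ~= (0 :: nat) then Skip else pair_core P R) Q"
 proof (cases "s = t")
  case True
  then have "~ hit Z kp idx" by (simp add: hit_def s_def t_def i_def j_def)
  from skip[OF this] have "tru 1 (asu s0 ?r4 hs) Skip Q" by auto
  then show ?thesis using True tri_mono[of UNIV 1 _ Skip Q ?T] by simp
 qed (use core in simp)
 qed (auto intro!: sm)
 let ?fS = "found Z kp (Suc idx)"
 have chX: "chain s' (regs s' rPT) ?fS" if "fr {rIX} s1 s'" "chain s1 (regs s1 rPT) ?fS" for s1 s' :: state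
 using fr_regs[OF that(1)] chain_fr[OF that] by simp
 have t6: "tru 1 Q (Assign rIX (Add (Reg rIX) (Const 1)))
 (%s. asu s0 ((rIX, Suc idx) # (rCN, length ?fS) # rv) hs s & chain s (regs s rPT) ?fS)"
 unfolding Q_def
 proof (rule tri_frame[where F = "{rIX}", OF _ chX])
 show "tri {rIX} 1 (asrt {rIX} s1 ((rCN, length ?fS) # (rIX, idx) # rv) hs) (Assign rIX (Add (Reg rIX) (Const 1)))
  (asrt {rIX} s1 ((rIX, Suc idx) # (rCN, length ?fS) # rv) hs)" for s1
  by (rule tri_Assign) (use ijB in "auto intro!: sm")
 qed auto
 show ?thesis unfolding pair_cmd_def cn_def[symmetric]
 by (rule tri_mono[OF tri_Seq[OF t1 tri_Seq[OF t2 tri_Seq[OF t3 tri_Seq[OF t4 tri_Seq[OF t5 t6]]]]]]) (simp add: K_def)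
qed

end

section \<open>Sizes and prime search\<close>

text \<open>With \<open>H = 2 ^ (q div 4)\<close>, the bound \<open>G = 2 ^ 14 * D ^ 2 / H\<close>
  is about \<open>D powr (7/4)\<close>, and \<open>X = G * G = 2 ^ e\<close>. The last loop raises
  \<open>2 * D * X\<close> to the power \<open>c\<close>; this gives
  \<open>(d + p) ^ c <= 2 ^ v\<close> for all orders \<open>d <= D\<close> and primes
  \<open>p < X\<close>, as the multiplication program requires.\<close>

definition sizes_cmd :: "nat => cmd" where
 "sizes_cmd c =
  Seq (Assign rD (Const 1))
 (Seq (Assign rQ (Const 0))
 (Seq (While (Less (Reg rD) (Add (Reg rN) (Mul (Add (Reg rSA) (Reg rTA)) (Reg rK))))
  (Seq (Assign rD (Add (Reg rD) (Reg rD))) (Assign rQ (Add (Reg rQ) (Const 1)))))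
 (Seq (Assign rH (Const 1))
 (Seq (Assign rHC (Const 0))
 (Seq (While (Less (Mul (Const 16) (Mul (Mul (Reg rH) (Reg rH)) (Mul (Reg rH) (Reg rH)))) (Add (Reg rD) (Const 1)))
  (Seq (Assign rH (Add (Reg rH) (Reg rH))) (Assign rHC (Add (Reg rHC) (Const 1)))))
 (Seq (Assign rG (Div (Mul (Const 16384) (Mul (Reg rD) (Reg rD))) (Reg rH)))
 (Seq (Assign rE (Mul (Const 2) (Sub (Add (Add (Reg rQ) (Reg rQ)) (Const 14)) (Reg rHC))))
 (Seq (Assign rX (Mul (Reg rG) (Reg rG)))
 (Seq (Assign rLO (Mul (Const 1024) (Mul (Reg rD) (Mul (Reg rD) (Reg rD)))))
 (Seq (Assign rLR (Add (Mul (Const 3) (Mul (Reg rD) (Reg rD))) (Mul (Const 6) (Reg rE))))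
 (Seq (Assign RW (Const 1))
 (Seq (Assign rIX (Const 0))
  (While (Less (Reg rIX) (Const c))
  (Seq (Assign RW (Mul (Reg RW) (Mul (Const 2) (Mul (Reg rD) (Reg rX)))))
  (Assign rIX (Add (Reg rIX) (Const 1)))))))))))))))))"

definition setup_cmd :: "nat => cmd" where
 "setup_cmd c =
  Seq (Assign rN (cell rAJ (Const 0)))
 (Seq (Assign rK (cell rAJ (Const 1)))
 (Seq (Assign rSB (Const 2))
 (Seq (Assign rTB (Add (Const 2) (Reg rN)))
 (Seq (Assign rAJ (Add (Const 2) (Add (Reg rN) (Reg rN))))
 (Seq (collect rSB rSL rSA)
 (Seq (collect rTB rTS rTA)
  (sizes_cmd c)))))))"

text \<open>The nested comparison in the inner loop tests for a proper divisor: the remainder is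
  compared with 1 if the divisor is below the candidate and with 0 otherwise, and only a zero
  remainder in the first case passes.\<close>

definition prime_cmd :: cmd where
 "prime_cmd =
  Seq (Assign PR (Const 0))
 (Seq (Assign rCJ (Const 0))
  (While (Less (Reg rCJ) (Mul (Const 6) (Reg rE)))
  (Seq (Assign rC (Mod (cell rRND (Add (Mul (Const 3) (Mul (Reg rD) (Reg rD))) (Reg rCJ))) (Reg rX)))
  (Seq (Assign rFL (Sub (Const 1) (Less (Reg rC) (Reg rLO))))
  (Seq (Assign rDV (Const 2))
  (Seq (While (Less (Reg rDV) (Reg rG))
  (Seq (Assign rFL (Mul (Reg rFL) (Sub (Const 1) (Less (Mod (Reg rC) (Reg rDV)) (Less (Reg rDV) (Reg rC))))))
  (Assign rDV (Add (Reg rDV) (Const 1)))))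
  (Seq (Branch (Reg rFL) (Assign PR (Reg rC)) Skip)
  (Assign rCJ (Add (Reg rCJ) (Const 1)))))))))) "

text \<open>Of two complementary divisors of a number below \<open>G * G\<close>, one is below
  \<open>G\<close>. The condition \<open>d < C\<close> keeps primes below \<open>G\<close> from
  being rejected as divisors of themselves.\<close>

lemma trial_division:
 fixes C G :: nat
 assumes "2 <= C" "C < G * G"
 shows "prime C \<longleftrightarrow> (ALL d. 2 <= d --> d < G --> d < C --> C mod d ~= 0)"
proof
 assume "prime C"
 show "ALL d. 2 <= d --> d < G --> d < C --> C mod d ~= 0"
 proof (intro allI impI notI)
 fix d assume d: "2 <= d" "d < C" "C mod d = 0"
 then have "d dvd C" by (simp add: mod_eq_0_iff_dvd)
 then have "d = 1 | d = C" using \<open>prime C\<close> prime_nat_iff by blast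
 then show False using d by simp
 qed
next
 assume *: "ALL d. 2 <= d --> d < G --> d < C --> C mod d ~= 0"
 have no: "~ (d dvd C & 2 <= d & d < C & d < G)" for d using * by (auto simp: mod_eq_0_iff_dvd)
 show "prime C"
 proof (rule ccontr)
 assume "~ prime C"
 then obtain d where d: "d dvd C" "d ~= 1" "d ~= C" using assms(1) by (auto simp: prime_nat_iff)
 then obtain k where k: "C = d * k" by (elim dvdE)
 have "d ~= 0" using k assms(1) by (cases d) auto
 moreover have "k ~= 0" using k assms(1) by (cases k) auto
 ultimately have nz: "d ~= 0" "k ~= 0" by auto
 have k1: "k ~= 1" using k d by auto
 have lt: "d < C" "k < C" using k d nz k1 by (auto simp: nat_mult_eq_cancel1)
 have kd: "k dvd C" using k by simp
 have "d < G | k < G"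
 proof (rule ccontr)
  assume "~ ?thesis"
  then have "G * G <= d * k" by (intro mult_le_mono) auto
  then show False using assms(2) k by simp
 qed
 then show False using no[of d] no[of k] d(1) kd lt nz d(2) k1 by force
 qed
qed

section \<open>Computing sizes and testing primality\<close>

context ram
begin

lemma tri_sizes:
 fixes n k a b q c :: nat
 defines "D == 2 ^ q" and "e == 2 * (2 * q + 14 - q div 4)"
 defines "v == c * (1 + q + e)"
 assumes q: "n + (a + b) * k <= 2 ^ q" "!!i. i < q ==> 2 ^ i < n + (a + b) * k" and c: "2 <= c" and vB: "2 ^ v <= B" "c <= B"
 and av: "avoid {41..49} [] hs" "avoid {HP, RW, rIX} [] hs"
 defines "rv == [(rN, n), (rK, k), (rSA, a), (rTA, b)]"
 shows "tru (4 * (q + q div 4 + c) + 100) (asu s0 rv hs) (sizes_cmd c)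
 (asu s0 ([(RW, 2 ^ v), (rLR, 3 * (D * D) + 6 * e), (rLO, 1024 * D ^ 3), (rX, 2 ^ e), (rE, e),
  (rG, 2 ^ (2 * q + 14 - q div 4)), (rQ, q), (rD, D)] @ rv) hs)"
proof -
 let ?cmda = "Less (Reg rD) (Add (Reg rN) (Mul (Add (Reg rSA) (Reg rTA)) (Reg rK)))"
 define h where "h = q div 4"
 define g where "g = 2 * q + 14 - h"
 have h: "4 * h <= q" "q < 4 * h + 4" by (auto simp: h_def)
 have eg: "e = 2 * g" by (simp add: e_def g_def h_def)
 have pw: "(2 :: nat) ^ i <= B" if "i <= v" for i using power_increasing[OF that, of "2 :: nat"] vB by linarith
 \<comment> \<open>From \<open>c >= 2\<close> there is room for squares of all the sizes, which
   keeps every intermediate value below \<open>B\<close>.\<close>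
 have v2: "2 * (1 + q + e) <= v" unfolding v_def using c by (rule mult_le_mono1)
 have eB: "2 ^ e <= B" and qB: "2 ^ q <= B" using v2 by (auto intro!: pw)
 have gB: "2 ^ g <= B" using v2 eg by (auto intro!: pw)
 have loB: "2 ^ (10 + 3 * q) <= B" using v2 eg h by (auto intro!: pw simp: g_def)
 have lo: "1024 * D ^ 3 = 2 ^ (10 + 3 * q)" by (simp add: D_def power_add power_mult[symmetric] mult.commute)
 have lB: "l <= B" if "2 ^ l <= B" for l using that less_exp[of l] by linarith
 have lrB: "3 * (D * D) + 6 * e <= B"
 proof -
 have "e < 2 ^ e" by (rule less_exp)
 have "3 <= e" unfolding eg g_def using h by linarith
 from power_increasing[OF this, of "2 :: nat"] have e1: "6 <= (2 :: nat) ^ e" by simp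
 have "6 * e <= 2 ^ e * 2 ^ e" using e1 \<open>e < 2 ^ e\<close> by (intro mult_le_mono) auto
 also have "... <= (D * D) * (2 ^ e * 2 ^ e)" by (simp add: D_def)
 finally have 1: "6 * e <= (D * D) * (2 ^ e * 2 ^ e)" .
 have "3 * (D * D) <= 3 * ((D * D) * (2 ^ e * 2 ^ e))" by simp
 then have "3 * (D * D) + 6 * e <= 4 * ((D * D) * (2 ^ e * 2 ^ e))" using 1 by linarith
 also have "... = 2 ^ (2 * (1 + q + e))" by (simp add: D_def power_add power_mult[symmetric] mult.commute flip: power_add mult_2)
 also have "... <= B" using v2 by (rule pw)
 finally show ?thesis .
 qed
 have B2: "16384 <= B" using B20 by simp
 note [simp] = small_def rvf_Cons avoid_def
 have avr: "!!x L f. (x, L, f) \<in> set hs ==> x ~: {HP, RW, rIX} \<union> {41..49}" using av by auto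
 let ?qc = "Seq (Assign rD (Add (Reg rD) (Reg rD))) (Assign rQ (Add (Reg rQ) (Const 1)))"
 have t1: "tru 1 (asu s0 rv hs) (Assign rD (Const 1)) (asu s0 ([(rD, 1)] @ rv) hs)"
 unfolding append.simps by (rule tri_Assign) (use B2 av in "auto simp: rv_def")
 have t2: "tru 1 (asu s0 ([(rD, 1)] @ rv) hs) (Assign rQ (Const 0)) (asu s0 ([(rQ, 0), (rD, 2 ^ 0)] @ rv) hs)"
 unfolding append.simps by (rule tri_Assign) (use B2 av in "auto simp: rv_def")
 have t3: "tru (q * (3 + 1) + 1) (asu s0 ([(rQ, 0), (rD, 2 ^ 0)] @ rv) hs)
 (While ?cmda ?qc) (asu s0 ([(rQ, q), (rD, 2 ^ q)] @ rv) hs)"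
 proof (rule tri_loop)
 fix i assume i: "i < q"
 have "(2 :: nat) ^ Suc i <= 2 ^ q" using i by (intro power_increasing) auto
 then have pB: "2 ^ i + 2 ^ i <= B" "i + 1 <= B" using qB lB[OF qB] i by auto
 have 1: "tru 1 (asu s0 ([(rQ, i), (rD, 2 ^ i)] @ rv) hs) (Assign rD (Add (Reg rD) (Reg rD)))
  (asu s0 ((rD, 2 ^ Suc i) # [(rQ, i)] @ rv) hs)"
  by (rule tri_Assign) (use B2 pB av in "auto simp: rv_def")
 have 2: "tru 1 (asu s0 ((rD, 2 ^ Suc i) # [(rQ, i)] @ rv) hs) (Assign rQ (Add (Reg rQ) (Const 1)))
  (asu s0 ((rQ, Suc i) # [(rD, 2 ^ Suc i)] @ rv) hs)"
  by (rule tri_Assign) (use B2 pB av in "auto simp: rv_def")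
 show "tru 3 (asu s0 ([(rQ, i), (rD, 2 ^ i)] @ rv) hs) ?qc (asu s0 ([(rQ, Suc i), (rD, 2 ^ Suc i)] @ rv) hs)"
  by (rule tri_mono[OF tri_post[OF tri_Seq[OF 1 2]]]) auto
 next
 show "evn s ?cmda ~= 0"
  if "i < q" "asu s0 ([(rQ, i), (rD, 2 ^ i)] @ rv) hs s" for i s
  using asrt_rvf[OF that(2)] q(2)[OF that(1)] by (simp add: rv_def)
 show "evn s ?cmda = 0"
  if "asu s0 ([(rQ, q), (rD, 2 ^ q)] @ rv) hs s" for s
  using asrt_rvf[OF that] q(1) by (simp add: rv_def)
 qed (use B2 in simp)
 let ?r1 = "[(rQ, q), (rD, D)] @ rv"
 have t4: "tru 1 (asu s0 ([(rQ, q), (rD, 2 ^ q)] @ rv) hs) (Assign rH (Const 1)) (asu s0 ((rH, 1) # ?r1) hs)"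
 by (rule tri_Assign) (use B2 av in "auto simp: rv_def D_def")
 have t5: "tru 1 (asu s0 ((rH, 1) # ?r1) hs) (Assign rHC (Const 0)) (asu s0 ((rHC, 0) # (rH, 2 ^ 0) # ?r1) hs)"
 by (rule tri_Assign) (use B2 av in "auto simp: rv_def D_def")
 let ?hc = "Seq (Assign rH (Add (Reg rH) (Reg rH))) (Assign rHC (Add (Reg rHC) (Const 1)))"
 let ?hcond = "Less (Mul (Const 16) (Mul (Mul (Reg rH) (Reg rH)) (Mul (Reg rH) (Reg rH)))) (Add (Reg rD) (Const 1))"
 have p16: "16 * ((2 ^ i * 2 ^ i) * (2 ^ i * 2 ^ i)) = (2 :: nat) ^ (4 + 4 * i)" for i
 by (simp add: power_add mult_2 numeral_eq_Suc)
 have t6: "tru (h * (3 + 1) + 1) (asu s0 ((rHC, 0) # (rH, 2 ^ 0) # ?r1) hs) (While ?hcond ?hc)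
  (asu s0 ((rHC, h) # (rH, 2 ^ h) # ?r1) hs)"
 proof (rule tri_loop)
 fix i assume i: "i < h"
 have "(2 :: nat) ^ Suc i <= 2 ^ q" using i h by (intro power_increasing) auto
 then have pB: "2 ^ i + 2 ^ i <= B" "i + 1 <= B" using qB lB[OF qB] i h by auto
 have 1: "tru 1 (asu s0 ((rHC, i) # (rH, 2 ^ i) # ?r1) hs) (Assign rH (Add (Reg rH) (Reg rH)))
  (asu s0 ((rH, 2 ^ Suc i) # (rHC, i) # ?r1) hs)"
  by (rule tri_Assign) (use B2 pB av in "auto simp: rv_def")
 have 2: "tru 1 (asu s0 ((rH, 2 ^ Suc i) # (rHC, i) # ?r1) hs) (Assign rHC (Add (Reg rHC) (Const 1)))
  (asu s0 ((rHC, Suc i) # (rH, 2 ^ Suc i) # ?r1) hs)"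
  by (rule tri_Assign) (use B2 pB av in "auto simp: rv_def")
 show "tru 3 (asu s0 ((rHC, i) # (rH, 2 ^ i) # ?r1) hs) ?hc (asu s0 ((rHC, Suc i) # (rH, 2 ^ Suc i) # ?r1) hs)"
  by (rule tri_mono[OF tri_Seq[OF 1 2]]) auto
 next
 show "evn s ?hcond ~= 0" if i: "i < h" and as: "asu s0 ((rHC, i) # (rH, 2 ^ i) # ?r1) hs s" for i s
 proof -
  have "(2 :: nat) ^ (4 + 4 * i) <= 2 ^ q" using i h by (intro power_increasing) auto
  then have "16 * ((2 ^ i * 2 ^ i) * (2 ^ i * 2 ^ i)) < D + 1" unfolding p16 D_def by linarith
  then show ?thesis using asrt_rvf[OF as] by simp
 qed
 show "evn s ?hcond = 0" if as: "asu s0 ((rHC, h) # (rH, 2 ^ h) # ?r1) hs s" for s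
 proof -
  have "(2 :: nat) ^ q < 2 ^ (4 + 4 * h)" using h by (intro power_strict_increasing) auto
  then have "~ 16 * ((2 ^ h * 2 ^ h) * (2 ^ h * 2 ^ h)) < D + 1" unfolding p16 D_def by linarith
  then show ?thesis using asrt_rvf[OF as] by simp
 qed
 qed (use B2 in simp)
 have gv: "16384 * (D * D) div 2 ^ h = 2 ^ g"
 proof -
 have "(2 :: nat) ^ (2 * q + 14) = (2 ^ q * 2 ^ q) * 2 ^ 14" by (simp only: power_add mult_2)
 then have "16384 * (D * D) = 2 ^ (2 * q + 14)" by (simp add: D_def)
 moreover have "(2 :: nat) ^ g = 2 ^ (2 * q + 14) div 2 ^ h" unfolding g_def using h by (intro power_diff) auto
 ultimately show ?thesis by simp
 qed
 have ev8: "2 * (q + q + 14 - h) = e" by (simp only: eg g_def mult_2)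
 have ev9: "2 ^ g * 2 ^ g = (2 :: nat) ^ e" by (simp only: eg mult_2 power_add)
 have t7: "tru 1 (asu s0 ((rHC, h) # (rH, 2 ^ h) # ?r1) hs) (Assign rG (Div (Mul (Const 16384) (Mul (Reg rD) (Reg rD))) (Reg rH)))
 (asu s0 ((rG, 2 ^ g) # (rHC, h) # ?r1) hs)"
 by (rule tri_Assign) (use B2 gB gv av in "auto simp: rv_def")
 have t8: "tru 1 (asu s0 ((rG, 2 ^ g) # (rHC, h) # ?r1) hs) (Assign rE (Mul (Const 2) (Sub (Add (Add (Reg rQ) (Reg rQ)) (Const 14)) (Reg rHC))))
 (asu s0 ((rE, e) # (rG, 2 ^ g) # ?r1) hs)"
 by (rule tri_Assign) (use B2 lB[OF eB] av ev8 in "auto simp: rv_def")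
 have t9: "tru 1 (asu s0 ((rE, e) # (rG, 2 ^ g) # ?r1) hs) (Assign rX (Mul (Reg rG) (Reg rG)))
 (asu s0 ((rX, 2 ^ e) # (rE, e) # (rG, 2 ^ g) # ?r1) hs)"
 by (rule tri_Assign) (use B2 eB av ev9 in "auto simp: rv_def")
 have t10: "tru 1 (asu s0 ((rX, 2 ^ e) # (rE, e) # (rG, 2 ^ g) # ?r1) hs) (Assign rLO (Mul (Const 1024) (Mul (Reg rD) (Mul (Reg rD) (Reg rD)))))
 (asu s0 ((rLO, 1024 * D ^ 3) # (rX, 2 ^ e) # (rE, e) # (rG, 2 ^ g) # ?r1) hs)"
 by (rule tri_Assign) (use B2 loB[folded lo] av in "auto simp: rv_def power3_eq_cube")
 let ?r2 = "(rLR, 3 * (D * D) + 6 * e) # (rLO, 1024 * D ^ 3) # (rX, 2 ^ e) # (rE, e) # (rG, 2 ^ g) # ?r1"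
 have t11: "tru 1 (asu s0 ((rLO, 1024 * D ^ 3) # (rX, 2 ^ e) # (rE, e) # (rG, 2 ^ g) # ?r1) hs)
 (Assign rLR (Add (Mul (Const 3) (Mul (Reg rD) (Reg rD))) (Mul (Const 6) (Reg rE)))) (asu s0 ?r2 hs)"
 by (rule tri_Assign) (use B2 lrB av in "auto simp: rv_def")
 have t12: "tru 1 (asu s0 ?r2 hs) (Assign RW (Const 1)) (asu s0 ((RW, 1) # ?r2) hs)"
 by (rule tri_Assign) (use B2 av in "auto simp: rv_def")
 have t13: "tru 1 (asu s0 ((RW, 1) # ?r2) hs) (Assign rIX (Const 0)) (asu s0 ((rIX, 0) # (RW, 2 ^ (0 * (1 + q + e))) # ?r2) hs)"
 by (rule tri_Assign) (use B2 av in "auto simp: rv_def")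
 let ?wc = "Seq (Assign RW (Mul (Reg RW) (Mul (Const 2) (Mul (Reg rD) (Reg rX))))) (Assign rIX (Add (Reg rIX) (Const 1)))"
 have t14: "tru (c * (3 + 1) + 1) (asu s0 ((rIX, 0) # (RW, 2 ^ (0 * (1 + q + e))) # ?r2) hs) (While (Less (Reg rIX) (Const c)) ?wc)
 (asu s0 ((rIX, c) # (RW, 2 ^ (c * (1 + q + e))) # ?r2) hs)"
 proof (rule tri_loop)
 fix i assume i: "i < c"
 have "Suc i * (1 + q + e) <= v" unfolding v_def using i by (intro mult_le_mono1) simp
 then have pB: "2 ^ (Suc i * (1 + q + e)) <= B" by (rule pw)
 have ev: "2 ^ (i * (1 + q + e)) * (2 * (D * 2 ^ e)) = 2 ^ (Suc i * (1 + q + e))"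
  by (simp add: D_def power_add)
 have 1: "tru 1 (asu s0 ((rIX, i) # (RW, 2 ^ (i * (1 + q + e))) # ?r2) hs) (Assign RW (Mul (Reg RW) (Mul (Const 2) (Mul (Reg rD) (Reg rX)))))
  (asu s0 ((RW, 2 ^ (Suc i * (1 + q + e))) # (rIX, i) # ?r2) hs)"
 proof (rule tri_Assign)
  fix s assume "rvf ((rIX, i) # (RW, 2 ^ (i * (1 + q + e))) # ?r2) s"
  then have "evn s (Mul (Reg RW) (Mul (Const 2) (Mul (Reg rD) (Reg rX)))) = 2 ^ (i * (1 + q + e)) * (2 * (D * 2 ^ e))" by simp
  then show "evn s (Mul (Reg RW) (Mul (Const 2) (Mul (Reg rD) (Reg rX)))) = 2 ^ (Suc i * (1 + q + e)) & 2 ^ (Suc i * (1 + q + e)) <= B"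
  using ev pB by simp
 qed (use B2 av in "auto simp: rv_def")
 have 2: "tru 1 (asu s0 ((RW, 2 ^ (Suc i * (1 + q + e))) # (rIX, i) # ?r2) hs) (Assign rIX (Add (Reg rIX) (Const 1)))
  (asu s0 ((rIX, Suc i) # (RW, 2 ^ (Suc i * (1 + q + e))) # ?r2) hs)"
  by (rule tri_Assign) (use B2 vB(2) i av in "auto simp: rv_def")
 show "tru 3 (asu s0 ((rIX, i) # (RW, 2 ^ (i * (1 + q + e))) # ?r2) hs) ?wc
  (asu s0 ((rIX, Suc i) # (RW, 2 ^ (Suc i * (1 + q + e))) # ?r2) hs)"
  by (rule tri_mono[OF tri_Seq[OF 1 2]]) auto
 next
 show "evn s (Less (Reg rIX) (Const c)) ~= 0" if "i < c" "asu s0 ((rIX, i) # (RW, 2 ^ (i * (1 + q + e))) # ?r2) hs s" for i s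
  using asrt_rvf[OF that(2)] that(1) by simp
 show "evn s (Less (Reg rIX) (Const c)) = 0" if "asu s0 ((rIX, c) # (RW, 2 ^ (c * (1 + q + e))) # ?r2) hs s" for s
  using asrt_rvf[OF that] by simp
 qed (use vB in simp)
 show ?thesis
 unfolding sizes_cmd_def
 proof (rule tri_conseq[OF tri_Seq[OF t1 tri_Seq[OF t2 tri_Seq[OF t3 tri_Seq[OF t4 tri_Seq[OF t5 tri_Seq[OF t6 tri_Seq[OF t7 tri_Seq[OF t8
  tri_Seq[OF t9 tri_Seq[OF t10 tri_Seq[OF t11 tri_Seq[OF t12 tri_Seq[OF t13 t14]]]]]]]]]]]]]])
 fix s assume "asu s0 ((rIX, c) # (RW, 2 ^ (c * (1 + q + e))) # ?r2) hs s"
 then show "asu s0 ([(RW, 2 ^ v), (rLR, 3 * (D * D) + 6 * e), (rLO, 1024 * D ^ 3), (rX, 2 ^ e), (rE, e),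
  (rG, 2 ^ (2 * q + 14 - q div 4)), (rQ, q), (rD, D)] @ rv) hs s"
  by (rule asrt_weaken) (auto simp: v_def g_def h_def)
 qed (auto simp: h_def)
qed

lemma tri_prime:
 fixes f :: "nat => nat"
 assumes G: "2 <= G" "X = G * G" and lo: "2 <= lo" and B: "X <= B" "6 * e <= B" and l: "d + 6 * e <= l" "d = 3 * (D * D)"
 and rv: "{(rE, e), (rD, D), (rX, X), (rLO, lo), (rG, G)} \<subseteq> set rv" and hs: "(rRND, l, f) \<in> set hs"
 and av: "avoid {HP, PR, rCJ, rC, rFL, rDV} rv hs"
 shows "tru (6 * e * (4 * G + 30) + 10) (asu s0 rv hs) prime_cmd
 (asu s0 ((PR, pick (%j. f (d + j) mod X) lo (6 * e)) # rv) hs)"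
proof -
 let ?cmda = "Seq (Assign rC (Mod (cell rRND (Add (Mul (Const 3) (Mul (Reg rD) (Reg rD))) (Reg rCJ))) (Reg rX))) (Seq (Assign rFL (Sub (Const 1) (Less (Reg rC) (Reg rLO)))) (Seq (Assign rDV (Const 2)) (Seq (While (Less (Reg rDV) (Reg rG)) (Seq (Assign rFL (Mul (Reg rFL) (Sub (Const 1) (Less (Mod (Reg rC) (Reg rDV)) (Less (Reg rDV) (Reg rC)))))) (Assign rDV (Add (Reg rDV) (Const 1))))) (Seq (Branch (Reg rFL) (Assign PR (Reg rC)) Skip) (Assign rCJ (Add (Reg rCJ) (Const 1)))))))"
 let ?cmdb = "Mul (Reg rFL) (Sub (Const 1) (Less (Mod (Reg rC) (Reg rDV)) (Less (Reg rDV) (Reg rC))))"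
 define g where "g j = f (d + j) mod X" for j
 have B2: "2 <= B" using B20 by simp
 have GB: "G <= B" using G B by (metis le_square le_trans)
 have gX: "g j < X" for j using G by (auto simp: g_def)
 note [simp] = small_def rvf_Cons
 have avr: "!!r L h. (r, L, h) \<in> set hs ==> r ~: {HP, PR, rCJ, rC, rFL, rDV}"
  "!!r x. (r, x) \<in> set rv ==> r ~: {HP, PR, rCJ, rC, rFL, rDV}" using av by (auto simp: avoid_def)
 have val: "regs s rE = e" "regs s rD = D" "regs s rX = X" "regs s rLO = lo" "regs s rG = G" if "rvf rv s" for s
 using rv that by (auto dest: rvfD)
 \<comment> \<open>The value of the flag once all trial divisors below \<open>i\<close> have been
   used.\<close>
 define fl where "fl j i = (if lo <= g j & (ALL x. 2 <= x --> x < i --> x < g j --> g j mod x ~= 0) then 1 else (0::nat))" for j i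
 define P where "P j = pick g lo j" for j
 have PX: "P j <= B" for j
 proof (cases "P j = 0")
 case False
 then obtain i where "P j = g i" using pick_nonzero[of g lo j] unfolding P_def by blast
 then show ?thesis using gX[of i] B by simp
 qed simp
 let ?r = "%j. (rCJ, j) # (PR, P j) # rv"
 let ?r2 = "%j. (rC, g j) # ?r j"
 have body: "tru (4 * G + 20) (asu s0 (?r j) hs)
  ?cmda
  (asu s0 (?r (Suc j)) hs)" if j: "j < 6 * e" for j
 proof -
 have t1: "tru 1 (asu s0 (?r j) hs) (Assign rC (Mod (cell rRND (Add (Mul (Const 3) (Mul (Reg rD) (Reg rD))) (Reg rCJ))) (Reg rX)))
  (asu s0 (?r2 j) hs)"
 proof (rule tri_Assign)
  fix s assume s: "rvf (?r j) s" "hsf hs s"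
  have "mem s (regs s rRND + (d + j)) = f (d + j)" using j l by (intro hsfD[OF s(2) hs]) simp
  then show "evn s (Mod (cell rRND (Add (Mul (Const 3) (Mul (Reg rD) (Reg rD))) (Reg rCJ))) (Reg rX)) = g j & g j <= B"
  using s(1) val[of s] l(2) gX[of j] B by (simp add: g_def)
 qed (use B20 av in "auto simp: avoid_def")
 have t2: "tru 1 (asu s0 (?r2 j) hs) (Assign rFL (Sub (Const 1) (Less (Reg rC) (Reg rLO)))) (asu s0 ((rFL, fl j 2) # ?r2 j) hs)"
  by (rule tri_Assign) (use B2 av val in "auto simp: avoid_def fl_def")
 have t3: "tru 1 (asu s0 ((rFL, fl j 2) # ?r2 j) hs) (Assign rDV (Const 2)) (asu s0 ((rDV, 2 + 0) # (rFL, fl j (2 + 0)) # ?r2 j) hs)"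
  by (rule tri_Assign) (use B2 av in "auto simp: avoid_def")
 let ?c = "Seq (Assign rFL ?cmdb)
  (Assign rDV (Add (Reg rDV) (Const 1)))"
 have t4: "tru ((G - 2) * (3 + 1) + 1) (asu s0 ((rDV, 2 + 0) # (rFL, fl j (2 + 0)) # ?r2 j) hs)
  (While (Less (Reg rDV) (Reg rG)) ?c) (asu s0 ((rDV, 2 + (G - 2)) # (rFL, fl j (2 + (G - 2))) # ?r2 j) hs)"
 proof (rule tri_loop)
  fix i assume i: "i < G - 2"
  have fS: "fl j (2 + i) * (1 - (if g j mod (2 + i) < (if 2 + i < g j then 1 else 0) then 1 else 0)) = fl j (2 + Suc i)"
  proof -
  have "x < 2 + Suc i \<longleftrightarrow> x < 2 + i | x = 2 + i" for x by linarith
  then have "(ALL x. 2 <= x --> x < 2 + Suc i --> x < g j --> g j mod x ~= 0) \<longleftrightarrow>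
  (ALL x. 2 <= x --> x < 2 + i --> x < g j --> g j mod x ~= 0) & (2 + i < g j --> g j mod (2 + i) ~= 0)"
  using le_add1[of 2 i] by (simp only:) blast
  then show ?thesis by (auto simp: fl_def)
  qed
  have 1: "tru 1 (asu s0 ((rDV, 2 + i) # (rFL, fl j (2 + i)) # ?r2 j) hs)
  (Assign rFL ?cmdb)
  (asu s0 ((rFL, fl j (2 + Suc i)) # (rDV, 2 + i) # ?r2 j) hs)"
  proof (rule tri_Assign)
  fix s assume "rvf ((rDV, 2 + i) # (rFL, fl j (2 + i)) # ?r2 j) s"
  then have "evn s ?cmdb =
  fl j (2 + i) * (1 - (if g j mod (2 + i) < (if 2 + i < g j then 1 else 0) then 1 else 0))" by simp
  then show "evn s ?cmdb = fl j (2 + Suc i) & fl j (2 + Suc i) <= B"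
  using fS B2 by (simp add: fl_def)
  qed (use B2 av in "auto simp: avoid_def")
  have 2: "tru 1 (asu s0 ((rFL, fl j (2 + Suc i)) # (rDV, 2 + i) # ?r2 j) hs) (Assign rDV (Add (Reg rDV) (Const 1)))
  (asu s0 ((rDV, 2 + Suc i) # (rFL, fl j (2 + Suc i)) # ?r2 j) hs)"
  by (rule tri_Assign) (use B2 GB i av in "auto simp: avoid_def")
  show "tru 3 (asu s0 ((rDV, 2 + i) # (rFL, fl j (2 + i)) # ?r2 j) hs) ?c (asu s0 ((rDV, 2 + Suc i) # (rFL, fl j (2 + Suc i)) # ?r2 j) hs)"
  by (rule tri_mono[OF tri_Seq[OF 1 2]]) simp
 next
  show "evn s (Less (Reg rDV) (Reg rG)) ~= 0" if "i < G - 2" "asu s0 ((rDV, 2 + i) # (rFL, fl j (2 + i)) # ?r2 j) hs s" for i s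
  using asrt_rvf[OF that(2)] that(1) val by simp
  show "evn s (Less (Reg rDV) (Reg rG)) = 0" if "asu s0 ((rDV, 2 + (G - 2)) # (rFL, fl j (2 + (G - 2))) # ?r2 j) hs s" for s
  using asrt_rvf[OF that] val by simp
 qed simp
 have GG: "2 + (G - 2) = G" using G by simp
 have flG: "fl j (2 + (G - 2)) ~= 0 \<longleftrightarrow> prime (g j) & lo <= g j"
 proof (cases "lo <= g j")
  case True
  have td: "prime (g j) \<longleftrightarrow> (ALL d. 2 <= d --> d < G --> d < g j --> g j mod d ~= 0)"
  by (rule trial_division) (use True lo gX[of j] G in auto)
  show ?thesis unfolding GG fl_def td[symmetric] using True by simp
 next
  case False
  then show ?thesis by (simp add: fl_def)
 qed
 have t5: "tru (1 + 1) (asu s0 ((rDV, 2 + (G - 2)) # (rFL, fl j (2 + (G - 2))) # ?r2 j) hs) (Branch (Reg rFL) (Assign PR (Reg rC)) Skip)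
  (asu s0 ((PR, P (Suc j)) # (rCJ, j) # rv) hs)"
 proof (rule tri_Branch)
  show "evn s (Reg rFL) = fl j (2 + (G - 2))" if "asu s0 ((rDV, 2 + (G - 2)) # (rFL, fl j (2 + (G - 2))) # ?r2 j) hs s" for s
  using asrt_rvf[OF that] by simp
  show "tru 1 (asu s0 ((rDV, 2 + (G - 2)) # (rFL, fl j (2 + (G - 2))) # ?r2 j) hs)
  (if fl j (2 + (G - 2)) ~= 0 then Assign PR (Reg rC) else Skip) (asu s0 ((PR, P (Suc j)) # (rCJ, j) # rv) hs)"
  proof (cases "fl j (2 + (G - 2)) ~= 0")
  case True
  then have P: "P (Suc j) = g j" using flG by (simp add: P_def)
  have "tru 1 (asu s0 ((rDV, 2 + (G - 2)) # (rFL, fl j (2 + (G - 2))) # ?r2 j) hs) (Assign PR (Reg rC)) (asu s0 ((PR, P (Suc j)) # (rCJ, j) # rv) hs)"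
  unfolding P by (rule tri_Assign) (use gX[of j] B av in "auto simp: avoid_def")
  then show ?thesis using True by simp
  next
  case False
  then have P: "P (Suc j) = P j" using flG by (auto simp: P_def)
  have "tru 1 (asu s0 ((rDV, 2 + (G - 2)) # (rFL, fl j (2 + (G - 2))) # ?r2 j) hs) Skip (asu s0 ((PR, P (Suc j)) # (rCJ, j) # rv) hs)"
  unfolding P tri_def by (auto intro!: call_Skip elim!: asrt_weaken)
  then show ?thesis using False by simp
  qed
 qed simp
 have t6: "tru 1 (asu s0 ((PR, P (Suc j)) # (rCJ, j) # rv) hs) (Assign rCJ (Add (Reg rCJ) (Const 1))) (asu s0 (?r (Suc j)) hs)"
  by (rule tri_Assign) (use B B2 j av in "auto simp: avoid_def")
 show ?thesis
  by (rule tri_mono[OF tri_Seq[OF t1 tri_Seq[OF t2 tri_Seq[OF t3 tri_Seq[OF t4 tri_Seq[OF t5 t6]]]]]]) simp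
 qed
 have i1: "tru 1 (asu s0 rv hs) (Assign PR (Const 0)) (asu s0 ((PR, P 0) # rv) hs)"
 by (rule tri_Assign) (use av in "auto simp: avoid_def P_def")
 have i2: "tru 1 (asu s0 ((PR, P 0) # rv) hs) (Assign rCJ (Const 0)) (asu s0 (?r 0) hs)"
 by (rule tri_Assign) (use av in "auto simp: avoid_def")
 have i3: "tru (6 * e * (4 * G + 20 + 1) + 1) (asu s0 (?r 0) hs)
  (While (Less (Reg rCJ) (Mul (Const 6) (Reg rE)))
  ?cmda)
  (asu s0 (?r (6 * e)) hs)"
 proof (rule tri_loop[where I = "%j. asu s0 (?r j) hs", OF _ body])
 show "evn s (Less (Reg rCJ) (Mul (Const 6) (Reg rE))) ~= 0" if "j < 6 * e" "asu s0 (?r j) hs s" for j s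
  using asrt_rvf[OF that(2)] that(1) val by simp
 show "evn s (Less (Reg rCJ) (Mul (Const 6) (Reg rE))) = 0" if "asu s0 (?r (6 * e)) hs s" for s
  using asrt_rvf[OF that] val by simp
 qed (use B20 in simp)
 show ?thesis unfolding prime_cmd_def g_def[symmetric] P_def[symmetric]
 proof (rule tri_conseq[OF tri_Seq[OF i1 tri_Seq[OF i2 i3]]])
 have "6 * e * (4 * G + 20 + 1) <= 6 * e * (4 * G + 30)" by (intro mult_le_mono2) simp
 then show "1 + 1 + (1 + 1 + (6 * e * (4 * G + 20 + 1) + 1)) <= 6 * e * (4 * G + 30) + 10" by linarith
 show "asu s0 ((PR, P (6 * e)) # rv) hs s" if "asu s0 (?r (6 * e)) hs s" for s
  using that by (rule asrt_weaken) auto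
 qed auto
qed

text \<open>At the start register \<open>rAJ\<close> is zero, so it points to the whole input.\<close>

lemma tri_setup:
 fixes n k q c :: nat and S T :: "nat set" and E :: "(nat \<times> nat) set"
 defines "D == 2 ^ q" and "e == 2 * (2 * q + 14 - q div 4)" and "Sl == filter (%i. i \<in> S) [0..<n]" and "Tl == filter (%i. i \<in> T) [0..<n]"
 defines "v == c * (1 + q + e)" and "a == length Sl" and "b == length Tl"
 assumes q: "n + (a + b) * k <= 2 ^ q" "!!i. i < q ==> 2 ^ i < n + (a + b) * k" and c: "2 <= c" and vB: "2 ^ v <= B" "c <= B"
 and nk: "2 + 2 * n + n * n <= B" "k <= B"
 and inp: "arr (mem s0) 0 2 (%i. [n, k] ! i)" "arr (mem s0) 2 n (%i. of_bool (i \<in> S))" "arr (mem s0) (2 + n) n (%i. of_bool (i \<in> T))"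
  "arr (mem s0) (2 + 2 * n) (n * n) adj" "regs s0 HP = 2 + 2 * n + n * n" "regs s0 rAJ = 0" "ok s0"
 shows "call UNIV (60 * n + 4 * (q + q div 4 + c) + 200) (setup_cmd c) s0
 (asu s0 [(RW, 2 ^ v), (rLR, 3 * (D * D) + 6 * e), (rLO, 1024 * D ^ 3), (rX, 2 ^ e), (rE, e),
  (rG, 2 ^ (2 * q + 14 - q div 4)), (rQ, q), (rD, D), (rN, n), (rK, k), (rSA, a), (rTA, b)]
  [(rSL, a, %i. Sl ! i), (rTS, b, %i. Tl ! i), (rAJ, n * n, adj)])"
proof -
 note [simp] = small_def rvf_Cons avoid_def
 have B2: "2 <= B" using B20 by simp
 let ?i = "(rAJ, 2, %i. [n, k] ! i)"
 have t1: "tru 1 (asu s0 [] [?i]) (Assign rN (cell rAJ (Const 0))) (asu s0 [(rN, n)] [?i])"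
 proof (rule tri_Assign)
 fix s assume "hsf [?i] s"
 from hsfD[OF this, of rAJ 2 _ 0] show "evn s (cell rAJ (Const 0)) = n & n <= B" using nk by simp
 qed auto
 have t2: "tru 1 (asu s0 [(rN, n)] [?i]) (Assign rK (cell rAJ (Const 1))) (asu s0 [(rK, k), (rN, n)] [])"
 proof (rule tri_Assign)
 fix s assume "hsf [?i] s"
 from hsfD[OF this, of rAJ 2 _ 1] show "evn s (cell rAJ (Const 1)) = k & k <= B" using nk by simp
 qed (use B2 in auto)
 have t3: "tru 1 (asu s0 [(rK, k), (rN, n)] []) (Assign rSB (Const 2)) (asu s0 [(rSB, 2), (rK, k), (rN, n)] [])"
 by (rule tri_Assign) (use B2 in auto)
 have t4: "tru 1 (asu s0 [(rSB, 2), (rK, k), (rN, n)] []) (Assign rTB (Add (Const 2) (Reg rN))) (asu s0 [(rTB, 2 + n), (rSB, 2), (rK, k), (rN, n)] [])"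
 by (rule tri_Assign) (use B2 nk in auto)
 let ?r = "[(rAJ, 2 + 2 * n), (rTB, 2 + n), (rSB, 2), (rK, k), (rN, n)]"
 let ?h = "[(rTB, n, %i. of_bool (i \<in> T)), (rSB, n, %i. of_bool (i \<in> S)), (rAJ, n * n, adj)]"
 have "tru 1 (asu s0 [(rTB, 2 + n), (rSB, 2), (rK, k), (rN, n)] []) (Assign rAJ (Add (Const 2) (Add (Reg rN) (Reg rN))))
 (asu s0 ?r [])"
 by (rule tri_Assign) (use B2 nk in auto)
 then have t5: "tru 1 (asu s0 [(rTB, 2 + n), (rSB, 2), (rK, k), (rN, n)] []) (Assign rAJ (Add (Const 2) (Add (Reg rN) (Reg rN))))
 (asu s0 [(rK, k), (rN, n)] ?h)"
 proof (rule tri_post)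
 fix s assume s: "asu s0 ?r [] s"
 have "asu s0 ?r ?h s"
  by (rule asrt_old[where a = "2 + n"], rule asrt_old[where a = 2], rule asrt_old[where a = "2 + 2 * n"], rule s) (use inp in auto)
 then show "asu s0 [(rK, k), (rN, n)] ?h s" by (rule asrt_weaken) auto
 qed
 have t6: "tru (n * 30 + 30) (asu s0 [(rK, k), (rN, n)] ?h) (collect rSB rSL rSA)
  (asu s0 ((rSA, a) # [(rK, k), (rN, n)]) ((rSL, a, %i. Sl ! i) # ?h))"
 unfolding a_def Sl_def by (rule tri_collect) (use nk in auto)
 have t7: "tru (n * 30 + 30) (asu s0 ((rSA, a) # [(rK, k), (rN, n)]) ((rSL, a, %i. Sl ! i) # ?h)) (collect rTB rTS rTA)
  (asu s0 ((rTA, b) # (rSA, a) # [(rK, k), (rN, n)]) ((rTS, b, %i. Tl ! i) # (rSL, a, %i. Sl ! i) # ?h))"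
 unfolding b_def Tl_def by (rule tri_collect) (use nk in auto)
 let ?hs = "[(rSL, a, %i. Sl ! i), (rTS, b, %i. Tl ! i), (rAJ, n * n, adj)]"
 have t8: "tru (4 * (q + q div 4 + c) + 100) (asu s0 ((rTA, b) # (rSA, a) # [(rK, k), (rN, n)]) ((rTS, b, %i. Tl ! i) # (rSL, a, %i. Sl ! i) # ?h)) (sizes_cmd c)
 (asu s0 ([(RW, 2 ^ v), (rLR, 3 * (D * D) + 6 * e), (rLO, 1024 * D ^ 3), (rX, 2 ^ e), (rE, e),
  (rG, 2 ^ (2 * q + 14 - q div 4)), (rQ, q), (rD, D)] @ [(rN, n), (rK, k), (rSA, a), (rTA, b)]) ?hs)"
 proof (rule tri_pre)
 show "tru (4 * (q + q div 4 + c) + 100) (asu s0 [(rN, n), (rK, k), (rSA, a), (rTA, b)] ?hs) (sizes_cmd c)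
 (asu s0 ([(RW, 2 ^ v), (rLR, 3 * (D * D) + 6 * e), (rLO, 1024 * D ^ 3), (rX, 2 ^ e), (rE, e),
  (rG, 2 ^ (2 * q + 14 - q div 4)), (rQ, q), (rD, D)] @ [(rN, n), (rK, k), (rSA, a), (rTA, b)]) ?hs)"
  unfolding D_def v_def e_def by (rule tri_sizes[OF q c]) (use vB in "auto simp: v_def e_def")
 show "asu s0 [(rN, n), (rK, k), (rSA, a), (rTA, b)] ?hs s"
  if "asu s0 ((rTA, b) # (rSA, a) # [(rK, k), (rN, n)]) ((rTS, b, %i. Tl ! i) # (rSL, a, %i. Sl ! i) # ?h) s" for s
  using that by (rule asrt_weaken) auto
 qed
 have "asu s0 [] [?i] s0" using inp nk by (intro asrt_start) (auto simp: rvf_Nil)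
 moreover have "tru (60 * n + 4 * (q + q div 4 + c) + 200) (asu s0 [] [?i]) (setup_cmd c)
 (asu s0 ([(RW, 2 ^ v), (rLR, 3 * (D * D) + 6 * e), (rLO, 1024 * D ^ 3), (rX, 2 ^ e), (rE, e),
  (rG, 2 ^ (2 * q + 14 - q div 4)), (rQ, q), (rD, D)] @ [(rN, n), (rK, k), (rSA, a), (rTA, b)]) ?hs)"
 unfolding setup_cmd_def
 by (rule tri_mono[OF tri_Seq[OF t1 tri_Seq[OF t2 tri_Seq[OF t3 tri_Seq[OF t4 tri_Seq[OF t5 tri_Seq[OF t6 tri_Seq[OF t7 t8]]]]]]]]) simp
 ultimately show ?thesis by (simp add: tri_def)
qed

end

section \<open>Correctness for fixed cells and a fixed prime\<close>

context main_ram
begin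

text \<open>The cap at \<open>D\<close> matters when both vertex sets are empty: \<open>k\<close> is
  then unrelated to \<open>D\<close>, and doubling up to \<open>k + 2\<close> could exceed the time
  bound. With a pair present \<open>k + 2 <= D\<close>, so the result still reaches
  \<open>k + 2\<close>.\<close>

lemma tri_kk:
 assumes kp: "!!i. i < kp ==> 2 ^ i < k + 2 & 2 ^ i < D" "~ (2 ^ kp < k + 2 & 2 ^ kp < D)" and av: "avoid {HP, rKK} [] hs"
 shows "tru (kp * 2 + 3) (asu s0 main_rv hs) kk_cmd (asu s0 ((rKK, 2 ^ kp) # main_rv) hs)"
proof -
 let ?cmda = "Mul (Less (Reg rKK) (Add (Reg rK) (Const 2))) (Less (Reg rKK) (Reg rD))"
 note [simp] = rvf_Cons avoid_def small_def
 have B2: "4 <= B" using B20 by simp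
 have DB: "2 * D <= B"
 proof -
 have "2 + 2 * (D * D) <= B" using Dmax block_le by (simp add: D_def)
 moreover have "D <= D * D" by simp
 ultimately show ?thesis by linarith
 qed
 have avh: "!!x L g. (x, L, g) \<in> set hs ==> x ~= HP & x ~= rKK" using av by auto
 have t1: "tru 1 (asu s0 main_rv hs) (Assign rKK (Const 1)) (asu s0 ((rKK, 2 ^ 0) # main_rv) hs)"
 by (rule tri_Assign) (use B2 av in auto)
 have t2: "tru (kp * (1 + 1) + 1) (asu s0 ((rKK, 2 ^ 0) # main_rv) hs)
 (While ?cmda (Assign rKK (Add (Reg rKK) (Reg rKK))))
 (asu s0 ((rKK, 2 ^ kp) # main_rv) hs)"
 proof (rule tri_loop[where I = "%i. asu s0 ((rKK, 2 ^ i) # main_rv) hs"])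
 fix i assume i: "i < kp"
 have "2 ^ i + 2 ^ i <= B" using kp(1)[OF i] DB by linarith
 then show "tru 1 (asu s0 ((rKK, 2 ^ i) # main_rv) hs) (Assign rKK (Add (Reg rKK) (Reg rKK))) (asu s0 ((rKK, 2 ^ Suc i) # main_rv) hs)"
  by (intro tri_Assign) (use B2 av in auto)
 next
 show "evn s ?cmda ~= 0"
  if "i < kp" "asu s0 ((rKK, 2 ^ i) # main_rv) hs s" for i s
  using asrt_rvf[OF that(2)] kp(1)[OF that(1)] by simp
 show "evn s ?cmda = 0"
  if "asu s0 ((rKK, 2 ^ kp) # main_rv) hs s" for s
  using asrt_rvf[OF that] kp(2) by auto
 qed (use B2 in simp)
 show ?thesis unfolding kk_cmd_def by (rule tri_mono[OF tri_Seq[OF t1 t2]]) simp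
qed

text \<open>Iteration \<open>idx\<close> stands for the positions \<open>idx div length Tl\<close>
  and \<open>idx mod length Tl\<close>. As both lists are distinct, this enumerates all pairs
  without repetition, which gives distinctness as well as completeness of the answer.\<close>

lemma found_correct:
 fixes G :: "nat pair_pre_digraph"
 assumes G: "pair_fin_digraph G" "parcs G = E" and dist: "distinct Sl" "distinct Tl" and good: "good_cells p f"
 and N: "N \<in> carrier_mat D D" "Amat f * N = d \<cdot>\<^sub>m 1\<^sub>m D" "~ int p dvd d"
 and kp: "length Sl * length Tl ~= 0 ==> k + 2 <= 2 ^ kp"
 defines "L == found (Pmat f * N * Qmat f) kp (length Sl * length Tl)"
 shows "distinct L" "set L = kSTMVC G (set Sl) (set Tl) k"
proof -
 let ?Z = "Pmat f * N * Qmat f"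
 let ?a = "length Sl" and ?b = "length Tl"
 define i j where "i idx = idx div ?b" and "j idx = idx mod ?b" for idx
 have ij: "i idx < ?a" "j idx < ?b" if "idx < ?a * ?b" for idx
 using that by (auto simp: i_def j_def less_mult_imp_div_less intro!: mod_less_divisor gr0I)
 let ?val = "%idx. vertex_cut_value G (Sl ! i idx) (Tl ! j idx)"
 have cnt: "count ?Z kp idx < k + 2 \<longleftrightarrow> ?val idx < k" "?val idx < k ==> count ?Z kp idx - 2 = ?val idx"
 if idx: "idx < ?a * ?b" and ne: "Sl ! i idx ~= Tl ! j idx" for idx
 proof -
 obtain c N' e where pi: "pinv (int p) kp (Wmat (i idx) (j idx) (2 ^ kp) ?Z) = (c, N', e)" by (metis prod_cases3)
 have "?a * ?b ~= 0" using idx by linarith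
 note cc = count_correct[OF G ij(1)[OF idx] ij(2)[OF idx] ne kp[OF this] prime_p good N pi]
 have "count ?Z kp idx = c + of_bool ((Sl ! i idx, Tl ! j idx) \<in> E)"
  using pi by (simp add: count_def i_def j_def)
 then show "count ?Z kp idx < k + 2 \<longleftrightarrow> ?val idx < k" "?val idx < k ==> count ?Z kp idx - 2 = ?val idx"
  using cc by auto
 qed
 have tr: "triple ?Z kp idx = (Sl ! i idx, Tl ! j idx, count ?Z kp idx - 2)" for idx by (simp add: triple_def i_def j_def)
 have hit: "hit ?Z kp idx \<longleftrightarrow> Sl ! i idx ~= Tl ! j idx & count ?Z kp idx < k + 2" for idx by (simp add: hit_def i_def j_def)
 have inj: "inj_on (triple ?Z kp) {0..<?a * ?b}"
 proof (rule inj_onI)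
 fix x y assume x: "x \<in> {0..<?a * ?b}" and y: "y \<in> {0..<?a * ?b}" and eq: "triple ?Z kp x = triple ?Z kp y"
 have "i x = i y" "j x = j y"
  using eq ij[of x] ij[of y] x y dist unfolding tr by (auto simp: nth_eq_iff_index_eq)
 then show "x = y" unfolding i_def j_def by (metis div_mult_mod_eq)
 qed
 have inj2: "inj_on (triple ?Z kp) (set (filter (hit ?Z kp) (rev [0..<?a * ?b])))"
 by (rule inj_on_subset[OF inj]) auto
 show "distinct L" unfolding L_def found_def distinct_map using inj2 by simp
 have setL: "set L = triple ?Z kp ` {idx. idx < ?a * ?b & hit ?Z kp idx}" by (auto simp: L_def found_def)
 show "set L = kSTMVC G (set Sl) (set Tl) k"
 proof (intro equalityI subsetI)
 fix x assume "x \<in> set L"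
 then obtain idx where x: "idx < ?a * ?b" "hit ?Z kp idx" "x = triple ?Z kp idx" unfolding setL by blast
 then have ne: "Sl ! i idx ~= Tl ! j idx" and lt: "?val idx < k" using cnt(1)[OF x(1)] unfolding hit by auto
 have "x = (Sl ! i idx, Tl ! j idx, ?val idx)" unfolding x(3) tr using cnt(2)[OF x(1) ne lt] by simp
 then show "x \<in> kSTMVC G (set Sl) (set Tl) k" using ne lt ij[OF x(1)] by (auto simp: kSTMVC_def)
 next
 fix x assume "x \<in> kSTMVC G (set Sl) (set Tl) k"
 then obtain s t where x: "x = (s, t, vertex_cut_value G s t)" "s \<in> set Sl" "t \<in> set Tl" "s ~= t" "vertex_cut_value G s t < k"
  by (auto simp: kSTMVC_def)
 obtain u w' where u: "u < ?a" "Sl ! u = s" "w' < ?b" "Tl ! w' = t" using x(2,3) by (auto simp: in_set_conv_nth)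
 define idx where "idx = u * ?b + w'"
 have "(w' + u * ?b) div ?b = u + w' div ?b" by (rule div_mult_self1) (use u(3) in linarith)
 then have iu: "i idx = u" "j idx = w'" using u(3) by (simp_all add: idx_def i_def j_def add.commute)
 have "idx < Suc u * ?b" using u(3) by (simp add: idx_def)
 also have "... <= ?a * ?b" using u(1) by (intro mult_le_mono1) simp
 finally have lt: "idx < ?a * ?b" .
 have ne: "Sl ! i idx ~= Tl ! j idx" and vk: "?val idx < k" using x u iu by auto
 have "hit ?Z kp idx" unfolding hit using ne cnt(1)[OF lt ne] vk by simp
 moreover have "triple ?Z kp idx = x" unfolding tr using cnt(2)[OF lt ne vk] iu u x(1) by simp
 ultimately show "x \<in> set L" unfolding setL using lt by blast
 qed
qed

text \<open>The time bound is unconditional and only the answer depends on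
  \<open>good_cells\<close>, since the running time has to be guaranteed for every outcome of the
  random choices.\<close>

lemma tri_main:
 fixes G :: "nat pair_pre_digraph"
 assumes G: "pair_fin_digraph G" "parcs G = E" and dist: "distinct Sl" "distinct Tl"
 and kp: "!!i. i < kp ==> 2 ^ i < k + 2 & 2 ^ i < D" "~ (2 ^ kp < k + 2 & 2 ^ kp < D)"
 shows "tru (60 * (D * D) + 2 * mt D + 4 * R + inv_time q + 2 * kp +
  length Sl * length Tl * (5 * (2 ^ kp * 2 ^ kp) + inv_time kp + 300) + 1000)
 (asu s0 main_rv ((rRND, l, f) # main_hs)) (main_cmd P R)
 (%s. good_cells p f --> (EX L. distinct L & set L = kSTMVC G (set Sl) (set Tl) k &
  (ALL m<length (answer_words L). mem s (regs s 0 + m) = answer_words L ! m)))"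
proof -
 note [simp] = rvf_Cons avoid_def small_def
 have B2: "4 <= B" using B20 by simp
 obtain c N d where pi: "pinv (int p) q (Amat f) = (c, N, d)" by (metis prod_cases3)
 have Ac: "Amat f \<in> carrier_mat (2 ^ q) (2 ^ q)" by (simp add: Amat_def D_def)
 note pc = pinv_correct[OF prime_p Ac pi, unfolded D_props(3)]
 define ab where "ab = length Sl * length Tl"
 define Q :: "state => bool" where "Q = (%s. good_cells p f --> (EX L. distinct L & set L = kSTMVC G (set Sl) (set Tl) k &
  (ALL m<length (answer_words L). mem s (regs s 0 + m) = answer_words L ! m)))"
 note prep = tri_prep[OF pi, of s0]
 let ?T = "45 * (D * D) + 2 * mt D + 4 * R + 2 * kp + ab * (5 * (2 ^ kp * 2 ^ kp) + inv_time kp + 300) + 700"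
 have branch: "tru (1 + ?T) (%s. asu s0 ((CNT, c) # main_rv) main_hs s & (c = D --> asu s0 ((CNT, c) # main_rv)
  ((RES, D * D, mf D N) # (rQF, D * D, mf D (Qmat f)) # (rPF, D * D, mf D (Pmat f)) # main_hs) s))
  (Branch (Less (Reg CNT) (Reg rD)) Skip (rest_cmd P R)) Q"
 proof (rule tri_Branch[where x = "if c < D then 1 else 0"])
 show "evn s (Less (Reg CNT) (Reg rD)) = (if c < D then 1 else 0)"
  if "asu s0 ((CNT, c) # main_rv) main_hs s & (c = D --> asu s0 ((CNT, c) # main_rv)
  ((RES, D * D, mf D N) # (rQF, D * D, mf D (Qmat f)) # (rPF, D * D, mf D (Pmat f)) # main_hs) s)" for s
  using that asrt_rvf[of UNIV s0 "(CNT, c) # main_rv" _ s] by auto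
 show "tru ?T (%s. asu s0 ((CNT, c) # main_rv) main_hs s & (c = D --> asu s0 ((CNT, c) # main_rv)
  ((RES, D * D, mf D N) # (rQF, D * D, mf D (Qmat f)) # (rPF, D * D, mf D (Pmat f)) # main_hs) s))
  (if (if c < D then 1 else 0) ~= (0 :: nat) then Skip else rest_cmd P R) Q"
 proof (cases "c < D")
  case True
  \<comment> \<open>Fewer than \<open>D\<close> nonvanishing leading minors contradict goodness, so
    giving up is allowed here.\<close>
  have "~ good_cells p f" using pc True unfolding good_cells_def by auto
  then have "Q s" for s by (simp add: Q_def)
  then have "tru ?T X Skip Q" for X unfolding tri_def by (auto intro: call_Skip)
  then show ?thesis using True by simp
 next
  case False
  then have cD: "c = D" using pc by simp
  have N: "N \<in> carrier_mat D D" "Amat f * N = d \<cdot>\<^sub>m 1\<^sub>m D" "~ int p dvd d" using pc cD by auto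
  have Pc: "Pmat f \<in> carrier_mat D D" and Qc: "Qmat f \<in> carrier_mat D D" by (auto simp: Pmat_def Qmat_def)
  have PNc: "Pmat f * N \<in> carrier_mat D D" using Pc N(1) by simp
  define Z where "Z = Pmat f * N * Qmat f"
  let ?h0 = "(RES, D * D, mf D N) # (rQF, D * D, mf D (Qmat f)) # (rPF, D * D, mf D (Pmat f)) # main_hs"
  have m0: "tru 1 (asu s0 ((CNT, c) # main_rv) ?h0) (Assign DM (Reg rD)) (asu s0 ((DM, D) # main_rv) ?h0)"
  by (rule tri_Assign) (use D_props in auto)
  have m1: "tru (20 * (D * D) + mt D + 2 * R + 60) (asu s0 ((DM, D) # main_rv) ?h0) (mul P R rZA rPF RES)
  (asu s0 ((DM, D) # main_rv) ((rZA, D * D, mf D (Pmat f * N)) # ?h0))"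
  by (rule tri_mul) (use D_props Pc N in auto)
  have m2: "tru (20 * (D * D) + mt D + 2 * R + 60) (asu s0 ((DM, D) # main_rv) ((rZA, D * D, mf D (Pmat f * N)) # ?h0)) (mul P R rZ rZA rQF)
  (asu s0 ((DM, D) # main_rv) ((rZ, D * D, mf D Z) # (rZA, D * D, mf D (Pmat f * N)) # ?h0))"
  unfolding Z_def by (rule tri_mul) (use D_props PNc Qc in auto)
  let ?hz = "(rZ, D * D, mf D Z) # main_hs" and ?r = "(rKK, 2 ^ kp) # main_rv"
  have m3: "tru (kp * 2 + 3) (asu s0 ((DM, D) # main_rv) ((rZ, D * D, mf D Z) # (rZA, D * D, mf D (Pmat f * N)) # ?h0)) kk_cmd
  (asu s0 ?r ?hz)"
  proof (rule tri_pre[OF tri_kk[OF kp]])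
  show "asu s0 main_rv ?hz s" if "asu s0 ((DM, D) # main_rv) ((rZ, D * D, mf D Z) # (rZA, D * D, mf D (Pmat f * N)) # ?h0) s" for s
  using that by (rule asrt_weaken) auto
  qed auto
  have m4: "tru 1 (asu s0 ?r ?hz) (Assign rPT (Const 0)) (asu s0 ((rPT, 0) # ?r) ?hz)"
  by (rule tri_Assign) auto
  have m5: "tru 1 (asu s0 ((rPT, 0) # ?r) ?hz) (Assign rCN (Const 0)) (asu s0 ((rCN, 0) # (rPT, 0) # ?r) ?hz)"
  by (rule tri_Assign) auto
  define I where "I = (%idx s. asu s0 ((rIX, idx) # (rCN, length (found Z kp idx)) # ?r) ?hz s & chain s (regs s rPT) (found Z kp idx))"
  have m6: "tru 1 (asu s0 ((rCN, 0) # (rPT, 0) # ?r) ?hz) (Assign rIX (Const 0)) (I 0)"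
  proof (rule tri_post)
  show "tru 1 (asu s0 ((rCN, 0) # (rPT, 0) # ?r) ?hz) (Assign rIX (Const 0)) (asu s0 ((rIX, 0) # (rCN, 0) # (rPT, 0) # ?r) ?hz)"
  by (rule tri_Assign) auto
  show "I 0 s" if a: "asu s0 ((rIX, 0) # (rCN, 0) # (rPT, 0) # ?r) ?hz s" for s
  proof -
  have "asu s0 ((rIX, 0) # (rCN, 0) # ?r) ?hz s" using a by (rule asrt_weaken) auto
  then show ?thesis by (simp add: I_def found_def)
  qed
  qed
  \<comment> \<open>A pair makes \<open>k\<close> count twice in the size, so
    \<open>k + 2 <= 1 + 2 * k <= D\<close>.\<close>
  have kD: "k + 2 <= 2 ^ kp" "2 ^ kp <= D" if ne: "ab ~= 0"
  proof -
  have "1 * k <= length Sl * k" "1 * k <= length Tl * k" using ne by (intro mult_le_mono1; simp add: ab_def Suc_le_eq)+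
  moreover have "n + length Sl * k + length Tl * k <= D" using size by (simp add: D_def add_mult_distrib)
  ultimately have "k + 2 <= D" using n_pos k_pos by linarith
  then show "k + 2 <= 2 ^ kp" using kp(2) by linarith
  have "kp <= q"
  proof (rule ccontr)
  assume "~ kp <= q"
  then have "2 ^ q < D" using kp(1)[of q] by simp
  then show False by (simp add: D_def)
  qed
  then show "2 ^ kp <= D" by (simp add: D_def)
  qed
  let ?Tp = "5 * (2 ^ kp * 2 ^ kp) + inv_time kp + 250"
  have m7: "tru (ab * (?Tp + 1) + 1) (I 0) (While (Less (Reg rIX) (Mul (Reg rSA) (Reg rTA))) (pair_cmd P R)) (I ab)"
  proof (rule tri_loop[where I = I])
  fix idx assume idx: "idx < ab"
  have ne: "ab ~= 0" using idx by simp
  show "tru ?Tp (I idx) (pair_cmd P R) (I (Suc idx))" unfolding tri_def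
  proof (intro allI impI)
  fix s assume "I idx s"
  then have a: "asu s0 ((rIX, idx) # (rCN, length (found Z kp idx)) # ?r) ?hz s" and ch: "chain s (regs s rPT) (found Z kp idx)"
  by (auto simp: I_def)
  have "asu s ((rPT, regs s rPT) # (rIX, idx) # (rCN, length (found Z kp idx)) # ?r) ?hz s"
  by (rule asrt_reg[OF asrt_self[OF a] refl])
  then have st: "asu s ((rIX, idx) # (rCN, length (found Z kp idx)) # (rPT, regs s rPT) # ?r) ?hz s" by (rule asrt_weaken) auto
  have "call UNIV ?Tp (pair_cmd P R) s (%s'. asu s ((rIX, Suc idx) # (rCN, length (found Z kp (Suc idx))) # ?r) ?hz s' &
  chain s' (regs s' rPT) (found Z kp (Suc idx)))"
  using tri_pair[OF idx[unfolded ab_def] kD[OF ne] ch ok_regs[OF asrt_ok[OF a]]] st unfolding tri_def by blast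
  then show "call UNIV ?Tp (pair_cmd P R) s (I (Suc idx))"
  proof (rule call_conseq)
  fix s' assume "asu s ((rIX, Suc idx) # (rCN, length (found Z kp (Suc idx))) # ?r) ?hz s' &
  chain s' (regs s' rPT) (found Z kp (Suc idx))"
  then show "I (Suc idx) s'" unfolding I_def using asrt_rebase[OF a] by blast
  qed auto
  qed
  next
  show "evn s (Less (Reg rIX) (Mul (Reg rSA) (Reg rTA))) ~= 0" if "idx < ab" "I idx s" for idx s
  proof -
  have "asu s0 ((rIX, idx) # (rCN, length (found Z kp idx)) # ?r) ?hz s" using that by (simp add: I_def)
  from asrt_rvf[OF this] show ?thesis using that(1) by (simp add: ab_def)
  qed
  show "evn s (Less (Reg rIX) (Mul (Reg rSA) (Reg rTA))) = 0" if "I ab s" for s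
  proof -
  have "asu s0 ((rIX, ab) # (rCN, length (found Z kp ab)) # ?r) ?hz s" using that by (simp add: I_def)
  from asrt_rvf[OF this] show ?thesis by (simp add: ab_def)
  qed
  qed auto
  let ?L = "found Z kp ab"
  have LB: "length ?L <= ab" by (rule length_found)
  have m8: "tru (length ?L * 45 + 45) (I ab) emit_cmd (%s. ALL m<1 + 3 * length ?L. mem s (regs s 0 + m) = emitted ?L m)"
  proof (rule tri_pre[OF tri_emit])
  show "length ?L <= B" using LB pairs_le by (simp add: ab_def)
  show "asu s0 [(rCN, length ?L)] [] s & chain s (regs s rPT) ?L" if "I ab s" for s
  using that unfolding I_def by (auto elim: asrt_weaken)
  qed
  have "tru ?T (asu s0 ((CNT, c) # main_rv) ?h0) (rest_cmd P R) Q"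
  unfolding rest_cmd_def
  proof (rule tri_conseq[OF tri_Seq[OF m0 tri_Seq[OF m1 tri_Seq[OF m2 tri_Seq[OF m3 tri_Seq[OF m4 tri_Seq[OF m5 tri_Seq[OF m6 tri_Seq[OF m7 m8]]]]]]]]])
  have "length ?L * 45 <= ab * 45" using LB by simp
  moreover have "ab * (?Tp + 1) + ab * 45 <= ab * (5 * (2 ^ kp * 2 ^ kp) + inv_time kp + 300)"
  unfolding add_mult_distrib2[symmetric] by (intro mult_le_mono2) simp
  ultimately show "1 + 1 + (1 + (20 * (D * D) + mt D + 2 * R + 60) + (1 + (20 * (D * D) + mt D + 2 * R + 60) + (1 + (kp * 2 + 3) + (1 + 1 + (1 + 1 + (1 + 1 +
  (1 + (ab * (?Tp + 1) + 1) + (length ?L * 45 + 45)))))))) <= ?T" by linarith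
  fix s :: state assume em: "ALL m<1 + 3 * length ?L. mem s (regs s 0 + m) = emitted ?L m"
  show "Q s" unfolding Q_def
  proof
  assume good: "good_cells p f"
  have "distinct ?L" "set ?L = kSTMVC G (set Sl) (set Tl) k"
  using found_correct[OF G dist good N, of kp] kD(1) unfolding Z_def ab_def by auto
  moreover have "ALL m<length (answer_words ?L). mem s (regs s 0 + m) = answer_words ?L ! m"
  using em answer_words_emitted(1)[of ?L] answer_words_emitted(2)[where L = ?L] by simp
  ultimately show "EX L. distinct L & set L = kSTMVC G (set Sl) (set Tl) k &
  (ALL m<length (answer_words L). mem s (regs s 0 + m) = answer_words L ! m)" by blast
  qed
  qed auto
  then show ?thesis using False cD by (auto elim!: tri_pre)
 qed
 qed auto
 show ?thesis unfolding main_cmd_def Q_def[symmetric]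
 by (rule tri_mono[OF tri_Seq[OF prep branch]]) (simp add: ab_def)
qed

end

section \<open>The complete algorithm\<close>

text \<open>The deterministic rest of the run. Moving the heap pointer behind the random cells makes
  them an ordinary array.\<close>

definition post_cmd :: "cmd => nat => cmd" where
 "post_cmd P R =
  Seq (Assign rRND (Reg HP))
 (Seq (Assign HP (Add (Reg HP) (Reg rLR)))
 (Seq prime_cmd (Branch (Reg PR) (main_cmd P R) Skip)))"

definition solver :: "nat => cmd => nat => cmd" where
 "solver c P R =
  Seq (Assign HP (Add (Const 2) (Add (Mul (Const 2) (Load (Const 0))) (Mul (Load (Const 0)) (Load (Const 0))))))
 (Seq (setup_cmd c)
 (Seq (Assign rIX (Const 0))
 (Seq (Assign rTMP (Const 0))
 (Seq rand_loop (post_cmd P R)))))"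

lemma run_Seq: "exec w c s t s' ==> run w (1 + t + T) (Seq c d # cs, s) = run w T (d # cs, s')"
 by (simp add: exec_def run_add bind_return_pmf)

fun itime :: "nat => (nat => nat) => nat => nat" where
 "itime R mt 0 = 100"
| "itime R mt (Suc e) = 2 * itime R mt e + (300 * (2 ^ e * 2 ^ e) + 6 * mt (2 ^ e) + 12 * R + 1200)"

lemma (in inv_ram) inv_time_itime: "inv_time e = itime R mt e"
 by (induction e) auto

text \<open>Unlike in \<open>main_ram\<close>, neither the cells nor the prime are fixed; both are
  outcomes of the run. The word length \<open>v\<close> of the simulation is chosen before them,
  large enough for every prime below \<open>2 ^ e\<close>.\<close>

locale solver_data = instance_data n k q E Sl Tl + ram w B "2 * 2 ^ v"
 for n k q :: nat and E :: "(nat \<times> nat) set" and Sl Tl :: "nat list" and w B v :: nat +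
 fixes P :: cmd and R c e kp :: nat and mt :: "nat => nat" and S T :: "nat set" and G :: "nat pair_pre_digraph"
 assumes e_eq: "e = 2 * (2 * q + 14 - q div 4)" and v_eq: "v = c * (1 + q + e)" and c2: "2 <= c" and cB: "c <= B"
 and det: "deterministic P" and regsP: "cmd_regs P \<subseteq> {..<R}" and R_pos: "1 <= R"
 and mult: "!!d m A C. 1 <= d ==> 1 <= m ==> (d + m) ^ c <= 2 ^ v ==> A \<in> carrier_mat d d ==> C \<in> carrier_mat d d ==>
  (ALL i<d. ALL j<d. A $$ (i, j) < m & C $$ (i, j) < m) ==>
  \<forall>x \<in> set_pmf (run v (mt d) (start P ([d, m] @ mat_words A @ mat_words C))). has_output x (mat_words (A * C))"
 and vB: "2 * 2 ^ v <= B" and q_min: "!!i. i < q ==> 2 ^ i < n + (length Sl + length Tl) * k"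
 and kp: "!!i. i < kp ==> 2 ^ i < k + 2 & 2 ^ i < (2 :: nat) ^ q" "~ (2 ^ kp < k + 2 & 2 ^ kp < (2 :: nat) ^ q)"
 and lists: "Sl = filter (%i. i \<in> S) [0..<n]" "Tl = filter (%i. i \<in> T) [0..<n]"
 and G: "pair_fin_digraph G" "parcs G = E" and ST: "S \<subseteq> {..<n}" "T \<subseteq> {..<n}"
 and sizes_le: "2 + 2 * n + n * n <= B" "n + k + 3 <= B" "length Sl * length Tl <= B"
begin

definition Lr :: nat where "Lr = 3 * (D * D) + 6 * e"
definition Ts :: nat where "Ts = 60 * n + 4 * (q + q div 4 + c) + 200"
definition Tp :: nat where "Tp = 6 * e * (4 * 2 ^ (2 * q + 14 - q div 4) + 30) + 10"
definition Tm :: nat where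
 "Tm = 60 * (D * D) + 2 * mt D + 4 * R + itime R mt q + 2 * kp +
  length Sl * length Tl * (5 * (2 ^ kp * 2 ^ kp) + itime R mt kp + 300) + 1000"

definition chosen :: "(nat => nat) => nat" where
 "chosen f = pick (%j. f (3 * (D * D) + j) mod 2 ^ e) (1024 * D ^ 3) (6 * e)"

definition answered :: "state => bool" where
 "answered s \<longleftrightarrow> (EX L. distinct L & set L = kSTMVC G (set Sl) (set Tl) k &
  (ALL m<length (answer_words L). mem s (regs s 0 + m) = answer_words L ! m))"

definition adjE :: "nat => nat" where
 "adjE i = of_bool ((i div n, i mod n) \<in> E)"

lemma v_ge: "2 + 2 * q + 2 * e <= v"
 using mult_le_mono1[OF c2, of "1 + q + e"] by (simp add: v_eq)

lemma pow_v: "i <= v ==> (2 :: nat) ^ i <= 2 ^ v"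
 by (intro power_increasing) auto

lemma D_q: "D = 2 ^ q"
 by (simp add: D_def)

lemma e_large: "28 <= e" "10 + 3 * q <= e"
 unfolding e_eq by linarith+

abbreviation rv1 :: "(nat \<times> nat) list" where
 "rv1 == [(RW, 2 ^ v), (rLR, Lr), (rLO, 1024 * D ^ 3), (rX, 2 ^ e), (rE, e),
  (rG, 2 ^ (2 * q + 14 - q div 4)), (rQ, q), (rD, D), (rN, n), (rK, k), (rSA, length Sl), (rTA, length Tl)]"

abbreviation hs1 :: "(nat \<times> nat \<times> (nat => nat)) list" where
 "hs1 == [(rSL, length Sl, %i. Sl ! i), (rTS, length Tl, %i. Tl ! i), (rAJ, n * n, adjE)]"

lemma main_phase:
 assumes f: "prime p" "p < 2 ^ e"
 shows "tru Tm (asu s0 ((PR, p) # rv1) ((rRND, Lr, f) # hs1)) (main_cmd P R) (%s. good_cells p f --> answered s)"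
proof -
 have p2: "2 <= p" using f(1) prime_ge_2_nat by blast
 have ev: "e <= v" "1 <= v" using v_ge by auto
 have D2: "2 + 2 * (2 ^ q * 2 ^ q) <= (2 :: nat) ^ v"
 proof -
 have "(2 :: nat) + 2 * (2 ^ q * 2 ^ q) <= 4 * (2 ^ q * 2 ^ q)" by simp
 also have "... = 2 ^ (2 + (q + q))" by (simp add: power_add)
 also have "... <= 2 ^ v" using v_ge by (intro pow_v) linarith
 finally show ?thesis .
 qed
 \<comment> \<open>Only here is the prime known, so the locale for a fixed prime is instantiated
   inside the proof.\<close>
 interpret M: main_ram w B "2 * 2 ^ v" P R v p q mt n k E Sl Tl f Lr
 proof unfold_locales
 show "1 <= v" by (rule ev(2))
 have "(2 :: nat) ^ v < 2 ^ w"
 proof -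
  have "B ^ 1 <= B ^ 200" using B20 by (intro power_increasing) auto
  then have "B <= B ^ 200" by simp
  then show ?thesis using word vB by linarith
 qed
 then show "v <= w" by simp
 show "p < 2 ^ v" using f(2) pow_v[OF ev(1)] by linarith
 show "2 + 2 * (2 ^ q * 2 ^ q) <= (2 :: nat) ^ v" by (rule D2)
 fix d A C assume d: "1 <= d" "d <= 2 ^ q" and A: "A \<in> carrier_mat d d" "C \<in> carrier_mat d d"
  "ALL i<d. ALL j<d. A $$ (i, j) < p & C $$ (i, j) < p"
 \<comment> \<open>Both summands are at most \<open>2 ^ q * 2 ^ e\<close>, so
   \<open>d + p <= 2 ^ (1 + q + e)\<close>; the form of \<open>v\<close> comes from here.\<close>
 have "d + p <= 2 ^ q * 2 ^ e + 2 ^ q * 2 ^ e"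
 proof (rule add_mono)
  have "d * 1 <= 2 ^ q * 2 ^ e" using d(2) by (intro mult_le_mono) auto
  then show "d <= 2 ^ q * 2 ^ e" by simp
  have "1 * p <= 2 ^ q * 2 ^ e" using f(2) by (intro mult_le_mono) auto
  then show "p <= 2 ^ q * 2 ^ e" by simp
 qed
 then have "(d + p) ^ c <= (2 ^ (1 + q + e)) ^ c" by (intro power_mono) (auto simp: power_add)
 also have "... = 2 ^ v" by (simp only: v_eq power_mult[symmetric] mult.commute)
 finally show "\<forall>x\<in>set_pmf (run v (mt d) (start P ([d, p] @ mat_words A @ mat_words C))). has_output x (mat_words (A * C))"
  using mult[OF d(1) _ _ A] p2 by simp
 qed (use det regsP R_pos p2 vB f sizes_le in "auto simp: Lr_def")
 have adj: "M.adj = adjE" by (auto simp: M.adj_def adjE_def fun_eq_iff)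
 have dist: "distinct Sl" "distinct Tl" by (auto simp: lists)
 have "tru Tm (asu s0 M.main_rv ((rRND, Lr, f) # M.main_hs)) (main_cmd P R) (%s. good_cells p f --> answered s)"
 unfolding Tm_def answered_def M.inv_time_itime[symmetric]
 by (rule M.tri_main[OF G dist]) (use kp in "auto simp: D_q")
 then show ?thesis by (rule tri_pre) (auto simp: adj elim: asrt_weaken)
qed

lemma prime_main:
 shows "tru (Tp + Tm + 5) (asu s0 rv1 ((rRND, Lr, f) # hs1)) (Seq prime_cmd (Branch (Reg PR) (main_cmd P R) Skip))
 (%s. chosen f ~= 0 & good_cells (chosen f) f --> answered s)"
proof -
 have "e <= v" using v_ge by simp
 from pow_v[OF this] have eB: "2 ^ e <= B" using vB by linarith
 have lrB: "6 * e <= B"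
 proof -
 have "e < 2 ^ e" by (rule less_exp)
 moreover have "6 * 2 ^ e <= 2 * (2 :: nat) ^ v"
 proof -
  have "6 * 2 ^ e <= (2 :: nat) ^ (e + 3)" by (simp add: power_add)
  also have "... <= 2 ^ v" using v_ge by (intro pow_v) (use e_large in linarith)
  finally show ?thesis by simp
 qed
 ultimately show ?thesis using vB by linarith
 qed
 have gg: "(2 :: nat) ^ e = 2 ^ (2 * q + 14 - q div 4) * 2 ^ (2 * q + 14 - q div 4)" by (simp only: e_eq mult_2 power_add)
 have "1 <= 2 * q + 14 - q div 4" by linarith
 from power_increasing[OF this, of "2 :: nat"] have g2: "2 <= (2 :: nat) ^ (2 * q + 14 - q div 4)" by simp
 have lo2: "2 <= 1024 * D ^ 3" by (simp add: D_def)
 have t1: "tru Tp (asu s0 rv1 ((rRND, Lr, f) # hs1)) prime_cmd (asu s0 ((PR, chosen f) # rv1) ((rRND, Lr, f) # hs1))"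
 unfolding Tp_def chosen_def
 by (rule tri_prime[OF g2 gg lo2 eB lrB, where D = D and l = Lr]) (auto simp: Lr_def avoid_def)
 have t2: "tru (1 + (Tm + 1)) (asu s0 ((PR, chosen f) # rv1) ((rRND, Lr, f) # hs1)) (Branch (Reg PR) (main_cmd P R) Skip)
  (%s. chosen f ~= 0 & good_cells (chosen f) f --> answered s)"
 proof (rule tri_Branch[where x = "chosen f"])
 show "evn s (Reg PR) = chosen f" if "asu s0 ((PR, chosen f) # rv1) ((rRND, Lr, f) # hs1) s" for s
  using asrt_rvf[OF that] by (simp add: rvf_Cons)
 show "tru (Tm + 1) (asu s0 ((PR, chosen f) # rv1) ((rRND, Lr, f) # hs1)) (if chosen f ~= 0 then main_cmd P R else Skip)
  (%s. chosen f ~= 0 & good_cells (chosen f) f --> answered s)"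
 proof (cases "chosen f = 0")
  case True
  then show ?thesis unfolding tri_def by (auto intro: call_Skip)
 next
  case False
  then have "prime (chosen f)" "chosen f < 2 ^ e"
  using pick_nonzero[of "%j. f (3 * (D * D) + j) mod 2 ^ e" "1024 * D ^ 3" "6 * e"] unfolding chosen_def by auto
  from main_phase[OF this, of s0 f] have "tru (Tm + 1) (asu s0 ((PR, chosen f) # rv1) ((rRND, Lr, f) # hs1)) (main_cmd P R)
  (%s. chosen f ~= 0 & good_cells (chosen f) f --> answered s)"
  by (rule tri_conseq) auto
  then show ?thesis using False by simp
 qed
 qed (simp add: small_def)
 show ?thesis by (rule tri_mono[OF tri_Seq[OF t1 t2]]) simp
qed

text \<open>After the random loop \<open>ok\<close> may fail, because cells behind the heap pointer
  are filled. The assertions are rebuilt from the earlier state \<open>s1\<close> once the pointer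
  has been moved.\<close>

lemma exec_post:
 assumes s1: "asu s0 rv1 hs1 s1" and room: "regs s1 HP + Lr + (Tp + Tm + 5) * (2 * 2 ^ v) <= B"
 and f: "!!i. i < Lr ==> f i < 2 ^ v"
 shows "EX t s'. t <= Tp + Tm + 10 & exec w (post_cmd P R) (rand_state s1 Lr f) t s' &
 (chosen f ~= 0 & good_cells (chosen f) f --> answered s')"
proof -
 have ok1: "ok s1" using asrt_ok[OF s1] .
 define h where "h = regs s1 HP"
 define s2 where "s2 = rand_state s1 Lr f"
 define s3 where "s3 = upd s2 rRND h"
 define s4 where "s4 = upd s3 HP (h + Lr)"
 have h2: "regs s2 HP = h" by (simp add: s2_def rand_state_def h_def)
 have lr: "regs s1 rLR = Lr" using rvfD[OF asrt_rvf[OF s1], of rLR Lr] by simp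
 have x1: "exec w (Assign rRND (Reg HP)) s2 1 s3" using exec_Assign[of w rRND "Reg HP" s2] h2 by (simp add: s3_def)
 have hB: "h + Lr <= B" using room by (simp add: h_def)
 have x2: "exec w (Assign HP (Add (Reg HP) (Reg rLR))) s3 1 s4 & ok s4" unfolding s4_def
 proof (rule exec_init)
 show "ALL r. regs s3 r <= B" using ok_regs[OF ok1] hB by (auto simp: s3_def s2_def rand_state_def)
 show "ALL a. mem s3 a <= B"
 proof
  fix a
  have "f (a - h) <= B" if "a < h + Lr" "h <= a" 
  proof -
  have "a - h < Lr" using that by linarith
  from f[OF this] show ?thesis using vB by linarith
  qed
  then show "mem s3 a <= B" using ok_mem[OF ok1] by (auto simp: s3_def s2_def rand_state_def h_def)
 qed
 show "evn s3 (Add (Reg HP) (Reg rLR)) = h + Lr" using lr by (simp add: s3_def s2_def rand_state_def h_def)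
 show "\<forall>a\<ge>h + Lr. mem s3 a = 0" using ok_zero[OF ok1] by (auto simp: s3_def s2_def rand_state_def h_def)
 qed (use hB in "auto simp: small_def")
 have r4: "regs s4 z = regs s1 z" if "z ~: {HP, rRND, rIX, rTMP}" for z
 using that by (simp add: s4_def s3_def s2_def rand_state_def)
 have m4: "mem s4 a = mem s1 a" if "a < h" for a using that by (simp add: s4_def s3_def s2_def rand_state_def h_def)
 have "asu s4 rv1 ((rRND, Lr, f) # hs1) s4"
 proof (rule asrt_start)
 show "ok s4" using x2 by simp
 show "rvf rv1 s4" using asrt_rvf[OF s1] by (simp add: rvf_Cons r4 rvf_Nil)
 have "regs s4 z + L <= regs s4 HP & arr (mem s4) (regs s4 z) L g" if zL: "(z, L, g) \<in> set hs1" for z L g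
 proof -
  have z: "z ~: {HP, rRND, rIX, rTMP}" using zL by auto
  have b: "regs s1 z + L <= h" "arr (mem s1) (regs s1 z) L g" using s1 zL unfolding asrt_def h_def by auto
  then have "arr (mem s4) (regs s1 z) L g" using m4 by (auto simp: arr_def)
  moreover have "regs s4 HP = h + Lr" by (simp add: s4_def)
  ultimately show ?thesis using r4[OF z] b by simp
 qed
 moreover have "regs s4 rRND + Lr <= regs s4 HP & arr (mem s4) (regs s4 rRND) Lr f"
  by (auto simp: s4_def s3_def s2_def rand_state_def h_def arr_def)
 ultimately show "\<forall>(z, L, g)\<in>set ((rRND, Lr, f) # hs1). regs s4 z + L <= regs s4 HP & arr (mem s4) (regs s4 z) L g" by fastforce
 qed
 then have cl: "call UNIV (Tp + Tm + 5) (Seq prime_cmd (Branch (Reg PR) (main_cmd P R) Skip)) s4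
  (%s. chosen f ~= 0 & good_cells (chosen f) f --> answered s)"
 using prime_main unfolding tri_def by blast
 have "regs s4 HP + (Tp + Tm + 5) * (2 * 2 ^ v) <= B" using room by (simp add: s4_def h_def)
 from callD[OF cl conjunct2[OF x2] this] obtain t s' where t: "t <= Tp + Tm + 5"
 "exec w (Seq prime_cmd (Branch (Reg PR) (main_cmd P R) Skip)) s4 t s'" "chosen f ~= 0 & good_cells (chosen f) f --> answered s'" by blast
 have "exec w (post_cmd P R) s2 (1 + 1 + (1 + 1 + t)) s'"
 unfolding post_cmd_def by (rule exec_Seq[OF x1 exec_Seq[OF conjunct1[OF x2] t(2)]])
 then show ?thesis using t unfolding s2_def by (intro exI[of _ "1 + 1 + (1 + 1 + t)"] exI[of _ s']) auto
qed

text \<open>Only the middle stretch of \<open>8 * Lr\<close> steps is random. The final state is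
  therefore a function of the drawn cells, and all probabilities can be computed under
  \<open>rnd_cells\<close>.\<close>

lemma run_solver:
 assumes room: "2 + 2 * n + n * n + (Ts + 8 * Lr + Tp + Tm + 40) * (2 * 2 ^ v) <= B"
 and time: "Ts + 8 * Lr + Tp + Tm + 40 <= t"
 shows "EX fin. run w t (start (solver c P R) (instance_words n G S T k)) = map_pmf (%f. ([], fin f)) (rnd_cells {..<Lr} (2 ^ v)) &
 (\<forall>f\<in>set_pmf (rnd_cells {..<Lr} (2 ^ v)). chosen f ~= 0 & good_cells (chosen f) f --> answered (fin f))"
proof -
 define xs where "xs = instance_words n G S T k"
 define s where "s = snd (start (solver c P R) xs)"
 define h where "h = 2 + 2 * n + n * n"
 have lenxs: "length xs = h" by (simp add: xs_def instance_words_def length_mat_words h_def)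
 have mem: "mem s i = (if i < h then xs ! i else 0)" for i by (simp add: s_def start_def lenxs)
 have xnk: "xs ! 0 = n" "xs ! 1 = k" by (auto simp: xs_def instance_words_def)
 have xS: "xs ! (2 + i) = of_bool (i \<in> S)" "xs ! (2 + n + i) = of_bool (i \<in> T)" if "i < n" for i
 using that by (auto simp: xs_def instance_words_def nth_append)
 have xE: "xs ! (2 + 2 * n + i) = adjE i" if "i < n * n" for i
 proof -
 have "i div n < n" "i mod n < n" using that n_pos by (auto simp: less_mult_imp_div_less)
 then show ?thesis using that by (simp add: xs_def instance_words_def nth_append mat_words_conv adjE_def G(2))
 qed
 have xB: "xs ! i <= B" if "i < h" for i
 proof -
 have b1: "of_bool x <= B" for x using B20 by (auto simp: of_bool_def)
 consider "i = 0" | "i = 1" | j where "i = 2 + j" "j < n" | j where "i = 2 + n + j" "j < n" | j where "i = 2 + 2 * n + j" "j < n * n"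
 proof -
  assume a: "i = 0 ==> thesis" "i = 1 ==> thesis" "!!j. i = 2 + j ==> j < n ==> thesis" "!!j. i = 2 + n + j ==> j < n ==> thesis"
  "!!j. i = 2 + 2 * n + j ==> j < n * n ==> thesis"
  have "i = 0 | i = 1 | (2 <= i & i < 2 + n) | (2 + n <= i & i < 2 + 2 * n) | 2 + 2 * n <= i" by linarith
  then show thesis
  using a(1,2) a(3)[of "i - 2"] a(4)[of "i - (2 + n)"] a(5)[of "i - (2 + 2 * n)"] \<open>i < h\<close> by (auto simp: h_def)
 qed
 then show ?thesis using xnk xS xE b1 sizes_le by cases (auto simp: adjE_def)
 qed
 have hB: "h <= B" using sizes_le by (simp add: h_def)
 let ?e0 = "Add (Const 2) (Add (Mul (Const 2) (Load (Const 0))) (Mul (Load (Const 0)) (Load (Const 0))))"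
 have init: "exec w (Assign HP ?e0) s 1 (upd s HP h) & ok (upd s HP h)"
 proof (rule exec_init)
 show "ALL r. regs s r <= B" by (simp add: s_def start_def)
 show "ALL a. mem s a <= B" using mem xB by simp
 show "evn s ?e0 = h" using mem[of 0] xnk by (simp add: h_def)
 show "\<forall>a\<ge>h. mem s a = 0" using mem by simp
 qed (use hB B20 in "auto simp: small_def")
 let ?s = "upd s HP h"
 have vB': "2 ^ v <= B" using vB by simp
 have cl: "call UNIV Ts (setup_cmd c) ?s (asu ?s rv1 hs1)"
 unfolding Ts_def Lr_def D_q
 proof (rule tri_setup[of n S T k q c ?s adjE, unfolded lists[symmetric] e_eq[symmetric] v_eq[symmetric]])
 show "n + (length Sl + length Tl) * k <= 2 ^ q" by (rule size)
 show "2 ^ i < n + (length Sl + length Tl) * k" if "i < q" for i using q_min[OF that] .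
 show "arr (mem ?s) 0 2 (%i. [n, k] ! i)"
  unfolding arr_def using mem[of 0] mem[of 1] xnk by (auto simp: less_2_cases_iff h_def)
 show "arr (mem ?s) 2 n (%i. of_bool (i \<in> S))"
  unfolding arr_def upd_simps mem using xS(1) by (auto simp: h_def)
 show "arr (mem ?s) (2 + n) n (%i. of_bool (i \<in> T))"
  unfolding arr_def upd_simps mem using xS(2) by (auto simp: h_def)
 show "arr (mem ?s) (2 + 2 * n) (n * n) adjE"
  unfolding arr_def upd_simps mem using xE by (auto simp: h_def)
 show "regs ?s HP = 2 + 2 * n + n * n" by (simp add: h_def)
 show "regs ?s rAJ = 0" by (simp add: s_def start_def)
 show "ok ?s" using init by simp
 show "k <= B" using sizes_le by simp
 qed (use c2 cB vB' sizes_le in auto)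
 have V1: "1 <= 2 * (2 :: nat) ^ v" by simp
 have split: "(Ts + 8 * Lr + Tp + Tm + 40) * (2 * 2 ^ v) = Ts * (2 * 2 ^ v) + 8 * Lr * (2 * 2 ^ v) + (Tp + Tm + 5) * (2 * 2 ^ v) + 35 * (2 * 2 ^ v)"
 by (simp add: algebra_simps)
 have LV: "Lr <= 8 * Lr * (2 * 2 ^ v)" by (simp add: mult.assoc)
 have "regs ?s HP + Ts * (2 * 2 ^ v) <= B" using room split by (simp add: h_def)
 from callD[OF cl conjunct2[OF init] this] obtain ts s1 where s1: "ts <= Ts" "exec w (setup_cmd c) ?s ts s1"
 "regs s1 HP <= regs ?s HP + Ts * (2 * 2 ^ v)" "asu ?s rv1 hs1 s1" by blast
 have hs1: "regs s1 HP <= h + Ts * (2 * 2 ^ v)" using s1(3) by simp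
 have room1: "regs s1 HP + Lr + (Tp + Tm + 5) * (2 * 2 ^ v) <= B" using room split hs1 LV unfolding h_def by linarith
 have reg1: "regs s1 RW = 2 ^ v" "regs s1 rLR = Lr" using rvfD[OF asrt_rvf[OF s1(4)]] by auto
 have Bw: "B < 2 ^ w"
 proof -
 have "B ^ 1 <= B ^ 200" using B20 by (intro power_increasing) auto
 then show ?thesis using word by simp
 qed
 have vw: "v <= w"
 proof -
 have "(2 :: nat) ^ v < 2 ^ w" using vB' Bw by linarith
 then show ?thesis by simp
 qed
 have roomL: "regs s1 HP + Lr < 2 ^ w" using room1 Bw by linarith
 define s2 where "s2 = upd (upd s1 rIX 0) rTMP 0"
 have y1: "exec w (Assign rIX (Const 0)) s1 1 (upd s1 rIX 0)" using exec_Assign[of w rIX "Const 0" s1] by simp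
 have y2: "exec w (Assign rTMP (Const 0)) (upd s1 rIX 0) 1 s2" using exec_Assign[of w rTMP "Const 0" "upd s1 rIX 0"] by (simp add: s2_def)
 have s2: "s2 = rand_state s1 0 (%_. 0)" by (cases s1) (auto simp: s2_def rand_state_def upd_def fun_eq_iff)
 \<comment> \<open>What remains of \<open>t\<close> after the setup, the loop and its exit; surplus
   steps idle in the halted configuration.\<close>
 define t3 where "t3 = t - (1 + 1 + (1 + ts + (1 + 1 + (1 + 1 + (1 + (8 * Lr + 1))))))"
 have tt: "t = 1 + 1 + (1 + ts + (1 + 1 + (1 + 1 + (1 + (8 * Lr + (1 + t3))))))" "Tp + Tm + 10 <= t3"
 using time s1(1) unfolding t3_def by linarith+
 let ?RC = "rnd_cells {..<Lr} (2 ^ v)"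
 have "\<forall>f\<in>set_pmf ?RC. EX s'. run w t3 ([post_cmd P R], rand_state s1 Lr f) = return_pmf ([], s') &
  (chosen f ~= 0 & good_cells (chosen f) f --> answered s')"
 proof
 fix f assume "f \<in> set_pmf ?RC"
 then have fv: "f i < 2 ^ v" if "i < Lr" for i
  using that unfolding rnd_cells_def set_Pi_pmf[OF finite_lessThan] PiE_dflt_def by (auto simp: lessThan_empty_iff)
 obtain t' s' where "t' <= Tp + Tm + 10" "exec w (post_cmd P R) (rand_state s1 Lr f) t' s'"
  "chosen f ~= 0 & good_cells (chosen f) f --> answered s'"
  using exec_post[OF s1(4) room1, of f] fv by blast
 moreover from this have "run w t3 ([post_cmd P R], rand_state s1 Lr f) = return_pmf ([], s')"
  by (intro exec_run[of w "post_cmd P R" _ t']) (use tt(2) in auto)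
 ultimately show "EX s'. run w t3 ([post_cmd P R], rand_state s1 Lr f) = return_pmf ([], s') &
  (chosen f ~= 0 & good_cells (chosen f) f --> answered s')"
  by blast
 qed
 from bchoice[OF this] obtain fin where fin: "\<forall>f\<in>set_pmf ?RC. run w t3 ([post_cmd P R], rand_state s1 Lr f) = return_pmf ([], fin f) &
  (chosen f ~= 0 & good_cells (chosen f) f --> answered (fin f))" ..
 have exit: "run w (1 + t3) (rand_loop # [post_cmd P R], rand_state s1 Lr f) = run w t3 ([post_cmd P R], rand_state s1 Lr f)" for f
 using reg1 by (simp add: rand_loop_def rand_state_def bind_return_pmf)
 have "run w t ([solver c P R], s) = run w (8 * Lr + (1 + t3)) (rand_loop # [post_cmd P R], s2)"
 unfolding tt(1) solver_def run_Seq[OF conjunct1[OF init]] run_Seq[OF s1(2)] run_Seq[OF y1] run_Seq[OF y2]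
 by (simp add: bind_return_pmf)
 also have "... = bind_pmf ?RC (%f. run w (1 + t3) (rand_loop # [post_cmd P R], rand_state s1 Lr f))"
 unfolding s2 run_add[of w "8 * Lr"] run_rand_loop[OF reg1 vw roomL order_refl] by (simp add: bind_map_pmf)
 also have "... = bind_pmf ?RC (%f. return_pmf ([], fin f))"
 unfolding exit using fin by (intro bind_pmf_cong) auto
 also have "... = map_pmf (%f. ([], fin f)) ?RC" by (simp add: map_pmf_def)
 finally have "run w t ([solver c P R], s) = map_pmf (%f. ([], fin f)) ?RC" .
 moreover have "start (solver c P R) xs = ([solver c P R], s)" by (simp add: s_def start_def)
 ultimately show ?thesis using fin unfolding xs_def by (intro exI[of _ fin]) auto
qed

lemma solver_correct:
 assumes room: "2 + 2 * n + n * n + (Ts + 8 * Lr + Tp + Tm + 40) * (2 * 2 ^ v) <= B"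
 and time: "Ts + 8 * Lr + Tp + Tm + 40 <= t"
 defines "X == run w t (start (solver c P R) (instance_words n G S T k))"
 shows "(\<forall>x\<in>set_pmf X. halted x) & measure_pmf.prob X {x. correct_answer G S T k x} \<ge> 2 / 3"
proof -
 let ?RC = "rnd_cells {..<Lr} (2 ^ v)"
 obtain fin where fin: "X = map_pmf (%f. ([], fin f)) ?RC"
 "\<forall>f\<in>set_pmf ?RC. chosen f ~= 0 & good_cells (chosen f) f --> answered (fin f)"
 using run_solver[OF room time] unfolding X_def by blast
 have halt: "\<forall>x\<in>set_pmf X. halted x" unfolding fin(1) by (auto simp: halted_def)
 \<comment> \<open>\<open>2 ^ e\<close> is \<open>1024 * D ^ 3\<close> times
   \<open>2 ^ (18 + m)\<close>, whereas \<open>e\<close> itself is bounded linearly in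
   \<open>m\<close> because \<open>q <= 2 * m\<close>. So primes above the threshold are frequent
   enough.\<close>
 have e2: "2 + 2 * (e * (1024 * D ^ 3)) <= 2 ^ e"
 proof -
 define m where "m = q - 2 * (q div 4)"
 define Y where "Y = (1024 :: nat) * D ^ 3"
 have Y: "Y = 2 ^ (10 + 3 * q)" by (simp add: Y_def D_def power_add power_mult[symmetric] mult.commute)
 have ee: "e = (10 + 3 * q) + (18 + m)" unfolding e_eq m_def by linarith
 have q2: "q <= 2 * m" unfolding m_def by linarith
 have m1: "m + 1 <= 2 ^ m" using less_exp[of m] by linarith
 have "2 + 2 * e = 58 + 6 * q + 2 * m" by (simp add: ee)
 also have "... <= 58 + 14 * m" using q2 by simp
 also have "... <= 58 * (m + 1)" by simp
 also have "... <= 2 ^ 18 * 2 ^ m" by (rule mult_le_mono[OF _ m1]) simp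
 finally have "(2 + 2 * e) * Y <= (2 ^ 18 * 2 ^ m) * Y" by (rule mult_le_mono1)
 also have "... = Y * (2 ^ 18 * 2 ^ m)" by (rule mult.commute)
 also have "... = 2 ^ (10 + 3 * q) * 2 ^ (18 + m)" by (simp only: Y power_add)
 also have "... = 2 ^ e" by (simp only: ee power_add)
 finally have "(2 + 2 * e) * Y <= 2 ^ e" .
 moreover have "2 <= 2 * Y" by (simp add: Y)
 moreover have "(2 + 2 * e) * Y = 2 * Y + 2 * (e * Y)" by (simp add: algebra_simps)
 ultimately show ?thesis unfolding Y_def by linarith
 qed
 have vv: "2 ^ (v - e) * 2 ^ e = (2 :: nat) ^ v" using v_ge by (simp add: power_add[symmetric])
 \<comment> \<open>One eighth for finding no prime and one eighth for bad cells; the remaining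
   \<open>3 / 4\<close> exceeds the required \<open>2 / 3\<close>.\<close>
 have bad: "measure_pmf.prob ?RC {f. chosen f = 0 \<or> ~ good_cells (chosen f) f} <= 1 / 4"
 using prob_failure[of e "2 ^ (v - e)"] e2 e_large unfolding vv by (simp add: Lr_def chosen_def Let_def)
 have setS: "set Sl = S" "set Tl = T" using lists ST by auto
 have "measure_pmf.prob ?RC {f. ~ (chosen f = 0 \<or> ~ good_cells (chosen f) f)} \<ge> 3 / 4"
 proof -
 have "measure_pmf.prob ?RC (UNIV - {f. chosen f = 0 \<or> ~ good_cells (chosen f) f}) = 1 - measure_pmf.prob ?RC {f. chosen f = 0 \<or> ~ good_cells (chosen f) f}"
  using measure_pmf.prob_compl[of "{f. chosen f = 0 \<or> ~ good_cells (chosen f) f}" ?RC] by simp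
 moreover have "UNIV - {f. chosen f = 0 \<or> ~ good_cells (chosen f) f} = {f. ~ (chosen f = 0 \<or> ~ good_cells (chosen f) f)}" by auto
 ultimately show ?thesis using bad by simp
 qed
 also have "measure_pmf.prob ?RC {f. ~ (chosen f = 0 \<or> ~ good_cells (chosen f) f)} <= measure_pmf.prob ?RC {f. correct_answer G S T k ([], fin f)}"
 proof (rule measure_pmf.finite_measure_mono_AE)
 show "AE f in measure_pmf ?RC. f \<in> {f. ~ (chosen f = 0 \<or> ~ good_cells (chosen f) f)} --> f \<in> {f. correct_answer G S T k ([], fin f)}"
  unfolding AE_measure_pmf_iff
 proof (intro ballI impI CollectI)
  fix f assume f: "f \<in> set_pmf ?RC" "f \<in> {f. ~ (chosen f = 0 \<or> ~ good_cells (chosen f) f)}"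
  then have "answered (fin f)" using fin(2) by simp
  then show "correct_answer G S T k ([], fin f)"
  unfolding answered_def correct_answer_def has_output_def halted_def setS by simp
 qed
 qed simp
 also have "... = measure_pmf.prob X {x. correct_answer G S T k x}" unfolding fin(1) by (simp add: vimage_def)
 finally show ?thesis using halt by simp
qed

end

section \<open>Running time\<close>

text \<open>Two subproblems of half the order together cost at most half of the bound for the full
  order, since \<open>2 powr \<tau> >= 4\<close>. The work is therefore geometric over the levels
  and no logarithm appears. The constant is chosen such that twice itself plus the coefficients of
  one level is at most four times itself.\<close>

lemma itime_bound:
 assumes \<tau>: "2 <= \<tau>" and Cm: "0 <= Cm" and mt: "!!d. 1 <= d ==> real (mt d) <= Cm * real d powr \<tau>"
 shows "real (itime R mt e) <= (1600 + 6 * Cm + 12 * real R) * real (2 ^ e) powr \<tau>"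
proof (induction e)
 case 0
 then show ?case using Cm by simp
next
 case (Suc e)
 define A where "A = 1600 + 6 * Cm + 12 * real R"
 define x where "x = real (2 ^ e)"
 define y where "y = x powr \<tau>"
 have x: "1 <= x" by (simp add: x_def)
 have y2: "x * x <= y"
 proof -
 have "x powr 2 <= x powr \<tau>" using x \<tau> by (intro powr_mono) auto
 moreover have "x powr 2 = x * x" using x by (simp add: powr_numeral power2_eq_square)
 ultimately show ?thesis by (simp add: y_def)
 qed
 have "1 * 1 <= x * x" using x by (intro mult_mono) auto
 then have y1: "1 <= y" using y2 by simp
 have IH: "real (itime R mt e) <= A * y" using Suc by (simp add: A_def y_def x_def)
 have m: "real (mt (2 ^ e)) <= Cm * y" using mt[of "2 ^ e"] by (simp add: y_def x_def)
 have c: "12 * real R + 1200 <= (12 * real R + 1200) * y" using y1 by (simp add: mult_le_cancel_left1)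
 have A0: "0 <= A" using Cm by (simp add: A_def)
 have "real (itime R mt (Suc e)) = 2 * real (itime R mt e) + (300 * (x * x) + 6 * real (mt (2 ^ e)) + (12 * real R + 1200))"
 by (simp add: x_def)
 also have "... <= 2 * (A * y) + (300 * y + 6 * (Cm * y) + (12 * real R + 1200) * y)"
 using IH y2 m c by linarith
 also have "... = (2 * A + 1500 + 6 * Cm + 12 * real R) * y" by (simp add: algebra_simps)
 also have "... <= (4 * A) * y" using y1 Cm by (intro mult_right_mono) (auto simp: A_def)
 also have "... = 4 * (A * y)" by simp
 also have "... <= 2 powr \<tau> * (A * y)"
 proof (rule mult_right_mono)
 have "2 powr 2 <= 2 powr \<tau>" using \<tau> by (intro powr_mono) auto
 then show "4 <= 2 powr \<tau>" by (simp add: powr_numeral)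
 show "0 <= A * y" using A0 y1 by simp
 qed
 also have "... = A * (2 * x) powr \<tau>" using x by (simp add: y_def powr_mult)
 also have "2 * x = real (2 ^ Suc e)" by (simp add: x_def)
 finally show ?case by (simp only: A_def)
qed

definition total_time :: "nat => (nat => nat) => nat => nat => nat => nat => nat => nat" where
 "total_time R mt c n q kp ab = (let D = 2 ^ q; e = 2 * (2 * q + 14 - q div 4) in
  (60 * n + 4 * (q + q div 4 + c) + 200) + 8 * (3 * (D * D) + 6 * e) + (6 * e * (4 * 2 ^ (2 * q + 14 - q div 4) + 30) + 10) +
  (60 * (D * D) + 2 * mt D + 4 * R + itime R mt q + 2 * kp + ab * (5 * (2 ^ kp * 2 ^ kp) + itime R mt kp + 300) + 1000) + 40)"

lemma (in solver_data) total_time_eq: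
 "Ts + 8 * Lr + Tp + Tm + 40 = total_time R mt c n q kp (length Sl * length Tl)"
 unfolding Ts_def Lr_def Tp_def Tm_def D_q total_time_def Let_def e_eq[symmetric] by simp

text \<open>The critical term is the trial division \<open>e * 2 ^ g\<close>: dividing by
  \<open>2 ^ h\<close> in the definition of \<open>g\<close> leaves a factor that outweighs the
  logarithmic \<open>e <= 40 * 2 ^ h\<close>. The constant 16000000 rounds up
  \<open>24 * 655360\<close> together with the smaller terms.\<close>

lemma total_time_nat:
 fixes q :: nat
 assumes "n <= 2 ^ q" "kp <= q"
 defines "D == 2 ^ q"
 shows "total_time R mt c n q kp ab <= (16000000 + 4 * c + 4 * R) * (D * D) + 2 * mt D + itime R mt q +
 ab * (5 * (2 ^ kp * 2 ^ kp) + itime R mt kp + 300)"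
proof -
 define h where "h = q div 4"
 define g where "g = 2 * q + 14 - h"
 define e where "e = 2 * g"
 have hq: "4 * h <= q" "q < 4 * h + 4" by (auto simp: h_def)
 have "h + 1 <= 2 ^ h" using less_exp[of h] by linarith
 have "e <= 40 * (h + 1)" unfolding e_def g_def using hq by simp
 also have "... <= 40 * 2 ^ h" using \<open>h + 1 <= 2 ^ h\<close> by (rule mult_le_mono2)
 finally have e: "e <= 40 * 2 ^ h" .
 have hD: "2 ^ h <= D" unfolding D_def using hq by (intro power_increasing) auto
 have D1: "1 <= D" by (simp add: D_def)
 have DD: "D <= D * D" by simp
 have qD: "q < D" unfolding D_def by (rule less_exp)
 have "e * 2 ^ g <= (40 * 2 ^ h) * 2 ^ g" using e by (rule mult_le_mono1)
 also have "... = 40 * 2 ^ (h + g)" by (simp add: power_add)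
 also have "h + g = q + q + 14" unfolding g_def using hq by simp
 also have "40 * (2 :: nat) ^ (q + q + 14) = 655360 * (D * D)" by (simp only: D_def power_add) simp
 finally have eg: "e * 2 ^ g <= 655360 * (D * D)" .
 have e2: "e <= 40 * (D * D)" using e hD DD by linarith
 have ex: "6 * e * (4 * 2 ^ g + 30) = 24 * (e * 2 ^ g) + 180 * e" by (simp add: algebra_simps)
 have cR: "4 * c + 4 * R + 1250 <= (4 * c + 4 * R + 1250) * (D * D)" using D1 by simp
 have N0: "(16000000 + 4 * c + 4 * R) * (D * D) = 15998750 * (D * D) + (4 * c + 4 * R + 1250) * (D * D)" by (simp add: algebra_simps)
 have tot: "total_time R mt c n q kp ab =
  (60 * n + 4 * (q + h + c) + 200) + 8 * (3 * (D * D) + 6 * e) + (24 * (e * 2 ^ g) + 180 * e + 10) +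
  (60 * (D * D) + 2 * mt D + 4 * R + itime R mt q + 2 * kp + ab * (5 * (2 ^ kp * 2 ^ kp) + itime R mt kp + 300) + 1000) + 40"
 unfolding ex[symmetric] unfolding total_time_def Let_def D_def e_def g_def h_def by simp
 have nD: "n <= D" using assms(1) by (simp add: D_def)
 have "4 * (q + h + c) = 4 * q + 4 * h + 4 * c" "8 * (3 * (D * D) + 6 * e) = 24 * (D * D) + 48 * e" by simp_all
 then show ?thesis unfolding tot N0 using eg e2 cR nD DD qD hq assms(2) by linarith
qed

text \<open>The powers of two exceed the quantities that they round up by constant factors, 2 for
  \<open>M\<close> and 6 for \<open>k\<close>; these reappear as \<open>2 powr \<tau>\<close> and
  \<open>6 powr \<tau>\<close> in the constant.\<close>

lemma total_time_real:
 fixes \<tau> Cm :: real and M k q kp n ab R c :: nat and mt :: "nat => nat"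
 assumes \<tau>: "2 <= \<tau>" and Cm: "0 <= Cm" and mt: "!!d. 1 <= d ==> real (mt d) <= Cm * real d powr \<tau>"
 and n: "n <= 2 ^ q" and kp: "kp <= q" and M: "2 ^ q <= 2 * M" and K: "2 ^ kp <= 6 * k"
 defines "A == 1600 + 6 * Cm + 12 * real R"
 defines "C == (real (16000000 + 4 * c + 4 * R) + 2 * Cm + A) * 2 powr \<tau> + (305 + A) * 6 powr \<tau>"
 shows "real (total_time R mt c n q kp ab) <= C * (real M powr \<tau> + real ab * real k powr \<tau>)"
proof -
 define N0 where "N0 = real (16000000 + 4 * c + 4 * R)"
 have A0: "0 <= A" using Cm by (simp add: A_def)
 have pw: "real x * real x <= real x powr \<tau> & 1 <= real x powr \<tau>" if "1 <= x" for x :: nat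
 proof -
 have "real x powr 2 <= real x powr \<tau>" using that \<tau> by (intro powr_mono) auto
 moreover have "real x powr 2 = real x * real x" using that by (simp add: powr_numeral power2_eq_square)
 moreover have "1 * 1 <= real x * real x" using that by (intro mult_mono) auto
 ultimately show ?thesis by simp
 qed
 define DT where "DT = real (2 ^ q) powr \<tau>"
 define KT where "KT = real (2 ^ kp) powr \<tau>"
 have D: "real (2 ^ q) * real (2 ^ q) <= DT" "1 <= DT" using pw[of "2 ^ q"] by (auto simp: DT_def)
 have Kp: "real (2 ^ kp) * real (2 ^ kp) <= KT" "1 <= KT" using pw[of "2 ^ kp"] by (auto simp: KT_def)
 have it: "real (itime R mt x) <= A * real (2 ^ x) powr \<tau>" for x unfolding A_def by (rule itime_bound[OF \<tau> Cm mt])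
 have m: "real (mt (2 ^ q)) <= Cm * DT" using mt[of "2 ^ q"] by (simp add: DT_def)
 have "real (total_time R mt c n q kp ab) <= real ((16000000 + 4 * c + 4 * R) * (2 ^ q * 2 ^ q) + 2 * mt (2 ^ q) + itime R mt q +
 ab * (5 * (2 ^ kp * 2 ^ kp) + itime R mt kp + 300))"
 by (rule of_nat_mono[OF total_time_nat[OF n kp]])
 also have "... = N0 * (real (2 ^ q) * real (2 ^ q)) + 2 * real (mt (2 ^ q)) + real (itime R mt q) +
 real ab * (5 * (real (2 ^ kp) * real (2 ^ kp)) + real (itime R mt kp) + 300)"
 by (simp add: N0_def)
 also have "... <= N0 * DT + 2 * (Cm * DT) + A * DT + real ab * (5 * KT + A * KT + 300 * KT)"
 proof (intro add_mono mult_left_mono)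
 show "real (itime R mt q) <= A * DT" using it[of q] by (simp add: DT_def)
 show "real (itime R mt kp) <= A * KT" using it[of kp] by (simp add: KT_def)
 show "300 <= 300 * KT" using Kp(2) by simp
 qed (use D Kp m in "auto simp: N0_def")
 also have "... = (N0 + 2 * Cm + A) * DT + (305 + A) * (real ab * KT)" by (simp add: algebra_simps)
 also have "... <= (N0 + 2 * Cm + A) * (2 powr \<tau> * real M powr \<tau>) + (305 + A) * (real ab * (6 powr \<tau> * real k powr \<tau>))"
 proof (intro add_mono mult_left_mono)
 have "DT <= (2 * real M) powr \<tau>" unfolding DT_def using of_nat_mono[OF M, where 'a = real] \<tau> by (intro powr_mono2) auto
 then show "DT <= 2 powr \<tau> * real M powr \<tau>" by (simp add: powr_mult)
 have "KT <= (6 * real k) powr \<tau>" unfolding KT_def using of_nat_mono[OF K, where 'a = real] \<tau> by (intro powr_mono2) auto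
 then show "KT <= 6 powr \<tau> * real k powr \<tau>" by (simp add: powr_mult)
 qed (use A0 Cm in "auto simp: N0_def")
 also have "... = ((N0 + 2 * Cm + A) * 2 powr \<tau>) * real M powr \<tau> + ((305 + A) * 6 powr \<tau>) * (real ab * real k powr \<tau>)"
 by (simp only: ac_simps)
 also have "... <= C * real M powr \<tau> + C * (real ab * real k powr \<tau>)"
 using A0 Cm by (intro add_mono mult_right_mono) (auto simp: C_def N0_def)
 finally show ?thesis by (simp only: distrib_left)
qed

theorem theorem9:
 fixes \<tau> :: real
 assumes "\<tau> > omega \<or> (\<tau> = omega \<and> matmul_time omega)"
 shows "\<exists>P. solves_kSTMVC_in_time P (\<lambda>n a b k.
      (real n + (real a + real b) * real k) powr \<tau> + real a * real b * real k powr \<tau>)"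
proof -
 obtain sg where sg: "matmul_time sg" "sg <= \<tau>" "2 <= sg" using matmul_time_below[OF assms] .
 have \<tau>: "2 <= \<tau>" using sg by simp
 obtain P cm Cm where det: "deterministic P" and H: "ALL n m w A B. 1 <= n & 1 <= m & (n + m) ^ cm <= 2 ^ w
  & A \<in> carrier_mat n n & B \<in> carrier_mat n n
  & (ALL i<n. ALL j<n. A $$ (i, j) < m & B $$ (i, j) < m) -->
  (\<forall>x \<in> set_pmf (run w (nat \<lfloor>Cm * real n powr sg\<rfloor>)
  (start P ([n, m] @ mat_words A @ mat_words B))).
  has_output x (mat_words (A * B)))"
 using sg(1) unfolding matmul_time_def by blast
 define mt where "mt d = nat \<lfloor>Cm * real d powr sg\<rfloor>" for d
 define Cp where "Cp = max 0 Cm"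
 have Cp: "0 <= Cp" by (simp add: Cp_def)
 have mt: "real (mt d) <= Cp * real d powr \<tau>" if "1 <= d" for d
 proof -
 have "real d powr sg <= real d powr \<tau>" using that sg(2) by (intro powr_mono) auto
 then have "Cp * real d powr sg <= Cp * real d powr \<tau>" using Cp by (rule mult_left_mono)
 moreover have "Cm * real d powr sg <= Cp * real d powr sg" by (intro mult_right_mono) (auto simp: Cp_def)
 moreover have "0 <= Cp * real d powr \<tau>" using Cp by simp
 ultimately show ?thesis unfolding mt_def by linarith
 qed
 \<comment> \<open>The summand 2 ensures \<open>c >= 2\<close>, on which the size bounds rest, even
   if \<open>cm\<close> is 0.\<close>
 define c where "c = cm + 2"
 obtain R where R: "cmd_regs P \<subseteq> {..<R}" "1 <= R"
 proof -
 obtain R0 where "\<forall>r\<in>cmd_regs P. r < R0" using finite_cmd_regs[of P] finite_nat_set_iff_bounded by blast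
 then show thesis using that[of "Suc R0"] by force
 qed
 define A where "A = 1600 + 6 * Cp + 12 * real R"
 define C where "C = (real (16000000 + 4 * c + 4 * R) + 2 * Cp + A) * 2 powr \<tau> + (305 + A) * 6 powr \<tau>"
 have C0: "0 <= C" using Cp by (simp add: C_def A_def)
 define cc where "cc = nat \<lceil>C\<rceil>"
 define t0 where "t0 = nat \<lceil>\<tau>\<rceil>"
 \<comment> \<open>Exponent of \<open>n + k\<close> in the bound on the heap:
   \<open>cc + 2 * t0 + 3\<close> for the time plus \<open>44 * c + 1\<close> for the block per time
   unit.\<close>
 define z where "z = cc + 2 * t0 + 44 * c + 4"
 \<comment> \<open>The bound \<open>B\<close> will be \<open>(n + k) ^ y\<close>. The summand 21
   covers \<open>2 ^ 20 <= B\<close> and leaves a further factor for the input; the word length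
   exponent \<open>200 * y + 1\<close> makes \<open>B ^ 200 < 2 ^ w\<close> strict.\<close>
 define y where "y = z + 21"
 show ?thesis unfolding solves_kSTMVC_in_time_def
 proof (intro exI[of _ "solver c P R"] exI[of _ "200 * y + 1"] exI[of _ C] allI impI)
 fix n k w :: nat and G :: "nat pair_pre_digraph" and S T :: "nat set"
 assume I: "1 <= n & pair_fin_digraph G & pverts G = {..<n} & S \<subseteq> {..<n} & T \<subseteq> {..<n}
  & 0 < k & (n + k) ^ (200 * y + 1) <= 2 ^ w"
 define b where "b = n + k"
 have b: "2 <= b" "n < b" "k <= b" "n + 1 <= b" using I by (auto simp: b_def)
 have mono: "b ^ i <= b ^ j" if "i <= j" for i j using that b by (intro power_increasing) auto
 have two: "2 ^ i <= b ^ i" for i using b by (intro power_mono) auto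
 define Sl Tl where "Sl = filter (%i. i \<in> S) [0..<n]" and "Tl = filter (%i. i \<in> T) [0..<n]"
 have lists: "set Sl = S" "set Tl = T" "distinct Sl" "distinct Tl" using I by (auto simp: Sl_def Tl_def)
 have cards: "length Sl = card S" "length Tl = card T"
  using distinct_card[OF lists(3)] distinct_card[OF lists(4)] lists(1,2) by auto
 have len: "length Sl <= n" "length Tl <= n"
  using length_filter_le[of "%i. i \<in> S" "[0..<n]"] length_filter_le[of "%i. i \<in> T" "[0..<n]"] by (auto simp: Sl_def Tl_def)
 define M where "M = n + (length Sl + length Tl) * k"
 have M1: "1 <= M" using I by (simp add: M_def)
 define q where "q = (LEAST q. M <= 2 ^ q)"
 have "M <= 2 ^ M" using less_exp[of M] by simp
 then have q: "M <= 2 ^ q" unfolding q_def by (rule LeastI)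
 have q_min: "2 ^ i < M" if "i < q" for i using not_less_Least[OF that[unfolded q_def]] by simp
 have qM: "2 ^ q <= 2 * M"
 proof (cases q)
  case (Suc q')
  then show ?thesis using q_min[of q'] by simp
 qed (use M1 in simp)
 define kp where "kp = (LEAST kp. ~ (2 ^ kp < k + 2 & 2 ^ kp < (2 :: nat) ^ q))"
 have "~ (2 ^ q < k + 2 & 2 ^ q < (2 :: nat) ^ q)" by simp
 then have kp: "~ (2 ^ kp < k + 2 & 2 ^ kp < (2 :: nat) ^ q)" "kp <= q" unfolding kp_def by (rule LeastI, rule Least_le)
 have kp_min: "2 ^ i < k + 2 & 2 ^ i < (2 :: nat) ^ q" if "i < kp" for i using not_less_Least[OF that[unfolded kp_def]] by simp
 \<comment> \<open>By minimality \<open>2 ^ kp < 2 * (k + 2)\<close> unless \<open>kp\<close> is 0,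
   and \<open>2 * (k + 2) <= 6 * k\<close> for \<open>k >= 1\<close>.\<close>
 have K6: "2 ^ kp <= 6 * k"
 proof (cases kp)
  case (Suc i)
  then show ?thesis using kp_min[of i] I by simp
 qed (use I in simp)
 have nq: "n <= 2 ^ q" using q by (simp add: M_def)
 define ab where "ab = length Sl * length Tl"
 define F where "F = real M powr \<tau> + real ab * real k powr \<tau>"
 have tot: "real (total_time R mt c n q kp ab) <= C * F"
  unfolding F_def C_def A_def by (rule total_time_real[OF \<tau> Cp mt nq kp(2) qM K6])
 define e where "e = 2 * (2 * q + 14 - q div 4)"
 define v where "v = c * (1 + q + e)"
 define B where "B = b ^ y"
 have Mb: "M <= b ^ 2"
 proof -
  have "(length Sl + length Tl) * k <= (n + n) * k" using len by (intro mult_le_mono1) simp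
  moreover have "n <= n * n" by simp
  moreover have "b ^ 2 = n * n + (n + n) * k + k * k" by (simp add: b_def power2_eq_square algebra_simps)
  ultimately show ?thesis unfolding M_def by linarith
 qed
 \<comment> \<open>\<open>2 ^ q <= b ^ 3\<close>, \<open>2 ^ e <= b ^ 40\<close> and the factor 2
   add up to the exponent \<open>1 + 3 + 40 = 44\<close>.\<close>
 have vb: "2 ^ v <= b ^ (44 * c)"
 proof -
  have "2 ^ q <= 2 * b ^ 2" using qM Mb by linarith
  also have "... <= b * b ^ 2" using b by (intro mult_le_mono1) simp
  finally have q3: "2 ^ q <= b ^ 3" by (simp add: power_Suc[symmetric] del: power_Suc)
  have "(2 :: nat) ^ e <= 2 ^ (q * 4 + 28)" by (intro power_increasing) (auto simp: e_def)
  also have "... = (2 ^ q) ^ 4 * 2 ^ 28" by (simp only: power_add power_mult)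
  also have "... <= (b ^ 3) ^ 4 * b ^ 28" using q3 b by (intro mult_le_mono power_mono) auto
  also have "... = b ^ 40" by (simp only: power_mult[symmetric] power_add[symmetric]) simp
  finally have e40: "2 ^ e <= b ^ 40" .
  have "(2 :: nat) ^ (1 + q + e) = 2 * 2 ^ q * 2 ^ e" by (simp add: power_add)
  also have "... <= b * b ^ 3 * b ^ 40" using b q3 e40 by (intro mult_le_mono) auto
  also have "... = b ^ 44" by (simp only: power_Suc[symmetric] power_add[symmetric]) simp
  finally have "(2 ^ (1 + q + e)) ^ c <= (b ^ 44) ^ c" by (intro power_mono) auto
  then show ?thesis by (simp only: v_def power_mult[symmetric] mult.commute)
 qed
 \<comment> \<open>The real time bound is turned into an integral power of \<open>b\<close>, because
   the heap has to fit under \<open>B\<close> and the word length may be any fixed power of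
   \<open>n + k\<close>.\<close>
 have tb: "total_time R mt c n q kp ab <= b ^ (cc + 2 * t0 + 3)"
 proof -
  have t0: "\<tau> <= real t0" unfolding t0_def by linarith
  have pt: "real x powr \<tau> <= real (x ^ t0)" if "1 <= x" for x :: nat
  proof -
  have "real x powr \<tau> <= real x powr real t0" using that t0 by (intro powr_mono) auto
  then show ?thesis using that by (simp add: powr_realpow)
  qed
  have "M ^ t0 <= (b ^ 2) ^ t0" using Mb by (intro power_mono) auto
  also have "... = b ^ (2 * t0)" by (simp only: power_mult)
  also have "... <= b ^ (2 * t0 + 2)" by (rule mono) simp
  finally have m1: "real M powr \<tau> <= real (b ^ (2 * t0 + 2))" using pt[OF M1] of_nat_mono[where 'a = real] by (meson order_trans)
  have "ab * k ^ t0 <= (b * b) * b ^ (2 * t0)"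
  proof (rule mult_le_mono)
  show "ab <= b * b" unfolding ab_def using len b by (intro mult_le_mono) auto
  have "k ^ t0 <= b ^ t0" using b by (intro power_mono) auto
  also have "... <= b ^ (2 * t0)" by (rule mono) simp
  finally show "k ^ t0 <= b ^ (2 * t0)" .
  qed
  also have "... = b ^ (2 * t0 + 2)" by (simp add: power_add power2_eq_square)
  finally have "real (ab * k ^ t0) <= real (b ^ (2 * t0 + 2))" by (rule of_nat_mono)
  moreover have "real ab * real k powr \<tau> <= real ab * real (k ^ t0)" using pt[of k] I by (intro mult_left_mono) auto
  ultimately have m2: "real ab * real k powr \<tau> <= real (b ^ (2 * t0 + 2))" by simp
  have "C <= real cc" unfolding cc_def by linarith
  also have "real cc <= real (b ^ cc)" using less_exp[of cc] two[of cc] by (intro of_nat_mono) linarith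
  finally have Cb: "C <= real (b ^ cc)" .
  have F0: "0 <= F" by (simp add: F_def)
  have "real (total_time R mt c n q kp ab) <= real (b ^ cc) * F" using tot mult_right_mono[OF Cb F0] by linarith
  also have "... <= real (b ^ cc) * real (2 * b ^ (2 * t0 + 2))" using m1 m2 by (intro mult_left_mono) (auto simp: F_def)
  also have "... = real (b ^ cc * (2 * b ^ (2 * t0 + 2)))" by simp
  finally have "total_time R mt c n q kp ab <= b ^ cc * (2 * b ^ (2 * t0 + 2))" by (simp only: of_nat_le_iff)
  also have "... <= b ^ cc * (b * b ^ (2 * t0 + 2))" using b by (intro mult_le_mono2 mult_le_mono1) simp
  also have "... = b ^ (cc + 2 * t0 + 3)" by (simp add: power_add numeral_3_eq_3 numeral_2_eq_2)
  finally show ?thesis .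
 qed
 have V2: "2 * 2 ^ v <= b ^ (44 * c + 1)"
 proof -
  have "2 * 2 ^ v <= b * b ^ (44 * c)" using b vb by (intro mult_le_mono) auto
  then show ?thesis by simp
 qed
 have nb: "2 + 2 * n + n * n <= b ^ 3"
 proof -
  have "(n + 1) * (n + 1) <= b * b" using b by (intro mult_le_mono) auto
  moreover have "(n + 1) * (n + 1) = n * n + 2 * n + 1" by (simp add: algebra_simps)
  moreover have "1 * 1 <= b * b" using b by (intro mult_le_mono) auto
  ultimately have "2 + 2 * n + n * n <= 2 * (b * b)" by linarith
  also have "... <= b * (b * b)" using b by (intro mult_le_mono1) simp
  finally show ?thesis by (simp add: power3_eq_cube)
 qed
 have room: "2 + 2 * n + n * n + total_time R mt c n q kp ab * (2 * 2 ^ v) <= B"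
 proof -
  have "total_time R mt c n q kp ab * (2 * 2 ^ v) <= b ^ (cc + 2 * t0 + 3) * b ^ (44 * c + 1)"
  using tb V2 by (rule mult_le_mono)
  also have "... = b ^ z" unfolding z_def by (simp only: power_add[symmetric]) (simp add: add.assoc add.commute add.left_commute)
  finally have 1: "total_time R mt c n q kp ab * (2 * 2 ^ v) <= b ^ z" .
  have "b ^ 3 <= b ^ z" by (rule mono) (simp add: z_def)
  then have "2 + 2 * n + n * n + total_time R mt c n q kp ab * (2 * 2 ^ v) <= 2 * b ^ z" using 1 nb by linarith
  also have "... <= b * b ^ z" using b by (intro mult_le_mono1) simp
  also have "... = b ^ Suc z" by simp
  also have "... <= B" unfolding B_def by (rule mono) (simp add: y_def)
  finally show ?thesis .
 qed
 have B3: "b ^ 3 <= B" unfolding B_def by (rule mono) (simp add: y_def)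
 have nkB: "n + k + 3 <= B"
 proof -
  have "2 * 2 * b <= b * b * b" using b by (intro mult_le_mono) auto
  then have "b + 3 <= b ^ 3" using b unfolding power3_eq_cube by linarith
  then show ?thesis using B3 unfolding b_def by linarith
 qed
 have abB: "length Sl * length Tl <= B"
 proof -
  have "length Sl * length Tl <= n * n" using len by (intro mult_le_mono) auto
  then show ?thesis using nb B3 by linarith
 qed
 have cB: "c <= B"
 proof -
  have "c < 2 ^ c" by (rule less_exp)
  also have "... <= b ^ c" by (rule two)
  also have "... <= B" unfolding B_def by (rule mono) (simp add: y_def z_def)
  finally show ?thesis by simp
 qed
 have vB: "2 * 2 ^ v <= B"
 proof -
  have "b ^ (44 * c + 1) <= B" unfolding B_def by (rule mono) (simp add: y_def z_def)
  then show ?thesis using V2 by linarith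
 qed
 interpret pair_fin_digraph G using I by blast
 have Esub: "parcs G \<subseteq> {..<n} \<times> {..<n}" using in_arcsD1 in_arcsD2 I by auto
 interpret D: solver_data n k q "parcs G" Sl Tl w B v P R c e kp mt S T G
 proof unfold_locales
  show "B ^ 200 < 2 ^ w"
  proof -
  have "b ^ (200 * y) < b ^ (200 * y + 1)" using b by (intro power_strict_increasing) auto
  then have "b ^ (200 * y) < 2 ^ w" using I unfolding b_def by linarith
  then show ?thesis by (simp add: B_def power_mult[symmetric] mult.commute)
  qed
  show "2 ^ 20 <= B" using two[of 20] mono[of 20 y] by (simp add: B_def y_def)
  show "n + (length Sl + length Tl) * k <= 2 ^ q" using q by (simp add: M_def)
  show "2 ^ i < n + (length Sl + length Tl) * k" if "i < q" for i using q_min[OF that] by (simp add: M_def)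
  fix d m and X Y :: "nat mat"
  assume dm: "1 <= d" "1 <= m" "(d + m) ^ c <= 2 ^ v" "X \<in> carrier_mat d d" "Y \<in> carrier_mat d d"
  "ALL i<d. ALL j<d. X $$ (i, j) < m & Y $$ (i, j) < m"
  have "(d + m) ^ cm <= (d + m) ^ c" unfolding c_def using dm by (intro power_increasing) auto
  then have "(d + m) ^ cm <= 2 ^ v" using dm(3) by linarith
  then show "\<forall>x\<in>set_pmf (run v (mt d) (start P ([d, m] @ mat_words X @ mat_words Y))). has_output x (mat_words (X * Y))"
  unfolding mt_def using dm by (intro H[THEN spec, THEN spec, THEN spec, THEN spec, THEN spec, THEN mp]) auto
 qed (use I Esub lists det R vB cB nkB abB nb B3 kp(1) kp_min in "auto simp: e_def v_def c_def Sl_def Tl_def")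
 have F: "(real n + (real (card S) + real (card T)) * real k) powr \<tau> + real (card S) * real (card T) * real k powr \<tau> = F"
  by (simp add: F_def M_def ab_def cards)
 have "total_time R mt c n q kp ab <= nat \<lfloor>C * F\<rfloor>" using tot by (rule le_nat_floor)
 then show "let X = run w (nat \<lfloor>C * ((real n + (real (card S) + real (card T)) * real k) powr \<tau> +
  real (card S) * real (card T) * real k powr \<tau>)\<rfloor>) (start (solver c P R) (instance_words n G S T k))
  in (\<forall>x\<in>set_pmf X. halted x) & measure_pmf.prob X {x. correct_answer G S T k x} \<ge> 2 / 3"
  unfolding Let_def F using D.solver_correct room unfolding D.total_time_eq ab_def by blast
 qed
qed

end
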